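(* Let $\mathbb{W}$ be a 2-category with a notion of discreteness and with finite (weighted) limits. Then with every object $A\in\mathbb{W}$ one may associate, in a canonical way, a $\mathit{Disc}(\mathbb{W})$-internal category $E(A)$, namely one whose externalisation is isomorphic, 2-naturally in $A$, to the family fibration $\mathit{fam}_F(A)=\hom_{\mathbb{W}}(F(-),A)$. Moreover, this assignment makes $\mathbb{W}$ a full (necessarily dense) 2-subcategory of $\mathbf{cat}(\mathit{Disc}(\mathbb{W}))$, i.e. the resulting 2-functor $E\colon\mathbb{W}\to\mathbf{cat}(\mathit{Disc}(\mathbb{W}))$ is 2-fully faithful (and then necessarily dense), if and only if $\mathit{Disc}(\mathbb{W})$ is a dense subcategory of $\mathbb{W}$.
   Context: A notion of discreteness on a 2-category $\mathbb{W}$ is given by a 1-category $\mathbb{C}$ and a 2-fully faithful functor $F\colon\mathbb{C}\to\mathbb{W}$ (each $\hom_{\mathbb{C}}(X,Y)\to\hom_{\mathbb{W}}(FX,FY)$ is an isomorphism of categories, the domain being regarded as discrete) which is left adjoint, as a functor of underlying 1-categories, to a 1-functor $U\colon\mathbb{W}\to\mathbb{C}$ with invertible unit. One identifies $\mathbb{C}$ with the full image of $F$, denoted $\mathit{Disc}(\mathbb{W})$. Finite weighted limits are $\mathbf{Cat}$-weighted limits (including inserters), where $\mathbf{Cat}$ is the 2-category of locally small categories. $\mathbf{cat}(\mathbb{C})$ is the 2-category of categories internal to $\mathbb{C}$. $\mathbf{Cat}^{\mathbb{C}^{op}}$ is the 2-category of functors $\mathbb{C}^{op}\to\mathbf{Cat}$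 (split indexed categories). Family fibration: $\mathit{fam}_F(A)=\hom_{\mathbb{W}}(F(-),A)\colon\mathbb{C}^{op}\to\mathbf{Cat}$; this extends to a 2-functor $\mathit{fam}_F\colon\mathbb{W}\to\mathbf{Cat}^{\mathbb{C}^{op}}$. Externalisation of a $\mathbb{C}$-internal category $\mathbb{A}=(\mathbb{A}_0,\mathbb{A}_1,\dots)$: the split indexed category $\mathit{fam}(\mathbb{A})\colon\mathbb{C}^{op}\to\mathbf{Cat}$ for which $\mathit{fam}(\mathbb{A})(X)$ has as objects the morphisms $X\to\mathbb{A}_0$, as morphisms $x\to y$ the morphisms $f\colon X\to\mathbb{A}_1$ with $\langle\mathit{dom},\mathit{cod}\rangle\circ f=\langle x,y\rangle$, with identities and composition inherited from $\mathbb{A}$, and reindexing given by precomposition. A 2-functor $H\colon\mathbb{D}\to\mathbb{E}$ is dense if the 2-functor $A\mapsto\hom_{\mathbb{E}}(H(-),A)$, $\mathbb{E}\to\mathbf{Cat}^{\mathbb{D}^{op}}$, is fully faithful (isomorphisms on hom-categories). $\mathit{Disc}(\mathbb{W})$ is a dense subcategory of $\mathbb{W}$ if the inclusion $F$ is dense. *)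

theory Defs
  imports "HOL-Library.FuncSet"
begin

section \<open>Categories and functors\<close>

record ('o, 'a) cat =
  obj :: "'o set"
  arr :: "'a set"
  src :: "'a \<Rightarrow> 'o"
  tgt :: "'a \<Rightarrow> 'o"
  idt :: "'o \<Rightarrow> 'a"
  cmp :: "'a \<Rightarrow> 'a \<Rightarrow> 'a"  (infixl \<open>\<cdot>\<index>\<close> 70)

definition hom :: "('o, 'a) cat \<Rightarrow> 'o \<Rightarrow> 'o \<Rightarrow> 'a set" where
  "hom C x y = {f \<in> arr C. src C f = x \<and> tgt C f = y}"

locale category =
  fixes C :: "('o, 'a) cat"
  assumes src_obj: "f \<in> arr C \<Longrightarrow> src C f \<in> obj C"
    and tgt_obj: "f \<in> arr C \<Longrightarrow> tgt C f \<in> obj C"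
    and idt_hom: "x \<in> obj C \<Longrightarrow> idt C x \<in> hom C x x"
    and cmp_hom: "f \<in> hom C x y \<Longrightarrow> g \<in> hom C y z \<Longrightarrow> g \<cdot>\<^bsub>C\<^esub> f \<in> hom C x z"
    and cmp_idt_left: "f \<in> hom C x y \<Longrightarrow> idt C y \<cdot>\<^bsub>C\<^esub> f = f"
    and cmp_idt_right: "f \<in> hom C x y \<Longrightarrow> f \<cdot>\<^bsub>C\<^esub> idt C x = f"
    and cmp_assoc: "f \<in> hom C w x \<Longrightarrow> g \<in> hom C x y \<Longrightarrow> h \<in> hom C y z \<Longrightarrow>
      (h \<cdot>\<^bsub>C\<^esub> g) \<cdot>\<^bsub>C\<^esub> f = h \<cdot>\<^bsub>C\<^esub> (g \<cdot>\<^bsub>C\<^esub> f)"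

definition invertible :: "('o, 'a) cat \<Rightarrow> 'a \<Rightarrow> bool" where
  "invertible C f \<longleftrightarrow> f \<in> arr C \<and>
     (\<exists>g \<in> hom C (tgt C f) (src C f).
        g \<cdot>\<^bsub>C\<^esub> f = idt C (src C f) \<and> f \<cdot>\<^bsub>C\<^esub> g = idt C (tgt C f))"

locale is_functor =
  fixes C :: "('o, 'a) cat" and D :: "('p, 'b) cat"
    and Fo :: "'o \<Rightarrow> 'p" and Fa :: "'a \<Rightarrow> 'b"
  assumes map_obj: "x \<in> obj C \<Longrightarrow> Fo x \<in> obj D"
    and map_hom: "f \<in> hom C x y \<Longrightarrow> Fa f \<in> hom D (Fo x) (Fo y)"
    and map_idt: "x \<in> obj C \<Longrightarrow> Fa (idt C x) = idt D (Fo x)"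
    and map_cmp: "f \<in> hom C x y \<Longrightarrow> g \<in> hom C y z \<Longrightarrow>
      Fa (g \<cdot>\<^bsub>C\<^esub> f) = Fa g \<cdot>\<^bsub>D\<^esub> Fa f"

definition cat_iso :: "('o, 'a) cat \<Rightarrow> ('p, 'b) cat \<Rightarrow> ('o \<Rightarrow> 'p) \<Rightarrow> ('a \<Rightarrow> 'b) \<Rightarrow> bool" where
  "cat_iso C D Fo Fa \<longleftrightarrow>
     is_functor C D Fo Fa \<and> bij_betw Fo (obj C) (obj D) \<and> bij_betw Fa (arr C) (arr D)"

definition is_nat ::
  "('o, 'a) cat \<Rightarrow> ('p, 'b) cat \<Rightarrow> ('o \<Rightarrow> 'p) \<Rightarrow> ('a \<Rightarrow> 'b) \<Rightarrow> ('o \<Rightarrow> 'p) \<Rightarrow> ('a \<Rightarrow> 'b) \<Rightarrow>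
   ('o \<Rightarrow> 'b) \<Rightarrow> bool" where
  "is_nat C D Fo Fa Go Ga t \<longleftrightarrow>
     (\<forall>x \<in> obj C. t x \<in> hom D (Fo x) (Go x)) \<and>
     (\<forall>f \<in> arr C. t (tgt C f) \<cdot>\<^bsub>D\<^esub> Fa f = Ga f \<cdot>\<^bsub>D\<^esub> t (src C f))"

locale adjunction =
  left: is_functor C D Fo Fa + right: is_functor D C Uo Ua
  for C :: "('o, 'a) cat" and D :: "('p, 'b) cat" and Fo Fa Uo Ua +
  fixes unit :: "'o \<Rightarrow> 'a" and counit :: "'p \<Rightarrow> 'b"
  assumes unit_nat: "is_nat C C id id (Uo \<circ> Fo) (Ua \<circ> Fa) unit"
    and counit_nat: "is_nat D D (Fo \<circ> Uo) (Fa \<circ> Ua) id id counit"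
    and triangle_left: "x \<in> obj C \<Longrightarrow> counit (Fo x) \<cdot>\<^bsub>D\<^esub> Fa (unit x) = idt D (Fo x)"
    and triangle_right: "a \<in> obj D \<Longrightarrow> Ua (counit a) \<cdot>\<^bsub>C\<^esub> unit (Uo a) = idt C (Uo a)"

section \<open>2-categories and 2-functors\<close>

text \<open>A (strict) 2-category is given by its category \<open>one\<close> of objects and 1-cells, the category
  \<open>two\<close> of 1-cells and 2-cells under vertical composition, and horizontal composition of
  2-cells.\<close>

record ('o, 'm, 't) twocat =
  one :: "('o, 'm) cat"
  two :: "('m, 't) cat"
  hcmp :: "'t \<Rightarrow> 't \<Rightarrow> 't"  (infixl \<open>\<star>\<index>\<close> 70)

definition homcat :: "('o, 'm, 't) twocat \<Rightarrow> 'o \<Rightarrow> 'o \<Rightarrow> ('m, 't) cat" where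
  "homcat K A B =
     (two K)\<lparr>obj := hom (one K) A B,
             arr := {\<alpha> \<in> arr (two K). src (two K) \<alpha> \<in> hom (one K) A B}\<rparr>"

locale two_category =
  one: category "one K" + two: category "two K"
  for K :: "('o, 'm, 't) twocat" +
  assumes obj_two: "obj (two K) = arr (one K)"
    and globular: "\<alpha> \<in> arr (two K) \<Longrightarrow> src (two K) \<alpha> \<in> hom (one K) A B \<Longrightarrow>
      tgt (two K) \<alpha> \<in> hom (one K) A B"
    and hcmp_hom: "\<alpha> \<in> hom (two K) f f' \<Longrightarrow> \<beta> \<in> hom (two K) g g' \<Longrightarrow>
      tgt (one K) f = src (one K) g \<Longrightarrow>
      \<beta> \<star>\<^bsub>K\<^esub> \<alpha> \<in> hom (two K) (g \<cdot>\<^bsub>one K\<^esub> f) (g' \<cdot>\<^bsub>one K\<^esub> f')"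
    and hcmp_idt: "f \<in> hom (one K) A B \<Longrightarrow> g \<in> hom (one K) B D \<Longrightarrow>
      idt (two K) g \<star>\<^bsub>K\<^esub> idt (two K) f = idt (two K) (g \<cdot>\<^bsub>one K\<^esub> f)"
    and interchange: "\<alpha> \<in> hom (two K) f f' \<Longrightarrow> \<alpha>' \<in> hom (two K) f' f'' \<Longrightarrow>
      \<beta> \<in> hom (two K) g g' \<Longrightarrow> \<beta>' \<in> hom (two K) g' g'' \<Longrightarrow>
      tgt (one K) f = src (one K) g \<Longrightarrow>
      (\<beta>' \<cdot>\<^bsub>two K\<^esub> \<beta>) \<star>\<^bsub>K\<^esub> (\<alpha>' \<cdot>\<^bsub>two K\<^esub> \<alpha>) = (\<beta>' \<star>\<^bsub>K\<^esub> \<alpha>') \<cdot>\<^bsub>two K\<^esub> (\<beta> \<star>\<^bsub>K\<^esub> \<alpha>)"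
    and hcmp_idt_left: "\<alpha> \<in> arr (homcat K A B) \<Longrightarrow> idt (two K) (idt (one K) B) \<star>\<^bsub>K\<^esub> \<alpha> = \<alpha>"
    and hcmp_idt_right: "\<alpha> \<in> arr (homcat K A B) \<Longrightarrow> \<alpha> \<star>\<^bsub>K\<^esub> idt (two K) (idt (one K) A) = \<alpha>"
    and hcmp_assoc: "\<alpha> \<in> arr (homcat K A B) \<Longrightarrow> \<beta> \<in> arr (homcat K B D) \<Longrightarrow>
      \<gamma> \<in> arr (homcat K D E) \<Longrightarrow> (\<gamma> \<star>\<^bsub>K\<^esub> \<beta>) \<star>\<^bsub>K\<^esub> \<alpha> = \<gamma> \<star>\<^bsub>K\<^esub> (\<beta> \<star>\<^bsub>K\<^esub> \<alpha>)"

record ('o, 'm, 't, 'o2, 'm2, 't2) twofun =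
  app0 :: "'o \<Rightarrow> 'o2"
  app1 :: "'m \<Rightarrow> 'm2"
  app2 :: "'t \<Rightarrow> 't2"

locale two_functor =
  one: is_functor "one K" "one L" "app0 F" "app1 F" +
  two: is_functor "two K" "two L" "app1 F" "app2 F"
  for K :: "('o, 'm, 't) twocat" and L :: "('o2, 'm2, 't2) twocat"
    and F :: "('o, 'm, 't, 'o2, 'm2, 't2) twofun" +
  assumes map_hcmp: "\<alpha> \<in> arr (homcat K A B) \<Longrightarrow> \<beta> \<in> arr (homcat K B D) \<Longrightarrow>
    app2 F (\<beta> \<star>\<^bsub>K\<^esub> \<alpha>) = app2 F \<beta> \<star>\<^bsub>L\<^esub> app2 F \<alpha>"

definition twofun_comp ::
  "('o2, 'm2, 't2, 'o3, 'm3, 't3) twofun \<Rightarrow> ('o, 'm, 't, 'o2, 'm2, 't2) twofun \<Rightarrow>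
   ('o, 'm, 't, 'o3, 'm3, 't3) twofun" where
  "twofun_comp G F =
     \<lparr>app0 = app0 G \<circ> app0 F, app1 = app1 G \<circ> app1 F, app2 = app2 G \<circ> app2 F\<rparr>"

definition two_fully_faithful ::
  "('o, 'm, 't) twocat \<Rightarrow> ('o2, 'm2, 't2) twocat \<Rightarrow>
   ('o, 'm, 't, 'o2, 'm2, 't2) twofun \<Rightarrow> bool" where
  "two_fully_faithful K L F \<longleftrightarrow>
     (\<forall>A \<in> obj (one K). \<forall>B \<in> obj (one K).
        cat_iso (homcat K A B) (homcat L (app0 F A) (app0 F B)) (app1 F) (app2 F))"

definition op_cat :: "('o, 'a) cat \<Rightarrow> ('o, 'a) cat" where
  "op_cat C = C\<lparr>src := tgt C, tgt := src C, cmp := (\<lambda>g f. f \<cdot>\<^bsub>C\<^esub> g)\<rparr>"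

text \<open>Only 1-cells are reversed.\<close>

definition op_twocat :: "('o, 'm, 't) twocat \<Rightarrow> ('o, 'm, 't) twocat" where
  "op_twocat K = K\<lparr>one := op_cat (one K), hcmp := (\<lambda>\<beta> \<alpha>. \<alpha> \<star>\<^bsub>K\<^esub> \<beta>)\<rparr>"

text \<open>A category as a 2-category with discrete hom-categories: the arrow \<open>f\<close> doubles as the
  identity 2-cell on \<open>f\<close>.\<close>

definition loc_disc :: "('o, 'a) cat \<Rightarrow> ('o, 'a, 'a) twocat" where
  "loc_disc C =
     \<lparr>one = C,
      two = \<lparr>obj = arr C, arr = arr C, src = id, tgt = id, idt = id, cmp = (\<lambda>g f. f)\<rparr>,
      hcmp = cmp C\<rparr>"

section \<open>The 2-category of categories\<close>

text \<open>Functors and natural transformations that carry their source and target. Their underlying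
  functions are \<^const>\<open>undefined\<close> off the carriers, so that equality of records is equality of
  functors. The four type parameters allow functors between categories over different types.\<close>

record ('x, 'y, 'x2, 'y2) cfun =
  fdom :: "('x, 'y) cat"
  fcod :: "('x2, 'y2) cat"
  fob :: "'x \<Rightarrow> 'x2"
  far :: "'y \<Rightarrow> 'y2"

definition is_cfun :: "('x, 'y, 'x2, 'y2) cfun \<Rightarrow> bool" where
  "is_cfun F \<longleftrightarrow> category (fdom F) \<and> category (fcod F) \<and>
     is_functor (fdom F) (fcod F) (fob F) (far F) \<and>
     fob F \<in> extensional (obj (fdom F)) \<and> far F \<in> extensional (arr (fdom F))"

definition cfun_id :: "('x, 'y) cat \<Rightarrow> ('x, 'y, 'x, 'y) cfun" where
  "cfun_id C = \<lparr>fdom = C, fcod = C, fob = (\<lambda>x \<in> obj C. x), far = (\<lambda>f \<in> arr C. f)\<rparr>"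

definition cfun_comp ::
  "('x2, 'y2, 'x3, 'y3) cfun \<Rightarrow> ('x, 'y, 'x2, 'y2) cfun \<Rightarrow> ('x, 'y, 'x3, 'y3) cfun" where
  "cfun_comp G F =
     \<lparr>fdom = fdom F, fcod = fcod G,
      fob = (\<lambda>x \<in> obj (fdom F). fob G (fob F x)),
      far = (\<lambda>f \<in> arr (fdom F). far G (far F f))\<rparr>"

record ('x, 'y, 'x2, 'y2) cnat =
  ndom :: "('x, 'y, 'x2, 'y2) cfun"
  ncod :: "('x, 'y, 'x2, 'y2) cfun"
  ncmp :: "'x \<Rightarrow> 'y2"

definition is_cnat :: "('x, 'y, 'x2, 'y2) cnat \<Rightarrow> bool" where
  "is_cnat \<alpha> \<longleftrightarrow> is_cfun (ndom \<alpha>) \<and> is_cfun (ncod \<alpha>) \<and>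
     fdom (ncod \<alpha>) = fdom (ndom \<alpha>) \<and> fcod (ncod \<alpha>) = fcod (ndom \<alpha>) \<and>
     is_nat (fdom (ndom \<alpha>)) (fcod (ndom \<alpha>)) (fob (ndom \<alpha>)) (far (ndom \<alpha>))
       (fob (ncod \<alpha>)) (far (ncod \<alpha>)) (ncmp \<alpha>) \<and>
     ncmp \<alpha> \<in> extensional (obj (fdom (ndom \<alpha>)))"

definition cnat_id :: "('x, 'y, 'x2, 'y2) cfun \<Rightarrow> ('x, 'y, 'x2, 'y2) cnat" where
  "cnat_id F =
     \<lparr>ndom = F, ncod = F, ncmp = (\<lambda>x \<in> obj (fdom F). idt (fcod F) (fob F x))\<rparr>"

definition cnat_vcomp ::
  "('x, 'y, 'x2, 'y2) cnat \<Rightarrow> ('x, 'y, 'x2, 'y2) cnat \<Rightarrow> ('x, 'y, 'x2, 'y2) cnat" where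
  "cnat_vcomp \<beta> \<alpha> =
     \<lparr>ndom = ndom \<alpha>, ncod = ncod \<beta>,
      ncmp = (\<lambda>x \<in> obj (fdom (ndom \<alpha>)). ncmp \<beta> x \<cdot>\<^bsub>fcod (ndom \<alpha>)\<^esub> ncmp \<alpha> x)\<rparr>"

definition cnat_hcomp ::
  "('x2, 'y2, 'x3, 'y3) cnat \<Rightarrow> ('x, 'y, 'x2, 'y2) cnat \<Rightarrow> ('x, 'y, 'x3, 'y3) cnat" where
  "cnat_hcomp \<beta> \<alpha> =
     \<lparr>ndom = cfun_comp (ndom \<beta>) (ndom \<alpha>), ncod = cfun_comp (ncod \<beta>) (ncod \<alpha>),
      ncmp = (\<lambda>x \<in> obj (fdom (ndom \<alpha>)).
        ncmp \<beta> (fob (ncod \<alpha>) x) \<cdot>\<^bsub>fcod (ndom \<beta>)\<^esub> far (ndom \<beta>) (ncmp \<alpha> x))\<rparr>"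

definition Cat ::
  "(('x, 'y) cat, ('x, 'y, 'x, 'y) cfun, ('x, 'y, 'x, 'y) cnat) twocat" where
  "Cat =
     \<lparr>one = \<lparr>obj = {C. category C}, arr = {F. is_cfun F}, src = fdom, tgt = fcod,
             idt = cfun_id, cmp = cfun_comp\<rparr>,
      two = \<lparr>obj = {F. is_cfun F}, arr = {\<alpha>. is_cnat \<alpha>}, src = ndom, tgt = ncod,
             idt = cnat_id, cmp = cnat_vcomp\<rparr>,
      hcmp = cnat_hcomp\<rparr>"

section \<open>The 2-category of Cat-valued 2-functors\<close>

type_synonym ('i, 'j, 'k, 'x, 'y) catvalued =
  "('i, 'j, 'k, ('x, 'y) cat, ('x, 'y, 'x, 'y) cfun, ('x, 'y, 'x, 'y) cnat) twofun"

record ('i, 'j, 'k, 'x, 'y, 'x2, 'y2) tnat =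
  tdom :: "('i, 'j, 'k, 'x, 'y) catvalued"
  tcod :: "('i, 'j, 'k, 'x2, 'y2) catvalued"
  tcmp :: "'i \<Rightarrow> ('x, 'y, 'x2, 'y2) cfun"

text \<open>2-natural transformations between 2-functors from \<open>K\<close> to \<^const>\<open>Cat\<close>.\<close>

definition is_tnat ::
  "('i, 'j, 'k) twocat \<Rightarrow> ('i, 'j, 'k, 'x, 'y, 'x2, 'y2) tnat \<Rightarrow> bool" where
  "is_tnat K \<tau> \<longleftrightarrow> two_functor K Cat (tdom \<tau>) \<and> two_functor K Cat (tcod \<tau>) \<and>
     (\<forall>i \<in> obj (one K). is_cfun (tcmp \<tau> i) \<and>
        fdom (tcmp \<tau> i) = app0 (tdom \<tau>) i \<and> fcod (tcmp \<tau> i) = app0 (tcod \<tau>) i) \<and>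
     (\<forall>i \<in> obj (one K). \<forall>i' \<in> obj (one K). \<forall>u \<in> hom (one K) i i'.
        cfun_comp (tcmp \<tau> i') (app1 (tdom \<tau>) u) = cfun_comp (app1 (tcod \<tau>) u) (tcmp \<tau> i)) \<and>
     (\<forall>i \<in> obj (one K). \<forall>i' \<in> obj (one K). \<forall>\<theta> \<in> arr (homcat K i i').
        cnat_hcomp (cnat_id (tcmp \<tau> i')) (app2 (tdom \<tau>) \<theta>) =
        cnat_hcomp (app2 (tcod \<tau>) \<theta>) (cnat_id (tcmp \<tau> i))) \<and>
     tcmp \<tau> \<in> extensional (obj (one K))"

definition tnat_id ::
  "('i, 'j, 'k) twocat \<Rightarrow> ('i, 'j, 'k, 'x, 'y) catvalued \<Rightarrow>
   ('i, 'j, 'k, 'x, 'y, 'x, 'y) tnat" where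
  "tnat_id K P = \<lparr>tdom = P, tcod = P, tcmp = (\<lambda>i \<in> obj (one K). cfun_id (app0 P i))\<rparr>"

definition tnat_comp ::
  "('i, 'j, 'k) twocat \<Rightarrow> ('i, 'j, 'k, 'x2, 'y2, 'x3, 'y3) tnat \<Rightarrow>
   ('i, 'j, 'k, 'x, 'y, 'x2, 'y2) tnat \<Rightarrow> ('i, 'j, 'k, 'x, 'y, 'x3, 'y3) tnat" where
  "tnat_comp K \<sigma> \<tau> =
     \<lparr>tdom = tdom \<tau>, tcod = tcod \<sigma>,
      tcmp = (\<lambda>i \<in> obj (one K). cfun_comp (tcmp \<sigma> i) (tcmp \<tau> i))\<rparr>"

record ('i, 'j, 'k, 'x, 'y, 'x2, 'y2) modif =
  mdom :: "('i, 'j, 'k, 'x, 'y, 'x2, 'y2) tnat"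
  mcod :: "('i, 'j, 'k, 'x, 'y, 'x2, 'y2) tnat"
  mcmp :: "'i \<Rightarrow> ('x, 'y, 'x2, 'y2) cnat"

definition is_modif ::
  "('i, 'j, 'k) twocat \<Rightarrow> ('i, 'j, 'k, 'x, 'y, 'x2, 'y2) modif \<Rightarrow> bool" where
  "is_modif K m \<longleftrightarrow> is_tnat K (mdom m) \<and> is_tnat K (mcod m) \<and>
     tdom (mcod m) = tdom (mdom m) \<and> tcod (mcod m) = tcod (mdom m) \<and>
     (\<forall>i \<in> obj (one K). is_cnat (mcmp m i) \<and>
        ndom (mcmp m i) = tcmp (mdom m) i \<and> ncod (mcmp m i) = tcmp (mcod m) i) \<and>
     (\<forall>i \<in> obj (one K). \<forall>i' \<in> obj (one K). \<forall>u \<in> hom (one K) i i'.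
        cnat_hcomp (mcmp m i') (cnat_id (app1 (tdom (mdom m)) u)) =
        cnat_hcomp (cnat_id (app1 (tcod (mdom m)) u)) (mcmp m i)) \<and>
     mcmp m \<in> extensional (obj (one K))"

definition modif_id ::
  "('i, 'j, 'k) twocat \<Rightarrow> ('i, 'j, 'k, 'x, 'y, 'x2, 'y2) tnat \<Rightarrow>
   ('i, 'j, 'k, 'x, 'y, 'x2, 'y2) modif" where
  "modif_id K \<tau> =
     \<lparr>mdom = \<tau>, mcod = \<tau>, mcmp = (\<lambda>i \<in> obj (one K). cnat_id (tcmp \<tau> i))\<rparr>"

definition modif_vcomp ::
  "('i, 'j, 'k) twocat \<Rightarrow> ('i, 'j, 'k, 'x, 'y, 'x2, 'y2) modif \<Rightarrow>
   ('i, 'j, 'k, 'x, 'y, 'x2, 'y2) modif \<Rightarrow> ('i, 'j, 'k, 'x, 'y, 'x2, 'y2) modif" where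
  "modif_vcomp K n m =
     \<lparr>mdom = mdom m, mcod = mcod n,
      mcmp = (\<lambda>i \<in> obj (one K). cnat_vcomp (mcmp n i) (mcmp m i))\<rparr>"

definition modif_hcomp ::
  "('i, 'j, 'k) twocat \<Rightarrow> ('i, 'j, 'k, 'x2, 'y2, 'x3, 'y3) modif \<Rightarrow>
   ('i, 'j, 'k, 'x, 'y, 'x2, 'y2) modif \<Rightarrow> ('i, 'j, 'k, 'x, 'y, 'x3, 'y3) modif" where
  "modif_hcomp K n m =
     \<lparr>mdom = tnat_comp K (mdom n) (mdom m), mcod = tnat_comp K (mcod n) (mcod m),
      mcmp = (\<lambda>i \<in> obj (one K). cnat_hcomp (mcmp n i) (mcmp m i))\<rparr>"

text \<open>The 2-category of 2-functors from \<open>K\<close> to \<^const>\<open>Cat\<close>. Its objects are not required to be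
  extensional: this only adds isomorphic copies of objects.\<close>

definition CatFun ::
  "('i, 'j, 'k) twocat \<Rightarrow>
   (('i, 'j, 'k, 'x, 'y) catvalued, ('i, 'j, 'k, 'x, 'y, 'x, 'y) tnat,
    ('i, 'j, 'k, 'x, 'y, 'x, 'y) modif) twocat" where
  "CatFun K =
     \<lparr>one = \<lparr>obj = {P. two_functor K Cat P}, arr = {\<tau>. is_tnat K \<tau>}, src = tdom, tgt = tcod,
             idt = tnat_id K, cmp = tnat_comp K\<rparr>,
      two = \<lparr>obj = {\<tau>. is_tnat K \<tau>}, arr = {m. is_modif K m}, src = mdom, tgt = mcod,
             idt = modif_id K, cmp = modif_vcomp K\<rparr>,
      hcmp = modif_hcomp K\<rparr>"

text \<open>The category of 2-natural transformations from \<open>P\<close> to \<open>Q\<close> and modifications, where the values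
  of \<open>P\<close> and \<open>Q\<close> may be categories over different types. For equal types it is
  \<^term>\<open>homcat (CatFun K) P Q\<close>.\<close>

definition tnat_cat ::
  "('i, 'j, 'k) twocat \<Rightarrow> ('i, 'j, 'k, 'x, 'y) catvalued \<Rightarrow> ('i, 'j, 'k, 'x2, 'y2) catvalued \<Rightarrow>
   (('i, 'j, 'k, 'x, 'y, 'x2, 'y2) tnat, ('i, 'j, 'k, 'x, 'y, 'x2, 'y2) modif) cat" where
  "tnat_cat K P Q =
     \<lparr>obj = {\<tau>. is_tnat K \<tau> \<and> tdom \<tau> = P \<and> tcod \<tau> = Q},
      arr = {m. is_modif K m \<and> tdom (mdom m) = P \<and> tcod (mdom m) = Q},
      src = mdom, tgt = mcod, idt = modif_id K, cmp = modif_vcomp K\<rparr>"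

text \<open>\<open>G\<close> and \<open>H\<close> stand for 2-functors from \<open>W\<close> to \<^term>\<open>CatFun K\<close>, again with values over possibly
  different types.\<close>

definition two_naturally_isomorphic ::
  "('o, 'm, 't) twocat \<Rightarrow> ('i, 'j, 'k) twocat \<Rightarrow>
   ('o, 'm, 't, ('i, 'j, 'k, 'x, 'y) catvalued, ('i, 'j, 'k, 'x, 'y, 'x, 'y) tnat,
    ('i, 'j, 'k, 'x, 'y, 'x, 'y) modif) twofun \<Rightarrow>
   ('o, 'm, 't, ('i, 'j, 'k, 'x2, 'y2) catvalued, ('i, 'j, 'k, 'x2, 'y2, 'x2, 'y2) tnat,
    ('i, 'j, 'k, 'x2, 'y2, 'x2, 'y2) modif) twofun \<Rightarrow> bool" where
  "two_naturally_isomorphic W K G H \<longleftrightarrow>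
     (\<exists>\<phi> :: 'o \<Rightarrow> ('i, 'j, 'k, 'x, 'y, 'x2, 'y2) tnat.
        (\<forall>A \<in> obj (one W).
           is_tnat K (\<phi> A) \<and> tdom (\<phi> A) = app0 G A \<and> tcod (\<phi> A) = app0 H A \<and>
           (\<forall>i \<in> obj (one K). cat_iso (app0 (app0 G A) i) (app0 (app0 H A) i)
              (fob (tcmp (\<phi> A) i)) (far (tcmp (\<phi> A) i)))) \<and>
        (\<forall>A \<in> obj (one W). \<forall>B \<in> obj (one W). \<forall>a \<in> hom (one W) A B.
           tnat_comp K (\<phi> B) (app1 G a) = tnat_comp K (app1 H a) (\<phi> A)) \<and>
        (\<forall>A \<in> obj (one W). \<forall>B \<in> obj (one W). \<forall>\<alpha> \<in> arr (homcat W A B).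
           modif_hcomp K (modif_id K (\<phi> B)) (app2 G \<alpha>) =
           modif_hcomp K (app2 H \<alpha>) (modif_id K (\<phi> A))))"

section \<open>Hom 2-functors, density and the family fibration\<close>

definition hom_post :: "('o, 'm, 't) twocat \<Rightarrow> 'o \<Rightarrow> 'm \<Rightarrow> ('m, 't, 'm, 't) cfun" where
  "hom_post W X a =
     \<lparr>fdom = homcat W X (src (one W) a), fcod = homcat W X (tgt (one W) a),
      fob = (\<lambda>g \<in> obj (homcat W X (src (one W) a)). a \<cdot>\<^bsub>one W\<^esub> g),
      far = (\<lambda>\<gamma> \<in> arr (homcat W X (src (one W) a)). idt (two W) a \<star>\<^bsub>W\<^esub> \<gamma>)\<rparr>"

definition hom_post2 :: "('o, 'm, 't) twocat \<Rightarrow> 'o \<Rightarrow> 't \<Rightarrow> ('m, 't, 'm, 't) cnat" where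
  "hom_post2 W X \<alpha> =
     \<lparr>ndom = hom_post W X (src (two W) \<alpha>), ncod = hom_post W X (tgt (two W) \<alpha>),
      ncmp = (\<lambda>g \<in> obj (homcat W X (src (one W) (src (two W) \<alpha>))). \<alpha> \<star>\<^bsub>W\<^esub> idt (two W) g)\<rparr>"

definition hom_pre :: "('o, 'm, 't) twocat \<Rightarrow> 'o \<Rightarrow> 'm \<Rightarrow> ('m, 't, 'm, 't) cfun" where
  "hom_pre W A f =
     \<lparr>fdom = homcat W (tgt (one W) f) A, fcod = homcat W (src (one W) f) A,
      fob = (\<lambda>g \<in> obj (homcat W (tgt (one W) f) A). g \<cdot>\<^bsub>one W\<^esub> f),
      far = (\<lambda>\<gamma> \<in> arr (homcat W (tgt (one W) f) A). \<gamma> \<star>\<^bsub>W\<^esub> idt (two W) f)\<rparr>"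

definition hom_pre2 :: "('o, 'm, 't) twocat \<Rightarrow> 'o \<Rightarrow> 't \<Rightarrow> ('m, 't, 'm, 't) cnat" where
  "hom_pre2 W A \<theta> =
     \<lparr>ndom = hom_pre W A (src (two W) \<theta>), ncod = hom_pre W A (tgt (two W) \<theta>),
      ncmp = (\<lambda>g \<in> obj (homcat W (tgt (one W) (src (two W) \<theta>)) A). idt (two W) g \<star>\<^bsub>W\<^esub> \<theta>)\<rparr>"

text \<open>For a 2-functor \<open>H\<close> from \<open>D\<close> to \<open>W\<close>, the 2-functor
  \<open>A \<mapsto> hom\<^sub>W(H(-), A)\<close> from \<open>W\<close> to \<^term>\<open>CatFun (op_twocat D)\<close>.\<close>

definition nerve0 ::
  "('o, 'm, 't) twocat \<Rightarrow> ('i, 'j, 'k, 'o, 'm, 't) twofun \<Rightarrow> 'o \<Rightarrow>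
   ('i, 'j, 'k, 'm, 't) catvalued" where
  "nerve0 W H A =
     \<lparr>app0 = (\<lambda>X. homcat W (app0 H X) A),
      app1 = (\<lambda>f. hom_pre W A (app1 H f)),
      app2 = (\<lambda>\<theta>. hom_pre2 W A (app2 H \<theta>))\<rparr>"

definition nerve1 ::
  "('i, 'j, 'k) twocat \<Rightarrow> ('o, 'm, 't) twocat \<Rightarrow> ('i, 'j, 'k, 'o, 'm, 't) twofun \<Rightarrow> 'm \<Rightarrow>
   ('i, 'j, 'k, 'm, 't, 'm, 't) tnat" where
  "nerve1 D W H a =
     \<lparr>tdom = nerve0 W H (src (one W) a), tcod = nerve0 W H (tgt (one W) a),
      tcmp = (\<lambda>X \<in> obj (one D). hom_post W (app0 H X) a)\<rparr>"

definition nerve2 ::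
  "('i, 'j, 'k) twocat \<Rightarrow> ('o, 'm, 't) twocat \<Rightarrow> ('i, 'j, 'k, 'o, 'm, 't) twofun \<Rightarrow> 't \<Rightarrow>
   ('i, 'j, 'k, 'm, 't, 'm, 't) modif" where
  "nerve2 D W H \<alpha> =
     \<lparr>mdom = nerve1 D W H (src (two W) \<alpha>), mcod = nerve1 D W H (tgt (two W) \<alpha>),
      mcmp = (\<lambda>X \<in> obj (one D). hom_post2 W (app0 H X) \<alpha>)\<rparr>"

definition nerve ::
  "('i, 'j, 'k) twocat \<Rightarrow> ('o, 'm, 't) twocat \<Rightarrow> ('i, 'j, 'k, 'o, 'm, 't) twofun \<Rightarrow>
   ('o, 'm, 't, ('i, 'j, 'k, 'm, 't) catvalued, ('i, 'j, 'k, 'm, 't, 'm, 't) tnat,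
    ('i, 'j, 'k, 'm, 't, 'm, 't) modif) twofun" where
  "nerve D W H = \<lparr>app0 = nerve0 W H, app1 = nerve1 D W H, app2 = nerve2 D W H\<rparr>"

definition dense ::
  "('i, 'j, 'k) twocat \<Rightarrow> ('o, 'm, 't) twocat \<Rightarrow> ('i, 'j, 'k, 'o, 'm, 't) twofun \<Rightarrow> bool" where
  "dense D W H \<longleftrightarrow> two_fully_faithful W (CatFun (op_twocat D)) (nerve D W H)"

abbreviation family_fibration ::
  "('o, 'm, 't) twocat \<Rightarrow> ('c, 'a) cat \<Rightarrow> ('c, 'a, 'a, 'o, 'm, 't) twofun \<Rightarrow>
   ('o, 'm, 't, ('c, 'a, 'a, 'm, 't) catvalued, ('c, 'a, 'a, 'm, 't, 'm, 't) tnat,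
    ('c, 'a, 'a, 'm, 't, 'm, 't) modif) twofun" where
  "family_fibration W C F \<equiv> nerve (loc_disc C) W F"

section \<open>Finite weighted limits\<close>

text \<open>For \<open>D\<close> a 2-functor from \<open>J\<close> to \<open>W\<close>: the 2-functor \<open>hom\<^sub>W(X, D(-))\<close> from \<open>J\<close> to \<^const>\<open>Cat\<close>,
  and its action on 1-cells and 2-cells in \<open>X\<close>.\<close>

definition conerve0 ::
  "('o, 'm, 't) twocat \<Rightarrow> ('i, 'j, 'k, 'o, 'm, 't) twofun \<Rightarrow> 'o \<Rightarrow>
   ('i, 'j, 'k, 'm, 't) catvalued" where
  "conerve0 W D X =
     \<lparr>app0 = (\<lambda>i. homcat W X (app0 D i)),
      app1 = (\<lambda>u. hom_post W X (app1 D u)),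
      app2 = (\<lambda>\<theta>. hom_post2 W X (app2 D \<theta>))\<rparr>"

definition conerve1 ::
  "('i, 'j, 'k) twocat \<Rightarrow> ('o, 'm, 't) twocat \<Rightarrow> ('i, 'j, 'k, 'o, 'm, 't) twofun \<Rightarrow> 'm \<Rightarrow>
   ('i, 'j, 'k, 'm, 't, 'm, 't) tnat" where
  "conerve1 J W D f =
     \<lparr>tdom = conerve0 W D (tgt (one W) f), tcod = conerve0 W D (src (one W) f),
      tcmp = (\<lambda>i \<in> obj (one J). hom_pre W (app0 D i) f)\<rparr>"

definition conerve2 ::
  "('i, 'j, 'k) twocat \<Rightarrow> ('o, 'm, 't) twocat \<Rightarrow> ('i, 'j, 'k, 'o, 'm, 't) twofun \<Rightarrow> 't \<Rightarrow>
   ('i, 'j, 'k, 'm, 't, 'm, 't) modif" where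
  "conerve2 J W D \<alpha> =
     \<lparr>mdom = conerve1 J W D (src (two W) \<alpha>), mcod = conerve1 J W D (tgt (two W) \<alpha>),
      mcmp = (\<lambda>i \<in> obj (one J). hom_pre2 W (app0 D i) \<alpha>)\<rparr>"

text \<open>\<open>L\<close> is the limit of \<open>D\<close> weighted by \<open>\<Phi>\<close> with unit \<open>u : \<Phi> \<Rightarrow> hom\<^sub>W(L, D(-))\<close>: composing with \<open>u\<close>
  is an isomorphism \<open>hom\<^sub>W(X, L) \<cong> [J, Cat](\<Phi>, hom\<^sub>W(X, D(-)))\<close> for all \<open>X\<close>. The isomorphisms that
  are 2-natural in \<open>X\<close> are exactly those of this form.\<close>

definition is_weighted_limit ::
  "('o, 'm, 't) twocat \<Rightarrow> ('i, 'j, 'k) twocat \<Rightarrow> ('i, 'j, 'k, 'x, 'y) catvalued \<Rightarrow>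
   ('i, 'j, 'k, 'o, 'm, 't) twofun \<Rightarrow> 'o \<Rightarrow> ('i, 'j, 'k, 'x, 'y, 'm, 't) tnat \<Rightarrow> bool" where
  "is_weighted_limit W J \<Phi> D L u \<longleftrightarrow>
     L \<in> obj (one W) \<and> u \<in> obj (tnat_cat J \<Phi> (conerve0 W D L)) \<and>
     (\<forall>X \<in> obj (one W).
        cat_iso (homcat W X L) (tnat_cat J \<Phi> (conerve0 W D X))
          (\<lambda>f. tnat_comp J (conerve1 J W D f) u)
          (\<lambda>\<alpha>. modif_hcomp J (conerve2 J W D \<alpha>) (modif_id J u)))"

definition finite_cat :: "('o, 'a) cat \<Rightarrow> bool" where
  "finite_cat C \<longleftrightarrow> finite (obj C) \<and> finite (arr C)"

text \<open>A weight is finite if its indexing 2-category and all its values are finite. Every such weight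
  is isomorphic to one whose carriers are sets of natural numbers. Terminal objects, pullbacks,
  inserters and cotensors with the arrow category are instances, so weights that are merely
  finitely presentable yield the same notion.\<close>

definition has_finite_weighted_limits :: "('o, 'm, 't) twocat \<Rightarrow> bool" where
  "has_finite_weighted_limits W \<longleftrightarrow>
     (\<forall>(J :: (nat, nat, nat) twocat) (\<Phi> :: (nat, nat, nat, nat, nat) catvalued) D.
        two_category J \<and> finite_cat (one J) \<and> finite_cat (two J) \<and>
        two_functor J Cat \<Phi> \<and> (\<forall>j \<in> obj (one J). finite_cat (app0 \<Phi> j)) \<and>
        two_functor J W D \<longrightarrow>
        (\<exists>L u. is_weighted_limit W J \<Phi> D L u))"

section \<open>Notions of discreteness\<close>

locale notion_of_discreteness =
  W: two_category W + C: category C + F: two_functor "loc_disc C" W F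
  for W :: "('o, 'm, 't) twocat" and C :: "('c, 'a) cat"
    and F :: "('c, 'a, 'a, 'o, 'm, 't) twofun" +
  assumes fully_faithful: "two_fully_faithful (loc_disc C) W F"
    and coreflective: "\<exists>Uo Ua unit counit.
      adjunction C (one W) (app0 F) (app1 F) Uo Ua unit counit \<and>
      (\<forall>x \<in> obj C. invertible C (unit x))"

section \<open>Internal categories\<close>

definition is_pullback :: "('o, 'a) cat \<Rightarrow> 'a \<Rightarrow> 'a \<Rightarrow> 'a \<Rightarrow> 'a \<Rightarrow> bool" where
  "is_pullback C f g p q \<longleftrightarrow>
     f \<in> arr C \<and> g \<in> arr C \<and> tgt C f = tgt C g \<and>
     p \<in> arr C \<and> q \<in> arr C \<and> src C p = src C q \<and> tgt C p = src C f \<and> tgt C q = src C g \<and>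
     f \<cdot>\<^bsub>C\<^esub> p = g \<cdot>\<^bsub>C\<^esub> q \<and>
     (\<forall>X \<in> obj C. \<forall>h \<in> hom C X (src C f). \<forall>k \<in> hom C X (src C g).
        f \<cdot>\<^bsub>C\<^esub> h = g \<cdot>\<^bsub>C\<^esub> k \<longrightarrow>
        (\<exists>!v. v \<in> hom C X (src C p) \<and> p \<cdot>\<^bsub>C\<^esub> v = h \<and> q \<cdot>\<^bsub>C\<^esub> v = k))"

definition pair :: "('o, 'a) cat \<Rightarrow> 'a \<Rightarrow> 'a \<Rightarrow> 'a \<Rightarrow> 'a \<Rightarrow> 'a" where
  "pair C p q h k =
     (THE v. v \<in> hom C (src C h) (src C p) \<and> p \<cdot>\<^bsub>C\<^esub> v = h \<and> q \<cdot>\<^bsub>C\<^esub> v = k)"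

text \<open>An internal category comes with its object of composable pairs \<open>(g, f)\<close>, where \<open>g\<close> is applied
  after \<open>f\<close>; the projections are \<open>pr1\<close> (giving \<open>g\<close>) and \<open>pr2\<close> (giving \<open>f\<close>).\<close>

record ('o, 'a) intcat =
  ob0 :: 'o
  ob1 :: 'o
  idom :: 'a
  icod :: 'a
  iid :: 'a
  pr1 :: 'a
  pr2 :: 'a
  icomp :: 'a

abbreviation ob2 :: "('o, 'a) cat \<Rightarrow> ('o, 'a) intcat \<Rightarrow> 'o" where
  "ob2 C A \<equiv> src C (pr1 A)"

text \<open>Composition of generalised elements of the object of arrows.\<close>

definition icmp :: "('o, 'a) cat \<Rightarrow> ('o, 'a) intcat \<Rightarrow> 'a \<Rightarrow> 'a \<Rightarrow> 'a" where
  "icmp C A g f = icomp A \<cdot>\<^bsub>C\<^esub> pair C (pr1 A) (pr2 A) g f"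

locale internal_category =
  fixes C :: "('o, 'a) cat" and A :: "('o, 'a) intcat"
  assumes ob0: "ob0 A \<in> obj C" and ob1: "ob1 A \<in> obj C"
    and idom: "idom A \<in> hom C (ob1 A) (ob0 A)"
    and icod: "icod A \<in> hom C (ob1 A) (ob0 A)"
    and iid: "iid A \<in> hom C (ob0 A) (ob1 A)"
    and pullback: "is_pullback C (idom A) (icod A) (pr1 A) (pr2 A)"
    and icomp: "icomp A \<in> hom C (ob2 C A) (ob1 A)"
    and idom_iid: "idom A \<cdot>\<^bsub>C\<^esub> iid A = idt C (ob0 A)"
    and icod_iid: "icod A \<cdot>\<^bsub>C\<^esub> iid A = idt C (ob0 A)"
    and idom_icomp: "idom A \<cdot>\<^bsub>C\<^esub> icomp A = idom A \<cdot>\<^bsub>C\<^esub> pr2 A"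
    and icod_icomp: "icod A \<cdot>\<^bsub>C\<^esub> icomp A = icod A \<cdot>\<^bsub>C\<^esub> pr1 A"
    and unit_left: "icmp C A (iid A \<cdot>\<^bsub>C\<^esub> icod A) (idt C (ob1 A)) = idt C (ob1 A)"
    and unit_right: "icmp C A (idt C (ob1 A)) (iid A \<cdot>\<^bsub>C\<^esub> idom A) = idt C (ob1 A)"
    and assoc: "\<exists>r s. is_pullback C (pr2 A) (pr1 A) r s \<and>
      icmp C A (icomp A \<cdot>\<^bsub>C\<^esub> r) (pr2 A \<cdot>\<^bsub>C\<^esub> s) = icmp C A (pr1 A \<cdot>\<^bsub>C\<^esub> r) (icomp A \<cdot>\<^bsub>C\<^esub> s)"

record ('o, 'a) intfun =
  ifdom :: "('o, 'a) intcat"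
  ifcod :: "('o, 'a) intcat"
  if0 :: 'a
  if1 :: 'a

definition is_intfun :: "('o, 'a) cat \<Rightarrow> ('o, 'a) intfun \<Rightarrow> bool" where
  "is_intfun C F \<longleftrightarrow> (let A = ifdom F; B = ifcod F in
     internal_category C A \<and> internal_category C B \<and>
     if0 F \<in> hom C (ob0 A) (ob0 B) \<and> if1 F \<in> hom C (ob1 A) (ob1 B) \<and>
     idom B \<cdot>\<^bsub>C\<^esub> if1 F = if0 F \<cdot>\<^bsub>C\<^esub> idom A \<and>
     icod B \<cdot>\<^bsub>C\<^esub> if1 F = if0 F \<cdot>\<^bsub>C\<^esub> icod A \<and>
     if1 F \<cdot>\<^bsub>C\<^esub> iid A = iid B \<cdot>\<^bsub>C\<^esub> if0 F \<and>
     if1 F \<cdot>\<^bsub>C\<^esub> icomp A = icmp C B (if1 F \<cdot>\<^bsub>C\<^esub> pr1 A) (if1 F \<cdot>\<^bsub>C\<^esub> pr2 A))"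

record ('o, 'a) intnat =
  indom :: "('o, 'a) intfun"
  incod :: "('o, 'a) intfun"
  incmp :: 'a

definition is_intnat :: "('o, 'a) cat \<Rightarrow> ('o, 'a) intnat \<Rightarrow> bool" where
  "is_intnat C \<tau> \<longleftrightarrow> (let F = indom \<tau>; G = incod \<tau>; t = incmp \<tau>; A = ifdom F; B = ifcod F in
     is_intfun C F \<and> is_intfun C G \<and> ifdom G = A \<and> ifcod G = B \<and>
     t \<in> hom C (ob0 A) (ob1 B) \<and>
     idom B \<cdot>\<^bsub>C\<^esub> t = if0 F \<and> icod B \<cdot>\<^bsub>C\<^esub> t = if0 G \<and>
     icmp C B (t \<cdot>\<^bsub>C\<^esub> icod A) (if1 F) = icmp C B (if1 G) (t \<cdot>\<^bsub>C\<^esub> idom A))"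

definition IntCat ::
  "('o, 'a) cat \<Rightarrow> (('o, 'a) intcat, ('o, 'a) intfun, ('o, 'a) intnat) twocat" where
  "IntCat C =
     \<lparr>one = \<lparr>obj = {A. internal_category C A}, arr = {F. is_intfun C F},
             src = ifdom, tgt = ifcod,
             idt = (\<lambda>A. \<lparr>ifdom = A, ifcod = A, if0 = idt C (ob0 A), if1 = idt C (ob1 A)\<rparr>),
             cmp = (\<lambda>G F. \<lparr>ifdom = ifdom F, ifcod = ifcod G,
                           if0 = if0 G \<cdot>\<^bsub>C\<^esub> if0 F, if1 = if1 G \<cdot>\<^bsub>C\<^esub> if1 F\<rparr>)\<rparr>,
      two = \<lparr>obj = {F. is_intfun C F}, arr = {\<tau>. is_intnat C \<tau>}, src = indom, tgt = incod,
             idt = (\<lambda>F. \<lparr>indom = F, incod = F, incmp = iid (ifcod F) \<cdot>\<^bsub>C\<^esub> if0 F\<rparr>),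
             cmp = (\<lambda>\<sigma> \<tau>. \<lparr>indom = indom \<tau>, incod = incod \<sigma>,
                           incmp = icmp C (ifcod (indom \<tau>)) (incmp \<sigma>) (incmp \<tau>)\<rparr>)\<rparr>,
      hcmp = (\<lambda>\<sigma> \<tau>.
        \<lparr>indom = \<lparr>ifdom = ifdom (indom \<tau>), ifcod = ifcod (indom \<sigma>),
                  if0 = if0 (indom \<sigma>) \<cdot>\<^bsub>C\<^esub> if0 (indom \<tau>), if1 = if1 (indom \<sigma>) \<cdot>\<^bsub>C\<^esub> if1 (indom \<tau>)\<rparr>,
         incod = \<lparr>ifdom = ifdom (incod \<tau>), ifcod = ifcod (incod \<sigma>),
                  if0 = if0 (incod \<sigma>) \<cdot>\<^bsub>C\<^esub> if0 (incod \<tau>), if1 = if1 (incod \<sigma>) \<cdot>\<^bsub>C\<^esub> if1 (incod \<tau>)\<rparr>,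
         incmp = icmp C (ifcod (indom \<sigma>))
                   (incmp \<sigma> \<cdot>\<^bsub>C\<^esub> if0 (incod \<tau>)) (if1 (indom \<sigma>) \<cdot>\<^bsub>C\<^esub> incmp \<tau>)\<rparr>)\<rparr>"

section \<open>Externalisation\<close>

definition ext_cat :: "('o, 'a) cat \<Rightarrow> ('o, 'a) intcat \<Rightarrow> 'o \<Rightarrow> ('a, 'a) cat" where
  "ext_cat C A X =
     \<lparr>obj = hom C X (ob0 A), arr = hom C X (ob1 A),
      src = (\<lambda>f. idom A \<cdot>\<^bsub>C\<^esub> f), tgt = (\<lambda>f. icod A \<cdot>\<^bsub>C\<^esub> f),
      idt = (\<lambda>x. iid A \<cdot>\<^bsub>C\<^esub> x), cmp = icmp C A\<rparr>"

definition ext_reindex :: "('o, 'a) cat \<Rightarrow> ('o, 'a) intcat \<Rightarrow> 'a \<Rightarrow> ('a, 'a, 'a, 'a) cfun" where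
  "ext_reindex C A u =
     \<lparr>fdom = ext_cat C A (tgt C u), fcod = ext_cat C A (src C u),
      fob = (\<lambda>x \<in> obj (ext_cat C A (tgt C u)). x \<cdot>\<^bsub>C\<^esub> u),
      far = (\<lambda>f \<in> arr (ext_cat C A (tgt C u)). f \<cdot>\<^bsub>C\<^esub> u)\<rparr>"

definition ext0 :: "('o, 'a) cat \<Rightarrow> ('o, 'a) intcat \<Rightarrow> ('o, 'a, 'a, 'a, 'a) catvalued" where
  "ext0 C A =
     \<lparr>app0 = ext_cat C A, app1 = ext_reindex C A, app2 = (\<lambda>u. cnat_id (ext_reindex C A u))\<rparr>"

definition ext1 ::
  "('o, 'a) cat \<Rightarrow> ('o, 'a) intfun \<Rightarrow> ('o, 'a, 'a, 'a, 'a, 'a, 'a) tnat" where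
  "ext1 C F =
     \<lparr>tdom = ext0 C (ifdom F), tcod = ext0 C (ifcod F),
      tcmp = (\<lambda>X \<in> obj C.
        \<lparr>fdom = ext_cat C (ifdom F) X, fcod = ext_cat C (ifcod F) X,
         fob = (\<lambda>x \<in> obj (ext_cat C (ifdom F) X). if0 F \<cdot>\<^bsub>C\<^esub> x),
         far = (\<lambda>f \<in> arr (ext_cat C (ifdom F) X). if1 F \<cdot>\<^bsub>C\<^esub> f)\<rparr>)\<rparr>"

definition ext2 ::
  "('o, 'a) cat \<Rightarrow> ('o, 'a) intnat \<Rightarrow> ('o, 'a, 'a, 'a, 'a, 'a, 'a) modif" where
  "ext2 C \<tau> =
     \<lparr>mdom = ext1 C (indom \<tau>), mcod = ext1 C (incod \<tau>),
      mcmp = (\<lambda>X \<in> obj C.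
        \<lparr>ndom = tcmp (ext1 C (indom \<tau>)) X, ncod = tcmp (ext1 C (incod \<tau>)) X,
         ncmp = (\<lambda>x \<in> obj (ext_cat C (ifdom (indom \<tau>)) X). incmp \<tau> \<cdot>\<^bsub>C\<^esub> x)\<rparr>)\<rparr>"

text \<open>Externalisation as a 2-functor from \<^term>\<open>IntCat C\<close> to
  \<^term>\<open>CatFun (op_twocat (loc_disc C))\<close>.\<close>

definition externalisation ::
  "('o, 'a) cat \<Rightarrow>
   (('o, 'a) intcat, ('o, 'a) intfun, ('o, 'a) intnat,
    ('o, 'a, 'a, 'a, 'a) catvalued, ('o, 'a, 'a, 'a, 'a, 'a, 'a) tnat,
    ('o, 'a, 'a, 'a, 'a, 'a, 'a) modif) twofun" where
  "externalisation C = \<lparr>app0 = ext0 C, app1 = ext1 C, app2 = ext2 C\<rparr>"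

text \<open>\<open>C\<close> plays the role of \<open>Disc(W)\<close>, and \<open>F\<close> that of the inclusion.\<close>

definition internalises_families ::
  "('o, 'm, 't) twocat \<Rightarrow> ('c, 'a) cat \<Rightarrow> ('c, 'a, 'a, 'o, 'm, 't) twofun \<Rightarrow>
   ('o, 'm, 't, ('c, 'a) intcat, ('c, 'a) intfun, ('c, 'a) intnat) twofun \<Rightarrow> bool" where
  "internalises_families W C F E \<longleftrightarrow>
     two_functor W (IntCat C) E \<and>
     two_naturally_isomorphic W (op_twocat (loc_disc C))
       (twofun_comp (externalisation C) E) (family_fibration W C F)"

end

theory Submission
  imports Defs
begin

text \<open>Externalisation is the nerve of the inclusion of discrete internal categories, and by the Yoneda
  lemma it is 2-fully faithful. So an \<open>E\<close> with the required property exists as soon as each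
  \<open>hom\<^sub>W(F(-), A)\<close> is isomorphic to an externalisation, and any such \<open>E\<close> is 2-fully faithful iff the
  family fibration is. For the former, the objects of \<open>hom\<^sub>W(F X, A)\<close> are represented by the
  coreflection of \<open>A\<close> and its arrows by the coreflection of the cotensor of \<open>A\<close> with the walking arrow;
  together with pullbacks, this turns representability into an internal category.
  Finally, \<open>E \<circ> F\<close> is always dense, being isomorphic to the inclusion of discrete internal categories, and
  a 2-fully faithful 2-functor is dense once its restriction along some 2-functor is.\<close>

section \<open>Categories\<close>

text \<open>The two families being compared live over different types: externalisation takes values
  in categories made of arrows of \<open>C\<close>, the family fibration in categories made of cells
  of \<open>W\<close>. No single \<open>CatFun\<close> contains a transformation between them, so
  invertibility, transfer of full faithfulness and lifting along an isomorphism are developed by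
  hand, with equations between functor records reduced to equations between elements of their
  values. Elements also tame the internal side: an internal category acts on its generalised
  elements like an ordinary one, and an axiom stated for a generic arrow or composable tuple extends
  to all elements by precomposition. The defining property fixes an internalisation only up to
  isomorphism. Thus \<open>E (F X)\<close> need not be a literal discrete category on
  \<open>X\<close>: that it is discrete, and that its object of objects is isomorphic to
  \<open>X\<close>, has to be derived from the isomorphism with the family fibration. This works
  because all 2-cells between discrete objects are identities.\<close>

lemma hom_iff: "f \<in> hom C x y \<longleftrightarrow> f \<in> arr C \<and> src C f = x \<and> tgt C f = y"
  by (simp add: hom_def)

context category
begin

lemma idt_arr [simp]: "x \<in> obj C \<Longrightarrow> idt C x \<in> arr C"
  and src_idt [simp]: "x \<in> obj C \<Longrightarrow> src C (idt C x) = x"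
  and tgt_idt [simp]: "x \<in> obj C \<Longrightarrow> tgt C (idt C x) = x"
  using idt_hom by (auto simp: hom_iff)

lemma cmp_arr [simp]: "f \<in> arr C \<Longrightarrow> g \<in> arr C \<Longrightarrow> src C g = tgt C f \<Longrightarrow> g \<cdot>\<^bsub>C\<^esub> f \<in> arr C"
  and src_cmp [simp]: "f \<in> arr C \<Longrightarrow> g \<in> arr C \<Longrightarrow> src C g = tgt C f \<Longrightarrow> src C (g \<cdot>\<^bsub>C\<^esub> f) = src C f"
  and tgt_cmp [simp]: "f \<in> arr C \<Longrightarrow> g \<in> arr C \<Longrightarrow> src C g = tgt C f \<Longrightarrow> tgt C (g \<cdot>\<^bsub>C\<^esub> f) = tgt C g"
  using cmp_hom[of f "src C f" "tgt C f" g "tgt C g"] by (auto simp: hom_iff)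

lemma idt_cmp [simp]: "f \<in> arr C \<Longrightarrow> tgt C f = y \<Longrightarrow> idt C y \<cdot>\<^bsub>C\<^esub> f = f"
  and cmp_idt [simp]: "f \<in> arr C \<Longrightarrow> src C f = x \<Longrightarrow> f \<cdot>\<^bsub>C\<^esub> idt C x = f"
  using cmp_idt_left cmp_idt_right by (auto simp: hom_iff)

lemma assoc: "f \<in> arr C \<Longrightarrow> g \<in> arr C \<Longrightarrow> h \<in> arr C \<Longrightarrow> src C g = tgt C f \<Longrightarrow> src C h = tgt C g \<Longrightarrow>
    (h \<cdot>\<^bsub>C\<^esub> g) \<cdot>\<^bsub>C\<^esub> f = h \<cdot>\<^bsub>C\<^esub> (g \<cdot>\<^bsub>C\<^esub> f)"
  using cmp_assoc by (auto simp: hom_iff)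

declare src_obj [simp] tgt_obj [simp]

end

text \<open>Endpoints are computed by \<open>src\<close> and \<open>tgt\<close> here, where the
  locale axioms quantify over them through \<open>hom\<close>; this is the form that rewriting can
  check for a concrete category. The other introduction rules follow the same pattern.\<close>

lemma categoryI:
  assumes "\<And>f. f \<in> arr C \<Longrightarrow> src C f \<in> obj C \<and> tgt C f \<in> obj C"
    and "\<And>x. x \<in> obj C \<Longrightarrow> idt C x \<in> arr C \<and> src C (idt C x) = x \<and> tgt C (idt C x) = x"
    and "\<And>f g. f \<in> arr C \<Longrightarrow> g \<in> arr C \<Longrightarrow> src C g = tgt C f \<Longrightarrow>
      g \<cdot>\<^bsub>C\<^esub> f \<in> arr C \<and> src C (g \<cdot>\<^bsub>C\<^esub> f) = src C f \<and> tgt C (g \<cdot>\<^bsub>C\<^esub> f) = tgt C g"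
    and "\<And>f. f \<in> arr C \<Longrightarrow> idt C (tgt C f) \<cdot>\<^bsub>C\<^esub> f = f \<and> f \<cdot>\<^bsub>C\<^esub> idt C (src C f) = f"
    and "\<And>f g h. f \<in> arr C \<Longrightarrow> g \<in> arr C \<Longrightarrow> h \<in> arr C \<Longrightarrow> src C g = tgt C f \<Longrightarrow> src C h = tgt C g \<Longrightarrow>
      (h \<cdot>\<^bsub>C\<^esub> g) \<cdot>\<^bsub>C\<^esub> f = h \<cdot>\<^bsub>C\<^esub> (g \<cdot>\<^bsub>C\<^esub> f)"
  shows "category C"
  using assms by unfold_locales (auto simp: hom_iff)

lemma is_functorI:
  assumes "\<And>x. x \<in> obj C \<Longrightarrow> Fo x \<in> obj D"
    and "\<And>f. f \<in> arr C \<Longrightarrow> Fa f \<in> arr D \<and> src D (Fa f) = Fo (src C f) \<and> tgt D (Fa f) = Fo (tgt C f)"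
    and "\<And>x. x \<in> obj C \<Longrightarrow> Fa (idt C x) = idt D (Fo x)"
    and "\<And>f g. f \<in> arr C \<Longrightarrow> g \<in> arr C \<Longrightarrow> src C g = tgt C f \<Longrightarrow> Fa (g \<cdot>\<^bsub>C\<^esub> f) = Fa g \<cdot>\<^bsub>D\<^esub> Fa f"
  shows "is_functor C D Fo Fa"
  using assms by unfold_locales (auto simp: hom_iff)

context is_functor
begin

lemma arr [simp]: "f \<in> arr C \<Longrightarrow> Fa f \<in> arr D"
  and src_map [simp]: "f \<in> arr C \<Longrightarrow> src D (Fa f) = Fo (src C f)"
  and tgt_map [simp]: "f \<in> arr C \<Longrightarrow> tgt D (Fa f) = Fo (tgt C f)"
  using map_hom by (auto simp: hom_iff)

lemma cmp: "f \<in> arr C \<Longrightarrow> g \<in> arr C \<Longrightarrow> src C g = tgt C f \<Longrightarrow> Fa (g \<cdot>\<^bsub>C\<^esub> f) = Fa g \<cdot>\<^bsub>D\<^esub> Fa f"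
  using map_cmp by (auto simp: hom_iff)

declare map_obj [simp]

end

lemma is_functor_comp:
  assumes "is_functor C D Fo Fa" "is_functor D E Go Ga"
  shows "is_functor C E (Go \<circ> Fo) (Ga \<circ> Fa)"
proof -
  interpret F: is_functor C D Fo Fa by fact
  interpret G: is_functor D E Go Ga by fact
  show ?thesis by (rule is_functorI) (simp_all add: F.map_idt G.map_idt F.cmp G.cmp)
qed

lemma cat_iso_comp:
  assumes "cat_iso C D Fo Fa" "cat_iso D E Go Ga"
  shows "cat_iso C E (Go \<circ> Fo) (Ga \<circ> Fa)"
  using assms unfolding cat_iso_def by (blast intro: is_functor_comp bij_betw_trans)

text \<open>Two out of three for isomorphisms of categories: if a composite and its outer factor are
  bijective, so is the inner factor, once that is known to land in \<open>D\<close>. This later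
  strips externalisation off a composite.\<close>

lemma cat_iso_cancel:
  assumes "cat_iso C E (Go \<circ> Fo) (Ga \<circ> Fa)" "cat_iso D E Go Ga" and F: "is_functor C D Fo Fa"
  shows "cat_iso C D Fo Fa"
proof -
  interpret F: is_functor C D Fo Fa by fact
  have "bij_betw Fo (obj C) (obj D)"
    using assms unfolding cat_iso_def by (subst bij_betw_comp_iff2[of Go _ "obj E"]) auto
  moreover have "bij_betw Fa (arr C) (arr D)"
    using assms unfolding cat_iso_def by (subst bij_betw_comp_iff2[of Ga _ "arr E"]) auto
  ultimately show ?thesis using F by (simp add: cat_iso_def)
qed

text \<open>Functor records store restricted functions; this carries functoriality over from the
  unrestricted formula.\<close>

lemma is_functor_cong:
  assumes "is_functor C D Fo Fa" "category C"
    and "\<And>x. x \<in> obj C \<Longrightarrow> Fo' x = Fo x" "\<And>f. f \<in> arr C \<Longrightarrow> Fa' f = Fa f"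
  shows "is_functor C D Fo' Fa'"
proof -
  interpret F: is_functor C D Fo Fa by fact
  interpret C: category C by fact
  show ?thesis by (rule is_functorI) (simp_all add: assms F.map_idt F.cmp)
qed

section \<open>2-categories\<close>

context two_category
begin

lemma two_src [simp]: "\<alpha> \<in> arr (two K) \<Longrightarrow> src (two K) \<alpha> \<in> arr (one K)"
  and two_tgt [simp]: "\<alpha> \<in> arr (two K) \<Longrightarrow> tgt (two K) \<alpha> \<in> arr (one K)"
  using two.src_obj two.tgt_obj obj_two by auto

lemma src_tgt [simp]: "\<alpha> \<in> arr (two K) \<Longrightarrow> src (one K) (tgt (two K) \<alpha>) = src (one K) (src (two K) \<alpha>)"
  and tgt_tgt [simp]: "\<alpha> \<in> arr (two K) \<Longrightarrow> tgt (one K) (tgt (two K) \<alpha>) = tgt (one K) (src (two K) \<alpha>)"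
  using globular[of \<alpha> "src (one K) (src (two K) \<alpha>)" "tgt (one K) (src (two K) \<alpha>)"]
  by (auto simp: hom_iff)

lemma two_idt [simp]: "f \<in> arr (one K) \<Longrightarrow> idt (two K) f \<in> arr (two K)"
  and two_src_idt [simp]: "f \<in> arr (one K) \<Longrightarrow> src (two K) (idt (two K) f) = f"
  and two_tgt_idt [simp]: "f \<in> arr (one K) \<Longrightarrow> tgt (two K) (idt (two K) f) = f"
  by (simp_all add: obj_two)

lemma hcmp_arr [simp]: "\<alpha> \<in> arr (two K) \<Longrightarrow> \<beta> \<in> arr (two K) \<Longrightarrow>
    src (one K) (src (two K) \<beta>) = tgt (one K) (src (two K) \<alpha>) \<Longrightarrow> \<beta> \<star>\<^bsub>K\<^esub> \<alpha> \<in> arr (two K)"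
  and src_hcmp [simp]: "\<alpha> \<in> arr (two K) \<Longrightarrow> \<beta> \<in> arr (two K) \<Longrightarrow>
    src (one K) (src (two K) \<beta>) = tgt (one K) (src (two K) \<alpha>) \<Longrightarrow>
    src (two K) (\<beta> \<star>\<^bsub>K\<^esub> \<alpha>) = src (two K) \<beta> \<cdot>\<^bsub>one K\<^esub> src (two K) \<alpha>"
  and tgt_hcmp [simp]: "\<alpha> \<in> arr (two K) \<Longrightarrow> \<beta> \<in> arr (two K) \<Longrightarrow>
    src (one K) (src (two K) \<beta>) = tgt (one K) (src (two K) \<alpha>) \<Longrightarrow>
    tgt (two K) (\<beta> \<star>\<^bsub>K\<^esub> \<alpha>) = tgt (two K) \<beta> \<cdot>\<^bsub>one K\<^esub> tgt (two K) \<alpha>"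
  using hcmp_hom[of \<alpha> "src (two K) \<alpha>" "tgt (two K) \<alpha>" \<beta> "src (two K) \<beta>" "tgt (two K) \<beta>"]
  by (auto simp: hom_iff)

lemma idt_hcmp_idt: "f \<in> arr (one K) \<Longrightarrow> g \<in> arr (one K) \<Longrightarrow> src (one K) g = tgt (one K) f \<Longrightarrow>
    idt (two K) g \<star>\<^bsub>K\<^esub> idt (two K) f = idt (two K) (g \<cdot>\<^bsub>one K\<^esub> f)"
  using hcmp_idt by (auto simp: hom_iff)

lemma idt_hcmp [simp]: "\<alpha> \<in> arr (two K) \<Longrightarrow> tgt (one K) (src (two K) \<alpha>) = B \<Longrightarrow>
    idt (two K) (idt (one K) B) \<star>\<^bsub>K\<^esub> \<alpha> = \<alpha>"
  and hcmp_idt' [simp]: "\<alpha> \<in> arr (two K) \<Longrightarrow> src (one K) (src (two K) \<alpha>) = A \<Longrightarrow>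
    \<alpha> \<star>\<^bsub>K\<^esub> idt (two K) (idt (one K) A) = \<alpha>"
  using hcmp_idt_left hcmp_idt_right by (auto simp: homcat_def hom_iff)

lemma hassoc: "\<alpha> \<in> arr (two K) \<Longrightarrow> \<beta> \<in> arr (two K) \<Longrightarrow> \<gamma> \<in> arr (two K) \<Longrightarrow>
    src (one K) (src (two K) \<beta>) = tgt (one K) (src (two K) \<alpha>) \<Longrightarrow>
    src (one K) (src (two K) \<gamma>) = tgt (one K) (src (two K) \<beta>) \<Longrightarrow>
    (\<gamma> \<star>\<^bsub>K\<^esub> \<beta>) \<star>\<^bsub>K\<^esub> \<alpha> = \<gamma> \<star>\<^bsub>K\<^esub> (\<beta> \<star>\<^bsub>K\<^esub> \<alpha>)"
  using hcmp_assoc by (auto simp: homcat_def hom_iff)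

lemma exchange: "\<alpha> \<in> arr (two K) \<Longrightarrow> \<alpha>' \<in> arr (two K) \<Longrightarrow> \<beta> \<in> arr (two K) \<Longrightarrow> \<beta>' \<in> arr (two K) \<Longrightarrow>
    src (two K) \<alpha>' = tgt (two K) \<alpha> \<Longrightarrow> src (two K) \<beta>' = tgt (two K) \<beta> \<Longrightarrow>
    src (one K) (src (two K) \<beta>) = tgt (one K) (src (two K) \<alpha>) \<Longrightarrow>
    (\<beta>' \<cdot>\<^bsub>two K\<^esub> \<beta>) \<star>\<^bsub>K\<^esub> (\<alpha>' \<cdot>\<^bsub>two K\<^esub> \<alpha>) = (\<beta>' \<star>\<^bsub>K\<^esub> \<alpha>') \<cdot>\<^bsub>two K\<^esub> (\<beta> \<star>\<^bsub>K\<^esub> \<alpha>)"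
  using interchange by (auto simp: hom_iff)

lemma homcat_category: "category (homcat K A B)"
  by (rule categoryI) (auto simp: homcat_def hom_iff two.assoc)

end

text \<open>\<open>homcat\<close> only asks the source of a 2-cell to lie in \<open>hom\<close>. The
  2-category axioms ensure that this source is a 1-cell at all, which leaves just its two endpoints
  to compare.\<close>

lemma obj_homcat [simp]: "f \<in> obj (homcat K A B) \<longleftrightarrow> f \<in> arr (one K) \<and> src (one K) f = A \<and> tgt (one K) f = B"
  and arr_homcat [simp]: "\<alpha> \<in> arr (homcat K A B) \<longleftrightarrow> \<alpha> \<in> arr (two K) \<and>
    src (one K) (src (two K) \<alpha>) = A \<and> tgt (one K) (src (two K) \<alpha>) = B"
  if "two_category K"
proof -
  interpret two_category K by fact
  show "f \<in> obj (homcat K A B) \<longleftrightarrow> f \<in> arr (one K) \<and> src (one K) f = A \<and> tgt (one K) f = B"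
    "\<alpha> \<in> arr (homcat K A B) \<longleftrightarrow> \<alpha> \<in> arr (two K) \<and>
    src (one K) (src (two K) \<alpha>) = A \<and> tgt (one K) (src (two K) \<alpha>) = B"
    by (auto simp: homcat_def hom_iff)
qed

lemma homcat_simps [simp]: "src (homcat K A B) = src (two K)" "tgt (homcat K A B) = tgt (two K)"
  "idt (homcat K A B) = idt (two K)" "cmp (homcat K A B) = cmp (two K)"
  by (simp_all add: homcat_def)

lemma two_categoryI:
  assumes "category (one K)" "category (two K)" "obj (two K) = arr (one K)"
    and "\<And>\<alpha>. \<alpha> \<in> arr (two K) \<Longrightarrow> src (one K) (tgt (two K) \<alpha>) = src (one K) (src (two K) \<alpha>) \<and>
      tgt (one K) (tgt (two K) \<alpha>) = tgt (one K) (src (two K) \<alpha>)"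
    and "\<And>\<alpha> \<beta>. \<alpha> \<in> arr (two K) \<Longrightarrow> \<beta> \<in> arr (two K) \<Longrightarrow>
      src (one K) (src (two K) \<beta>) = tgt (one K) (src (two K) \<alpha>) \<Longrightarrow>
      \<beta> \<star>\<^bsub>K\<^esub> \<alpha> \<in> arr (two K) \<and> src (two K) (\<beta> \<star>\<^bsub>K\<^esub> \<alpha>) = src (two K) \<beta> \<cdot>\<^bsub>one K\<^esub> src (two K) \<alpha> \<and>
      tgt (two K) (\<beta> \<star>\<^bsub>K\<^esub> \<alpha>) = tgt (two K) \<beta> \<cdot>\<^bsub>one K\<^esub> tgt (two K) \<alpha>"
    and "\<And>f g. f \<in> arr (one K) \<Longrightarrow> g \<in> arr (one K) \<Longrightarrow> src (one K) g = tgt (one K) f \<Longrightarrow>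
      idt (two K) g \<star>\<^bsub>K\<^esub> idt (two K) f = idt (two K) (g \<cdot>\<^bsub>one K\<^esub> f)"
    and "\<And>\<alpha> \<alpha>' \<beta> \<beta>'. \<alpha> \<in> arr (two K) \<Longrightarrow> \<alpha>' \<in> arr (two K) \<Longrightarrow> \<beta> \<in> arr (two K) \<Longrightarrow> \<beta>' \<in> arr (two K) \<Longrightarrow>
      src (two K) \<alpha>' = tgt (two K) \<alpha> \<Longrightarrow> src (two K) \<beta>' = tgt (two K) \<beta> \<Longrightarrow>
      src (one K) (src (two K) \<beta>) = tgt (one K) (src (two K) \<alpha>) \<Longrightarrow>
      (\<beta>' \<cdot>\<^bsub>two K\<^esub> \<beta>) \<star>\<^bsub>K\<^esub> (\<alpha>' \<cdot>\<^bsub>two K\<^esub> \<alpha>) = (\<beta>' \<star>\<^bsub>K\<^esub> \<alpha>') \<cdot>\<^bsub>two K\<^esub> (\<beta> \<star>\<^bsub>K\<^esub> \<alpha>)"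
    and "\<And>\<alpha>. \<alpha> \<in> arr (two K) \<Longrightarrow> idt (two K) (idt (one K) (tgt (one K) (src (two K) \<alpha>))) \<star>\<^bsub>K\<^esub> \<alpha> = \<alpha> \<and>
      \<alpha> \<star>\<^bsub>K\<^esub> idt (two K) (idt (one K) (src (one K) (src (two K) \<alpha>))) = \<alpha>"
    and "\<And>\<alpha> \<beta> \<gamma>. \<alpha> \<in> arr (two K) \<Longrightarrow> \<beta> \<in> arr (two K) \<Longrightarrow> \<gamma> \<in> arr (two K) \<Longrightarrow>
      src (one K) (src (two K) \<beta>) = tgt (one K) (src (two K) \<alpha>) \<Longrightarrow>
      src (one K) (src (two K) \<gamma>) = tgt (one K) (src (two K) \<beta>) \<Longrightarrow>
      (\<gamma> \<star>\<^bsub>K\<^esub> \<beta>) \<star>\<^bsub>K\<^esub> \<alpha> = \<gamma> \<star>\<^bsub>K\<^esub> (\<beta> \<star>\<^bsub>K\<^esub> \<alpha>)"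
  shows "two_category K"
proof -
  interpret one: category "one K" by fact
  interpret two: category "two K" by fact
  have "src (two K) \<alpha> \<in> arr (one K)" "tgt (two K) \<alpha> \<in> arr (one K)" if "\<alpha> \<in> arr (two K)" for \<alpha>
    using that two.src_obj two.tgt_obj assms(3) by auto
  then show ?thesis
    using assms by unfold_locales (auto simp: hom_iff homcat_def)
qed

context two_functor
begin

lemma hcmp: 
  assumes "two_category K" "\<alpha> \<in> arr (two K)" "\<beta> \<in> arr (two K)"
    "src (one K) (src (two K) \<beta>) = tgt (one K) (src (two K) \<alpha>)"
  shows "app2 F (\<beta> \<star>\<^bsub>K\<^esub> \<alpha>) = app2 F \<beta> \<star>\<^bsub>L\<^esub> app2 F \<alpha>"
  using map_hcmp assms by auto

lemma hom_functor:
  assumes "two_category K"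
  shows "is_functor (homcat K A B) (homcat L (app0 F A) (app0 F B)) (app1 F) (app2 F)"
proof -
  interpret K: two_category K by fact
  show ?thesis
    by (rule is_functorI) (auto simp: homcat_def hom_iff two.map_idt two.cmp K.obj_two)
qed

end

lemma two_functorI:
  assumes K: "two_category K"
    and "is_functor (one K) (one L) (app0 F) (app1 F)" "is_functor (two K) (two L) (app1 F) (app2 F)"
    and "\<And>\<alpha> \<beta>. \<alpha> \<in> arr (two K) \<Longrightarrow> \<beta> \<in> arr (two K) \<Longrightarrow>
      src (one K) (src (two K) \<beta>) = tgt (one K) (src (two K) \<alpha>) \<Longrightarrow>
      app2 F (\<beta> \<star>\<^bsub>K\<^esub> \<alpha>) = app2 F \<beta> \<star>\<^bsub>L\<^esub> app2 F \<alpha>"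
  shows "two_functor K L F"
proof -
  interpret one: is_functor "one K" "one L" "app0 F" "app1 F" by fact
  interpret two: is_functor "two K" "two L" "app1 F" "app2 F" by fact
  show ?thesis by unfold_locales (simp add: assms)
qed

lemma two_functor_comp:
  assumes "two_category K" "two_category L" "two_functor K L F" "two_functor L M G"
  shows "two_functor K M (twofun_comp G F)"
proof -
  interpret K: two_category K by fact
  interpret F: two_functor K L F by fact
  interpret G: two_functor L M G by fact
  show ?thesis
    using F.one.is_functor_axioms F.two.is_functor_axioms G.one.is_functor_axioms G.two.is_functor_axioms
    by (intro two_functorI assms)
      (auto simp: twofun_comp_def assms F.hcmp G.hcmp intro: is_functor_comp)
qed

lemma op_twocat_simps [simp]:
  "obj (one (op_twocat K)) = obj (one K)" "arr (one (op_twocat K)) = arr (one K)"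
  "src (one (op_twocat K)) = tgt (one K)" "tgt (one (op_twocat K)) = src (one K)"
  "idt (one (op_twocat K)) = idt (one K)" "g \<cdot>\<^bsub>one (op_twocat K)\<^esub> f = f \<cdot>\<^bsub>one K\<^esub> g"
  "two (op_twocat K) = two K" "\<beta> \<star>\<^bsub>op_twocat K\<^esub> \<alpha> = \<alpha> \<star>\<^bsub>K\<^esub> \<beta>"
  by (simp_all add: op_twocat_def op_cat_def)

lemma op_op_twocat [simp]: "op_twocat (op_twocat K) = K"
  by (simp add: op_twocat_def op_cat_def)

text \<open>Reversing the 1-cells swaps the two objects and leaves the direction of the 2-cells
  alone, so contravariant hom constructions can be read off from covariant ones.\<close>

lemma homcat_op: "homcat (op_twocat K) A B = homcat K B A"
  by (auto simp: homcat_def hom_iff intro!: cat.equality)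

lemma two_category_op: 
  assumes "two_category K"
  shows "two_category (op_twocat K)"
proof -
  interpret two_category K by fact
  show ?thesis
    by (intro two_categoryI categoryI)
      (auto simp: one.assoc two.assoc obj_two idt_hcmp_idt exchange hassoc)
qed

lemma two_functor_op: 
  assumes "two_category K" "two_functor K L F"
  shows "two_functor (op_twocat K) (op_twocat L) F"
proof -
  interpret K: two_category K by fact
  interpret F: two_functor K L F by fact
  show ?thesis using F.two.is_functor_axioms
    by (intro two_functorI two_category_op assms is_functorI)
      (auto simp: F.one.map_idt F.one.cmp F.two.map_idt F.two.cmp F.hcmp assms)
qed

lemma loc_disc_simps [simp]:
  "one (loc_disc C) = C" "obj (two (loc_disc C)) = arr C" "arr (two (loc_disc C)) = arr C"
  "src (two (loc_disc C)) f = f" "tgt (two (loc_disc C)) f = f" "idt (two (loc_disc C)) f = f"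
  "g \<cdot>\<^bsub>two (loc_disc C)\<^esub> f = f" "g \<star>\<^bsub>loc_disc C\<^esub> f = g \<cdot>\<^bsub>C\<^esub> f"
  by (simp_all add: loc_disc_def)

lemma two_category_loc_disc:
  assumes "category C"
  shows "two_category (loc_disc C)"
proof -
  interpret category C by fact
  show ?thesis
    by (intro two_categoryI) (auto simp: assoc assms intro: categoryI)
qed

section \<open>Cat-valued 2-functors, elementwise\<close>

lemma Cat_simps [simp]:
  "A \<in> obj (one Cat) \<longleftrightarrow> category A" "G \<in> arr (one Cat) \<longleftrightarrow> is_cfun G"
  "src (one Cat) = fdom" "tgt (one Cat) = fcod" "idt (one Cat) = cfun_id" "cmp (one Cat) = cfun_comp"
  "G \<in> obj (two Cat) \<longleftrightarrow> is_cfun G" "\<alpha> \<in> arr (two Cat) \<longleftrightarrow> is_cnat \<alpha>"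
  "src (two Cat) = ndom" "tgt (two Cat) = ncod" "idt (two Cat) = cnat_id" "cmp (two Cat) = cnat_vcomp"
  "hcmp Cat = cnat_hcomp"
  by (simp_all add: Cat_def)

lemma cfun_eqI:
  assumes "is_cfun F" "is_cfun G" "fdom F = fdom G" "fcod F = fcod G"
    and "\<And>x. x \<in> obj (fdom F) \<Longrightarrow> fob F x = fob G x"
    and "\<And>f. f \<in> arr (fdom F) \<Longrightarrow> far F f = far G f"
  shows "F = G"
proof (rule cfun.equality)
  show "fob F = fob G" "far F = far G"
    using assms unfolding is_cfun_def by (auto intro: extensionalityI)
qed (use assms in auto)

lemma is_cfunI:
  assumes "category (fdom F)" "category (fcod F)" "is_functor (fdom F) (fcod F) (fob F) (far F)"
    "fob F \<in> extensional (obj (fdom F))" "far F \<in> extensional (arr (fdom F))"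
  shows "is_cfun F"
  using assms by (simp add: is_cfun_def)

lemma cfun_id_simps [simp]:
  "fdom (cfun_id A) = A" "fcod (cfun_id A) = A"
  "x \<in> obj A \<Longrightarrow> fob (cfun_id A) x = x" "f \<in> arr A \<Longrightarrow> far (cfun_id A) f = f"
  by (simp_all add: cfun_id_def)

lemma is_cfun_id [simp]: "category A \<Longrightarrow> is_cfun (cfun_id A)"
proof -
  assume "category A"
  then interpret category A .
  show ?thesis
    by (rule is_cfunI) (auto simp: cfun_id_def intro!: is_functorI categoryI assoc)
qed

lemma cfun_comp_simps [simp]:
  "fdom (cfun_comp G F) = fdom F" "fcod (cfun_comp G F) = fcod G"
  "x \<in> obj (fdom F) \<Longrightarrow> fob (cfun_comp G F) x = fob G (fob F x)"
  "f \<in> arr (fdom F) \<Longrightarrow> far (cfun_comp G F) f = far G (far F f)"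
  by (simp_all add: cfun_comp_def)

lemma is_cfun_comp [simp]:
  assumes "is_cfun F" "is_cfun G" "fdom G = fcod F"
  shows "is_cfun (cfun_comp G F)"
proof (rule is_cfunI)
  interpret F: is_functor "fdom F" "fcod F" "fob F" "far F" using assms by (simp add: is_cfun_def)
  interpret C: category "fdom F" using assms by (simp add: is_cfun_def)
  have "is_functor (fdom F) (fcod G) (fob G \<circ> fob F) (far G \<circ> far F)"
    using assms by (intro is_functor_comp[of _ "fcod F"]) (auto simp: is_cfun_def)
  from is_functor_cong[OF this C.category_axioms]
  show "is_functor (fdom (cfun_comp G F)) (fcod (cfun_comp G F)) (fob (cfun_comp G F)) (far (cfun_comp G F))"
    by simp
qed (use assms in \<open>auto simp: is_cfun_def cfun_comp_def\<close>)

lemma is_nat_iff: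
  "is_nat A B Fo Fa Go Ga t \<longleftrightarrow>
     (\<forall>x \<in> obj A. t x \<in> arr B \<and> src B (t x) = Fo x \<and> tgt B (t x) = Go x) \<and>
     (\<forall>f \<in> arr A. t (tgt A f) \<cdot>\<^bsub>B\<^esub> Fa f = Ga f \<cdot>\<^bsub>B\<^esub> t (src A f))"
  by (auto simp: is_nat_def hom_iff)

lemma cnat_eqI:
  assumes "is_cnat \<alpha>" "is_cnat \<beta>" "ndom \<alpha> = ndom \<beta>" "ncod \<alpha> = ncod \<beta>"
    and "\<And>x. x \<in> obj (fdom (ndom \<alpha>)) \<Longrightarrow> ncmp \<alpha> x = ncmp \<beta> x"
  shows "\<alpha> = \<beta>"
proof (rule cnat.equality)
  show "ncmp \<alpha> = ncmp \<beta>" using assms unfolding is_cnat_def by (auto intro: extensionalityI)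
qed (use assms in auto)

lemma is_cnatI:
  assumes "is_cfun (ndom \<alpha>)" "is_cfun (ncod \<alpha>)" "fdom (ncod \<alpha>) = fdom (ndom \<alpha>)" "fcod (ncod \<alpha>) = fcod (ndom \<alpha>)"
    and "\<And>x. x \<in> obj (fdom (ndom \<alpha>)) \<Longrightarrow> ncmp \<alpha> x \<in> arr (fcod (ndom \<alpha>)) \<and>
      src (fcod (ndom \<alpha>)) (ncmp \<alpha> x) = fob (ndom \<alpha>) x \<and> tgt (fcod (ndom \<alpha>)) (ncmp \<alpha> x) = fob (ncod \<alpha>) x"
    and "\<And>f. f \<in> arr (fdom (ndom \<alpha>)) \<Longrightarrow>
      ncmp \<alpha> (tgt (fdom (ndom \<alpha>)) f) \<cdot>\<^bsub>fcod (ndom \<alpha>)\<^esub> far (ndom \<alpha>) f =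
      far (ncod \<alpha>) f \<cdot>\<^bsub>fcod (ndom \<alpha>)\<^esub> ncmp \<alpha> (src (fdom (ndom \<alpha>)) f)"
    and "ncmp \<alpha> \<in> extensional (obj (fdom (ndom \<alpha>)))"
  shows "is_cnat \<alpha>"
  using assms by (simp add: is_cnat_def is_nat_iff)

lemma cnat_simps [simp]:
  "ndom (cnat_id F) = F" "ncod (cnat_id F) = F"
  "x \<in> obj (fdom F) \<Longrightarrow> ncmp (cnat_id F) x = idt (fcod F) (fob F x)"
  "ndom (cnat_vcomp \<beta> \<alpha>) = ndom \<alpha>" "ncod (cnat_vcomp \<beta> \<alpha>) = ncod \<beta>"
  "x \<in> obj (fdom (ndom \<alpha>)) \<Longrightarrow> ncmp (cnat_vcomp \<beta> \<alpha>) x = ncmp \<beta> x \<cdot>\<^bsub>fcod (ndom \<alpha>)\<^esub> ncmp \<alpha> x"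
  by (simp_all add: cnat_id_def cnat_vcomp_def)

lemma cnat_hcomp_simps [simp]:
  "ndom (cnat_hcomp \<beta> \<alpha>) = cfun_comp (ndom \<beta>) (ndom \<alpha>)"
  "ncod (cnat_hcomp \<beta> \<alpha>) = cfun_comp (ncod \<beta>) (ncod \<alpha>)"
  "x \<in> obj (fdom (ndom \<alpha>)) \<Longrightarrow> ncmp (cnat_hcomp \<beta> \<alpha>) x =
     ncmp \<beta> (fob (ncod \<alpha>) x) \<cdot>\<^bsub>fcod (ndom \<beta>)\<^esub> far (ndom \<beta>) (ncmp \<alpha> x)"
  by (simp_all add: cnat_hcomp_def)

text \<open>The source and target of a functor are parameters, so that the rules apply after these have been
  rewritten.\<close>

locale cfunctor = C: category C + D: category D + is_functor C D "fob F" "far F"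
  for C :: "('x, 'y) cat" and D :: "('x2, 'y2) cat" and F +
  assumes is_cfun: "is_cfun F" and fdom: "fdom F = C" and fcod: "fcod F = D"

lemma cfunctorI: "is_cfun F \<Longrightarrow> fdom F = C \<Longrightarrow> fcod F = D \<Longrightarrow> cfunctor C D F"
  by (auto simp: is_cfun_def cfunctor_def cfunctor_axioms_def)

lemma is_cnatE:
  assumes "is_cnat \<alpha>" "ndom \<alpha> = F" "ncod \<alpha> = G" "fdom F = C" "fcod F = D"
  shows "is_cfun F" "is_cfun G" "fdom G = C" "fcod G = D"
    "x \<in> obj C \<Longrightarrow> ncmp \<alpha> x \<in> arr D" "x \<in> obj C \<Longrightarrow> src D (ncmp \<alpha> x) = fob F x"
    "x \<in> obj C \<Longrightarrow> tgt D (ncmp \<alpha> x) = fob G x"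
    "f \<in> arr C \<Longrightarrow> ncmp \<alpha> (tgt C f) \<cdot>\<^bsub>D\<^esub> far F f = far G f \<cdot>\<^bsub>D\<^esub> ncmp \<alpha> (src C f)"
  using assms by (auto simp: is_cnat_def is_nat_iff)

lemma is_cnat_id [simp]:
  assumes "is_cfun F"
  shows "is_cnat (cnat_id F)"
proof -
  interpret F: cfunctor "fdom F" "fcod F" F using assms by (intro cfunctorI) auto
  show ?thesis by (intro is_cnatI) (auto simp: F.is_cfun cnat_id_def)
qed

lemma is_cnat_vcomp [simp]:
  assumes "is_cnat \<alpha>" "is_cnat \<beta>" "ndom \<beta> = ncod \<alpha>"
  shows "is_cnat (cnat_vcomp \<beta> \<alpha>)"
proof -
  define F G H C D where "F = ndom \<alpha>" "G = ncod \<alpha>" "H = ncod \<beta>" "C = fdom F" "D = fcod F"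
  note d = this
  note a = is_cnatE[OF assms(1) d(1)[symmetric] d(2)[symmetric] d(4)[symmetric] d(5)[symmetric]]
  note b = is_cnatE[OF assms(2) assms(3) d(3)[symmetric], folded d, OF a(3,4)]
  interpret F: cfunctor C D F using a d by (intro cfunctorI) auto
  interpret G: cfunctor C D G using a d by (intro cfunctorI) auto
  interpret H: cfunctor C D H using b d by (intro cfunctorI) auto
  \<comment> \<open>The two naturality squares are pasted: first that of \<open>\<alpha>\<close>,
    which turns \<open>far F f\<close> into \<open>far G f\<close>, then that of
    \<open>\<beta>\<close>, which turns this into \<open>far H f\<close>.\<close>
  have 1: "(ncmp \<beta> (tgt C f) \<cdot>\<^bsub>D\<^esub> ncmp \<alpha> (tgt C f)) \<cdot>\<^bsub>D\<^esub> far F f =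
      far H f \<cdot>\<^bsub>D\<^esub> (ncmp \<beta> (src C f) \<cdot>\<^bsub>D\<^esub> ncmp \<alpha> (src C f))" if f: "f \<in> arr C" for f
  proof -
    have "(ncmp \<beta> (tgt C f) \<cdot>\<^bsub>D\<^esub> ncmp \<alpha> (tgt C f)) \<cdot>\<^bsub>D\<^esub> far F f
      = ncmp \<beta> (tgt C f) \<cdot>\<^bsub>D\<^esub> (far G f \<cdot>\<^bsub>D\<^esub> ncmp \<alpha> (src C f))"
      using f a b by (simp add: F.D.assoc)
    also have "\<dots> = (far H f \<cdot>\<^bsub>D\<^esub> ncmp \<beta> (src C f)) \<cdot>\<^bsub>D\<^esub> ncmp \<alpha> (src C f)"
      using f a b(5-7) by (simp add: F.D.assoc[symmetric] b(8)[symmetric])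
    finally show ?thesis using f a b by (simp add: F.D.assoc)
  qed
  show ?thesis
    using a b 1 by (intro is_cnatI) (auto simp: d(1-3)[symmetric] F.fdom F.fcod cnat_vcomp_def)
qed

text \<open>Turns equations between functor and transformation records into equations between
  elements of the values of \<open>P\<close>; the later proofs rewrite with these.\<close>

locale cat_valued = K: two_category K + two_functor K Cat P
  for K :: "('i, 'j, 'k) twocat" and P :: "('i, 'j, 'k, 'x, 'y) catvalued"
begin

lemma category: "i \<in> obj (one K) \<Longrightarrow> category (app0 P i)"
  using one.map_obj by simp

lemma cfunctor: "u \<in> arr (one K) \<Longrightarrow> cfunctor (app0 P (src (one K) u)) (app0 P (tgt (one K) u)) (app1 P u)"
  using one.arr[of u] one.src_map[of u] one.tgt_map[of u] by (intro cfunctorI) auto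

lemma cfun [simp]: "u \<in> arr (one K) \<Longrightarrow> is_cfun (app1 P u)"
  "u \<in> arr (one K) \<Longrightarrow> fdom (app1 P u) = app0 P (src (one K) u)"
  "u \<in> arr (one K) \<Longrightarrow> fcod (app1 P u) = app0 P (tgt (one K) u)"
  using one.arr[of u] one.src_map[of u] one.tgt_map[of u] by auto

lemma cfun_idt [simp]: "i \<in> obj (one K) \<Longrightarrow> x \<in> obj (app0 P i) \<Longrightarrow> fob (app1 P (idt (one K) i)) x = x"
  "i \<in> obj (one K) \<Longrightarrow> f \<in> arr (app0 P i) \<Longrightarrow> far (app1 P (idt (one K) i)) f = f"
  using one.map_idt by auto

lemma cfun_cmp: 
  assumes "u \<in> arr (one K)" "v \<in> arr (one K)" "src (one K) v = tgt (one K) u"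
  shows "x \<in> obj (app0 P (src (one K) u)) \<Longrightarrow>
      fob (app1 P (v \<cdot>\<^bsub>one K\<^esub> u)) x = fob (app1 P v) (fob (app1 P u) x)"
    "f \<in> arr (app0 P (src (one K) u)) \<Longrightarrow>
      far (app1 P (v \<cdot>\<^bsub>one K\<^esub> u)) f = far (app1 P v) (far (app1 P u) f)"
  using one.cmp[OF assms] assms by auto

lemma cfun_map [simp]:
  assumes "u \<in> arr (one K)" "tgt (one K) u = j"
  shows "x \<in> obj (app0 P (src (one K) u)) \<Longrightarrow> fob (app1 P u) x \<in> obj (app0 P j)"
    "f \<in> arr (app0 P (src (one K) u)) \<Longrightarrow> far (app1 P u) f \<in> arr (app0 P j)"
    "f \<in> arr (app0 P (src (one K) u)) \<Longrightarrow>
      src (app0 P j) (far (app1 P u) f) = fob (app1 P u) (src (app0 P (src (one K) u)) f)"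
    "f \<in> arr (app0 P (src (one K) u)) \<Longrightarrow>
      tgt (app0 P j) (far (app1 P u) f) = fob (app1 P u) (tgt (app0 P (src (one K) u)) f)"
proof -
  interpret cfunctor "app0 P (src (one K) u)" "app0 P (tgt (one K) u)" "app1 P u"
    by (rule cfunctor) fact
  show "x \<in> obj (app0 P (src (one K) u)) \<Longrightarrow> fob (app1 P u) x \<in> obj (app0 P j)"
    "f \<in> arr (app0 P (src (one K) u)) \<Longrightarrow> far (app1 P u) f \<in> arr (app0 P j)"
    "f \<in> arr (app0 P (src (one K) u)) \<Longrightarrow>
      src (app0 P j) (far (app1 P u) f) = fob (app1 P u) (src (app0 P (src (one K) u)) f)"
    "f \<in> arr (app0 P (src (one K) u)) \<Longrightarrow>
      tgt (app0 P j) (far (app1 P u) f) = fob (app1 P u) (tgt (app0 P (src (one K) u)) f)"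
    using assms by auto
qed

lemma cfun_map_cmp:
  assumes "u \<in> arr (one K)"
  shows "f \<in> arr (app0 P (src (one K) u)) \<Longrightarrow> g \<in> arr (app0 P (src (one K) u)) \<Longrightarrow>
      src (app0 P (src (one K) u)) g = tgt (app0 P (src (one K) u)) f \<Longrightarrow>
      far (app1 P u) (g \<cdot>\<^bsub>app0 P (src (one K) u)\<^esub> f) = far (app1 P u) g \<cdot>\<^bsub>app0 P (tgt (one K) u)\<^esub> far (app1 P u) f"
    "x \<in> obj (app0 P (src (one K) u)) \<Longrightarrow>
      far (app1 P u) (idt (app0 P (src (one K) u)) x) = idt (app0 P (tgt (one K) u)) (fob (app1 P u) x)"
proof -
  interpret cfunctor "app0 P (src (one K) u)" "app0 P (tgt (one K) u)" "app1 P u"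
    by (rule cfunctor) fact
  show "f \<in> arr (app0 P (src (one K) u)) \<Longrightarrow> g \<in> arr (app0 P (src (one K) u)) \<Longrightarrow>
      src (app0 P (src (one K) u)) g = tgt (app0 P (src (one K) u)) f \<Longrightarrow>
      far (app1 P u) (g \<cdot>\<^bsub>app0 P (src (one K) u)\<^esub> f) = far (app1 P u) g \<cdot>\<^bsub>app0 P (tgt (one K) u)\<^esub> far (app1 P u) f"
    "x \<in> obj (app0 P (src (one K) u)) \<Longrightarrow>
      far (app1 P u) (idt (app0 P (src (one K) u)) x) = idt (app0 P (tgt (one K) u)) (fob (app1 P u) x)"
    using cmp map_idt by auto
qed

lemma cnat [simp]:
  assumes "\<theta> \<in> arr (two K)"
  shows "is_cnat (app2 P \<theta>)" "ndom (app2 P \<theta>) = app1 P (src (two K) \<theta>)" "ncod (app2 P \<theta>) = app1 P (tgt (two K) \<theta>)"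
  using two.arr two.src_map two.tgt_map assms by auto

lemma cnat_map [simp]:
  assumes "\<theta> \<in> arr (two K)" "tgt (one K) (src (two K) \<theta>) = j" "x \<in> obj (app0 P (src (one K) (src (two K) \<theta>)))"
  shows "ncmp (app2 P \<theta>) x \<in> arr (app0 P j)"
    "src (app0 P j) (ncmp (app2 P \<theta>) x) = fob (app1 P (src (two K) \<theta>)) x"
    "tgt (app0 P j) (ncmp (app2 P \<theta>) x) = fob (app1 P (tgt (two K) \<theta>)) x"
  using is_cnatE(5-7)[OF cnat[OF assms(1)], of "app0 P (src (one K) (src (two K) \<theta>))" "app0 P (tgt (one K) (src (two K) \<theta>))"]
    assms by auto

end

lemma cat_valuedI: "two_category K \<Longrightarrow> two_functor K Cat P \<Longrightarrow> cat_valued K P"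
  by (simp add: cat_valued_def)

text \<open>Converse of the elementwise facts in \<open>cat_valued\<close>: laws checked on objects
  and arrows of the values suffice because the records are extensional.\<close>

lemma two_functor_CatI:
  assumes K: "two_category K"
    and cat: "\<And>i. i \<in> obj (one K) \<Longrightarrow> category (app0 P i)"
    and cfun: "\<And>u. u \<in> arr (one K) \<Longrightarrow> is_cfun (app1 P u) \<and> fdom (app1 P u) = app0 P (src (one K) u) \<and>
      fcod (app1 P u) = app0 P (tgt (one K) u)"
    and "\<And>i x. i \<in> obj (one K) \<Longrightarrow> x \<in> obj (app0 P i) \<Longrightarrow> fob (app1 P (idt (one K) i)) x = x"
    and "\<And>i f. i \<in> obj (one K) \<Longrightarrow> f \<in> arr (app0 P i) \<Longrightarrow> far (app1 P (idt (one K) i)) f = f"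
    and "\<And>u v x. u \<in> arr (one K) \<Longrightarrow> v \<in> arr (one K) \<Longrightarrow> src (one K) v = tgt (one K) u \<Longrightarrow>
      x \<in> obj (app0 P (src (one K) u)) \<Longrightarrow> fob (app1 P (v \<cdot>\<^bsub>one K\<^esub> u)) x = fob (app1 P v) (fob (app1 P u) x)"
    and "\<And>u v f. u \<in> arr (one K) \<Longrightarrow> v \<in> arr (one K) \<Longrightarrow> src (one K) v = tgt (one K) u \<Longrightarrow>
      f \<in> arr (app0 P (src (one K) u)) \<Longrightarrow> far (app1 P (v \<cdot>\<^bsub>one K\<^esub> u)) f = far (app1 P v) (far (app1 P u) f)"
    and cnat: "\<And>\<theta>. \<theta> \<in> arr (two K) \<Longrightarrow> is_cnat (app2 P \<theta>) \<and> ndom (app2 P \<theta>) = app1 P (src (two K) \<theta>) \<and>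
      ncod (app2 P \<theta>) = app1 P (tgt (two K) \<theta>)"
    and "\<And>u x. u \<in> arr (one K) \<Longrightarrow> x \<in> obj (app0 P (src (one K) u)) \<Longrightarrow>
      ncmp (app2 P (idt (two K) u)) x = idt (app0 P (tgt (one K) u)) (fob (app1 P u) x)"
    and "\<And>\<theta> \<eta> x. \<theta> \<in> arr (two K) \<Longrightarrow> \<eta> \<in> arr (two K) \<Longrightarrow> src (two K) \<eta> = tgt (two K) \<theta> \<Longrightarrow>
      x \<in> obj (app0 P (src (one K) (src (two K) \<theta>))) \<Longrightarrow>
      ncmp (app2 P (\<eta> \<cdot>\<^bsub>two K\<^esub> \<theta>)) x =
      ncmp (app2 P \<eta>) x \<cdot>\<^bsub>app0 P (tgt (one K) (src (two K) \<theta>))\<^esub> ncmp (app2 P \<theta>) x"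
    and "\<And>\<theta> \<eta> x. \<theta> \<in> arr (two K) \<Longrightarrow> \<eta> \<in> arr (two K) \<Longrightarrow>
      src (one K) (src (two K) \<eta>) = tgt (one K) (src (two K) \<theta>) \<Longrightarrow>
      x \<in> obj (app0 P (src (one K) (src (two K) \<theta>))) \<Longrightarrow>
      ncmp (app2 P (\<eta> \<star>\<^bsub>K\<^esub> \<theta>)) x =
      ncmp (app2 P \<eta>) (fob (app1 P (tgt (two K) \<theta>)) x) \<cdot>\<^bsub>app0 P (tgt (one K) (src (two K) \<eta>))\<^esub>
        far (app1 P (src (two K) \<eta>)) (ncmp (app2 P \<theta>) x)"
  shows "two_functor K Cat P"
proof -
  interpret K: two_category K by fact
  have idt: "app1 P (idt (one K) i) = cfun_id (app0 P i)" if "i \<in> obj (one K)" for i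
    using assms that by (intro cfun_eqI) auto
  have cmp: "app1 P (v \<cdot>\<^bsub>one K\<^esub> u) = cfun_comp (app1 P v) (app1 P u)"
    if "u \<in> arr (one K)" "v \<in> arr (one K)" "src (one K) v = tgt (one K) u" for u v
    using assms that by (intro cfun_eqI) auto
  show ?thesis
  proof (intro two_functorI K is_functorI)
    fix u assume "u \<in> obj (two K)"
    then show "app2 P (idt (two K) u) = idt (two Cat) (app1 P u)"
      using assms by (auto simp: K.obj_two intro!: cnat_eqI)
  next
    fix \<theta> \<eta> assume *: "\<theta> \<in> arr (two K)" "\<eta> \<in> arr (two K)" "src (two K) \<eta> = tgt (two K) \<theta>"
    then show "app2 P (\<eta> \<cdot>\<^bsub>two K\<^esub> \<theta>) = app2 P \<eta> \<cdot>\<^bsub>two Cat\<^esub> app2 P \<theta>"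
      using assms by (auto intro!: cnat_eqI)
  next
    fix \<theta> \<eta> assume *: "\<theta> \<in> arr (two K)" "\<eta> \<in> arr (two K)" "src (one K) (src (two K) \<eta>) = tgt (one K) (src (two K) \<theta>)"
    let ?C = "app0 P (src (one K) (src (two K) \<theta>))"
    \<comment> \<open>That the composite on the right is a natural transformation is not known
      beforehand. It inherits this from the left side, with which it shares boundary and
      components.\<close>
    have "app2 P (\<eta> \<star>\<^bsub>K\<^esub> \<theta>) = cnat_hcomp (app2 P \<eta>) (app2 P \<theta>)"
    proof (rule cnat_eqI)
      have n: "ncmp (app2 P (\<eta> \<star>\<^bsub>K\<^esub> \<theta>)) x = ncmp (cnat_hcomp (app2 P \<eta>) (app2 P \<theta>)) x" if "x \<in> obj ?C" for x
        using assms * that by auto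
      then show "ncmp (app2 P (\<eta> \<star>\<^bsub>K\<^esub> \<theta>)) x = ncmp (cnat_hcomp (app2 P \<eta>) (app2 P \<theta>)) x" 
        if "x \<in> obj (fdom (ndom (app2 P (\<eta> \<star>\<^bsub>K\<^esub> \<theta>))))" for x
        using that * cnat cfun cmp by auto
      show "is_cnat (app2 P (\<eta> \<star>\<^bsub>K\<^esub> \<theta>))" using * cnat by simp
      moreover show "ndom (app2 P (\<eta> \<star>\<^bsub>K\<^esub> \<theta>)) = ndom (cnat_hcomp (app2 P \<eta>) (app2 P \<theta>))"
        "ncod (app2 P (\<eta> \<star>\<^bsub>K\<^esub> \<theta>)) = ncod (cnat_hcomp (app2 P \<eta>) (app2 P \<theta>))"
        using * cnat cmp by auto
      moreover have "ncmp (cnat_hcomp (app2 P \<eta>) (app2 P \<theta>)) = ncmp (app2 P (\<eta> \<star>\<^bsub>K\<^esub> \<theta>))"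
      proof (rule extensionalityI)
        show "ncmp (app2 P (\<eta> \<star>\<^bsub>K\<^esub> \<theta>)) \<in> extensional (obj ?C)"
          using cnat[of "\<eta> \<star>\<^bsub>K\<^esub> \<theta>"] * cfun cmp by (auto simp: is_cnat_def)
      qed (use n * cnat cfun in \<open>auto simp: cnat_hcomp_def\<close>)
      ultimately show "is_cnat (cnat_hcomp (app2 P \<eta>) (app2 P \<theta>))"
        by (simp add: is_cnat_def)
    qed
    then show "app2 P (\<eta> \<star>\<^bsub>K\<^esub> \<theta>) = app2 P \<eta> \<star>\<^bsub>Cat\<^esub> app2 P \<theta>" by simp
  qed (use assms idt cmp in \<open>auto simp: K.obj_two\<close>)
qed

section \<open>2-natural transformations and modifications, elementwise\<close>

locale cat_nat = P: cat_valued K P + Q: cat_valued K Q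
  for K :: "('i, 'j, 'k) twocat" and P :: "('i, 'j, 'k, 'x, 'y) catvalued"
    and Q :: "('i, 'j, 'k, 'x2, 'y2) catvalued" and \<tau> +
  assumes tnat: "is_tnat K \<tau>" and tdom: "tdom \<tau> = P" and tcod: "tcod \<tau> = Q"
begin

lemma cfun [simp]: "i \<in> obj (one K) \<Longrightarrow> is_cfun (tcmp \<tau> i)"
  "i \<in> obj (one K) \<Longrightarrow> fdom (tcmp \<tau> i) = app0 P i"
  "i \<in> obj (one K) \<Longrightarrow> fcod (tcmp \<tau> i) = app0 Q i"
  using tnat tdom tcod by (auto simp: is_tnat_def)

lemma cfunctor: "i \<in> obj (one K) \<Longrightarrow> cfunctor (app0 P i) (app0 Q i) (tcmp \<tau> i)"
  by (intro cfunctorI) auto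

lemma cfun_map [simp]:
  assumes "i \<in> obj (one K)"
  shows "x \<in> obj (app0 P i) \<Longrightarrow> fob (tcmp \<tau> i) x \<in> obj (app0 Q i)"
    "f \<in> arr (app0 P i) \<Longrightarrow> far (tcmp \<tau> i) f \<in> arr (app0 Q i)"
    "f \<in> arr (app0 P i) \<Longrightarrow> src (app0 Q i) (far (tcmp \<tau> i) f) = fob (tcmp \<tau> i) (src (app0 P i) f)"
    "f \<in> arr (app0 P i) \<Longrightarrow> tgt (app0 Q i) (far (tcmp \<tau> i) f) = fob (tcmp \<tau> i) (tgt (app0 P i) f)"
proof -
  interpret cfunctor "app0 P i" "app0 Q i" "tcmp \<tau> i" by (rule cfunctor) fact
  show "x \<in> obj (app0 P i) \<Longrightarrow> fob (tcmp \<tau> i) x \<in> obj (app0 Q i)"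
    "f \<in> arr (app0 P i) \<Longrightarrow> far (tcmp \<tau> i) f \<in> arr (app0 Q i)"
    "f \<in> arr (app0 P i) \<Longrightarrow> src (app0 Q i) (far (tcmp \<tau> i) f) = fob (tcmp \<tau> i) (src (app0 P i) f)"
    "f \<in> arr (app0 P i) \<Longrightarrow> tgt (app0 Q i) (far (tcmp \<tau> i) f) = fob (tcmp \<tau> i) (tgt (app0 P i) f)"
    by auto
qed

lemma cfun_cmp:
  assumes "i \<in> obj (one K)"
  shows "f \<in> arr (app0 P i) \<Longrightarrow> g \<in> arr (app0 P i) \<Longrightarrow> src (app0 P i) g = tgt (app0 P i) f \<Longrightarrow>
      far (tcmp \<tau> i) (g \<cdot>\<^bsub>app0 P i\<^esub> f) = far (tcmp \<tau> i) g \<cdot>\<^bsub>app0 Q i\<^esub> far (tcmp \<tau> i) f"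
    "x \<in> obj (app0 P i) \<Longrightarrow> far (tcmp \<tau> i) (idt (app0 P i) x) = idt (app0 Q i) (fob (tcmp \<tau> i) x)"
proof -
  interpret cfunctor "app0 P i" "app0 Q i" "tcmp \<tau> i" by (rule cfunctor) fact
  show "f \<in> arr (app0 P i) \<Longrightarrow> g \<in> arr (app0 P i) \<Longrightarrow> src (app0 P i) g = tgt (app0 P i) f \<Longrightarrow>
      far (tcmp \<tau> i) (g \<cdot>\<^bsub>app0 P i\<^esub> f) = far (tcmp \<tau> i) g \<cdot>\<^bsub>app0 Q i\<^esub> far (tcmp \<tau> i) f"
    "x \<in> obj (app0 P i) \<Longrightarrow> far (tcmp \<tau> i) (idt (app0 P i) x) = idt (app0 Q i) (fob (tcmp \<tau> i) x)"
    using cmp map_idt by auto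
qed

lemma natural:
  assumes "u \<in> arr (one K)"
  shows "x \<in> obj (app0 P (src (one K) u)) \<Longrightarrow>
      fob (tcmp \<tau> (tgt (one K) u)) (fob (app1 P u) x) = fob (app1 Q u) (fob (tcmp \<tau> (src (one K) u)) x)"
    "f \<in> arr (app0 P (src (one K) u)) \<Longrightarrow>
      far (tcmp \<tau> (tgt (one K) u)) (far (app1 P u) f) = far (app1 Q u) (far (tcmp \<tau> (src (one K) u)) f)"
proof -
  have "cfun_comp (tcmp \<tau> (tgt (one K) u)) (app1 P u) = cfun_comp (app1 Q u) (tcmp \<tau> (src (one K) u))"
    using tnat assms tdom tcod by (auto simp: is_tnat_def hom_iff)
  from this[THEN arg_cong[of _ _ fob], THEN fun_cong[of _ _ x]] this[THEN arg_cong[of _ _ far], THEN fun_cong[of _ _ f]]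
  show "x \<in> obj (app0 P (src (one K) u)) \<Longrightarrow>
      fob (tcmp \<tau> (tgt (one K) u)) (fob (app1 P u) x) = fob (app1 Q u) (fob (tcmp \<tau> (src (one K) u)) x)"
    "f \<in> arr (app0 P (src (one K) u)) \<Longrightarrow>
      far (tcmp \<tau> (tgt (one K) u)) (far (app1 P u) f) = far (app1 Q u) (far (tcmp \<tau> (src (one K) u)) f)"
    using assms by simp_all
qed

text \<open>2-naturality is stated by whiskering with identity transformations. In components each
  side then carries an identity factor; cancelling it leaves the bare equation.\<close>

lemma natural2:
  assumes "\<theta> \<in> arr (two K)" "x \<in> obj (app0 P (src (one K) (src (two K) \<theta>)))"
  shows "far (tcmp \<tau> (tgt (one K) (src (two K) \<theta>))) (ncmp (app2 P \<theta>) x) =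
    ncmp (app2 Q \<theta>) (fob (tcmp \<tau> (src (one K) (src (two K) \<theta>))) x)"
proof -
  let ?i = "src (one K) (src (two K) \<theta>)" and ?j = "tgt (one K) (src (two K) \<theta>)"
  have "cnat_hcomp (cnat_id (tcmp \<tau> ?j)) (app2 P \<theta>) = cnat_hcomp (app2 Q \<theta>) (cnat_id (tcmp \<tau> ?i))"
    using tnat assms tdom tcod by (auto simp: is_tnat_def P.K.two_category_axioms)
  from this[THEN arg_cong[of _ _ ncmp], THEN fun_cong[of _ _ x]]
  have *: "idt (app0 Q ?j) (fob (tcmp \<tau> ?j) (fob (app1 P (tgt (two K) \<theta>)) x)) \<cdot>\<^bsub>app0 Q ?j\<^esub> far (tcmp \<tau> ?j) (ncmp (app2 P \<theta>) x) =
    ncmp (app2 Q \<theta>) (fob (tcmp \<tau> ?i) x) \<cdot>\<^bsub>app0 Q ?j\<^esub>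
      far (app1 Q (src (two K) \<theta>)) (idt (app0 Q ?i) (fob (tcmp \<tau> ?i) x))"
    using assms by simp
  interpret c: category "app0 Q ?j" using assms by (simp add: Q.category)
  show ?thesis using * assms by (simp add: Q.cfun_map_cmp)
qed

lemma extensional: "tcmp \<tau> \<in> extensional (obj (one K))"
  using tnat by (auto simp: is_tnat_def)

end

lemma cat_natI: "two_category K \<Longrightarrow> is_tnat K \<tau> \<Longrightarrow> tdom \<tau> = P \<Longrightarrow> tcod \<tau> = Q \<Longrightarrow> cat_nat K P Q \<tau>"
  unfolding cat_nat_def cat_nat_axioms_def cat_valued_def by (auto simp: is_tnat_def)

lemma is_tnatI:
  assumes K: "two_category K" and P: "two_functor K Cat (tdom \<tau>)" and Q: "two_functor K Cat (tcod \<tau>)"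
    and *: "\<And>i. i \<in> obj (one K) \<Longrightarrow> is_cfun (tcmp \<tau> i) \<and> fdom (tcmp \<tau> i) = app0 (tdom \<tau>) i \<and> fcod (tcmp \<tau> i) = app0 (tcod \<tau>) i"
    and "\<And>u x. u \<in> arr (one K) \<Longrightarrow> x \<in> obj (app0 (tdom \<tau>) (src (one K) u)) \<Longrightarrow>
      fob (tcmp \<tau> (tgt (one K) u)) (fob (app1 (tdom \<tau>) u) x) = fob (app1 (tcod \<tau>) u) (fob (tcmp \<tau> (src (one K) u)) x)"
    and "\<And>u f. u \<in> arr (one K) \<Longrightarrow> f \<in> arr (app0 (tdom \<tau>) (src (one K) u)) \<Longrightarrow>
      far (tcmp \<tau> (tgt (one K) u)) (far (app1 (tdom \<tau>) u) f) = far (app1 (tcod \<tau>) u) (far (tcmp \<tau> (src (one K) u)) f)"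
    and "\<And>\<theta> x. \<theta> \<in> arr (two K) \<Longrightarrow> x \<in> obj (app0 (tdom \<tau>) (src (one K) (src (two K) \<theta>))) \<Longrightarrow>
      far (tcmp \<tau> (tgt (one K) (src (two K) \<theta>))) (ncmp (app2 (tdom \<tau>) \<theta>) x) =
      ncmp (app2 (tcod \<tau>) \<theta>) (fob (tcmp \<tau> (src (one K) (src (two K) \<theta>))) x)"
    and "tcmp \<tau> \<in> extensional (obj (one K))"
  shows "is_tnat K \<tau>"
proof -
  define P Q where "P = tdom \<tau>" "Q = tcod \<tau>"
  note d = P_Q_def[symmetric]
  interpret P: cat_valued K P using K P d by (simp add: cat_valued_def)
  interpret Q: cat_valued K Q using K Q d by (simp add: cat_valued_def)
  have nat: "cfun_comp (tcmp \<tau> (tgt (one K) u)) (app1 P u) = cfun_comp (app1 Q u) (tcmp \<tau> (src (one K) u))"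
    if u: "u \<in> arr (one K)" for u
    using assms u by (intro cfun_eqI) (auto simp: d)
  have nat2: "cnat_hcomp (cnat_id (tcmp \<tau> (tgt (one K) (src (two K) \<theta>)))) (app2 P \<theta>) =
    cnat_hcomp (app2 Q \<theta>) (cnat_id (tcmp \<tau> (src (one K) (src (two K) \<theta>))))" if th: "\<theta> \<in> arr (two K)" for \<theta>
  proof -
    let ?i = "src (one K) (src (two K) \<theta>)" and ?j = "tgt (one K) (src (two K) \<theta>)"
    interpret c: category "app0 Q ?j" using th by (simp add: Q.category)
    interpret c: cfunctor "app0 P ?i" "app0 Q ?i" "tcmp \<tau> ?i" using * th by (intro cfunctorI) (auto simp: d)
    interpret c': cfunctor "app0 P ?j" "app0 Q ?j" "tcmp \<tau> ?j" using * th by (intro cfunctorI) (auto simp: d)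
    show ?thesis
    \<comment> \<open>Fields are compared one by one, which avoids having to know that the two
      whiskered composites are natural.\<close>
    proof (rule cnat.equality)
      show "ncmp (cnat_hcomp (cnat_id (tcmp \<tau> ?j)) (app2 P \<theta>)) = ncmp (cnat_hcomp (app2 Q \<theta>) (cnat_id (tcmp \<tau> ?i)))"
        using th assms(7)[OF th] assms(5)[of "tgt (two K) \<theta>"] * unfolding cnat_hcomp_def
        by (auto intro!: restrict_ext simp: d Q.cfun_map_cmp)
    qed (use nat[of "src (two K) \<theta>"] nat[of "tgt (two K) \<theta>"] th in auto)
  qed
  show ?thesis
    unfolding is_tnat_def using assms nat nat2 P.K.two_category_axioms by (auto simp: d hom_iff)
qed

lemma tnat_eqI:
  assumes "is_tnat K \<sigma>" "is_tnat K \<tau>" "tdom \<sigma> = tdom \<tau>" "tcod \<sigma> = tcod \<tau>"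
    and "\<And>i x. i \<in> obj (one K) \<Longrightarrow> x \<in> obj (app0 (tdom \<sigma>) i) \<Longrightarrow> fob (tcmp \<sigma> i) x = fob (tcmp \<tau> i) x"
    and "\<And>i f. i \<in> obj (one K) \<Longrightarrow> f \<in> arr (app0 (tdom \<sigma>) i) \<Longrightarrow> far (tcmp \<sigma> i) f = far (tcmp \<tau> i) f"
  shows "\<sigma> = \<tau>"
proof (rule tnat.equality)
  show "tcmp \<sigma> = tcmp \<tau>"
  proof (rule extensionalityI)
    show "tcmp \<sigma> i = tcmp \<tau> i" if "i \<in> obj (one K)" for i
      using assms that unfolding is_tnat_def by (intro cfun_eqI) auto
  qed (use assms in \<open>auto simp: is_tnat_def\<close>)
qed (use assms in auto)

lemma tnat_comp_simps [simp]:
  "tdom (tnat_comp K \<sigma> \<tau>) = tdom \<tau>" "tcod (tnat_comp K \<sigma> \<tau>) = tcod \<sigma>"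
  "i \<in> obj (one K) \<Longrightarrow> tcmp (tnat_comp K \<sigma> \<tau>) i = cfun_comp (tcmp \<sigma> i) (tcmp \<tau> i)"
  "tdom (tnat_id K P) = P" "tcod (tnat_id K P) = P"
  "i \<in> obj (one K) \<Longrightarrow> tcmp (tnat_id K P) i = cfun_id (app0 P i)"
  by (simp_all add: tnat_comp_def tnat_id_def)

lemma is_tnat_id: 
  assumes "two_category K" "two_functor K Cat P"
  shows "is_tnat K (tnat_id K P)"
proof -
  interpret P: cat_valued K P using assms by (simp add: cat_valued_def)
  show ?thesis
    by (intro is_tnatI assms) (auto simp: assms tnat_id_def P.category)
qed

lemma is_tnat_comp:
  assumes K: "two_category K" and s: "is_tnat K \<sigma>" and t: "is_tnat K \<tau>" and eq: "tdom \<sigma> = tcod \<tau>"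
  shows "is_tnat K (tnat_comp K \<sigma> \<tau>)"
proof -
  interpret t: cat_nat K "tdom \<tau>" "tcod \<tau>" \<tau> using assms by (intro cat_natI) auto
  interpret s: cat_nat K "tcod \<tau>" "tcod \<sigma>" \<sigma> using assms by (intro cat_natI) auto
  show ?thesis
    by (intro is_tnatI K)
      (auto simp: t.P.two_functor_axioms s.Q.two_functor_axioms t.natural s.natural t.natural2 s.natural2
         tnat_comp_def)
qed

locale cat_modif = S: cat_nat K P Q \<sigma> + T: cat_nat K P Q \<tau>
  for K :: "('i, 'j, 'k) twocat" and P :: "('i, 'j, 'k, 'x, 'y) catvalued"
    and Q :: "('i, 'j, 'k, 'x2, 'y2) catvalued" and \<sigma> \<tau> m +
  assumes modif: "is_modif K m" and mdom: "mdom m = \<sigma>" and mcod: "mcod m = \<tau>"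
begin

lemma cnat [simp]: "i \<in> obj (one K) \<Longrightarrow> is_cnat (mcmp m i)"
  "i \<in> obj (one K) \<Longrightarrow> ndom (mcmp m i) = tcmp \<sigma> i"
  "i \<in> obj (one K) \<Longrightarrow> ncod (mcmp m i) = tcmp \<tau> i"
  using modif mdom mcod by (auto simp: is_modif_def)

lemma cnat_map [simp]:
  assumes "i \<in> obj (one K)" "x \<in> obj (app0 P i)"
  shows "ncmp (mcmp m i) x \<in> arr (app0 Q i)"
    "src (app0 Q i) (ncmp (mcmp m i) x) = fob (tcmp \<sigma> i) x"
    "tgt (app0 Q i) (ncmp (mcmp m i) x) = fob (tcmp \<tau> i) x"
  using is_cnatE(5-7)[OF cnat(1)[OF assms(1)], of _ _ "app0 P i" "app0 Q i"] assms by auto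

lemma cnat_natural:
  assumes "i \<in> obj (one K)" "f \<in> arr (app0 P i)"
  shows "ncmp (mcmp m i) (tgt (app0 P i) f) \<cdot>\<^bsub>app0 Q i\<^esub> far (tcmp \<sigma> i) f =
    far (tcmp \<tau> i) f \<cdot>\<^bsub>app0 Q i\<^esub> ncmp (mcmp m i) (src (app0 P i) f)"
  using is_cnatE(8)[OF cnat(1)[OF assms(1)], of _ _ "app0 P i" "app0 Q i"] assms by auto

lemma natural:
  assumes "u \<in> arr (one K)" "x \<in> obj (app0 P (src (one K) u))"
  shows "ncmp (mcmp m (tgt (one K) u)) (fob (app1 P u) x) = far (app1 Q u) (ncmp (mcmp m (src (one K) u)) x)"
proof -
  let ?i = "src (one K) u" and ?j = "tgt (one K) u"
  have "cnat_hcomp (mcmp m ?j) (cnat_id (app1 P u)) = cnat_hcomp (cnat_id (app1 Q u)) (mcmp m ?i)"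
    using modif assms mdom S.tdom S.tcod by (auto simp: is_modif_def hom_iff)
  from this[THEN arg_cong[of _ _ ncmp], THEN fun_cong[of _ _ x]]
  have *: "ncmp (mcmp m ?j) (fob (app1 P u) x) \<cdot>\<^bsub>app0 Q ?j\<^esub> far (tcmp \<sigma> ?j) (idt (app0 P ?j) (fob (app1 P u) x)) =
    idt (app0 Q ?j) (fob (app1 Q u) (fob (tcmp \<tau> ?i) x)) \<cdot>\<^bsub>app0 Q ?j\<^esub> far (app1 Q u) (ncmp (mcmp m ?i) x)"
    using assms by simp
  interpret c: category "app0 Q ?j" using assms by (simp add: S.Q.category)
  show ?thesis using * assms by (simp add: S.cfun_cmp)
qed

lemma extensional: "mcmp m \<in> extensional (obj (one K))"
  using modif by (auto simp: is_modif_def)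

end

lemma cat_modifI: "two_category K \<Longrightarrow> is_modif K m \<Longrightarrow> mdom m = \<sigma> \<Longrightarrow> mcod m = \<tau> \<Longrightarrow> 
    tdom \<sigma> = P \<Longrightarrow> tcod \<sigma> = Q \<Longrightarrow> cat_modif K P Q \<sigma> \<tau> m"
  unfolding cat_modif_def cat_modif_axioms_def by (auto simp: is_modif_def intro!: cat_natI)

lemma is_modifI:
  assumes K: "two_category K" and s: "is_tnat K (mdom m)" and t: "is_tnat K (mcod m)"
    and d: "tdom (mcod m) = tdom (mdom m)" and c: "tcod (mcod m) = tcod (mdom m)"
    and "\<And>i x. i \<in> obj (one K) \<Longrightarrow> is_cnat (mcmp m i) \<and> ndom (mcmp m i) = tcmp (mdom m) i \<and> ncod (mcmp m i) = tcmp (mcod m) i"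
    and "\<And>u x. u \<in> arr (one K) \<Longrightarrow> x \<in> obj (app0 (tdom (mdom m)) (src (one K) u)) \<Longrightarrow>
      ncmp (mcmp m (tgt (one K) u)) (fob (app1 (tdom (mdom m)) u) x) =
      far (app1 (tcod (mdom m)) u) (ncmp (mcmp m (src (one K) u)) x)"
    and "mcmp m \<in> extensional (obj (one K))"
  shows "is_modif K m"
proof -
  define P Q where "P = tdom (mdom m)" "Q = tcod (mdom m)"
  note e = P_Q_def[symmetric]
  interpret s: cat_nat K P Q "mdom m" using K s e by (intro cat_natI) auto
  interpret t: cat_nat K P Q "mcod m" using K t c d e by (intro cat_natI) auto
  have nat: "cnat_hcomp (mcmp m (tgt (one K) u)) (cnat_id (app1 P u)) =
    cnat_hcomp (cnat_id (app1 Q u)) (mcmp m (src (one K) u))" if u: "u \<in> arr (one K)" for u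
  proof -
    let ?i = "src (one K) u" and ?j = "tgt (one K) u"
    have m: "is_cnat (mcmp m ?i)" "ndom (mcmp m ?i) = tcmp (mdom m) ?i" "ncod (mcmp m ?i) = tcmp (mcod m) ?i"
      "is_cnat (mcmp m ?j)" "ndom (mcmp m ?j) = tcmp (mdom m) ?j" "ncod (mcmp m ?j) = tcmp (mcod m) ?j"
      using u assms by auto
    have 1: "ncmp (mcmp m ?i) x \<in> arr (app0 Q ?i)" "src (app0 Q ?i) (ncmp (mcmp m ?i) x) = fob (tcmp (mdom m) ?i) x" "tgt (app0 Q ?i) (ncmp (mcmp m ?i) x) = fob (tcmp (mcod m) ?i) x"
      if "x \<in> obj (app0 P ?i)" for x
      using u that is_cnatE(5-7)[OF m(1-3), of "app0 P ?i" "app0 Q ?i"] by auto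
    have 2: "ncmp (mcmp m ?j) x \<in> arr (app0 Q ?j)" "src (app0 Q ?j) (ncmp (mcmp m ?j) x) = fob (tcmp (mdom m) ?j) x"
      if "x \<in> obj (app0 P ?j)" for x
      using u that is_cnatE(5-7)[OF m(4-6), of "app0 P ?j" "app0 Q ?j"] by auto
    interpret c: category "app0 Q ?j" using u by (simp add: s.Q.category)
    show ?thesis
    proof (rule cnat.equality)
      show "ncmp (cnat_hcomp (mcmp m ?j) (cnat_id (app1 P u))) = ncmp (cnat_hcomp (cnat_id (app1 Q u)) (mcmp m ?i))"
        using u assms(7)[OF u] m 1 2 unfolding cnat_hcomp_def
        by (auto intro!: restrict_ext simp: e s.cfun_cmp s.natural)
      show "ndom (cnat_hcomp (mcmp m ?j) (cnat_id (app1 P u))) = ndom (cnat_hcomp (cnat_id (app1 Q u)) (mcmp m ?i))"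
        using u m by (simp, intro cfun_eqI) (auto simp: s.natural)
      show "ncod (cnat_hcomp (mcmp m ?j) (cnat_id (app1 P u))) = ncod (cnat_hcomp (cnat_id (app1 Q u)) (mcmp m ?i))"
        using u m by (simp, intro cfun_eqI) (auto simp: t.natural)
    qed auto
  qed
  show ?thesis
    unfolding is_modif_def using assms nat by (auto simp: e hom_iff)
qed

lemma modif_eqI:
  assumes "is_modif K m" "is_modif K n" "mdom m = mdom n" "mcod m = mcod n"
    and "\<And>i x. i \<in> obj (one K) \<Longrightarrow> x \<in> obj (app0 (tdom (mdom m)) i) \<Longrightarrow> ncmp (mcmp m i) x = ncmp (mcmp n i) x"
  shows "m = n"
proof (rule modif.equality)
  show "mcmp m = mcmp n"
  proof (rule extensionalityI)
    show "mcmp m i = mcmp n i" if "i \<in> obj (one K)" for i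
      using assms that unfolding is_modif_def is_tnat_def by (intro cnat_eqI) auto
  qed (use assms in \<open>auto simp: is_modif_def\<close>)
qed (use assms in auto)

lemma modif_comp_simps [simp]:
  "mdom (modif_vcomp K n m) = mdom m" "mcod (modif_vcomp K n m) = mcod n"
  "i \<in> obj (one K) \<Longrightarrow> mcmp (modif_vcomp K n m) i = cnat_vcomp (mcmp n i) (mcmp m i)"
  "mdom (modif_id K \<tau>) = \<tau>" "mcod (modif_id K \<tau>) = \<tau>"
  "i \<in> obj (one K) \<Longrightarrow> mcmp (modif_id K \<tau>) i = cnat_id (tcmp \<tau> i)"
  by (simp_all add: modif_vcomp_def modif_id_def)

lemma modif_hcomp_simps [simp]:
  "mdom (modif_hcomp K n m) = tnat_comp K (mdom n) (mdom m)"
  "mcod (modif_hcomp K n m) = tnat_comp K (mcod n) (mcod m)"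
  "i \<in> obj (one K) \<Longrightarrow> mcmp (modif_hcomp K n m) i = cnat_hcomp (mcmp n i) (mcmp m i)"
  by (simp_all add: modif_hcomp_def)

lemma CatFun_simps [simp]:
  "P \<in> obj (one (CatFun K)) \<longleftrightarrow> two_functor K Cat P" "\<tau> \<in> arr (one (CatFun K)) \<longleftrightarrow> is_tnat K \<tau>"
  "src (one (CatFun K)) = tdom" "tgt (one (CatFun K)) = tcod" "idt (one (CatFun K)) = tnat_id K"
  "cmp (one (CatFun K)) = tnat_comp K"
  "\<tau> \<in> obj (two (CatFun K)) \<longleftrightarrow> is_tnat K \<tau>" "m \<in> arr (two (CatFun K)) \<longleftrightarrow> is_modif K m"
  "src (two (CatFun K)) = mdom" "tgt (two (CatFun K)) = mcod" "idt (two (CatFun K)) = modif_id K"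
  "cmp (two (CatFun K)) = modif_vcomp K" "hcmp (CatFun K) = modif_hcomp K"
  by (simp_all add: CatFun_def)

text \<open>The boundary conditions contained in \<open>is_modif\<close> make the two descriptions
  agree; full faithfulness into \<open>CatFun\<close> can then be checked with
  \<open>tnat_cat\<close>, whose membership conditions are explicit.\<close>

lemma homcat_CatFun: "homcat (CatFun K) P Q = tnat_cat K P Q"
  by (auto simp: homcat_def tnat_cat_def hom_iff is_modif_def intro!: cat.equality)

lemma tnat_cat_simps [simp]:
  "\<tau> \<in> obj (tnat_cat K P Q) \<longleftrightarrow> is_tnat K \<tau> \<and> tdom \<tau> = P \<and> tcod \<tau> = Q"
  "m \<in> arr (tnat_cat K P Q) \<longleftrightarrow> is_modif K m \<and> tdom (mdom m) = P \<and> tcod (mdom m) = Q"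
  "src (tnat_cat K P Q) = mdom" "tgt (tnat_cat K P Q) = mcod"
  "idt (tnat_cat K P Q) = modif_id K" "cmp (tnat_cat K P Q) = modif_vcomp K"
  by (simp_all add: tnat_cat_def)

section \<open>Invertible 2-natural transformations\<close>

text \<open>Naturality squares are equations of records in the definitions and equations of elements
  in the proofs; this and the next lemma translate between the two, also when \<open>\<phi>\<close>
  and \<open>\<psi>\<close> change the type of the values.\<close>

lemma tnat_comp_eq_iff:
  assumes "cat_nat K P P' \<phi>" "cat_nat K Q Q' \<psi>" "cat_nat K P Q \<tau>" "cat_nat K P' Q' \<tau>'"
  shows "tnat_comp K \<psi> \<tau> = tnat_comp K \<tau>' \<phi> \<longleftrightarrow> (\<forall>i \<in> obj (one K).
    (\<forall>x \<in> obj (app0 P i). fob (tcmp \<psi> i) (fob (tcmp \<tau> i) x) = fob (tcmp \<tau>' i) (fob (tcmp \<phi> i) x)) \<and>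
    (\<forall>f \<in> arr (app0 P i). far (tcmp \<psi> i) (far (tcmp \<tau> i) f) = far (tcmp \<tau>' i) (far (tcmp \<phi> i) f)))"
    (is "?l = ?r \<longleftrightarrow> ?R")
proof
  interpret f: cat_nat K P P' \<phi> by fact
  interpret g: cat_nat K Q Q' \<psi> by fact
  interpret t: cat_nat K P Q \<tau> by fact
  interpret t': cat_nat K P' Q' \<tau>' by fact
  show ?R if eq: "?l = ?r"
  proof (intro ballI conjI)
    fix i assume i: "i \<in> obj (one K)"
    with eq have *: "cfun_comp (tcmp \<psi> i) (tcmp \<tau> i) = cfun_comp (tcmp \<tau>' i) (tcmp \<phi> i)"
      by (metis tnat_comp_simps(3))
    show "fob (tcmp \<psi> i) (fob (tcmp \<tau> i) x) = fob (tcmp \<tau>' i) (fob (tcmp \<phi> i) x)" if "x \<in> obj (app0 P i)" for x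
      using *[THEN arg_cong[of _ _ fob], THEN fun_cong[of _ _ x]] that i by simp
    show "far (tcmp \<psi> i) (far (tcmp \<tau> i) x) = far (tcmp \<tau>' i) (far (tcmp \<phi> i) x)" if "x \<in> arr (app0 P i)" for x
      using *[THEN arg_cong[of _ _ far], THEN fun_cong[of _ _ x]] that i by simp
  qed
  show "?l = ?r" if ?R
  proof (rule tnat_eqI)
    note K = f.P.K.two_category_axioms
    show "is_tnat K ?l" "is_tnat K ?r"
      using is_tnat_comp[OF K g.tnat t.tnat] is_tnat_comp[OF K t'.tnat f.tnat]
      by (simp_all add: f.tcod g.tdom t.tcod t'.tdom)
  qed (use that in \<open>auto simp: f.tdom f.tcod g.tdom g.tcod t.tdom t.tcod t'.tdom t'.tcod\<close>)
qed

text \<open>Equality of modifications includes equality of their boundaries, which the last two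
  hypotheses provide; what remains is the equation of components, where the whiskering identities
  cancel.\<close>

lemma modif_hcomp_eq_iff:
  assumes f: "cat_nat K P P' \<phi>" and g: "cat_nat K Q Q' \<psi>"
    and m: "cat_modif K P Q \<sigma> \<tau> m" and m': "cat_modif K P' Q' \<sigma>' \<tau>' m'"
    and s: "tnat_comp K \<psi> \<sigma> = tnat_comp K \<sigma>' \<phi>" and t: "tnat_comp K \<psi> \<tau> = tnat_comp K \<tau>' \<phi>"
  shows "modif_hcomp K (modif_id K \<psi>) m = modif_hcomp K m' (modif_id K \<phi>) \<longleftrightarrow>
    (\<forall>i \<in> obj (one K). \<forall>x \<in> obj (app0 P i).
      far (tcmp \<psi> i) (ncmp (mcmp m i) x) = ncmp (mcmp m' i) (fob (tcmp \<phi> i) x))" (is "?l = ?r \<longleftrightarrow> ?R")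
proof -
  interpret f: cat_nat K P P' \<phi> by fact
  interpret g: cat_nat K Q Q' \<psi> by fact
  interpret m: cat_modif K P Q \<sigma> \<tau> m by fact
  interpret m': cat_modif K P' Q' \<sigma>' \<tau>' m' by fact
  have eq: "cfun_comp (tcmp \<psi> i) (tcmp \<sigma> i) = cfun_comp (tcmp \<sigma>' i) (tcmp \<phi> i)"
    "cfun_comp (tcmp \<psi> i) (tcmp \<tau> i) = cfun_comp (tcmp \<tau>' i) (tcmp \<phi> i)"if "i \<in> obj (one K)" for i
    using that s t by (metis tnat_comp_simps(3))+
  have st: "fob (tcmp \<psi> i) (fob (tcmp \<tau> i) x) = fob (tcmp \<tau>' i) (fob (tcmp \<phi> i) x)"
    "fob (tcmp \<psi> i) (fob (tcmp \<sigma> i) x) = fob (tcmp \<sigma>' i) (fob (tcmp \<phi> i) x)"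
    if "i \<in> obj (one K)" "x \<in> obj (app0 P i)" for i x
    using that s t
      tnat_comp_eq_iff[OF f g m.T.cat_nat_axioms m'.T.cat_nat_axioms]
      tnat_comp_eq_iff[OF f g m.S.cat_nat_axioms m'.S.cat_nat_axioms] by blast+
  have l: "ncmp (mcmp ?l i) x = far (tcmp \<psi> i) (ncmp (mcmp m i) x)"
    and r: "ncmp (mcmp ?r i) x = ncmp (mcmp m' i) (fob (tcmp \<phi> i) x)"
    if "i \<in> obj (one K)" "x \<in> obj (app0 P i)" for i x
  proof -
    interpret c: category "app0 Q' i" using that by (simp add: g.Q.category)
    show "ncmp (mcmp ?l i) x = far (tcmp \<psi> i) (ncmp (mcmp m i) x)"
      "ncmp (mcmp ?r i) x = ncmp (mcmp m' i) (fob (tcmp \<phi> i) x)"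
      using that by (simp_all add: m'.S.cfun_cmp)
  qed
  show ?thesis
  proof
    show ?R if "?l = ?r" using that l r by metis
    show "?l = ?r" if R: ?R
    proof (rule modif.equality)
      show "mcmp ?l = mcmp ?r"
      proof (rule extensionalityI)
        fix i assume i: "i \<in> obj (one K)"
        show "mcmp ?l i = mcmp ?r i"
        proof (rule cnat.equality)
          show "ncmp (mcmp ?l i) = ncmp (mcmp ?r i)"
            by (rule extensionalityI[of _ "obj (app0 P i)"]) (use R i l r in \<open>auto simp: cnat_hcomp_def\<close>)
        qed (use i eq in auto)
      qed (auto simp: modif_hcomp_def)
    qed (use s t in \<open>auto simp: m.mdom m.mcod m'.mdom m'.mcod\<close>)
  qed
qed

text \<open>Invertibility is recorded as bijectivity on objects and arrows, as
  \<open>cat_iso\<close> has it. An inverse transformation is constructed from this in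
  \<open>inverse\<close>.\<close>

locale cat_nat_iso = cat_nat +
  assumes bij: "i \<in> obj (one K) \<Longrightarrow> bij_betw (fob (tcmp \<tau> i)) (obj (app0 P i)) (obj (app0 Q i))"
    "i \<in> obj (one K) \<Longrightarrow> bij_betw (far (tcmp \<tau> i)) (arr (app0 P i)) (arr (app0 Q i))"
begin

lemma inj0: "fob (tcmp \<tau> i) x = fob (tcmp \<tau> i) y \<Longrightarrow> i \<in> obj (one K) \<Longrightarrow> x \<in> obj (app0 P i) \<Longrightarrow> y \<in> obj (app0 P i) \<Longrightarrow> x = y"
  using bij(1)[of i] by (auto simp: bij_betw_def dest: inj_onD)

lemma inj1: "far (tcmp \<tau> i) x = far (tcmp \<tau> i) y \<Longrightarrow> i \<in> obj (one K) \<Longrightarrow> x \<in> arr (app0 P i) \<Longrightarrow> y \<in> arr (app0 P i) \<Longrightarrow> x = y"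
  using bij(2)[of i] by (auto simp: bij_betw_def dest: inj_onD)

lemma surj0: "i \<in> obj (one K) \<Longrightarrow> y \<in> obj (app0 Q i) \<Longrightarrow> \<exists>x \<in> obj (app0 P i). y = fob (tcmp \<tau> i) x"
  using bij(1)[of i] by (auto simp: bij_betw_def)

lemma surj1: "i \<in> obj (one K) \<Longrightarrow> y \<in> arr (app0 Q i) \<Longrightarrow> \<exists>x \<in> arr (app0 P i). y = far (tcmp \<tau> i) x"
  using bij(2)[of i] by (auto simp: bij_betw_def)

text \<open>The pointwise inverse functions preserve structure and are natural because each such
  equation can be tested after applying the injective components of \<open>\<tau>\<close>, where it
  becomes a law of \<open>\<tau>\<close> itself.\<close>

lemma inverse:
  obtains \<rho> where "cat_nat_iso K Q P \<rho>"
    "\<And>i x. i \<in> obj (one K) \<Longrightarrow> x \<in> obj (app0 P i) \<Longrightarrow> fob (tcmp \<rho> i) (fob (tcmp \<tau> i) x) = x"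
    "\<And>i f. i \<in> obj (one K) \<Longrightarrow> f \<in> arr (app0 P i) \<Longrightarrow> far (tcmp \<rho> i) (far (tcmp \<tau> i) f) = f"
    "\<And>i x. i \<in> obj (one K) \<Longrightarrow> x \<in> obj (app0 Q i) \<Longrightarrow> fob (tcmp \<tau> i) (fob (tcmp \<rho> i) x) = x"
    "\<And>i f. i \<in> obj (one K) \<Longrightarrow> f \<in> arr (app0 Q i) \<Longrightarrow> far (tcmp \<tau> i) (far (tcmp \<rho> i) f) = f"
proof -
  define v0 v1 where "v0 i = inv_into (obj (app0 P i)) (fob (tcmp \<tau> i))"
    and "v1 i = inv_into (arr (app0 P i)) (far (tcmp \<tau> i))" for i
  have v0: "v0 i y \<in> obj (app0 P i)" "fob (tcmp \<tau> i) (v0 i y) = y"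
    if "i \<in> obj (one K)" "y \<in> obj (app0 Q i)" for i y
    using bij(1)[OF that(1)] that(2) unfolding v0_def
    by (auto simp: bij_betw_def inv_into_into f_inv_into_f)
  have v1: "v1 i y \<in> arr (app0 P i)" "far (tcmp \<tau> i) (v1 i y) = y"
    if "i \<in> obj (one K)" "y \<in> arr (app0 Q i)" for i y
    using bij(2)[OF that(1)] that(2) unfolding v1_def
    by (auto simp: bij_betw_def inv_into_into f_inv_into_f)
  have v0': "v0 i (fob (tcmp \<tau> i) x) = x" if "i \<in> obj (one K)" "x \<in> obj (app0 P i)" for i x
    using that v0 by (intro inj0[of i]) auto
  have v1': "v1 i (far (tcmp \<tau> i) x) = x" if "i \<in> obj (one K)" "x \<in> arr (app0 P i)" for i x
    using that v1 by (intro inj1[of i]) auto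
  define \<rho> where "\<rho> = \<lparr>tdom = Q, tcod = P, tcmp = (\<lambda>i \<in> obj (one K).
    \<lparr>fdom = app0 Q i, fcod = app0 P i, fob = (\<lambda>x \<in> obj (app0 Q i). v0 i x), far = (\<lambda>x \<in> arr (app0 Q i). v1 i x)\<rparr>)\<rparr>"
  have c: "is_cfun (tcmp \<rho> i)" if i: "i \<in> obj (one K)" for i
  proof (rule is_cfunI)
    interpret p: category "app0 P i" using i by (rule P.category)
    interpret q: category "app0 Q i" using i by (rule Q.category)
    have s: "src (app0 P i) (v1 i f) = v0 i (src (app0 Q i) f) \<and> tgt (app0 P i) (v1 i f) = v0 i (tgt (app0 Q i) f)"
      if "f \<in> arr (app0 Q i)" for f
      using v0[OF i] v1[OF i] i that q.src_obj q.tgt_obj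
      cfun_map(3,4)[OF i, of "v1 i f"] by (auto intro!: inj0[of i])
    have f: "is_functor (app0 Q i) (app0 P i) (v0 i) (v1 i)"
      by (intro is_functorI) (use v0[OF i] v1[OF i] i s in \<open>auto intro!: inj1[of i] simp: cfun_cmp\<close>)
    show "is_functor (fdom (tcmp \<rho> i)) (fcod (tcmp \<rho> i)) (fob (tcmp \<rho> i)) (far (tcmp \<rho> i))"
      using i by (simp add: \<rho>_def is_functor_cong[OF f q.category_axioms])
  qed (auto simp: \<rho>_def i P.category Q.category)
  have "is_tnat K \<rho>"
  proof (intro is_tnatI)
    fix u x assume u: "u \<in> arr (one K)" "x \<in> obj (app0 (tdom \<rho>) (src (one K) u))"
    then show "fob (tcmp \<rho> (tgt (one K) u)) (fob (app1 (tdom \<rho>) u) x) =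
      fob (app1 (tcod \<rho>) u) (fob (tcmp \<rho> (src (one K) u)) x)"
      by (intro inj0[of "tgt (one K) u"]) (auto simp: \<rho>_def v0 natural)
  next
    fix u f assume u: "u \<in> arr (one K)" "f \<in> arr (app0 (tdom \<rho>) (src (one K) u))"
    then show "far (tcmp \<rho> (tgt (one K) u)) (far (app1 (tdom \<rho>) u) f) =
      far (app1 (tcod \<rho>) u) (far (tcmp \<rho> (src (one K) u)) f)"
      by (intro inj1[of "tgt (one K) u"]) (auto simp: \<rho>_def v1 natural)
  next
    fix \<theta> x assume th: "\<theta> \<in> arr (two K)" "x \<in> obj (app0 (tdom \<rho>) (src (one K) (src (two K) \<theta>)))"
    then show "far (tcmp \<rho> (tgt (one K) (src (two K) \<theta>))) (ncmp (app2 (tdom \<rho>) \<theta>) x) =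
      ncmp (app2 (tcod \<rho>) \<theta>) (fob (tcmp \<rho> (src (one K) (src (two K) \<theta>))) x)"
      by (intro inj1[of "tgt (one K) (src (two K) \<theta>)"]) (auto simp: \<rho>_def v0 v1 natural2)
  qed (use c in \<open>auto simp: P.two_functor_axioms Q.two_functor_axioms P.K.two_category_axioms \<rho>_def\<close>)
  then interpret r: cat_nat K Q P \<rho> by (intro cat_natI) (auto simp: P.K.two_category_axioms \<rho>_def)
  have "cat_nat_iso K Q P \<rho>"
  proof
    fix i assume i: "i \<in> obj (one K)"
    show "bij_betw (fob (tcmp \<rho> i)) (obj (app0 Q i)) (obj (app0 P i))"
      by (rule bij_betw_byWitness[of _ "fob (tcmp \<tau> i)"]) (auto simp: i v0 v0' \<rho>_def)
    show "bij_betw (far (tcmp \<rho> i)) (arr (app0 Q i)) (arr (app0 P i))"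
      by (rule bij_betw_byWitness[of _ "far (tcmp \<tau> i)"]) (auto simp: i v1 v1' \<rho>_def)
  qed
  then show thesis by (rule that) (auto simp: \<rho>_def v0 v0' v1 v1')
qed

text \<open>Compose \<open>\<sigma>\<close> with the inverse of \<open>\<tau>\<close>. The result is
  described by elements, since that is how it is matched with naturality squares.\<close>

lemma lift:
  assumes "cat_nat K R Q \<sigma>"
  obtains \<upsilon> where "cat_nat K R P \<upsilon>"
    "\<And>i x. i \<in> obj (one K) \<Longrightarrow> x \<in> obj (app0 R i) \<Longrightarrow> fob (tcmp \<tau> i) (fob (tcmp \<upsilon> i) x) = fob (tcmp \<sigma> i) x"
    "\<And>i f. i \<in> obj (one K) \<Longrightarrow> f \<in> arr (app0 R i) \<Longrightarrow> far (tcmp \<tau> i) (far (tcmp \<upsilon> i) f) = far (tcmp \<sigma> i) f"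
proof -
  obtain \<rho> where r: "cat_nat_iso K Q P \<rho>"
    "\<And>i x. i \<in> obj (one K) \<Longrightarrow> x \<in> obj (app0 Q i) \<Longrightarrow> fob (tcmp \<tau> i) (fob (tcmp \<rho> i) x) = x"
    "\<And>i f. i \<in> obj (one K) \<Longrightarrow> f \<in> arr (app0 Q i) \<Longrightarrow> far (tcmp \<tau> i) (far (tcmp \<rho> i) f) = f"
    using inverse by metis
  interpret r: cat_nat_iso K Q P \<rho> by fact
  interpret s: cat_nat K R Q \<sigma> by fact
  have "cat_nat K R P (tnat_comp K \<rho> \<sigma>)"
    by (intro cat_natI is_tnat_comp P.K.two_category_axioms r.tnat s.tnat) (auto simp: r.tdom r.tcod s.tdom s.tcod)
  then show thesis by (rule that) (auto simp: r)
qed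

text \<open>The boundary \<open>\<upsilon>\<close>, \<open>\<upsilon>'\<close> of the lift is
  prescribed rather than produced: in the applications these are images of 1-cells already found,
  and the new modification has to run between exactly those.\<close>

lemma lift_modif:
  assumes "cat_modif K R Q \<sigma> \<sigma>' n" "cat_nat K R P \<upsilon>" "cat_nat K R P \<upsilon>'"
    and eq: "\<And>i x. i \<in> obj (one K) \<Longrightarrow> x \<in> obj (app0 R i) \<Longrightarrow> fob (tcmp \<tau> i) (fob (tcmp \<upsilon> i) x) = fob (tcmp \<sigma> i) x"
    "\<And>i f. i \<in> obj (one K) \<Longrightarrow> f \<in> arr (app0 R i) \<Longrightarrow> far (tcmp \<tau> i) (far (tcmp \<upsilon> i) f) = far (tcmp \<sigma> i) f"
    and eq': "\<And>i x. i \<in> obj (one K) \<Longrightarrow> x \<in> obj (app0 R i) \<Longrightarrow> fob (tcmp \<tau> i) (fob (tcmp \<upsilon>' i) x) = fob (tcmp \<sigma>' i) x"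
    "\<And>i f. i \<in> obj (one K) \<Longrightarrow> f \<in> arr (app0 R i) \<Longrightarrow> far (tcmp \<tau> i) (far (tcmp \<upsilon>' i) f) = far (tcmp \<sigma>' i) f"
  obtains m where "cat_modif K R P \<upsilon> \<upsilon>' m"
    "\<And>i x. i \<in> obj (one K) \<Longrightarrow> x \<in> obj (app0 R i) \<Longrightarrow> far (tcmp \<tau> i) (ncmp (mcmp m i) x) = ncmp (mcmp n i) x"
proof -
  obtain \<rho> where r: "cat_nat_iso K Q P \<rho>"
    "\<And>i x. i \<in> obj (one K) \<Longrightarrow> x \<in> obj (app0 Q i) \<Longrightarrow> fob (tcmp \<tau> i) (fob (tcmp \<rho> i) x) = x"
    "\<And>i f. i \<in> obj (one K) \<Longrightarrow> f \<in> arr (app0 Q i) \<Longrightarrow> far (tcmp \<tau> i) (far (tcmp \<rho> i) f) = f"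
    using inverse by metis
  interpret r: cat_nat_iso K Q P \<rho> by fact
  interpret n: cat_modif K R Q \<sigma> \<sigma>' n by fact
  interpret v: cat_nat K R P \<upsilon> by fact
  interpret v': cat_nat K R P \<upsilon>' by fact
  \<comment> \<open>Injectivity of \<open>\<tau>\<close> identifies the prescribed boundary with
    \<open>\<sigma>\<close> and \<open>\<sigma>'\<close> followed by the inverse, so the components
    have the right endpoints.\<close>
  have [simp]: "fob (tcmp \<rho> i) (fob (tcmp \<sigma> i) x) = fob (tcmp \<upsilon> i) x"
    "fob (tcmp \<rho> i) (fob (tcmp \<sigma>' i) x) = fob (tcmp \<upsilon>' i) x" if "i \<in> obj (one K)" "x \<in> obj (app0 R i)" for i x
    using that by (auto intro!: inj0[of i] simp: r eq eq')
  define m where "m = \<lparr>mdom = \<upsilon>, mcod = \<upsilon>', mcmp = (\<lambda>i \<in> obj (one K). \<lparr>ndom = tcmp \<upsilon> i, ncod = tcmp \<upsilon>' i,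
    ncmp = (\<lambda>x \<in> obj (app0 R i). far (tcmp \<rho> i) (ncmp (mcmp n i) x))\<rparr>)\<rparr>"
  have "is_modif K m"
  proof (rule is_modifI)
    fix i assume i: "i \<in> obj (one K)"
    interpret p: category "app0 P i" using i by (rule P.category)
    interpret R: category "app0 R i" using i by (rule n.S.P.category)
    have "is_cnat (mcmp m i)"
      using i v.cfun[OF i] v'.cfun[OF i]
    proof (intro is_cnatI)
      fix f assume f: "f \<in> arr (fdom (ndom (mcmp m i)))"
      then have "far (tcmp \<rho> i) (ncmp (mcmp n i) (tgt (app0 R i) f)) \<cdot>\<^bsub>app0 P i\<^esub> far (tcmp \<upsilon> i) f =
        far (tcmp \<upsilon>' i) f \<cdot>\<^bsub>app0 P i\<^esub> far (tcmp \<rho> i) (ncmp (mcmp n i) (src (app0 R i) f))"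
        using i n.cnat_natural[OF i, of f] by (intro inj1[of i]) (auto simp: m_def cfun_cmp eq eq' r)
      then show "ncmp (mcmp m i) (tgt (fdom (ndom (mcmp m i))) f) \<cdot>\<^bsub>fcod (ndom (mcmp m i))\<^esub> far (ndom (mcmp m i)) f =
        far (ncod (mcmp m i)) f \<cdot>\<^bsub>fcod (ndom (mcmp m i))\<^esub> ncmp (mcmp m i) (src (fdom (ndom (mcmp m i))) f)"
        using i f by (simp add: m_def)
    qed (auto simp: m_def)
    then show "is_cnat (mcmp m i) \<and> ndom (mcmp m i) = tcmp (mdom m) i \<and> ncod (mcmp m i) = tcmp (mcod m) i"
      using i by (auto simp: m_def)
  qed (auto simp: m_def v.tdom v.tcod v'.tdom v'.tcod v.tnat v'.tnat P.K.two_category_axioms n.natural r.natural)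
  then have "cat_modif K R P \<upsilon> \<upsilon>' m"
    by (intro cat_modifI) (auto simp: m_def v.tdom v.tcod P.K.two_category_axioms)
  then show thesis by (rule that) (auto simp: m_def r)
qed

end

section \<open>2-functors into 2-categories of Cat-valued 2-functors\<close>

text \<open>The same unpacking as \<open>cat_valued\<close>, one level up: the laws of a 2-functor
  with values in \<open>CatFun K\<close>, read at a stage \<open>i\<close> and an element
  \<open>x\<close>.\<close>

locale cat_functor = W: two_category W + K: two_category K + two_functor W "CatFun K" G
  for W :: "('o, 'm, 't) twocat" and K :: "('i, 'j, 'k) twocat"
    and G :: "('o, 'm, 't, ('i, 'j, 'k, 'x, 'y) catvalued, ('i, 'j, 'k, 'x, 'y, 'x, 'y) tnat,
    ('i, 'j, 'k, 'x, 'y, 'x, 'y) modif) twofun"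
begin

lemma valued: "A \<in> obj (one W) \<Longrightarrow> cat_valued K (app0 G A)"
  using one.map_obj[of A] by (intro cat_valuedI) (auto simp: K.two_category_axioms)

lemma nat_app1: "a \<in> arr (one W) \<Longrightarrow> cat_nat K (app0 G (src (one W) a)) (app0 G (tgt (one W) a)) (app1 G a)"
  using one.arr[of a] one.src_map[of a] one.tgt_map[of a]
  by (intro cat_natI) (auto simp: K.two_category_axioms)

lemma modif_app2: "\<alpha> \<in> arr (two W) \<Longrightarrow> cat_modif K (app0 G (src (one W) (src (two W) \<alpha>))) (app0 G (tgt (one W) (src (two W) \<alpha>)))
    (app1 G (src (two W) \<alpha>)) (app1 G (tgt (two W) \<alpha>)) (app2 G \<alpha>)"
  using two.arr[of \<alpha>] two.src_map[of \<alpha>] two.tgt_map[of \<alpha>] one.src_map[of "src (two W) \<alpha>"] one.tgt_map[of "src (two W) \<alpha>"]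
  by (intro cat_modifI) (auto simp: K.two_category_axioms)

lemma elem_map [simp]:
  assumes a: "a \<in> arr (one W)" "tgt (one W) a = B" and i: "i \<in> obj (one K)"
  shows "x \<in> obj (app0 (app0 G (src (one W) a)) i) \<Longrightarrow> fob (tcmp (app1 G a) i) x \<in> obj (app0 (app0 G B) i)"
    "f \<in> arr (app0 (app0 G (src (one W) a)) i) \<Longrightarrow> far (tcmp (app1 G a) i) f \<in> arr (app0 (app0 G B) i)"
    "f \<in> arr (app0 (app0 G (src (one W) a)) i) \<Longrightarrow> src (app0 (app0 G B) i) (far (tcmp (app1 G a) i) f) =
      fob (tcmp (app1 G a) i) (src (app0 (app0 G (src (one W) a)) i) f)"
    "f \<in> arr (app0 (app0 G (src (one W) a)) i) \<Longrightarrow> tgt (app0 (app0 G B) i) (far (tcmp (app1 G a) i) f) =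
      fob (tcmp (app1 G a) i) (tgt (app0 (app0 G (src (one W) a)) i) f)"
  using cat_nat.cfun_map[OF nat_app1[OF a(1)] i] a(2) by auto

lemma elem_idt [simp]:
  assumes "A \<in> obj (one W)" "i \<in> obj (one K)"
  shows "x \<in> obj (app0 (app0 G A) i) \<Longrightarrow> fob (tcmp (app1 G (idt (one W) A)) i) x = x"
    "f \<in> arr (app0 (app0 G A) i) \<Longrightarrow> far (tcmp (app1 G (idt (one W) A)) i) f = f"
  using one.map_idt[OF assms(1)] assms(2) by auto

lemma elem_cmp:
  assumes "a \<in> arr (one W)" "b \<in> arr (one W)" "src (one W) b = tgt (one W) a" "i \<in> obj (one K)"
  shows "x \<in> obj (app0 (app0 G (src (one W) a)) i) \<Longrightarrow>
      fob (tcmp (app1 G (b \<cdot>\<^bsub>one W\<^esub> a)) i) x = fob (tcmp (app1 G b) i) (fob (tcmp (app1 G a) i) x)"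
    "f \<in> arr (app0 (app0 G (src (one W) a)) i) \<Longrightarrow>
      far (tcmp (app1 G (b \<cdot>\<^bsub>one W\<^esub> a)) i) f = far (tcmp (app1 G b) i) (far (tcmp (app1 G a) i) f)"
proof -
  interpret a: cat_nat K "app0 G (src (one W) a)" "app0 G (tgt (one W) a)" "app1 G a" using assms by (simp add: nat_app1)
  show "x \<in> obj (app0 (app0 G (src (one W) a)) i) \<Longrightarrow>
      fob (tcmp (app1 G (b \<cdot>\<^bsub>one W\<^esub> a)) i) x = fob (tcmp (app1 G b) i) (fob (tcmp (app1 G a) i) x)"
    "f \<in> arr (app0 (app0 G (src (one W) a)) i) \<Longrightarrow>
      far (tcmp (app1 G (b \<cdot>\<^bsub>one W\<^esub> a)) i) f = far (tcmp (app1 G b) i) (far (tcmp (app1 G a) i) f)"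
    using one.cmp[OF assms(1-3)] assms(4) by auto
qed

lemma elem_two:
  assumes "\<alpha> \<in> arr (two W)" "i \<in> obj (one K)" "x \<in> obj (app0 (app0 G (src (one W) (src (two W) \<alpha>))) i)"
    "tgt (one W) (src (two W) \<alpha>) = B"
  shows "ncmp (mcmp (app2 G \<alpha>) i) x \<in> arr (app0 (app0 G B) i)"
    "src (app0 (app0 G B) i) (ncmp (mcmp (app2 G \<alpha>) i) x) = fob (tcmp (app1 G (src (two W) \<alpha>)) i) x"
    "tgt (app0 (app0 G B) i) (ncmp (mcmp (app2 G \<alpha>) i) x) = fob (tcmp (app1 G (tgt (two W) \<alpha>)) i) x"
  using cat_modif.cnat_map[OF modif_app2[OF assms(1)] assms(2,3)] assms(4) by auto

declare elem_two [simp]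

lemma elem_idt2:
  assumes "a \<in> arr (one W)" "i \<in> obj (one K)" "x \<in> obj (app0 (app0 G (src (one W) a)) i)"
  shows "ncmp (mcmp (app2 G (idt (two W) a)) i) x = idt (app0 (app0 G (tgt (one W) a)) i) (fob (tcmp (app1 G a) i) x)"
proof -
  interpret a: cat_nat K "app0 G (src (one W) a)" "app0 G (tgt (one W) a)" "app1 G a" using assms by (simp add: nat_app1)
  show ?thesis using two.map_idt[of a] assms by (auto simp: W.obj_two)
qed

lemma elem_vcmp:
  assumes "\<alpha> \<in> arr (two W)" "\<beta> \<in> arr (two W)" "src (two W) \<beta> = tgt (two W) \<alpha>"
    "i \<in> obj (one K)" "x \<in> obj (app0 (app0 G (src (one W) (src (two W) \<alpha>))) i)"
  shows "ncmp (mcmp (app2 G (\<beta> \<cdot>\<^bsub>two W\<^esub> \<alpha>)) i) x =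
    ncmp (mcmp (app2 G \<beta>) i) x \<cdot>\<^bsub>app0 (app0 G (tgt (one W) (src (two W) \<alpha>))) i\<^esub> ncmp (mcmp (app2 G \<alpha>) i) x"
proof -
  interpret a: cat_modif K "app0 G (src (one W) (src (two W) \<alpha>))" "app0 G (tgt (one W) (src (two W) \<alpha>))"
    "app1 G (src (two W) \<alpha>)" "app1 G (tgt (two W) \<alpha>)" "app2 G \<alpha>" using assms by (simp add: modif_app2)
  show ?thesis using two.cmp[OF assms(1-3)] assms(4,5) by auto
qed

lemma elem_hcmp:
  assumes "\<alpha> \<in> arr (two W)" "\<beta> \<in> arr (two W)" "src (one W) (src (two W) \<beta>) = tgt (one W) (src (two W) \<alpha>)"
    "i \<in> obj (one K)" "x \<in> obj (app0 (app0 G (src (one W) (src (two W) \<alpha>))) i)"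
  shows "ncmp (mcmp (app2 G (\<beta> \<star>\<^bsub>W\<^esub> \<alpha>)) i) x =
    ncmp (mcmp (app2 G \<beta>) i) (fob (tcmp (app1 G (tgt (two W) \<alpha>)) i) x)
      \<cdot>\<^bsub>app0 (app0 G (tgt (one W) (src (two W) \<beta>))) i\<^esub>
    far (tcmp (app1 G (src (two W) \<beta>)) i) (ncmp (mcmp (app2 G \<alpha>) i) x)"
proof -
  interpret a: cat_modif K "app0 G (src (one W) (src (two W) \<alpha>))" "app0 G (tgt (one W) (src (two W) \<alpha>))"
    "app1 G (src (two W) \<alpha>)" "app1 G (tgt (two W) \<alpha>)" "app2 G \<alpha>" using assms by (simp add: modif_app2)
  interpret b: cat_modif K "app0 G (src (one W) (src (two W) \<beta>))" "app0 G (tgt (one W) (src (two W) \<beta>))"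
    "app1 G (src (two W) \<beta>)" "app1 G (tgt (two W) \<beta>)" "app2 G \<beta>" by (rule modif_app2) fact
  show ?thesis using hcmp[OF W.two_category_axioms assms(1-3)] assms(3-5) by auto
qed

end

section \<open>2-natural isomorphisms and full faithfulness\<close>

lemma two_fully_faithful_inj1:
  assumes "two_category V" and ff: "two_fully_faithful V L Y"
    and f: "f \<in> arr (one V)" "g \<in> arr (one V)" "src (one V) f = src (one V) g" "tgt (one V) f = tgt (one V) g"
    and eq: "app1 Y f = app1 Y g"
  shows "f = g"
proof -
  interpret V: two_category V by fact
  have "inj_on (app1 Y) (obj (homcat V (src (one V) g) (tgt (one V) g)))"
    using f ff by (auto simp: two_fully_faithful_def cat_iso_def bij_betw_def)
  then show ?thesis using f eq by (auto simp: V.two_category_axioms dest: inj_onD)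
qed

lemma two_fully_faithful_inj2:
  assumes "two_category V" and ff: "two_fully_faithful V L Y"
    and f: "\<alpha> \<in> arr (two V)" "\<beta> \<in> arr (two V)" "src (two V) \<alpha> = src (two V) \<beta>"
    and eq: "app2 Y \<alpha> = app2 Y \<beta>"
  shows "\<alpha> = \<beta>"
proof -
  interpret V: two_category V by fact
  have "inj_on (app2 Y) (arr (homcat V (src (one V) (src (two V) \<beta>)) (tgt (one V) (src (two V) \<beta>))))"
    using f ff by (auto simp: two_fully_faithful_def cat_iso_def bij_betw_def)
  then show ?thesis using f eq by (auto simp: V.two_category_axioms dest: inj_onD)
qed

text \<open>A 2-natural isomorphism in elements. The values of \<open>G\<close> and \<open>H\<close>
  have independent types, so the components of \<open>\<phi>\<close> are not 1-cells of one
  \<open>CatFun\<close>.\<close>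

locale cat_functor_iso = G: cat_functor W K G + H: cat_functor W K H
  for W :: "('o, 'm, 't) twocat" and K :: "('i, 'j, 'k) twocat"
    and G :: "('o, 'm, 't, ('i, 'j, 'k, 'x, 'y) catvalued, ('i, 'j, 'k, 'x, 'y, 'x, 'y) tnat,
    ('i, 'j, 'k, 'x, 'y, 'x, 'y) modif) twofun"
    and H :: "('o, 'm, 't, ('i, 'j, 'k, 'x2, 'y2) catvalued, ('i, 'j, 'k, 'x2, 'y2, 'x2, 'y2) tnat,
    ('i, 'j, 'k, 'x2, 'y2, 'x2, 'y2) modif) twofun"
    and \<phi> :: "'o \<Rightarrow> ('i, 'j, 'k, 'x, 'y, 'x2, 'y2) tnat" +
  assumes iso: "A \<in> obj (one W) \<Longrightarrow> cat_nat_iso K (app0 G A) (app0 H A) (\<phi> A)"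
    and nat_ob: "a \<in> arr (one W) \<Longrightarrow> i \<in> obj (one K) \<Longrightarrow> x \<in> obj (app0 (app0 G (src (one W) a)) i) \<Longrightarrow>
      fob (tcmp (\<phi> (tgt (one W) a)) i) (fob (tcmp (app1 G a) i) x) =
      fob (tcmp (app1 H a) i) (fob (tcmp (\<phi> (src (one W) a)) i) x)"
    and nat_ar: "a \<in> arr (one W) \<Longrightarrow> i \<in> obj (one K) \<Longrightarrow> f \<in> arr (app0 (app0 G (src (one W) a)) i) \<Longrightarrow>
      far (tcmp (\<phi> (tgt (one W) a)) i) (far (tcmp (app1 G a) i) f) =
      far (tcmp (app1 H a) i) (far (tcmp (\<phi> (src (one W) a)) i) f)"
    and nat_two: "\<alpha> \<in> arr (two W) \<Longrightarrow> i \<in> obj (one K) \<Longrightarrow> x \<in> obj (app0 (app0 G (src (one W) (src (two W) \<alpha>))) i) \<Longrightarrow>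
      far (tcmp (\<phi> (tgt (one W) (src (two W) \<alpha>))) i) (ncmp (mcmp (app2 G \<alpha>) i) x) =
      ncmp (mcmp (app2 H \<alpha>) i) (fob (tcmp (\<phi> (src (one W) (src (two W) \<alpha>))) i) x)"

text \<open>Passage from the record equations of the definition to the elementwise locale; both
  directions read them through \<open>tnat_comp_eq_iff\<close> and
  \<open>modif_hcomp_eq_iff\<close>.\<close>

lemma two_naturally_isomorphic_iff:
  assumes "cat_functor W K G" "cat_functor W K H"
  shows "two_naturally_isomorphic W K G H \<longleftrightarrow> (\<exists>\<phi>. cat_functor_iso W K G H \<phi>)"
proof -
  interpret G: cat_functor W K G by fact
  interpret H: cat_functor W K H by fact
  show ?thesis
  proof
    assume "two_naturally_isomorphic W K G H"
    then obtain \<phi> where f: "\<And>A. A \<in> obj (one W) \<Longrightarrow> is_tnat K (\<phi> A) \<and> tdom (\<phi> A) = app0 G A \<and> tcod (\<phi> A) = app0 H A \<and>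
           (\<forall>i \<in> obj (one K). cat_iso (app0 (app0 G A) i) (app0 (app0 H A) i)
              (fob (tcmp (\<phi> A) i)) (far (tcmp (\<phi> A) i)))"
      and n1: "\<And>A B a. A \<in> obj (one W) \<Longrightarrow> B \<in> obj (one W) \<Longrightarrow> a \<in> hom (one W) A B \<Longrightarrow>
           tnat_comp K (\<phi> B) (app1 G a) = tnat_comp K (app1 H a) (\<phi> A)"
      and n2: "\<And>A B \<alpha>. A \<in> obj (one W) \<Longrightarrow> B \<in> obj (one W) \<Longrightarrow> \<alpha> \<in> arr (homcat W A B) \<Longrightarrow>
           modif_hcomp K (modif_id K (\<phi> B)) (app2 G \<alpha>) =
           modif_hcomp K (app2 H \<alpha>) (modif_id K (\<phi> A))"
      unfolding two_naturally_isomorphic_def by - (elim exE conjE, rule that, blast+)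
    have fn: "cat_nat K (app0 G A) (app0 H A) (\<phi> A)" if "A \<in> obj (one W)" for A
      using f[OF that] by (intro cat_natI) (auto simp: G.K.two_category_axioms)
    have n1': "tnat_comp K (\<phi> (tgt (one W) a)) (app1 G a) = tnat_comp K (app1 H a) (\<phi> (src (one W) a))"
      if "a \<in> arr (one W)" for a
      using that by (intro n1) (auto simp: hom_iff)
    have e1: "\<forall>i \<in> obj (one K).
        (\<forall>x \<in> obj (app0 (app0 G (src (one W) a)) i).
          fob (tcmp (\<phi> (tgt (one W) a)) i) (fob (tcmp (app1 G a) i) x) =
          fob (tcmp (app1 H a) i) (fob (tcmp (\<phi> (src (one W) a)) i) x)) \<and>
        (\<forall>f \<in> arr (app0 (app0 G (src (one W) a)) i).
          far (tcmp (\<phi> (tgt (one W) a)) i) (far (tcmp (app1 G a) i) f) =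
          far (tcmp (app1 H a) i) (far (tcmp (\<phi> (src (one W) a)) i) f))"
      if a: "a \<in> arr (one W)" for a
      using n1'[OF a] tnat_comp_eq_iff[OF fn fn G.nat_app1[OF a] H.nat_app1[OF a]] a by simp
    have n2': "modif_hcomp K (modif_id K (\<phi> (tgt (one W) (src (two W) \<alpha>)))) (app2 G \<alpha>) =
           modif_hcomp K (app2 H \<alpha>) (modif_id K (\<phi> (src (one W) (src (two W) \<alpha>))))"
      if "\<alpha> \<in> arr (two W)" for \<alpha>
      using that by (intro n2) (auto simp: G.W.two_category_axioms)
    have e2: "far (tcmp (\<phi> (tgt (one W) (src (two W) \<alpha>))) i) (ncmp (mcmp (app2 G \<alpha>) i) x) =
      ncmp (mcmp (app2 H \<alpha>) i) (fob (tcmp (\<phi> (src (one W) (src (two W) \<alpha>))) i) x)"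
      if a: "\<alpha> \<in> arr (two W)" and "i \<in> obj (one K)" "x \<in> obj (app0 (app0 G (src (one W) (src (two W) \<alpha>))) i)" for \<alpha> i x
      using n2'[OF a] modif_hcomp_eq_iff[OF fn fn G.modif_app2 H.modif_app2, OF _ _ a a] that
        n1'[of "src (two W) \<alpha>"] n1'[of "tgt (two W) \<alpha>"] by auto
    have "cat_functor_iso W K G H \<phi>"
    proof (intro cat_functor_iso.intro cat_functor_iso_axioms.intro assms)
      fix A assume A: "A \<in> obj (one W)"
      interpret cat_nat K "app0 G A" "app0 H A" "\<phi> A" using A by (rule fn)
      show "cat_nat_iso K (app0 G A) (app0 H A) (\<phi> A)"
        by unfold_locales (use f[OF A] in \<open>auto simp: cat_iso_def\<close>)
    qed (use e1 e2 in auto)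
    then show "\<exists>\<phi>. cat_functor_iso W K G H \<phi>" by (rule exI[of _ \<phi>])
  next
    assume "\<exists>\<phi>. cat_functor_iso W K G H \<phi>"
    then obtain \<phi> where f: "cat_functor_iso W K G H \<phi>" ..
    then interpret cat_functor_iso W K G H \<phi> .
    have fn: "cat_nat K (app0 G A) (app0 H A) (\<phi> A)" if "A \<in> obj (one W)" for A
      using iso[OF that] by (simp add: cat_nat_iso_def)
    have n1: "tnat_comp K (\<phi> (tgt (one W) a)) (app1 G a) = tnat_comp K (app1 H a) (\<phi> (src (one W) a))"
      if "a \<in> arr (one W)" for a
      using that nat_ob nat_ar by (subst tnat_comp_eq_iff[OF fn fn G.nat_app1 H.nat_app1]) auto
    have n2: "modif_hcomp K (modif_id K (\<phi> (tgt (one W) (src (two W) \<alpha>)))) (app2 G \<alpha>) =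
           modif_hcomp K (app2 H \<alpha>) (modif_id K (\<phi> (src (one W) (src (two W) \<alpha>))))"
      if "\<alpha> \<in> arr (two W)" for \<alpha>
      using that n1[of "src (two W) \<alpha>"] n1[of "tgt (two W) \<alpha>"] nat_two
      by (subst modif_hcomp_eq_iff[OF fn fn G.modif_app2 H.modif_app2]) auto
    have iso': "cat_iso (app0 (app0 G A) i) (app0 (app0 H A) i) (fob (tcmp (\<phi> A) i)) (far (tcmp (\<phi> A) i))"
      if A: "A \<in> obj (one W)" and i: "i \<in> obj (one K)" for A i
    proof -
      interpret cat_nat_iso K "app0 G A" "app0 H A" "\<phi> A" using A by (rule iso)
      show ?thesis using bij[OF i] cfun[OF i] by (auto simp: cat_iso_def is_cfun_def)
    qed
    show "two_naturally_isomorphic W K G H"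
      unfolding two_naturally_isomorphic_def using fn n1 n2 iso'
      by (intro exI[of _ \<phi>]) (auto simp: hom_iff cat_nat_def cat_nat_axioms_def G.W.two_category_axioms)
  qed
qed

lemma cat_functor_iso_sym:
  assumes "cat_functor_iso W K G H \<phi>"
  shows "\<exists>\<psi>. cat_functor_iso W K H G \<psi>"
proof -
  interpret cat_functor_iso W K G H \<phi> by fact
  \<comment> \<open>\<open>R\<close> bundles the inverse of one component with its four cancellation
    laws, so that a single choice over all \<open>A\<close> keeps them together.\<close>
  define R where "R A \<psi> \<longleftrightarrow> cat_nat_iso K (app0 H A) (app0 G A) \<psi> \<and> (\<forall>i \<in> obj (one K).
    (\<forall>x \<in> obj (app0 (app0 G A) i). fob (tcmp \<psi> i) (fob (tcmp (\<phi> A) i) x) = x) \<and>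
    (\<forall>x \<in> arr (app0 (app0 G A) i). far (tcmp \<psi> i) (far (tcmp (\<phi> A) i) x) = x) \<and>
    (\<forall>x \<in> obj (app0 (app0 H A) i). fob (tcmp (\<phi> A) i) (fob (tcmp \<psi> i) x) = x) \<and>
    (\<forall>x \<in> arr (app0 (app0 H A) i). far (tcmp (\<phi> A) i) (far (tcmp \<psi> i) x) = x))" for A \<psi>
  have "\<exists>\<psi>. R A \<psi>" if "A \<in> obj (one W)" for A
    by (rule cat_nat_iso.inverse[OF iso[OF that]]) (auto simp: R_def)
  then have "\<forall>A \<in> obj (one W). \<exists>\<psi>. R A \<psi>" by blast
  from bchoice[OF this] obtain \<psi> where R: "R A (\<psi> A)" if "A \<in> obj (one W)" for A by blast
  note p = R[unfolded R_def, THEN conjunct1]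
  have gf: "fob (tcmp (\<psi> A) i) (fob (tcmp (\<phi> A) i) x) = x"
    if "A \<in> obj (one W)" "i \<in> obj (one K)" "x \<in> obj (app0 (app0 G A) i)" for A i x
    using R that unfolding R_def by blast
  have gf': "far (tcmp (\<psi> A) i) (far (tcmp (\<phi> A) i) x) = x"
    if "A \<in> obj (one W)" "i \<in> obj (one K)" "x \<in> arr (app0 (app0 G A) i)" for A i x
    using R that unfolding R_def by blast
  have fg: "fob (tcmp (\<phi> A) i) (fob (tcmp (\<psi> A) i) x) = x"
    if "A \<in> obj (one W)" "i \<in> obj (one K)" "x \<in> obj (app0 (app0 H A) i)" for A i x
    using R that unfolding R_def by blast
  have fg': "far (tcmp (\<phi> A) i) (far (tcmp (\<psi> A) i) x) = x"
    if "A \<in> obj (one W)" "i \<in> obj (one K)" "x \<in> arr (app0 (app0 H A) i)" for A i x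
    using R that unfolding R_def by blast
  have pm0: "fob (tcmp (\<psi> A) i) x \<in> obj (app0 (app0 G A) i)" 
    if "A \<in> obj (one W)" "i \<in> obj (one K)" "x \<in> obj (app0 (app0 H A) i)" for A i x
    by (rule cat_nat.cfun_map(1)[OF cat_nat_iso.axioms(1)[OF p[OF that(1)]] that(2,3)])
  have pm1: "far (tcmp (\<psi> A) i) f \<in> arr (app0 (app0 G A) i)"
    if "A \<in> obj (one W)" "i \<in> obj (one K)" "f \<in> arr (app0 (app0 H A) i)" for A i f
    by (rule cat_nat.cfun_map(2)[OF cat_nat_iso.axioms(1)[OF p[OF that(1)]] that(2,3)])
  have "cat_functor_iso W K H G \<psi>"
  proof (intro cat_functor_iso.intro cat_functor_iso_axioms.intro G.cat_functor_axioms H.cat_functor_axioms)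
    fix a i x assume *: "a \<in> arr (one W)" "i \<in> obj (one K)" "x \<in> obj (app0 (app0 H (src (one W) a)) i)"
    show "fob (tcmp (\<psi> (tgt (one W) a)) i) (fob (tcmp (app1 H a) i) x) =
      fob (tcmp (app1 G a) i) (fob (tcmp (\<psi> (src (one W) a)) i) x)"
      \<comment> \<open>The square of \<open>\<phi>\<close> at the preimage of \<open>x\<close>,
        then \<open>\<psi>\<close> applied to both sides. The other two cases repeat this.\<close>
      using nat_ob[OF *(1,2), of "fob (tcmp (\<psi> (src (one W) a)) i) x"] *
      by (simp add: pm0 fg) (metis G.elem_map(1) G.W.one.src_obj G.W.one.tgt_obj gf pm0)
  next
    fix a i x assume *: "a \<in> arr (one W)" "i \<in> obj (one K)" "x \<in> arr (app0 (app0 H (src (one W) a)) i)"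
    show "far (tcmp (\<psi> (tgt (one W) a)) i) (far (tcmp (app1 H a) i) x) =
      far (tcmp (app1 G a) i) (far (tcmp (\<psi> (src (one W) a)) i) x)"
      using nat_ar[OF *(1,2), of "far (tcmp (\<psi> (src (one W) a)) i) x"] *
      by (simp add: pm1 fg') (metis G.elem_map(2) G.W.one.src_obj G.W.one.tgt_obj gf' pm1)
  next
    fix \<alpha> i x assume *: "\<alpha> \<in> arr (two W)" "i \<in> obj (one K)" "x \<in> obj (app0 (app0 H (src (one W) (src (two W) \<alpha>))) i)"
    show "far (tcmp (\<psi> (tgt (one W) (src (two W) \<alpha>))) i) (ncmp (mcmp (app2 H \<alpha>) i) x) =
      ncmp (mcmp (app2 G \<alpha>) i) (fob (tcmp (\<psi> (src (one W) (src (two W) \<alpha>))) i) x)"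
      using nat_two[OF *(1,2), of "fob (tcmp (\<psi> (src (one W) (src (two W) \<alpha>))) i) x"] *
      by (simp add: pm0 fg) (metis G.elem_two(1) G.W.one.src_obj G.W.one.tgt_obj G.W.two_src gf' pm0)
  qed (rule p)
  then show ?thesis by (rule exI[of _ \<psi>])
qed

text \<open>Whiskering on the source side. \<open>cnat_hcomp\<close> with an identity transformation
  leaves the image of an identity behind; once it is cancelled, the component at \<open>x\<close> is
  that of \<open>m\<close> at the image of \<open>x\<close> under \<open>\<phi>\<close>.\<close>

lemma precompose_modif:
  assumes "cat_nat K P Q \<phi>" "cat_modif K Q R \<sigma> \<tau> m"
  shows "\<exists>n. cat_modif K P R (tnat_comp K \<sigma> \<phi>) (tnat_comp K \<tau> \<phi>) n \<and> (\<forall>i \<in> obj (one K). \<forall>x \<in> obj (app0 P i).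
    ncmp (mcmp n i) x = ncmp (mcmp m i) (fob (tcmp \<phi> i) x))"
proof -
  interpret A: cat_nat K P Q \<phi> by fact
  interpret m: cat_modif K Q R \<sigma> \<tau> m by fact
  note K = A.P.K.two_category_axioms
    define n where "n = \<lparr>mdom = tnat_comp K \<sigma> \<phi>, mcod = tnat_comp K \<tau> \<phi>,
      mcmp = (\<lambda>i \<in> obj (one K). cnat_hcomp (mcmp m i) (cnat_id (tcmp \<phi> i)))\<rparr>"
    have n: "ncmp (mcmp n i) x = ncmp (mcmp m i) (fob (tcmp \<phi> i) x)"
      if "i \<in> obj (one K)" "x \<in> obj (app0 P i)" for i x
    proof -
      interpret c: category "app0 R i" using that by (simp add: m.S.Q.category)
      show ?thesis using that by (simp add: n_def m.S.cfun_cmp)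
    qed
    have "is_modif K n"
    proof (rule is_modifI)
      show "is_tnat K (mdom n)" "is_tnat K (mcod n)"
        using is_tnat_comp[OF K m.S.tnat A.tnat] is_tnat_comp[OF K m.T.tnat A.tnat]
        by (simp_all add: n_def A.tcod m.S.tdom m.T.tdom)
    next
      fix i assume i: "i \<in> obj (one K)"
      interpret p: category "app0 P i" using i by (rule A.P.category)
      have "is_cnat (mcmp n i)"
      proof (rule is_cnatI)
        fix f assume f: "f \<in> arr (fdom (ndom (mcmp n i)))"
        then have f': "f \<in> arr (app0 P i)" using i by (simp add: n_def)
        then show "ncmp (mcmp n i) (tgt (fdom (ndom (mcmp n i))) f) \<cdot>\<^bsub>fcod (ndom (mcmp n i))\<^esub> far (ndom (mcmp n i)) f =
          far (ncod (mcmp n i)) f \<cdot>\<^bsub>fcod (ndom (mcmp n i))\<^esub> ncmp (mcmp n i) (src (fdom (ndom (mcmp n i))) f)"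
          using i m.cnat_natural[OF i, of "far (tcmp \<phi> i) f"] n[OF i p.src_obj[OF f']] n[OF i p.tgt_obj[OF f']]
          by (simp add: n_def)
      next
        fix x assume x: "x \<in> obj (fdom (ndom (mcmp n i)))"
        then have x': "x \<in> obj (app0 P i)" using i by (simp add: n_def)
        then show "ncmp (mcmp n i) x \<in> arr (fcod (ndom (mcmp n i))) \<and>
          src (fcod (ndom (mcmp n i))) (ncmp (mcmp n i) x) = fob (ndom (mcmp n i)) x \<and>
          tgt (fcod (ndom (mcmp n i))) (ncmp (mcmp n i) x) = fob (ncod (mcmp n i)) x"
          using i n[OF i x'] by (simp add: n_def)
      qed (use i in \<open>auto simp: n_def\<close>, simp add: cnat_hcomp_def)
      then show "is_cnat (mcmp n i) \<and> ndom (mcmp n i) = tcmp (mdom n) i \<and> ncod (mcmp n i) = tcmp (mcod n) i"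
        using i by (simp add: n_def)
    next
      fix u x assume u: "u \<in> arr (one K)" and "x \<in> obj (app0 (tdom (mdom n)) (src (one K) u))"
      then have x: "x \<in> obj (app0 P (src (one K) u))" by (simp add: n_def A.tdom)
      with u have "ncmp (mcmp n (tgt (one K) u)) (fob (app1 P u) x) =
        far (app1 R u) (ncmp (mcmp n (src (one K) u)) x)"
        by (simp add: n A.natural m.natural)
      then show "ncmp (mcmp n (tgt (one K) u)) (fob (app1 (tdom (mdom n)) u) x) =
        far (app1 (tcod (mdom n)) u) (ncmp (mcmp n (src (one K) u)) x)"
        by (simp add: n_def A.tdom m.S.tcod)
    qed (auto simp: n_def K A.tdom m.S.tcod m.T.tcod)
    then have "cat_modif K P R (tnat_comp K \<sigma> \<phi>) (tnat_comp K \<tau> \<phi>) n"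
      by (intro cat_modifI K) (auto simp: n_def A.tdom m.S.tcod)
    then show ?thesis using n by blast
qed

text \<open>Conjugation with \<open>\<phi>\<close>: a cell between \<open>H A\<close> and
  \<open>H B\<close> corresponds to one between \<open>G A\<close> and \<open>G B\<close>, and the
  latter is known to come from \<open>W\<close>. Its preimage lies over the original cell as well,
  because every element of \<open>H A\<close> is the image of one of \<open>G A\<close>.\<close>

lemma two_fully_faithful_iso:
  assumes f: "cat_functor_iso W K G H \<phi>" and G: "two_fully_faithful W (CatFun K) G"
  shows "two_fully_faithful W (CatFun K) H"
  unfolding two_fully_faithful_def
proof (intro ballI)
  interpret cat_functor_iso W K G H \<phi> by fact
  fix A B assume A: "A \<in> obj (one W)" and B: "B \<in> obj (one W)"
  note W [simp] = G.W.two_category_axioms and K = G.K.two_category_axioms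
  interpret A: cat_nat_iso K "app0 G A" "app0 H A" "\<phi> A" using A by (rule iso)
  interpret B: cat_nat_iso K "app0 G B" "app0 H B" "\<phi> B" using B by (rule iso)
  have ob: "bij_betw (app1 G) (obj (homcat W A B)) (obj (homcat (CatFun K) (app0 G A) (app0 G B)))"
    and ar: "bij_betw (app2 G) (arr (homcat W A B)) (arr (homcat (CatFun K) (app0 G A) (app0 G B)))"
    using G A B by (auto simp: two_fully_faithful_def cat_iso_def)
  have inj: "a = b" if a: "a \<in> arr (one W)" "src (one W) a = A" "tgt (one W) a = B"
    and b: "b \<in> arr (one W)" "src (one W) b = A" "tgt (one W) b = B" and eq: "app1 H a = app1 H b" for a b
  proof -
    have "app1 G a = app1 G b"
    proof (rule tnat_eqI)
      show "is_tnat K (app1 G a)" "is_tnat K (app1 G b)" "tdom (app1 G a) = tdom (app1 G b)"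
        "tcod (app1 G a) = tcod (app1 G b)"
        using a b G.one.arr G.one.src_map G.one.tgt_map by simp_all
    next
      fix i x assume "i \<in> obj (one K)" "x \<in> obj (app0 (tdom (app1 G a)) i)"
      then show "fob (tcmp (app1 G a) i) x = fob (tcmp (app1 G b) i) x"
        using a b nat_ob[of a i x] nat_ob[of b i x] eq G.one.src_map[of a] by (intro B.inj0[of i]) auto
    next
      fix i x assume "i \<in> obj (one K)" "x \<in> arr (app0 (tdom (app1 G a)) i)"
      then show "far (tcmp (app1 G a) i) x = far (tcmp (app1 G b) i) x"
        using a b nat_ar[of a i x] nat_ar[of b i x] eq G.one.src_map[of a] by (intro B.inj1[of i]) auto
    qed
    then show ?thesis using ob a b by (auto simp: bij_betw_def dest: inj_onD)
  qed
  have surj: "\<exists>a. a \<in> arr (one W) \<and> src (one W) a = A \<and> tgt (one W) a = B \<and> app1 H a = \<tau>"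
    if t: "cat_nat K (app0 H A) (app0 H B) \<tau>" for \<tau>
  proof -
    interpret t: cat_nat K "app0 H A" "app0 H B" \<tau> by fact
    \<comment> \<open>First half of the conjugate; \<open>B.lift\<close> then inverts the component
      at \<open>B\<close>.\<close>
    have "cat_nat K (app0 G A) (app0 H B) (tnat_comp K \<tau> (\<phi> A))"
      by (intro cat_natI is_tnat_comp K t.tnat A.tnat) (auto simp: t.tdom t.tcod A.tdom A.tcod)
    then obtain \<upsilon> where u: "cat_nat K (app0 G A) (app0 G B) \<upsilon>"
      and u0: "\<And>i x. i \<in> obj (one K) \<Longrightarrow> x \<in> obj (app0 (app0 G A) i) \<Longrightarrow>
        fob (tcmp (\<phi> B) i) (fob (tcmp \<upsilon> i) x) = fob (tcmp (tnat_comp K \<tau> (\<phi> A)) i) x"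
      and u1: "\<And>i x. i \<in> obj (one K) \<Longrightarrow> x \<in> arr (app0 (app0 G A) i) \<Longrightarrow>
        far (tcmp (\<phi> B) i) (far (tcmp \<upsilon> i) x) = far (tcmp (tnat_comp K \<tau> (\<phi> A)) i) x"
      by (rule B.lift) blast
    interpret u: cat_nat K "app0 G A" "app0 G B" \<upsilon> by fact
    have "\<upsilon> \<in> obj (homcat (CatFun K) (app0 G A) (app0 G B))"
      by (simp add: homcat_CatFun u.tnat u.tdom u.tcod)
    then obtain a where a: "a \<in> arr (one W)" "src (one W) a = A" "tgt (one W) a = B" "app1 G a = \<upsilon>"
      using bij_betw_imp_surj_on[OF ob, symmetric] by auto
    have "app1 H a = \<tau>"
    proof (rule tnat_eqI)
      show "is_tnat K (app1 H a)" "is_tnat K \<tau>" "tdom (app1 H a) = tdom \<tau>" "tcod (app1 H a) = tcod \<tau>"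
        using a H.one.arr H.one.src_map H.one.tgt_map t.tnat t.tdom t.tcod by simp_all
    next
      fix i y assume i: "i \<in> obj (one K)" and "y \<in> obj (app0 (tdom (app1 H a)) i)"
      then obtain x where "x \<in> obj (app0 (app0 G A) i)" "y = fob (tcmp (\<phi> A) i) x"
        using A.surj0[of i y] H.one.src_map a by auto
      then show "fob (tcmp (app1 H a) i) y = fob (tcmp \<tau> i) y"
        using nat_ob[of a i x] a i u0[of i x] by simp
    next
      fix i y assume i: "i \<in> obj (one K)" and "y \<in> arr (app0 (tdom (app1 H a)) i)"
      then obtain x where "x \<in> arr (app0 (app0 G A) i)" "y = far (tcmp (\<phi> A) i) x"
        using A.surj1[of i y] H.one.src_map a by auto
      then show "far (tcmp (app1 H a) i) y = far (tcmp \<tau> i) y"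
        using nat_ar[of a i x] a i u1[of i x] by simp
    qed
    then show ?thesis using a by blast
  qed
  have inj2: "\<alpha> = \<beta>" if a: "\<alpha> \<in> arr (two W)" "src (one W) (src (two W) \<alpha>) = A" "tgt (one W) (src (two W) \<alpha>) = B"
    and b: "\<beta> \<in> arr (two W)" "src (one W) (src (two W) \<beta>) = A" "tgt (one W) (src (two W) \<beta>) = B"
    and eq: "app2 H \<alpha> = app2 H \<beta>" for \<alpha> \<beta>
  proof -
    have st: "src (two W) \<alpha> = src (two W) \<beta>" "tgt (two W) \<alpha> = tgt (two W) \<beta>"
      using a b H.two.src_map[of \<alpha>] H.two.src_map[of \<beta>] H.two.tgt_map[of \<alpha>] H.two.tgt_map[of \<beta>] eq
      by (auto intro!: inj)
    have "app2 G \<alpha> = app2 G \<beta>"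
    proof (rule modif_eqI)
      show "is_modif K (app2 G \<alpha>)" "is_modif K (app2 G \<beta>)" "mdom (app2 G \<alpha>) = mdom (app2 G \<beta>)"
        "mcod (app2 G \<alpha>) = mcod (app2 G \<beta>)"
        using a b G.two.arr G.two.src_map G.two.tgt_map st by simp_all
    next
      fix i x assume "i \<in> obj (one K)" "x \<in> obj (app0 (tdom (mdom (app2 G \<alpha>))) i)"
      then show "ncmp (mcmp (app2 G \<alpha>) i) x = ncmp (mcmp (app2 G \<beta>) i) x"
        using a b nat_two[of \<alpha> i x] nat_two[of \<beta> i x] eq G.two.src_map[of \<alpha>] G.one.src_map[of "src (two W) \<alpha>"]
        by (intro B.inj1[of i]) auto
    qed
    then show ?thesis using ar a b by (auto simp: bij_betw_def dest: inj_onD)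
  qed
  have surj2: "\<exists>\<alpha>. \<alpha> \<in> arr (two W) \<and> src (one W) (src (two W) \<alpha>) = A \<and> tgt (one W) (src (two W) \<alpha>) = B \<and> app2 H \<alpha> = m"
    if m: "is_modif K m" "tdom (mdom m) = app0 H A" "tcod (mdom m) = app0 H B" for m
  proof -
    interpret m: cat_modif K "app0 H A" "app0 H B" "mdom m" "mcod m" m
      using m by (intro cat_modifI K) auto
    obtain a where a: "a \<in> arr (one W)" "src (one W) a = A" "tgt (one W) a = B" "app1 H a = mdom m"
      using surj[OF m.S.cat_nat_axioms] by blast
    obtain b where b: "b \<in> arr (one W)" "src (one W) b = A" "tgt (one W) b = B" "app1 H b = mcod m"
      using surj[OF m.T.cat_nat_axioms] by blast
    interpret ga: cat_nat K "app0 G A" "app0 G B" "app1 G a" using G.nat_app1[of a] a by simp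
    interpret gb: cat_nat K "app0 G A" "app0 G B" "app1 G b" using G.nat_app1[of b] b by simp
    obtain n where n': "cat_modif K (app0 G A) (app0 H B) (tnat_comp K (mdom m) (\<phi> A)) (tnat_comp K (mcod m) (\<phi> A)) n"
      and n: "\<And>i x. i \<in> obj (one K) \<Longrightarrow> x \<in> obj (app0 (app0 G A) i) \<Longrightarrow>
        ncmp (mcmp n i) x = ncmp (mcmp m i) (fob (tcmp (\<phi> A) i) x)"
      using precompose_modif[OF A.cat_nat_axioms m.cat_modif_axioms] by blast
    from n' obtain l where l: "cat_modif K (app0 G A) (app0 G B) (app1 G a) (app1 G b) l"
      "\<And>i x. i \<in> obj (one K) \<Longrightarrow> x \<in> obj (app0 (app0 G A) i) \<Longrightarrow>
        far (tcmp (\<phi> B) i) (ncmp (mcmp l i) x) = ncmp (mcmp n i) x"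
      by (rule B.lift_modif[OF _ ga.cat_nat_axioms gb.cat_nat_axioms])
        (use a b nat_ob[of a] nat_ar[of a] nat_ob[of b] nat_ar[of b] in auto)
    interpret l: cat_modif K "app0 G A" "app0 G B" "app1 G a" "app1 G b" l by fact
    have "l \<in> arr (homcat (CatFun K) (app0 G A) (app0 G B))"
      by (simp add: homcat_CatFun l.modif l.mdom ga.tdom ga.tcod)
    then obtain \<alpha> where al: "\<alpha> \<in> arr (two W)" "src (one W) (src (two W) \<alpha>) = A" "tgt (one W) (src (two W) \<alpha>) = B" "app2 G \<alpha> = l"
      using bij_betw_imp_surj_on[OF ar, symmetric] by auto
    \<comment> \<open>\<open>\<alpha>\<close> was found through its image, so its boundary is known
      only after applying \<open>G\<close>; injectivity on 1-cells recovers \<open>a\<close> and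
      \<open>b\<close>.\<close>
    have "app1 G (src (two W) \<alpha>) = app1 G a" "app1 G (tgt (two W) \<alpha>) = app1 G b"
      using al G.two.src_map[of \<alpha>] G.two.tgt_map[of \<alpha>] l.mdom l.mcod by auto
    then have st: "src (two W) \<alpha> = a" "tgt (two W) \<alpha> = b"
      using ob al a b by (auto simp: bij_betw_def dest: inj_onD)
    have "app2 H \<alpha> = m"
    proof (rule modif_eqI)
      show "is_modif K (app2 H \<alpha>)" "is_modif K m" "mdom (app2 H \<alpha>) = mdom m" "mcod (app2 H \<alpha>) = mcod m"
        using al a b st H.two.arr H.two.src_map H.two.tgt_map m by simp_all
    next
      fix i y assume i: "i \<in> obj (one K)" and "y \<in> obj (app0 (tdom (mdom (app2 H \<alpha>))) i)"
      then obtain x where "x \<in> obj (app0 (app0 G A) i)" "y = fob (tcmp (\<phi> A) i) x"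
        using A.surj0[of i y] H.two.src_map[of \<alpha>] H.one.src_map[of a] a al st by auto
      then show "ncmp (mcmp (app2 H \<alpha>) i) y = ncmp (mcmp m i) y"
        using nat_two[of \<alpha> i x] al i l(2)[of i x] n by simp
    qed
    then show ?thesis using al by blast
  qed
  show "cat_iso (homcat W A B) (homcat (CatFun K) (app0 H A) (app0 H B)) (app1 H) (app2 H)"
    unfolding cat_iso_def
  proof (intro conjI)
    show F: "is_functor (homcat W A B) (homcat (CatFun K) (app0 H A) (app0 H B)) (app1 H) (app2 H)"
      by (rule H.hom_functor) simp
    interpret F: is_functor "homcat W A B" "homcat (CatFun K) (app0 H A) (app0 H B)" "app1 H" "app2 H" by fact
    have s: "\<exists>a \<in> obj (homcat W A B). app1 H a = \<tau>" if "\<tau> \<in> obj (homcat (CatFun K) (app0 H A) (app0 H B))" for \<tau>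
      using surj[OF cat_natI[OF K, of \<tau>]] that by (auto simp: homcat_CatFun)
    show "bij_betw (app1 H) (obj (homcat W A B)) (obj (homcat (CatFun K) (app0 H A) (app0 H B)))"
      unfolding bij_betw_def inj_on_def using inj F.map_obj by (auto dest!: s)
    have s: "\<exists>a \<in> arr (homcat W A B). app2 H a = m" if "m \<in> arr (homcat (CatFun K) (app0 H A) (app0 H B))" for m
      using surj2[of m] that by (auto simp: homcat_CatFun)
    show "bij_betw (app2 H) (arr (homcat W A B)) (arr (homcat (CatFun K) (app0 H A) (app0 H B)))"
      unfolding bij_betw_def inj_on_def using inj2 F.arr by (auto dest!: s)
  qed
qed

text \<open>Once the objects \<open>e A\<close> are chosen, full faithfulness of \<open>Y\<close>
  leaves no freedom on cells: \<open>E a\<close> is the unique cell whose image is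
  \<open>H a\<close> conjugated with the isomorphisms \<open>\<phi>\<close>. Uniqueness also yields
  every law of a 2-functor. Thus objects chosen without any coherence still assemble into a
  2-functor.\<close>

lemma lift_two_functor:
  assumes Y: "cat_functor V K Y" and ff: "two_fully_faithful V (CatFun K) Y" and H: "cat_functor W K H"
    and e [simp]: "\<And>A. A \<in> obj (one W) \<Longrightarrow> e A \<in> obj (one V)"
    and iso: "\<And>A. A \<in> obj (one W) \<Longrightarrow> cat_nat_iso K (app0 Y (e A)) (app0 H A) (\<phi> A)"
  shows "\<exists>E. two_functor W V E \<and> cat_functor_iso W K (twofun_comp Y E) H \<phi>"
proof -
  interpret Y: cat_functor V K Y by fact
  interpret H: cat_functor W K H by fact
  note V [simp] = Y.W.two_category_axioms and W [simp] = H.W.two_category_axioms and K = Y.K.two_category_axioms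
  \<comment> \<open>\<open>R1 a f\<close> says that the image of \<open>f\<close> under
    \<open>Y\<close> completes the naturality square of \<open>\<phi>\<close> over
    \<open>H a\<close>, in elements.\<close>
  define R1 where "R1 a f \<longleftrightarrow> f \<in> arr (one V) \<and> src (one V) f = e (src (one W) a) \<and> tgt (one V) f = e (tgt (one W) a) \<and>
    (\<forall>i \<in> obj (one K).
      (\<forall>x \<in> obj (app0 (app0 Y (e (src (one W) a))) i).
        fob (tcmp (\<phi> (tgt (one W) a)) i) (fob (tcmp (app1 Y f) i) x) =
        fob (tcmp (app1 H a) i) (fob (tcmp (\<phi> (src (one W) a)) i) x)) \<and>
      (\<forall>x \<in> arr (app0 (app0 Y (e (src (one W) a))) i).
        far (tcmp (\<phi> (tgt (one W) a)) i) (far (tcmp (app1 Y f) i) x) =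
        far (tcmp (app1 H a) i) (far (tcmp (\<phi> (src (one W) a)) i) x)))" for a f
  have map0 [simp]: "fob (tcmp (\<phi> A) i) x \<in> obj (app0 (app0 H A) i)"
    if "A \<in> obj (one W)" "i \<in> obj (one K)" "x \<in> obj (app0 (app0 Y (e A)) i)" for A i x
    using cat_nat.cfun_map(1)[OF cat_nat_iso.axioms(1)[OF iso]] that by simp
  have map1 [simp]: "far (tcmp (\<phi> A) i) x \<in> arr (app0 (app0 H A) i)"
    if "A \<in> obj (one W)" "i \<in> obj (one K)" "x \<in> arr (app0 (app0 Y (e A)) i)" for A i x
    using cat_nat.cfun_map(2)[OF cat_nat_iso.axioms(1)[OF iso]] that by simp
  note hom_eq = two_fully_faithful_inj1[OF V ff] and hom_eq2 = two_fully_faithful_inj2[OF V ff]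
  have uniq1: "f = g" if a: "a \<in> arr (one W)" and f: "R1 a f" and g: "R1 a g" for a f g
  proof -
    interpret B: cat_nat_iso K "app0 Y (e (tgt (one W) a))" "app0 H (tgt (one W) a)" "\<phi> (tgt (one W) a)"
      using a by (simp add: iso)
    note f = f[unfolded R1_def] and g = g[unfolded R1_def]
    have "app1 Y f = app1 Y g"
    proof (rule tnat_eqI)
      show "is_tnat K (app1 Y f)" "is_tnat K (app1 Y g)" "tdom (app1 Y f) = tdom (app1 Y g)" "tcod (app1 Y f) = tcod (app1 Y g)"
        using f g Y.one.arr Y.one.src_map Y.one.tgt_map by simp_all
    next
      fix i x assume "i \<in> obj (one K)" "x \<in> obj (app0 (tdom (app1 Y f)) i)"
      then show "fob (tcmp (app1 Y f) i) x = fob (tcmp (app1 Y g) i) x"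
        using f g Y.one.src_map[of f] by (intro B.inj0[of i]) auto
    next
      fix i x assume "i \<in> obj (one K)" "x \<in> arr (app0 (tdom (app1 Y f)) i)"
      then show "far (tcmp (app1 Y f) i) x = far (tcmp (app1 Y g) i) x"
        using f g Y.one.src_map[of f] by (intro B.inj1[of i]) auto
    qed
    then show ?thesis using f g by (intro hom_eq) auto
  qed
  have ex1: "\<exists>f. R1 a f" if a: "a \<in> arr (one W)" for a
  proof -
    let ?A = "src (one W) a" and ?B = "tgt (one W) a"
    interpret A: cat_nat_iso K "app0 Y (e ?A)" "app0 H ?A" "\<phi> ?A" using a by (simp add: iso)
    interpret B: cat_nat_iso K "app0 Y (e ?B)" "app0 H ?B" "\<phi> ?B" using a by (simp add: iso)
    interpret h: cat_nat K "app0 H ?A" "app0 H ?B" "app1 H a" by (rule H.nat_app1) fact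
    have "cat_nat K (app0 Y (e ?A)) (app0 H ?B) (tnat_comp K (app1 H a) (\<phi> ?A))"
      by (intro cat_natI is_tnat_comp K h.tnat A.tnat) (auto simp: h.tdom h.tcod A.tdom A.tcod)
    then obtain \<upsilon> where u: "cat_nat K (app0 Y (e ?A)) (app0 Y (e ?B)) \<upsilon>"
      and u0: "\<And>i x. i \<in> obj (one K) \<Longrightarrow> x \<in> obj (app0 (app0 Y (e ?A)) i) \<Longrightarrow>
        fob (tcmp (\<phi> ?B) i) (fob (tcmp \<upsilon> i) x) = fob (tcmp (tnat_comp K (app1 H a) (\<phi> ?A)) i) x"
      and u1: "\<And>i x. i \<in> obj (one K) \<Longrightarrow> x \<in> arr (app0 (app0 Y (e ?A)) i) \<Longrightarrow>
        far (tcmp (\<phi> ?B) i) (far (tcmp \<upsilon> i) x) = far (tcmp (tnat_comp K (app1 H a) (\<phi> ?A)) i) x"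
      by (rule B.lift) blast
    interpret u: cat_nat K "app0 Y (e ?A)" "app0 Y (e ?B)" \<upsilon> by fact
    have "bij_betw (app1 Y) (obj (homcat V (e ?A) (e ?B))) (obj (homcat (CatFun K) (app0 Y (e ?A)) (app0 Y (e ?B))))"
      using ff a by (auto simp: two_fully_faithful_def cat_iso_def)
    moreover have "\<upsilon> \<in> obj (homcat (CatFun K) (app0 Y (e ?A)) (app0 Y (e ?B)))"
      by (simp add: homcat_CatFun u.tnat u.tdom u.tcod)
    ultimately obtain f where "f \<in> arr (one V)" "src (one V) f = e ?A" "tgt (one V) f = e ?B" "app1 Y f = \<upsilon>"
      by (auto dest!: bij_betw_imp_surj_on[symmetric])
    then have "R1 a f" using a u0 u1 by (simp add: R1_def)
    then show ?thesis ..
  qed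
  define F1 where "F1 a = (SOME f. R1 a f)" for a
  have F1: "R1 a (F1 a)" if "a \<in> arr (one W)" for a
    unfolding F1_def using ex1[OF that] by (rule someI_ex)
  have F1_eq: "F1 a = f" if "a \<in> arr (one W)" "R1 a f" for a f
    using uniq1 F1 that by blast
  have F1_map [simp]: "F1 a \<in> arr (one V)" "src (one V) (F1 a) = e (src (one W) a)" "tgt (one V) (F1 a) = e (tgt (one W) a)"
    if "a \<in> arr (one W)" for a
    using F1[OF that] by (auto simp: R1_def)
  have F1_ob: "fob (tcmp (\<phi> (tgt (one W) a)) i) (fob (tcmp (app1 Y (F1 a)) i) x) =
      fob (tcmp (app1 H a) i) (fob (tcmp (\<phi> (src (one W) a)) i) x)"
    if "a \<in> arr (one W)" "i \<in> obj (one K)" "x \<in> obj (app0 (app0 Y (e (src (one W) a))) i)" for a i x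
    using F1[OF that(1)] that(2,3) by (auto simp: R1_def)
  have F1_ar: "far (tcmp (\<phi> (tgt (one W) a)) i) (far (tcmp (app1 Y (F1 a)) i) x) =
      far (tcmp (app1 H a) i) (far (tcmp (\<phi> (src (one W) a)) i) x)"
    if "a \<in> arr (one W)" "i \<in> obj (one K)" "x \<in> arr (app0 (app0 Y (e (src (one W) a))) i)" for a i x
    using F1[OF that(1)] that(2,3) by (auto simp: R1_def)
  \<comment> \<open>The same for 2-cells, with the boundary fixed to the chosen 1-cells
    \<open>F1\<close>.\<close>
  define R2 where "R2 \<alpha> \<theta> \<longleftrightarrow> \<theta> \<in> arr (two V) \<and> src (two V) \<theta> = F1 (src (two W) \<alpha>) \<and> tgt (two V) \<theta> = F1 (tgt (two W) \<alpha>) \<and>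
    (\<forall>i \<in> obj (one K). \<forall>x \<in> obj (app0 (app0 Y (e (src (one W) (src (two W) \<alpha>)))) i).
        far (tcmp (\<phi> (tgt (one W) (src (two W) \<alpha>))) i) (ncmp (mcmp (app2 Y \<theta>) i) x) =
        ncmp (mcmp (app2 H \<alpha>) i) (fob (tcmp (\<phi> (src (one W) (src (two W) \<alpha>))) i) x))" for \<alpha> \<theta>
  have uniq2: "f = g" if a: "a \<in> arr (two W)" and f: "R2 a f" and g: "R2 a g" for a f g
  proof -
    interpret B: cat_nat_iso K "app0 Y (e (tgt (one W) (src (two W) a)))" "app0 H (tgt (one W) (src (two W) a))" "\<phi> (tgt (one W) (src (two W) a))"
      using a by (simp add: iso)
    note f = f[unfolded R2_def] and g = g[unfolded R2_def]
    have "app2 Y f = app2 Y g"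
    proof (rule modif_eqI)
      show "is_modif K (app2 Y f)" "is_modif K (app2 Y g)" "mdom (app2 Y f) = mdom (app2 Y g)" "mcod (app2 Y f) = mcod (app2 Y g)"
        using f g Y.two.arr Y.two.src_map Y.two.tgt_map by simp_all
    next
      fix i x assume "i \<in> obj (one K)" "x \<in> obj (app0 (tdom (mdom (app2 Y f))) i)"
      then show "ncmp (mcmp (app2 Y f) i) x = ncmp (mcmp (app2 Y g) i) x"
        using a f g Y.two.src_map[of f] Y.one.src_map[of "F1 (src (two W) a)"] by (intro B.inj1[of i]) auto
    qed
    then show ?thesis using f g by (intro hom_eq2) auto
  qed
  have ex2: "\<exists>\<theta>. R2 \<alpha> \<theta>" if a: "\<alpha> \<in> arr (two W)" for \<alpha>
  proof -
    let ?a = "src (two W) \<alpha>" and ?b = "tgt (two W) \<alpha>"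
    let ?A = "src (one W) ?a" and ?B = "tgt (one W) ?a"
    interpret A: cat_nat_iso K "app0 Y (e ?A)" "app0 H ?A" "\<phi> ?A" using a by (simp add: iso)
    interpret B: cat_nat_iso K "app0 Y (e ?B)" "app0 H ?B" "\<phi> ?B" using a by (simp add: iso)
    interpret h: cat_modif K "app0 H ?A" "app0 H ?B" "app1 H ?a" "app1 H ?b" "app2 H \<alpha>" by (rule H.modif_app2) fact
    interpret ya: cat_nat K "app0 Y (e ?A)" "app0 Y (e ?B)" "app1 Y (F1 ?a)" using Y.nat_app1[of "F1 ?a"] a by simp
    interpret yb: cat_nat K "app0 Y (e ?A)" "app0 Y (e ?B)" "app1 Y (F1 ?b)" using Y.nat_app1[of "F1 ?b"] a by simp
    obtain n where n: "cat_modif K (app0 Y (e ?A)) (app0 H ?B) (tnat_comp K (app1 H ?a) (\<phi> ?A)) (tnat_comp K (app1 H ?b) (\<phi> ?A)) n"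
      "\<And>i x. i \<in> obj (one K) \<Longrightarrow> x \<in> obj (app0 (app0 Y (e ?A)) i) \<Longrightarrow>
        ncmp (mcmp n i) x = ncmp (mcmp (app2 H \<alpha>) i) (fob (tcmp (\<phi> ?A) i) x)"
      using precompose_modif[OF A.cat_nat_axioms h.cat_modif_axioms] by blast
    from n(1) obtain l where l: "cat_modif K (app0 Y (e ?A)) (app0 Y (e ?B)) (app1 Y (F1 ?a)) (app1 Y (F1 ?b)) l"
      "\<And>i x. i \<in> obj (one K) \<Longrightarrow> x \<in> obj (app0 (app0 Y (e ?A)) i) \<Longrightarrow>
        far (tcmp (\<phi> ?B) i) (ncmp (mcmp l i) x) = ncmp (mcmp n i) x"
      by (rule B.lift_modif[OF _ ya.cat_nat_axioms yb.cat_nat_axioms])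
        (use a F1_ob[of ?a] F1_ar[of ?a] F1_ob[of ?b] F1_ar[of ?b] in auto)
    interpret l: cat_modif K "app0 Y (e ?A)" "app0 Y (e ?B)" "app1 Y (F1 ?a)" "app1 Y (F1 ?b)" l by fact
    have "bij_betw (app2 Y) (arr (homcat V (e ?A) (e ?B))) (arr (homcat (CatFun K) (app0 Y (e ?A)) (app0 Y (e ?B))))"
      using ff a by (auto simp: two_fully_faithful_def cat_iso_def)
    moreover have "l \<in> arr (homcat (CatFun K) (app0 Y (e ?A)) (app0 Y (e ?B)))"
      by (simp add: homcat_CatFun l.modif l.mdom ya.tdom ya.tcod)
    ultimately obtain \<theta> where th: "\<theta> \<in> arr (two V)" "src (one V) (src (two V) \<theta>) = e ?A" "tgt (one V) (src (two V) \<theta>) = e ?B" "app2 Y \<theta> = l"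
      by (auto dest!: bij_betw_imp_surj_on[symmetric])
    have "app1 Y (src (two V) \<theta>) = app1 Y (F1 ?a)" "app1 Y (tgt (two V) \<theta>) = app1 Y (F1 ?b)"
      using th Y.two.src_map[of \<theta>] Y.two.tgt_map[of \<theta>] l.mdom l.mcod by auto
    then have "src (two V) \<theta> = F1 ?a" "tgt (two V) \<theta> = F1 ?b"
      using a th by (auto intro!: hom_eq)
    then have "R2 \<alpha> \<theta>" using a th l(2) n(2) by (simp add: R2_def)
    then show ?thesis ..
  qed
  define F2 where "F2 a = (SOME f. R2 a f)" for a
  have F2: "R2 a (F2 a)" if "a \<in> arr (two W)" for a
    unfolding F2_def using ex2[OF that] by (rule someI_ex)
  have F2_eq: "F2 a = f" if "a \<in> arr (two W)" "R2 a f" for a f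
    using uniq2 F2 that by blast
  have F2_map [simp]: "F2 a \<in> arr (two V)" "src (two V) (F2 a) = F1 (src (two W) a)" "tgt (two V) (F2 a) = F1 (tgt (two W) a)"
    if "a \<in> arr (two W)" for a
    using F2[OF that] by (auto simp: R2_def)
  have F2_cmp: "far (tcmp (\<phi> (tgt (one W) (src (two W) \<alpha>))) i) (ncmp (mcmp (app2 Y (F2 \<alpha>)) i) x) =
      ncmp (mcmp (app2 H \<alpha>) i) (fob (tcmp (\<phi> (src (one W) (src (two W) \<alpha>))) i) x)"
    if "\<alpha> \<in> arr (two W)" "i \<in> obj (one K)" "x \<in> obj (app0 (app0 Y (e (src (one W) (src (two W) \<alpha>)))) i)" for \<alpha> i x
    using F2[OF that(1)] that(2,3) by (auto simp: R2_def)
  note cc = cat_nat.cfun_cmp[OF cat_nat_iso.axioms(1)[OF iso]]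
  \<comment> \<open>Each law from here on holds since its right-hand side satisfies the relation
    that characterises its left-hand side.\<close>
  have F1_idt: "F1 (idt (one W) A) = idt (one V) (e A)" if "A \<in> obj (one W)" for A
    using that by (intro F1_eq) (auto simp: R1_def)
  have F1_cmp: "F1 (b \<cdot>\<^bsub>one W\<^esub> a) = F1 b \<cdot>\<^bsub>one V\<^esub> F1 a"
    if "a \<in> arr (one W)" "b \<in> arr (one W)" "src (one W) b = tgt (one W) a" for a b
    using that F1_ob[of b] F1_ob[of a] F1_ar[of b] F1_ar[of a]
    by (intro F1_eq) (auto simp: R1_def Y.elem_cmp H.elem_cmp)
  have F2_idt: "F2 (idt (two W) a) = idt (two V) (F1 a)" if "a \<in> arr (one W)" for a
    using that F1_ob[of a] by (intro F2_eq) (auto simp: R2_def Y.elem_idt2 H.elem_idt2 cc)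
  have F2_vcmp: "F2 (\<beta> \<cdot>\<^bsub>two W\<^esub> \<alpha>) = F2 \<beta> \<cdot>\<^bsub>two V\<^esub> F2 \<alpha>"
    if "\<alpha> \<in> arr (two W)" "\<beta> \<in> arr (two W)" "src (two W) \<beta> = tgt (two W) \<alpha>" for \<alpha> \<beta>
    using that F2_cmp[of \<alpha>] F2_cmp[of \<beta>] by (intro F2_eq) (auto simp: R2_def Y.elem_vcmp H.elem_vcmp cc)
  have F2_hcmp: "F2 (\<beta> \<star>\<^bsub>W\<^esub> \<alpha>) = F2 \<beta> \<star>\<^bsub>V\<^esub> F2 \<alpha>"
    if "\<alpha> \<in> arr (two W)" "\<beta> \<in> arr (two W)" "src (one W) (src (two W) \<beta>) = tgt (one W) (src (two W) \<alpha>)" for \<alpha> \<beta>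
    using that F2_cmp[of \<alpha>] F2_cmp[of \<beta>] F1_ob[of "tgt (two W) \<alpha>"] F1_ar[of "src (two W) \<beta>"]
    by (intro F2_eq) (auto simp: R2_def Y.elem_hcmp H.elem_hcmp cc F1_cmp)
  define E where "E = \<lparr>app0 = e, app1 = F1, app2 = F2\<rparr>"
  have E: "two_functor W V E"
    by (intro two_functorI is_functorI W)
      (auto simp: E_def F1_idt F1_cmp F2_idt F2_vcmp F2_hcmp H.W.obj_two Y.W.obj_two)
  have "cat_functor W K (twofun_comp Y E)"
    using two_functor_comp[OF W V E Y.two_functor_axioms] by (intro cat_functor.intro W K)
  then have "cat_functor_iso W K (twofun_comp Y E) H \<phi>"
    by (intro cat_functor_iso.intro cat_functor_iso_axioms.intro H)
      (auto simp: twofun_comp_def E_def iso F1_ob F1_ar F2_cmp)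
  with E show ?thesis by blast
qed

text \<open>Counterpart of \<open>two_functor_CatI\<close> one level up: by extensionality of
  transformations and modifications, the laws of a 2-functor into \<open>CatFun K\<close> reduce to
  equations at each stage and element.\<close>

lemma two_functor_CatFunI:
  assumes W: "two_category W" and K: "two_category K"
    and ob: "\<And>A. A \<in> obj (one W) \<Longrightarrow> two_functor K Cat (app0 G A)"
    and nat: "\<And>a. a \<in> arr (one W) \<Longrightarrow> is_tnat K (app1 G a) \<and> tdom (app1 G a) = app0 G (src (one W) a) \<and>
      tcod (app1 G a) = app0 G (tgt (one W) a)"
    and mod: "\<And>\<alpha>. \<alpha> \<in> arr (two W) \<Longrightarrow> is_modif K (app2 G \<alpha>) \<and> mdom (app2 G \<alpha>) = app1 G (src (two W) \<alpha>) \<and>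
      mcod (app2 G \<alpha>) = app1 G (tgt (two W) \<alpha>)"
    and idt0: "\<And>A i x. A \<in> obj (one W) \<Longrightarrow> i \<in> obj (one K) \<Longrightarrow> x \<in> obj (app0 (app0 G A) i) \<Longrightarrow>
      fob (tcmp (app1 G (idt (one W) A)) i) x = x"
    and idt1: "\<And>A i f. A \<in> obj (one W) \<Longrightarrow> i \<in> obj (one K) \<Longrightarrow> f \<in> arr (app0 (app0 G A) i) \<Longrightarrow>
      far (tcmp (app1 G (idt (one W) A)) i) f = f"
    and cmp0: "\<And>a b i x. a \<in> arr (one W) \<Longrightarrow> b \<in> arr (one W) \<Longrightarrow> src (one W) b = tgt (one W) a \<Longrightarrow>
      i \<in> obj (one K) \<Longrightarrow> x \<in> obj (app0 (app0 G (src (one W) a)) i) \<Longrightarrow>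
      fob (tcmp (app1 G (b \<cdot>\<^bsub>one W\<^esub> a)) i) x = fob (tcmp (app1 G b) i) (fob (tcmp (app1 G a) i) x)"
    and cmp1: "\<And>a b i f. a \<in> arr (one W) \<Longrightarrow> b \<in> arr (one W) \<Longrightarrow> src (one W) b = tgt (one W) a \<Longrightarrow>
      i \<in> obj (one K) \<Longrightarrow> f \<in> arr (app0 (app0 G (src (one W) a)) i) \<Longrightarrow>
      far (tcmp (app1 G (b \<cdot>\<^bsub>one W\<^esub> a)) i) f = far (tcmp (app1 G b) i) (far (tcmp (app1 G a) i) f)"
    and idt2: "\<And>a i x. a \<in> arr (one W) \<Longrightarrow> i \<in> obj (one K) \<Longrightarrow> x \<in> obj (app0 (app0 G (src (one W) a)) i) \<Longrightarrow>
      ncmp (mcmp (app2 G (idt (two W) a)) i) x =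
      idt (app0 (app0 G (tgt (one W) a)) i) (fob (tcmp (app1 G a) i) x)"
    and vcmp: "\<And>\<alpha> \<beta> i x. \<alpha> \<in> arr (two W) \<Longrightarrow> \<beta> \<in> arr (two W) \<Longrightarrow> src (two W) \<beta> = tgt (two W) \<alpha> \<Longrightarrow>
      i \<in> obj (one K) \<Longrightarrow> x \<in> obj (app0 (app0 G (src (one W) (src (two W) \<alpha>))) i) \<Longrightarrow>
      ncmp (mcmp (app2 G (\<beta> \<cdot>\<^bsub>two W\<^esub> \<alpha>)) i) x =
      ncmp (mcmp (app2 G \<beta>) i) x \<cdot>\<^bsub>app0 (app0 G (tgt (one W) (src (two W) \<alpha>))) i\<^esub> ncmp (mcmp (app2 G \<alpha>) i) x"
    and hcmp: "\<And>\<alpha> \<beta> i x. \<alpha> \<in> arr (two W) \<Longrightarrow> \<beta> \<in> arr (two W) \<Longrightarrow>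
      src (one W) (src (two W) \<beta>) = tgt (one W) (src (two W) \<alpha>) \<Longrightarrow>
      i \<in> obj (one K) \<Longrightarrow> x \<in> obj (app0 (app0 G (src (one W) (src (two W) \<alpha>))) i) \<Longrightarrow>
      ncmp (mcmp (app2 G (\<beta> \<star>\<^bsub>W\<^esub> \<alpha>)) i) x =
      ncmp (mcmp (app2 G \<beta>) i) (fob (tcmp (app1 G (tgt (two W) \<alpha>)) i) x)
        \<cdot>\<^bsub>app0 (app0 G (tgt (one W) (src (two W) \<beta>))) i\<^esub>
      far (tcmp (app1 G (src (two W) \<beta>)) i) (ncmp (mcmp (app2 G \<alpha>) i) x)"
  shows "two_functor W (CatFun K) G"
proof -
  interpret W: two_category W by fact
  have n: "cat_nat K (app0 G (src (one W) a)) (app0 G (tgt (one W) a)) (app1 G a)" if "a \<in> arr (one W)" for a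
    using nat[OF that] by (intro cat_natI K) auto
  have m: "cat_modif K (app0 G (src (one W) (src (two W) \<alpha>))) (app0 G (tgt (one W) (src (two W) \<alpha>)))
      (app1 G (src (two W) \<alpha>)) (app1 G (tgt (two W) \<alpha>)) (app2 G \<alpha>)" if "\<alpha> \<in> arr (two W)" for \<alpha>
    using mod[OF that] nat[of "src (two W) \<alpha>"] that by (intro cat_modifI K) auto
  note cf [simp] = cat_nat.cfun[OF n] and cn [simp] = cat_modif.cnat[OF m]
  have ce: "ncmp (mcmp (app2 G \<alpha>) i) \<in> extensional (obj (app0 (app0 G (src (one W) (src (two W) \<alpha>))) i))"
    if "\<alpha> \<in> arr (two W)" "i \<in> obj (one K)" for \<alpha> i
    using cn(1)[OF that] that by (auto simp: is_cnat_def)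
  have me: "mcmp (app2 G \<alpha>) \<in> extensional (obj (one K))" if "\<alpha> \<in> arr (two W)" for \<alpha>
    using mod[OF that] by (auto simp: is_modif_def)
  have idt: "app1 G (idt (one W) A) = tnat_id K (app0 G A)" if "A \<in> obj (one W)" for A
    using that nat[of "idt (one W) A"] cat_valued.category[OF cat_valuedI[OF K ob]]
    by (intro tnat_eqI) (auto simp: is_tnat_id K ob idt0 idt1)
  have cmp: "app1 G (b \<cdot>\<^bsub>one W\<^esub> a) = tnat_comp K (app1 G b) (app1 G a)"
    if "a \<in> arr (one W)" "b \<in> arr (one W)" "src (one W) b = tgt (one W) a" for a b
    using that by (intro tnat_eqI[of K]) (auto simp: nat cmp0 cmp1 is_tnat_comp K)
  have c: "cfun_comp (tcmp (app1 G b) i) (tcmp (app1 G a) i) = tcmp (app1 G (b \<cdot>\<^bsub>one W\<^esub> a)) i"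
    if "a \<in> arr (one W)" "b \<in> arr (one W)" "src (one W) b = tgt (one W) a" "i \<in> obj (one K)" for a b i
    using that by (simp add: cmp)
  show ?thesis
  proof (intro two_functorI W is_functorI)
    fix a assume "a \<in> obj (two W)"
    then have a: "a \<in> arr (one W)" by (simp add: W.obj_two)
    have "app2 G (idt (two W) a) = modif_id K (app1 G a)"
    proof (rule modif.equality)
      show "mcmp (app2 G (idt (two W) a)) = mcmp (modif_id K (app1 G a))"
      proof (rule extensionalityI)
        fix i assume "i \<in> obj (one K)"
        then show "mcmp (app2 G (idt (two W) a)) i = mcmp (modif_id K (app1 G a)) i"
          using a by (intro cnat_eqI) (auto simp: idt2)
      qed (use a me in \<open>auto simp: modif_id_def\<close>)
    qed (use a mod in auto)
    then show "app2 G (idt (two W) a) = idt (two (CatFun K)) (app1 G a)" by simp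
  next
    fix \<alpha> \<beta> assume a: "\<alpha> \<in> arr (two W)" "\<beta> \<in> arr (two W)" "src (two W) \<beta> = tgt (two W) \<alpha>"
    have "app2 G (\<beta> \<cdot>\<^bsub>two W\<^esub> \<alpha>) = modif_vcomp K (app2 G \<beta>) (app2 G \<alpha>)"
    proof (rule modif.equality)
      show "mcmp (app2 G (\<beta> \<cdot>\<^bsub>two W\<^esub> \<alpha>)) = mcmp (modif_vcomp K (app2 G \<beta>) (app2 G \<alpha>))"
      proof (rule extensionalityI)
        fix i assume "i \<in> obj (one K)"
        then show "mcmp (app2 G (\<beta> \<cdot>\<^bsub>two W\<^esub> \<alpha>)) i = mcmp (modif_vcomp K (app2 G \<beta>) (app2 G \<alpha>)) i"
          using a by (intro cnat_eqI) (auto simp: vcmp)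
      qed (use a me in \<open>auto simp: modif_vcomp_def\<close>)
    qed (use a mod in auto)
    then show "app2 G (\<beta> \<cdot>\<^bsub>two W\<^esub> \<alpha>) = app2 G \<beta> \<cdot>\<^bsub>two (CatFun K)\<^esub> app2 G \<alpha>" by simp
  next
    fix \<alpha> \<beta> assume a: "\<alpha> \<in> arr (two W)" "\<beta> \<in> arr (two W)" "src (one W) (src (two W) \<beta>) = tgt (one W) (src (two W) \<alpha>)"
    have "app2 G (\<beta> \<star>\<^bsub>W\<^esub> \<alpha>) = modif_hcomp K (app2 G \<beta>) (app2 G \<alpha>)"
    proof (rule modif.equality)
      show "mcmp (app2 G (\<beta> \<star>\<^bsub>W\<^esub> \<alpha>)) = mcmp (modif_hcomp K (app2 G \<beta>) (app2 G \<alpha>))"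
      proof (rule extensionalityI)
        fix i assume i: "i \<in> obj (one K)"
        show "mcmp (app2 G (\<beta> \<star>\<^bsub>W\<^esub> \<alpha>)) i = mcmp (modif_hcomp K (app2 G \<beta>) (app2 G \<alpha>)) i"
        \<comment> \<open>Again field by field, as the horizontal composite is not yet known to be
          natural.\<close>
        proof (rule cnat.equality)
          show "ncmp (mcmp (app2 G (\<beta> \<star>\<^bsub>W\<^esub> \<alpha>)) i) = ncmp (mcmp (modif_hcomp K (app2 G \<beta>) (app2 G \<alpha>)) i)"
            by (rule extensionalityI[where A = "obj (app0 (app0 G (src (one W) (src (two W) \<alpha>))) i)"])
              (use a i ce[of "\<beta> \<star>\<^bsub>W\<^esub> \<alpha>" i] in \<open>auto simp: hcmp\<close>, simp add: cnat_hcomp_def)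
        qed (use a i in \<open>auto simp: c\<close>)
      qed (use a me in \<open>auto simp: modif_hcomp_def\<close>)
    qed (use a mod in \<open>auto simp: cmp\<close>)
    then show "app2 G (\<beta> \<star>\<^bsub>W\<^esub> \<alpha>) = app2 G \<beta> \<star>\<^bsub>CatFun K\<^esub> app2 G \<alpha>" by simp
  qed (use nat mod ob idt cmp in \<open>auto simp: W.obj_two\<close>)
qed

section \<open>Nerves\<close>

context two_category
begin

text \<open>Interchange with identities inserted: a horizontal composite is a vertical composite of
  whiskerings in either order. That the two orders agree is the naturality of
  \<open>hom_post2\<close>.\<close>

lemma whisker_left: "\<alpha> \<in> arr (two K) \<Longrightarrow> \<beta> \<in> arr (two K) \<Longrightarrow>
    src (one K) (src (two K) \<beta>) = tgt (one K) (src (two K) \<alpha>) \<Longrightarrow>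
    (idt (two K) (tgt (two K) \<beta>) \<star>\<^bsub>K\<^esub> \<alpha>) \<cdot>\<^bsub>two K\<^esub> (\<beta> \<star>\<^bsub>K\<^esub> idt (two K) (src (two K) \<alpha>)) = \<beta> \<star>\<^bsub>K\<^esub> \<alpha>"
  by (subst exchange[symmetric]) auto

lemma whisker_right: "\<alpha> \<in> arr (two K) \<Longrightarrow> \<beta> \<in> arr (two K) \<Longrightarrow>
    src (one K) (src (two K) \<beta>) = tgt (one K) (src (two K) \<alpha>) \<Longrightarrow>
    (\<beta> \<star>\<^bsub>K\<^esub> idt (two K) (tgt (two K) \<alpha>)) \<cdot>\<^bsub>two K\<^esub> (idt (two K) (src (two K) \<beta>) \<star>\<^bsub>K\<^esub> \<alpha>) = \<beta> \<star>\<^bsub>K\<^esub> \<alpha>"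
  by (subst exchange[symmetric]) auto

lemma idt_hcmp_vcmp: "g \<in> arr (one K) \<Longrightarrow> \<alpha> \<in> arr (two K) \<Longrightarrow> \<alpha>' \<in> arr (two K) \<Longrightarrow> src (two K) \<alpha>' = tgt (two K) \<alpha> \<Longrightarrow>
    src (one K) g = tgt (one K) (src (two K) \<alpha>) \<Longrightarrow>
    idt (two K) g \<star>\<^bsub>K\<^esub> (\<alpha>' \<cdot>\<^bsub>two K\<^esub> \<alpha>) = (idt (two K) g \<star>\<^bsub>K\<^esub> \<alpha>') \<cdot>\<^bsub>two K\<^esub> (idt (two K) g \<star>\<^bsub>K\<^esub> \<alpha>)"
  by (subst exchange[symmetric]) auto

lemma vcmp_hcmp_idt: "f \<in> arr (one K) \<Longrightarrow> \<beta> \<in> arr (two K) \<Longrightarrow> \<beta>' \<in> arr (two K) \<Longrightarrow> src (two K) \<beta>' = tgt (two K) \<beta> \<Longrightarrow>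
    src (one K) (src (two K) \<beta>) = tgt (one K) f \<Longrightarrow>
    (\<beta>' \<cdot>\<^bsub>two K\<^esub> \<beta>) \<star>\<^bsub>K\<^esub> idt (two K) f = (\<beta>' \<star>\<^bsub>K\<^esub> idt (two K) f) \<cdot>\<^bsub>two K\<^esub> (\<beta> \<star>\<^bsub>K\<^esub> idt (two K) f)"
  by (subst exchange[symmetric]) auto

end

lemma hom_pre_simps [simp]:
  "fdom (hom_pre W A f) = homcat W (tgt (one W) f) A" "fcod (hom_pre W A f) = homcat W (src (one W) f) A"
  "g \<in> obj (homcat W (tgt (one W) f) A) \<Longrightarrow> fob (hom_pre W A f) g = g \<cdot>\<^bsub>one W\<^esub> f"
  "\<gamma> \<in> arr (homcat W (tgt (one W) f) A) \<Longrightarrow> far (hom_pre W A f) \<gamma> = \<gamma> \<star>\<^bsub>W\<^esub> idt (two W) f"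
  "ndom (hom_pre2 W A \<theta>) = hom_pre W A (src (two W) \<theta>)" "ncod (hom_pre2 W A \<theta>) = hom_pre W A (tgt (two W) \<theta>)"
  "g \<in> obj (homcat W (tgt (one W) (src (two W) \<theta>)) A) \<Longrightarrow> ncmp (hom_pre2 W A \<theta>) g = idt (two W) g \<star>\<^bsub>W\<^esub> \<theta>"
  by (simp_all add: hom_pre_def hom_pre2_def)

lemma hom_post_simps [simp]:
  "fdom (hom_post W X a) = homcat W X (src (one W) a)" "fcod (hom_post W X a) = homcat W X (tgt (one W) a)"
  "g \<in> obj (homcat W X (src (one W) a)) \<Longrightarrow> fob (hom_post W X a) g = a \<cdot>\<^bsub>one W\<^esub> g"
  "\<gamma> \<in> arr (homcat W X (src (one W) a)) \<Longrightarrow> far (hom_post W X a) \<gamma> = idt (two W) a \<star>\<^bsub>W\<^esub> \<gamma>"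
  "ndom (hom_post2 W X \<alpha>) = hom_post W X (src (two W) \<alpha>)" "ncod (hom_post2 W X \<alpha>) = hom_post W X (tgt (two W) \<alpha>)"
  "g \<in> obj (homcat W X (src (one W) (src (two W) \<alpha>))) \<Longrightarrow> ncmp (hom_post2 W X \<alpha>) g = \<alpha> \<star>\<^bsub>W\<^esub> idt (two W) g"
  by (simp_all add: hom_post_def hom_post2_def)

context two_category
begin

lemma is_cfun_hom_post [simp]: 
  assumes [simp]: "a \<in> arr (one K)"
  shows "is_cfun (hom_post K X a)"
proof -
  note [simp] = two_category_axioms
  interpret S: category "homcat K X (src (one K) a)" by (rule homcat_category)
  show ?thesis
  proof (intro is_cfunI is_functorI)
    fix \<gamma> \<delta> assume *: "\<gamma> \<in> arr (fdom (hom_post K X a))" "\<delta> \<in> arr (fdom (hom_post K X a))"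
      "src (fdom (hom_post K X a)) \<delta> = tgt (fdom (hom_post K X a)) \<gamma>"
    then show "far (hom_post K X a) (\<delta> \<cdot>\<^bsub>fdom (hom_post K X a)\<^esub> \<gamma>) =
      far (hom_post K X a) \<delta> \<cdot>\<^bsub>fcod (hom_post K X a)\<^esub> far (hom_post K X a) \<gamma>"
      using idt_hcmp_vcmp[of a \<gamma> \<delta>] S.cmp_arr[of \<gamma> \<delta>] by simp
  qed (simp_all add: homcat_category idt_hcmp_idt, simp_all add: hom_post_def)
qed

text \<open>Precomposition in \<open>K\<close> is postcomposition in the opposite 2-category, so
  functoriality and naturality are proved once only.\<close>

lemma hom_pre_op: "hom_pre K A f = hom_post (op_twocat K) A f"
  "hom_pre2 K A \<theta> = hom_post2 (op_twocat K) A \<theta>"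
  by (simp_all add: hom_pre_def hom_post_def hom_pre2_def hom_post2_def homcat_op)

lemma is_cfun_hom_pre [simp]: "f \<in> arr (one K) \<Longrightarrow> is_cfun (hom_pre K A f)"
  using two_category.is_cfun_hom_post[OF two_category_op[OF two_category_axioms]] by (simp add: hom_pre_op)

lemma is_cnat_hom_post2 [simp]:
  assumes [simp]: "\<alpha> \<in> arr (two K)"
  shows "is_cnat (hom_post2 K X \<alpha>)"
proof -
  note [simp] = two_category_axioms
  show ?thesis
  proof (rule is_cnatI)
    fix \<gamma> assume "\<gamma> \<in> arr (fdom (ndom (hom_post2 K X \<alpha>)))"
    then show "ncmp (hom_post2 K X \<alpha>) (tgt (fdom (ndom (hom_post2 K X \<alpha>))) \<gamma>) \<cdot>\<^bsub>fcod (ndom (hom_post2 K X \<alpha>))\<^esub>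
       far (ndom (hom_post2 K X \<alpha>)) \<gamma> =
       far (ncod (hom_post2 K X \<alpha>)) \<gamma> \<cdot>\<^bsub>fcod (ndom (hom_post2 K X \<alpha>))\<^esub>
       ncmp (hom_post2 K X \<alpha>) (src (fdom (ndom (hom_post2 K X \<alpha>))) \<gamma>)"
      using whisker_left[of \<gamma> \<alpha>] whisker_right[of \<gamma> \<alpha>] by simp
  qed (simp_all, simp_all add: hom_post2_def)
qed

lemma is_cnat_hom_pre2 [simp]: "\<theta> \<in> arr (two K) \<Longrightarrow> is_cnat (hom_pre2 K A \<theta>)"
  using two_category.is_cnat_hom_post2[OF two_category_op[OF two_category_axioms]] by (simp add: hom_pre_op)

end

lemma nerve0_simps [simp]:
  "app0 (nerve0 W H A) X = homcat W (app0 H X) A"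
  "app1 (nerve0 W H A) f = hom_pre W A (app1 H f)"
  "app2 (nerve0 W H A) \<theta> = hom_pre2 W A (app2 H \<theta>)"
  by (simp_all add: nerve0_def)

lemma two_functor_nerve0:
  assumes D: "two_category D" and W: "two_category W" and H: "two_functor D W H" and A: "A \<in> obj (one W)"
  shows "two_functor (op_twocat D) Cat (nerve0 W H A)"
proof -
  interpret D: two_category D by fact
  interpret W: two_category W by fact
  interpret H: two_functor D W H by fact
  note [simp] = D W A
  show ?thesis
  proof (rule two_functor_CatI)
    fix u v g assume "u \<in> arr (one (op_twocat D))" "v \<in> arr (one (op_twocat D))"
      "src (one (op_twocat D)) v = tgt (one (op_twocat D)) u"
      "g \<in> arr (app0 (nerve0 W H A) (src (one (op_twocat D)) u))"
    then show "far (app1 (nerve0 W H A) (v \<cdot>\<^bsub>one (op_twocat D)\<^esub> u)) g =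
      far (app1 (nerve0 W H A) v) (far (app1 (nerve0 W H A) u) g)"
      using W.hassoc[of "idt (two W) (app1 H v)" "idt (two W) (app1 H u)" g] by (simp add: H.one.cmp W.idt_hcmp_idt)
  next
    fix \<theta> \<eta> g assume *: "\<theta> \<in> arr (two (op_twocat D))" "\<eta> \<in> arr (two (op_twocat D))"
      "src (one (op_twocat D)) (src (two (op_twocat D)) \<eta>) = tgt (one (op_twocat D)) (src (two (op_twocat D)) \<theta>)"
      "g \<in> obj (app0 (nerve0 W H A) (src (one (op_twocat D)) (src (two (op_twocat D)) \<theta>)))"
    then show "ncmp (app2 (nerve0 W H A) (\<eta> \<star>\<^bsub>op_twocat D\<^esub> \<theta>)) g =
      ncmp (app2 (nerve0 W H A) \<eta>) (fob (app1 (nerve0 W H A) (tgt (two (op_twocat D)) \<theta>)) g)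
        \<cdot>\<^bsub>app0 (nerve0 W H A) (tgt (one (op_twocat D)) (src (two (op_twocat D)) \<eta>))\<^esub>
      far (app1 (nerve0 W H A) (src (two (op_twocat D)) \<eta>)) (ncmp (app2 (nerve0 W H A) \<theta>) g)"
      \<comment> \<open>\<open>cnat_hcomp\<close> expands into whiskerings in a fixed order;
        \<open>whisker_left\<close> recombines them into the horizontal composite.\<close>
      using W.whisker_left[of "app2 H \<eta>" "idt (two W) g \<star>\<^bsub>W\<^esub> app2 H \<theta>"]
        W.hassoc[of "app2 H \<eta>" "app2 H \<theta>" "idt (two W) g"]
      by (simp add: H.hcmp)
  next
    fix \<theta> \<eta> g assume *: "\<theta> \<in> arr (two (op_twocat D))" "\<eta> \<in> arr (two (op_twocat D))"
      "src (two (op_twocat D)) \<eta> = tgt (two (op_twocat D)) \<theta>"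
      "g \<in> obj (app0 (nerve0 W H A) (src (one (op_twocat D)) (src (two (op_twocat D)) \<theta>)))"
    then show "ncmp (app2 (nerve0 W H A) (\<eta> \<cdot>\<^bsub>two (op_twocat D)\<^esub> \<theta>)) g =
      ncmp (app2 (nerve0 W H A) \<eta>) g
        \<cdot>\<^bsub>app0 (nerve0 W H A) (tgt (one (op_twocat D)) (src (two (op_twocat D)) \<theta>))\<^esub>
      ncmp (app2 (nerve0 W H A) \<theta>) g"
      using W.idt_hcmp_vcmp[of g "app2 H \<theta>" "app2 H \<eta>"] by (simp add: H.two.cmp)
  qed (auto simp: two_category_op W.homcat_category H.one.map_idt H.one.cmp H.two.map_idt D.obj_two W.one.assoc
      W.idt_hcmp_idt)
qed

lemma nerve1_simps [simp]:
  "tdom (nerve1 D W H a) = nerve0 W H (src (one W) a)" "tcod (nerve1 D W H a) = nerve0 W H (tgt (one W) a)"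
  "X \<in> obj (one D) \<Longrightarrow> tcmp (nerve1 D W H a) X = hom_post W (app0 H X) a"
  "mdom (nerve2 D W H \<alpha>) = nerve1 D W H (src (two W) \<alpha>)" "mcod (nerve2 D W H \<alpha>) = nerve1 D W H (tgt (two W) \<alpha>)"
  "X \<in> obj (one D) \<Longrightarrow> mcmp (nerve2 D W H \<alpha>) X = hom_post2 W (app0 H X) \<alpha>"
  by (simp_all add: nerve1_def nerve2_def)

lemma is_tnat_nerve1:
  assumes D: "two_category D" and W: "two_category W" and H: "two_functor D W H" and a: "a \<in> arr (one W)"
  shows "is_tnat (op_twocat D) (nerve1 D W H a)"
proof -
  interpret D: two_category D by fact
  interpret W: two_category W by fact
  interpret H: two_functor D W H by fact
  note [simp] = D W a
  show ?thesis
  proof (rule is_tnatI)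
    fix u g assume "u \<in> arr (one (op_twocat D))" "g \<in> arr (app0 (tdom (nerve1 D W H a)) (src (one (op_twocat D)) u))"
    then show "far (tcmp (nerve1 D W H a) (tgt (one (op_twocat D)) u)) (far (app1 (tdom (nerve1 D W H a)) u) g) =
      far (app1 (tcod (nerve1 D W H a)) u) (far (tcmp (nerve1 D W H a) (src (one (op_twocat D)) u)) g)"
      using W.hassoc[of "idt (two W) (app1 H u)" g "idt (two W) a"] by simp
  next
    fix \<theta> g assume "\<theta> \<in> arr (two (op_twocat D))"
      "g \<in> obj (app0 (tdom (nerve1 D W H a)) (src (one (op_twocat D)) (src (two (op_twocat D)) \<theta>)))"
    then show "far (tcmp (nerve1 D W H a) (tgt (one (op_twocat D)) (src (two (op_twocat D)) \<theta>)))
         (ncmp (app2 (tdom (nerve1 D W H a)) \<theta>) g) =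
        ncmp (app2 (tcod (nerve1 D W H a)) \<theta>)
         (fob (tcmp (nerve1 D W H a) (src (one (op_twocat D)) (src (two (op_twocat D)) \<theta>))) g)"
      using W.hassoc[of "app2 H \<theta>" "idt (two W) g" "idt (two W) a"] by (simp add: W.idt_hcmp_idt)
  qed (auto simp: two_category_op two_functor_nerve0[OF D W H] W.one.assoc, simp add: nerve1_def)
qed

lemma is_modif_nerve2:
  assumes D: "two_category D" and W: "two_category W" and H: "two_functor D W H" and a: "\<alpha> \<in> arr (two W)"
  shows "is_modif (op_twocat D) (nerve2 D W H \<alpha>)"
proof -
  interpret D: two_category D by fact
  interpret W: two_category W by fact
  interpret H: two_functor D W H by fact
  note [simp] = D W a
  show ?thesis
  proof (rule is_modifI)
    fix u g assume "u \<in> arr (one (op_twocat D))"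
      "g \<in> obj (app0 (tdom (mdom (nerve2 D W H \<alpha>))) (src (one (op_twocat D)) u))"
    then show "ncmp (mcmp (nerve2 D W H \<alpha>) (tgt (one (op_twocat D)) u)) (fob (app1 (tdom (mdom (nerve2 D W H \<alpha>))) u) g) =
        far (app1 (tcod (mdom (nerve2 D W H \<alpha>))) u)
          (ncmp (mcmp (nerve2 D W H \<alpha>) (src (one (op_twocat D)) u)) g)"
      using W.hassoc[of "idt (two W) (app1 H u)" "idt (two W) g" \<alpha>] by (simp add: W.idt_hcmp_idt)
  qed (auto simp: two_category_op is_tnat_nerve1[OF D W H], simp add: nerve2_def)
qed

lemma nerve_simps [simp]: "app0 (nerve D W H) = nerve0 W H" "app1 (nerve D W H) = nerve1 D W H"
  "app2 (nerve D W H) = nerve2 D W H"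
  by (simp_all add: nerve_def)

lemma cat_functor_nerve:
  assumes D: "two_category D" and W: "two_category W" and H: "two_functor D W H"
  shows "cat_functor W (op_twocat D) (nerve D W H)"
proof -
  interpret D: two_category D by fact
  interpret W: two_category W by fact
  interpret H: two_functor D W H by fact
  note [simp] = D W
  have "two_functor W (CatFun (op_twocat D)) (nerve D W H)"
  proof (rule two_functor_CatFunI)
    fix a b i f assume "a \<in> arr (one W)" "b \<in> arr (one W)" "src (one W) b = tgt (one W) a" "i \<in> obj (one (op_twocat D))"
      "f \<in> arr (app0 (app0 (nerve D W H) (src (one W) a)) i)"
    then show "far (tcmp (app1 (nerve D W H) (b \<cdot>\<^bsub>one W\<^esub> a)) i) f =
       far (tcmp (app1 (nerve D W H) b) i) (far (tcmp (app1 (nerve D W H) a) i) f)"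
      using W.hassoc[of f "idt (two W) a" "idt (two W) b"] by (simp add: W.idt_hcmp_idt)
  next
    fix \<alpha> \<beta> i x assume "\<alpha> \<in> arr (two W)" "\<beta> \<in> arr (two W)" "src (two W) \<beta> = tgt (two W) \<alpha>"
       "i \<in> obj (one (op_twocat D))"
       "x \<in> obj (app0 (app0 (nerve D W H) (src (one W) (src (two W) \<alpha>))) i)"
    then show "ncmp (mcmp (app2 (nerve D W H) (\<beta> \<cdot>\<^bsub>two W\<^esub> \<alpha>)) i) x =
       ncmp (mcmp (app2 (nerve D W H) \<beta>) i) x \<cdot>\<^bsub>app0 (app0 (nerve D W H) (tgt (one W) (src (two W) \<alpha>))) i\<^esub>
       ncmp (mcmp (app2 (nerve D W H) \<alpha>) i) x"
      using W.vcmp_hcmp_idt[of x \<alpha> \<beta>] by simp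
  next
    fix \<alpha> \<beta> i x assume "\<alpha> \<in> arr (two W)" "\<beta> \<in> arr (two W)" "src (one W) (src (two W) \<beta>) = tgt (one W) (src (two W) \<alpha>)"
       "i \<in> obj (one (op_twocat D))"
       "x \<in> obj (app0 (app0 (nerve D W H) (src (one W) (src (two W) \<alpha>))) i)"
    then show "ncmp (mcmp (app2 (nerve D W H) (\<beta> \<star>\<^bsub>W\<^esub> \<alpha>)) i) x =
      ncmp (mcmp (app2 (nerve D W H) \<beta>) i) (fob (tcmp (app1 (nerve D W H) (tgt (two W) \<alpha>)) i) x)
        \<cdot>\<^bsub>app0 (app0 (nerve D W H) (tgt (one W) (src (two W) \<beta>))) i\<^esub>
      far (tcmp (app1 (nerve D W H) (src (two W) \<beta>)) i) (ncmp (mcmp (app2 (nerve D W H) \<alpha>) i) x)"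
      using W.whisker_right[of "\<alpha> \<star>\<^bsub>W\<^esub> idt (two W) x" \<beta>] W.hassoc[of "idt (two W) x" \<alpha> \<beta>] by simp
  qed (auto simp: two_category_op two_functor_nerve0[OF D W H] is_tnat_nerve1[OF D W H] is_modif_nerve2[OF D W H]
      W.one.assoc W.idt_hcmp_idt)
  then show ?thesis by (intro cat_functor.intro W two_category_op D)
qed

section \<open>Internal categories\<close>

lemma is_pullbackD:
  assumes "is_pullback C f g p q"
  shows "f \<in> arr C" "g \<in> arr C" "tgt C g = tgt C f" "p \<in> arr C" "q \<in> arr C" "src C q = src C p"
    "tgt C p = src C f" "tgt C q = src C g" "f \<cdot>\<^bsub>C\<^esub> p = g \<cdot>\<^bsub>C\<^esub> q"
    "X \<in> obj C \<Longrightarrow> h \<in> hom C X (src C f) \<Longrightarrow> k \<in> hom C X (src C g) \<Longrightarrow> f \<cdot>\<^bsub>C\<^esub> h = g \<cdot>\<^bsub>C\<^esub> k \<Longrightarrow>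
      \<exists>!v. v \<in> hom C X (src C p) \<and> p \<cdot>\<^bsub>C\<^esub> v = h \<and> q \<cdot>\<^bsub>C\<^esub> v = k"
  using assms unfolding is_pullback_def by metis+

section \<open>Pullbacks and generalised elements\<close>

context category
begin

text \<open>Both arrows induce the same cone, so uniqueness in the universal property applies: the
  projections are jointly monic.\<close>

lemma pullback_eqI:
  assumes "is_pullback C f g p q" "v \<in> arr C" "w \<in> arr C" "src C v = src C w" "tgt C v = src C p" "tgt C w = src C p"
    and "p \<cdot>\<^bsub>C\<^esub> v = p \<cdot>\<^bsub>C\<^esub> w" "q \<cdot>\<^bsub>C\<^esub> v = q \<cdot>\<^bsub>C\<^esub> w"
  shows "v = w"
proof -
  note pb = is_pullbackD[OF assms(1)]
  have "f \<cdot>\<^bsub>C\<^esub> (p \<cdot>\<^bsub>C\<^esub> v) = g \<cdot>\<^bsub>C\<^esub> (q \<cdot>\<^bsub>C\<^esub> v)"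
    using pb(1-9) assms(2-) by (simp add: assoc[symmetric])
  then have "\<exists>!v. v \<in> hom C (src C w) (src C p) \<and> p \<cdot>\<^bsub>C\<^esub> v = p \<cdot>\<^bsub>C\<^esub> w \<and> q \<cdot>\<^bsub>C\<^esub> v = q \<cdot>\<^bsub>C\<^esub> w"
    using pb(1-9) assms(2-) by (intro pb(10)) (auto simp: hom_iff)
  then show ?thesis using assms(2-) by (auto simp: hom_iff)
qed

lemma pair:
  assumes "is_pullback C f g p q" "h \<in> arr C" "k \<in> arr C" "src C k = src C h" "tgt C h = src C f" "tgt C k = src C g"
    "f \<cdot>\<^bsub>C\<^esub> h = g \<cdot>\<^bsub>C\<^esub> k"
  shows "pair C p q h k \<in> arr C" "src C (pair C p q h k) = src C h" "tgt C (pair C p q h k) = src C p"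
    "p \<cdot>\<^bsub>C\<^esub> pair C p q h k = h" "q \<cdot>\<^bsub>C\<^esub> pair C p q h k = k"
proof -
  have "\<exists>!v. v \<in> hom C (src C h) (src C p) \<and> p \<cdot>\<^bsub>C\<^esub> v = h \<and> q \<cdot>\<^bsub>C\<^esub> v = k"
    using is_pullbackD(1-9)[OF assms(1)] assms(2-) by (intro is_pullbackD(10)[OF assms(1)]) (auto simp: hom_iff)
  from theI'[OF this] show "pair C p q h k \<in> arr C" "src C (pair C p q h k) = src C h" "tgt C (pair C p q h k) = src C p"
    "p \<cdot>\<^bsub>C\<^esub> pair C p q h k = h" "q \<cdot>\<^bsub>C\<^esub> pair C p q h k = k"
    by (auto simp: pair_def hom_iff)
qed

end

locale intcat = C: category C + internal_category C A for C :: "('c, 'a) cat" and A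
begin

lemma structure_arr [simp]:
  "ob0 A \<in> obj C" "ob1 A \<in> obj C"
  "idom A \<in> arr C" "src C (idom A) = ob1 A" "tgt C (idom A) = ob0 A"
  "icod A \<in> arr C" "src C (icod A) = ob1 A" "tgt C (icod A) = ob0 A"
  "iid A \<in> arr C" "src C (iid A) = ob0 A" "tgt C (iid A) = ob1 A"
  "icomp A \<in> arr C" "src C (icomp A) = ob2 C A" "tgt C (icomp A) = ob1 A"
  "pr1 A \<in> arr C" "tgt C (pr1 A) = ob1 A"
  "pr2 A \<in> arr C" "src C (pr2 A) = ob2 C A" "tgt C (pr2 A) = ob1 A"
  using ob0 ob1 idom icod iid icomp is_pullbackD(1-9)[OF pullback] by (auto simp: hom_iff)

lemma pullback_square: "idom A \<cdot>\<^bsub>C\<^esub> pr1 A = icod A \<cdot>\<^bsub>C\<^esub> pr2 A"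
  by (rule is_pullbackD[OF pullback])

lemmas ipair [simp] = C.pair[OF pullback, simplified]

lemma ipair_eqI: "v \<in> arr C \<Longrightarrow> w \<in> arr C \<Longrightarrow> src C v = src C w \<Longrightarrow> tgt C v = ob2 C A \<Longrightarrow> tgt C w = ob2 C A \<Longrightarrow>
    pr1 A \<cdot>\<^bsub>C\<^esub> v = pr1 A \<cdot>\<^bsub>C\<^esub> w \<Longrightarrow> pr2 A \<cdot>\<^bsub>C\<^esub> v = pr2 A \<cdot>\<^bsub>C\<^esub> w \<Longrightarrow> v = w"
  by (rule C.pullback_eqI[OF pullback]) auto

lemma ipair_pr: "v \<in> arr C \<Longrightarrow> tgt C v = ob2 C A \<Longrightarrow> pair C (pr1 A) (pr2 A) (pr1 A \<cdot>\<^bsub>C\<^esub> v) (pr2 A \<cdot>\<^bsub>C\<^esub> v) = v"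
  by (rule ipair_eqI) (auto simp: C.assoc[symmetric] pullback_square)

lemma ipair_cmp:
  assumes "f \<in> arr C" "g \<in> arr C" "src C g = src C f" "tgt C f = ob1 A" "tgt C g = ob1 A" "idom A \<cdot>\<^bsub>C\<^esub> g = icod A \<cdot>\<^bsub>C\<^esub> f"
    and u: "u \<in> arr C" "tgt C u = src C f"
  shows "pair C (pr1 A) (pr2 A) (g \<cdot>\<^bsub>C\<^esub> u) (f \<cdot>\<^bsub>C\<^esub> u) = pair C (pr1 A) (pr2 A) g f \<cdot>\<^bsub>C\<^esub> u"
proof -
  have "pr1 A \<cdot>\<^bsub>C\<^esub> (pair C (pr1 A) (pr2 A) g f \<cdot>\<^bsub>C\<^esub> u) = g \<cdot>\<^bsub>C\<^esub> u"
    using assms by (subst C.assoc[symmetric]) auto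
  moreover have "pr2 A \<cdot>\<^bsub>C\<^esub> (pair C (pr1 A) (pr2 A) g f \<cdot>\<^bsub>C\<^esub> u) = f \<cdot>\<^bsub>C\<^esub> u"
    using assms by (subst C.assoc[symmetric]) auto
  ultimately show ?thesis
    using ipair_pr[of "pair C (pr1 A) (pr2 A) g f \<cdot>\<^bsub>C\<^esub> u"] assms by auto
qed

lemma icmp [simp]:
  assumes "f \<in> arr C" "g \<in> arr C" "src C g = src C f" "tgt C f = ob1 A" "tgt C g = ob1 A" "idom A \<cdot>\<^bsub>C\<^esub> g = icod A \<cdot>\<^bsub>C\<^esub> f"
  shows "icmp C A g f \<in> arr C" "src C (icmp C A g f) = src C f" "tgt C (icmp C A g f) = ob1 A"
    "idom A \<cdot>\<^bsub>C\<^esub> icmp C A g f = idom A \<cdot>\<^bsub>C\<^esub> f" "icod A \<cdot>\<^bsub>C\<^esub> icmp C A g f = icod A \<cdot>\<^bsub>C\<^esub> g"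
proof -
  show "icmp C A g f \<in> arr C" "src C (icmp C A g f) = src C f" "tgt C (icmp C A g f) = ob1 A"
    using assms by (auto simp: icmp_def)
  have "(idom A \<cdot>\<^bsub>C\<^esub> icomp A) \<cdot>\<^bsub>C\<^esub> pair C (pr1 A) (pr2 A) g f = idom A \<cdot>\<^bsub>C\<^esub> f"
    using assms unfolding idom_icomp by (subst C.assoc) auto
  then show "idom A \<cdot>\<^bsub>C\<^esub> icmp C A g f = idom A \<cdot>\<^bsub>C\<^esub> f"
    using assms by (simp add: icmp_def C.assoc)
  have "(icod A \<cdot>\<^bsub>C\<^esub> icomp A) \<cdot>\<^bsub>C\<^esub> pair C (pr1 A) (pr2 A) g f = icod A \<cdot>\<^bsub>C\<^esub> g"
    using assms unfolding icod_icomp by (subst C.assoc) auto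
  then show "icod A \<cdot>\<^bsub>C\<^esub> icmp C A g f = icod A \<cdot>\<^bsub>C\<^esub> g"
    using assms by (simp add: icmp_def C.assoc)
qed

text \<open>Stability under change of stage \<open>u\<close>. It moves every axiom stated at a
  generic stage to an arbitrary one.\<close>

lemma icmp_cmp:
  assumes "f \<in> arr C" "g \<in> arr C" "src C g = src C f" "tgt C f = ob1 A" "tgt C g = ob1 A" "idom A \<cdot>\<^bsub>C\<^esub> g = icod A \<cdot>\<^bsub>C\<^esub> f"
    and u: "u \<in> arr C" "tgt C u = src C f"
  shows "icmp C A g f \<cdot>\<^bsub>C\<^esub> u = icmp C A (g \<cdot>\<^bsub>C\<^esub> u) (f \<cdot>\<^bsub>C\<^esub> u)"
  using assms unfolding icmp_def by (simp add: ipair_cmp C.assoc)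

lemma idom_iid_cmp [simp]: "x \<in> arr C \<Longrightarrow> tgt C x = ob0 A \<Longrightarrow> idom A \<cdot>\<^bsub>C\<^esub> (iid A \<cdot>\<^bsub>C\<^esub> x) = x"
  and icod_iid_cmp [simp]: "x \<in> arr C \<Longrightarrow> tgt C x = ob0 A \<Longrightarrow> icod A \<cdot>\<^bsub>C\<^esub> (iid A \<cdot>\<^bsub>C\<^esub> x) = x"
  by (simp_all add: C.assoc[symmetric] idom_iid icod_iid)

declare idom_iid [simp] icod_iid [simp]

text \<open>The axiom concerns the generic arrow \<open>idt C (ob1 A)\<close>; precomposing with
  \<open>f\<close> specialises it.\<close>

lemma icmp_iid_left: 
  assumes "f \<in> arr C" "tgt C f = ob1 A"
  shows "icmp C A (iid A \<cdot>\<^bsub>C\<^esub> (icod A \<cdot>\<^bsub>C\<^esub> f)) f = f"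
  using arg_cong[OF unit_left, of "\<lambda>h. h \<cdot>\<^bsub>C\<^esub> f"] assms by (simp add: icmp_cmp C.assoc)

lemma icmp_iid_right: 
  assumes "f \<in> arr C" "tgt C f = ob1 A"
  shows "icmp C A f (iid A \<cdot>\<^bsub>C\<^esub> (idom A \<cdot>\<^bsub>C\<^esub> f)) = f"
  using arg_cong[OF unit_right, of "\<lambda>h. h \<cdot>\<^bsub>C\<^esub> f"] assms by (simp add: icmp_cmp C.assoc)

lemma icmp_unit [simp]:
  assumes "f \<in> arr C" "tgt C f = ob1 A"
  shows "icod A \<cdot>\<^bsub>C\<^esub> f = x \<Longrightarrow> icmp C A (iid A \<cdot>\<^bsub>C\<^esub> x) f = f"
    "idom A \<cdot>\<^bsub>C\<^esub> f = x \<Longrightarrow> icmp C A f (iid A \<cdot>\<^bsub>C\<^esub> x) = f"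
  using assms icmp_iid_left icmp_iid_right by auto

text \<open>The axiom speaks of a pullback of \<open>pr2\<close> and \<open>pr1\<close>, the object
  of composable triples. The triple \<open>(h, g, f)\<close> is a generalised element of it, and
  precomposing with that element gives associativity for the triple.\<close>

lemma icmp_assoc:
  assumes f: "f \<in> arr C" "tgt C f = ob1 A" and g: "g \<in> arr C" "src C g = src C f" "tgt C g = ob1 A" 
    and h: "h \<in> arr C" "src C h = src C f" "tgt C h = ob1 A"
    and gf: "idom A \<cdot>\<^bsub>C\<^esub> g = icod A \<cdot>\<^bsub>C\<^esub> f" and hg: "idom A \<cdot>\<^bsub>C\<^esub> h = icod A \<cdot>\<^bsub>C\<^esub> g"
  shows "icmp C A (icmp C A h g) f = icmp C A h (icmp C A g f)"
proof -
  obtain r s where pb: "is_pullback C (pr2 A) (pr1 A) r s"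
    and eq: "icmp C A (icomp A \<cdot>\<^bsub>C\<^esub> r) (pr2 A \<cdot>\<^bsub>C\<^esub> s) = icmp C A (pr1 A \<cdot>\<^bsub>C\<^esub> r) (icomp A \<cdot>\<^bsub>C\<^esub> s)"
    using assoc by blast
  have rs [simp]: "r \<in> arr C" "s \<in> arr C" "src C s = src C r" "tgt C r = ob2 C A" "tgt C s = ob2 C A"
    and prs: "pr2 A \<cdot>\<^bsub>C\<^esub> r = pr1 A \<cdot>\<^bsub>C\<^esub> s"
    using is_pullbackD(1-9)[OF pb] by auto
  let ?v = "pair C (pr1 A) (pr2 A) h g" and ?w = "pair C (pr1 A) (pr2 A) g f"
  \<comment> \<open>The triple: \<open>r\<close> takes it to \<open>(h, g)\<close> and
    \<open>s\<close> to \<open>(g, f)\<close>; these share the middle entry, as the pullback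
    requires.\<close>
  let ?t = "pair C r s ?v ?w"
  have t: "?t \<in> arr C" "src C ?t = src C f" "tgt C ?t = src C r" "r \<cdot>\<^bsub>C\<^esub> ?t = ?v" "s \<cdot>\<^bsub>C\<^esub> ?t = ?w"
    using assms by (subst C.pair[OF pb], auto)+
  \<comment> \<open>Composability within the generic triple, needed to move the precomposition with
    \<open>?t\<close> through \<open>icmp\<close>.\<close>
  have 1: "idom A \<cdot>\<^bsub>C\<^esub> (icomp A \<cdot>\<^bsub>C\<^esub> r) = icod A \<cdot>\<^bsub>C\<^esub> (pr2 A \<cdot>\<^bsub>C\<^esub> s)"
  proof -
    have "idom A \<cdot>\<^bsub>C\<^esub> (icomp A \<cdot>\<^bsub>C\<^esub> r) = idom A \<cdot>\<^bsub>C\<^esub> (pr2 A \<cdot>\<^bsub>C\<^esub> r)"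
      by (simp add: C.assoc[symmetric] idom_icomp)
    also have "\<dots> = (idom A \<cdot>\<^bsub>C\<^esub> pr1 A) \<cdot>\<^bsub>C\<^esub> s" by (simp add: prs C.assoc)
    finally show ?thesis by (simp add: pullback_square C.assoc)
  qed
  have 2: "idom A \<cdot>\<^bsub>C\<^esub> (pr1 A \<cdot>\<^bsub>C\<^esub> r) = icod A \<cdot>\<^bsub>C\<^esub> (icomp A \<cdot>\<^bsub>C\<^esub> s)"
  proof -
    have "icod A \<cdot>\<^bsub>C\<^esub> (icomp A \<cdot>\<^bsub>C\<^esub> s) = icod A \<cdot>\<^bsub>C\<^esub> (pr1 A \<cdot>\<^bsub>C\<^esub> s)"
      by (simp add: C.assoc[symmetric] icod_icomp)
    also have "\<dots> = (icod A \<cdot>\<^bsub>C\<^esub> pr2 A) \<cdot>\<^bsub>C\<^esub> r" by (simp add: prs[symmetric] C.assoc)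
    finally show ?thesis by (simp add: pullback_square[symmetric] C.assoc)
  qed
  have "icmp C A (icmp C A h g) f = icmp C A ((icomp A \<cdot>\<^bsub>C\<^esub> r) \<cdot>\<^bsub>C\<^esub> ?t) ((pr2 A \<cdot>\<^bsub>C\<^esub> s) \<cdot>\<^bsub>C\<^esub> ?t)"
    using assms t by (simp add: C.assoc) (simp add: icmp_def)
  also have "\<dots> = icmp C A ((pr1 A \<cdot>\<^bsub>C\<^esub> r) \<cdot>\<^bsub>C\<^esub> ?t) ((icomp A \<cdot>\<^bsub>C\<^esub> s) \<cdot>\<^bsub>C\<^esub> ?t)"
    using t 1 2 eq by (subst (1 2) icmp_cmp[symmetric]) auto
  also have "\<dots> = icmp C A h (icmp C A g f)"
    using assms t by (simp add: C.assoc) (simp add: icmp_def)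
  finally show ?thesis .
qed

lemma obj_ext_cat [simp]: "x \<in> obj (ext_cat C A X) \<longleftrightarrow> x \<in> arr C \<and> src C x = X \<and> tgt C x = ob0 A"
  and arr_ext_cat [simp]: "f \<in> arr (ext_cat C A X) \<longleftrightarrow> f \<in> arr C \<and> src C f = X \<and> tgt C f = ob1 A"
  by (auto simp: ext_cat_def hom_iff)

text \<open>At a fixed stage the internal laws become those of an ordinary category.\<close>

lemma ext_cat_category: "category (ext_cat C A X)"
  by (rule categoryI, simp_all) (simp_all add: ext_cat_def icmp_assoc)

end

lemma ext_cat_simps [simp]: "src (ext_cat C A X) f = idom A \<cdot>\<^bsub>C\<^esub> f" "tgt (ext_cat C A X) f = icod A \<cdot>\<^bsub>C\<^esub> f"
  "idt (ext_cat C A X) x = iid A \<cdot>\<^bsub>C\<^esub> x" "cmp (ext_cat C A X) = icmp C A"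
  by (simp_all add: ext_cat_def)

lemma intcatI: "category C \<Longrightarrow> internal_category C A \<Longrightarrow> intcat C A"
  by (simp add: intcat_def)

locale intfunctor = A: intcat C A + B: intcat C B for C :: "('c, 'a) cat" and A B F +
  assumes intfun: "is_intfun C F" and ifdom: "ifdom F = A" and ifcod: "ifcod F = B"
begin

lemma if_arr [simp]:
  "if0 F \<in> arr C" "src C (if0 F) = ob0 A" "tgt C (if0 F) = ob0 B"
  "if1 F \<in> arr C" "src C (if1 F) = ob1 A" "tgt C (if1 F) = ob1 B"
  using intfun ifdom ifcod by (auto simp: is_intfun_def hom_iff Let_def)

lemma if_eqs: "idom B \<cdot>\<^bsub>C\<^esub> if1 F = if0 F \<cdot>\<^bsub>C\<^esub> idom A" "icod B \<cdot>\<^bsub>C\<^esub> if1 F = if0 F \<cdot>\<^bsub>C\<^esub> icod A"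
  "if1 F \<cdot>\<^bsub>C\<^esub> iid A = iid B \<cdot>\<^bsub>C\<^esub> if0 F"
  "if1 F \<cdot>\<^bsub>C\<^esub> icomp A = icmp C B (if1 F \<cdot>\<^bsub>C\<^esub> pr1 A) (if1 F \<cdot>\<^bsub>C\<^esub> pr2 A)"
  using intfun ifdom ifcod by (auto simp: is_intfun_def hom_iff Let_def)

lemma if_map [simp]:
  assumes "f \<in> arr C" 
  shows "tgt C f = ob1 A \<Longrightarrow> idom B \<cdot>\<^bsub>C\<^esub> (if1 F \<cdot>\<^bsub>C\<^esub> f) = if0 F \<cdot>\<^bsub>C\<^esub> (idom A \<cdot>\<^bsub>C\<^esub> f)"
    "tgt C f = ob1 A \<Longrightarrow> icod B \<cdot>\<^bsub>C\<^esub> (if1 F \<cdot>\<^bsub>C\<^esub> f) = if0 F \<cdot>\<^bsub>C\<^esub> (icod A \<cdot>\<^bsub>C\<^esub> f)"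
    "tgt C f = ob0 A \<Longrightarrow> if1 F \<cdot>\<^bsub>C\<^esub> (iid A \<cdot>\<^bsub>C\<^esub> f) = iid B \<cdot>\<^bsub>C\<^esub> (if0 F \<cdot>\<^bsub>C\<^esub> f)"
  using assms by (auto simp: A.C.assoc[symmetric] if_eqs)

text \<open>The law for the generic composable pair, precomposed with the pair of \<open>g\<close>
  and \<open>f\<close>.\<close>

lemma if_icmp:
  assumes "f \<in> arr C" "g \<in> arr C" "src C g = src C f" "tgt C f = ob1 A" "tgt C g = ob1 A" "idom A \<cdot>\<^bsub>C\<^esub> g = icod A \<cdot>\<^bsub>C\<^esub> f"
  shows "if1 F \<cdot>\<^bsub>C\<^esub> icmp C A g f = icmp C B (if1 F \<cdot>\<^bsub>C\<^esub> g) (if1 F \<cdot>\<^bsub>C\<^esub> f)"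
proof -
  let ?p = "pair C (pr1 A) (pr2 A) g f"
  have eq: "if1 F \<cdot>\<^bsub>C\<^esub> icmp C A g f = (if1 F \<cdot>\<^bsub>C\<^esub> icomp A) \<cdot>\<^bsub>C\<^esub> ?p"
    using assms unfolding icmp_def by (subst A.C.assoc) auto
  show ?thesis unfolding eq if_eqs using assms
    by (subst B.icmp_cmp) (auto simp: A.C.assoc A.pullback_square)
qed

end

lemma intfunctorI: "category C \<Longrightarrow> is_intfun C F \<Longrightarrow> ifdom F = A \<Longrightarrow> ifcod F = B \<Longrightarrow> intfunctor C A B F"
  by (auto simp: intfunctor_def intfunctor_axioms_def intcat_def is_intfun_def Let_def)

locale intnat = F: intfunctor C A B F + G: intfunctor C A B G for C :: "('c, 'a) cat" and A B F G \<tau> +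
  assumes intnat: "is_intnat C \<tau>" and indom: "indom \<tau> = F" and incod: "incod \<tau> = G"
begin

lemma in_arr [simp]: "incmp \<tau> \<in> arr C" "src C (incmp \<tau>) = ob0 A" "tgt C (incmp \<tau>) = ob1 B"
  "idom B \<cdot>\<^bsub>C\<^esub> incmp \<tau> = if0 F" "icod B \<cdot>\<^bsub>C\<^esub> incmp \<tau> = if0 G"
  using intnat indom incod F.ifdom F.ifcod by (auto simp: is_intnat_def hom_iff Let_def)

lemma in_map [simp]:
  assumes "x \<in> arr C" "tgt C x = ob0 A"
  shows "idom B \<cdot>\<^bsub>C\<^esub> (incmp \<tau> \<cdot>\<^bsub>C\<^esub> x) = if0 F \<cdot>\<^bsub>C\<^esub> x" "icod B \<cdot>\<^bsub>C\<^esub> (incmp \<tau> \<cdot>\<^bsub>C\<^esub> x) = if0 G \<cdot>\<^bsub>C\<^esub> x"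
  using assms by (auto simp: F.A.C.assoc[symmetric])

lemma in_natural:
  assumes "f \<in> arr C" "tgt C f = ob1 A"
  shows "icmp C B (incmp \<tau> \<cdot>\<^bsub>C\<^esub> (icod A \<cdot>\<^bsub>C\<^esub> f)) (if1 F \<cdot>\<^bsub>C\<^esub> f) = icmp C B (if1 G \<cdot>\<^bsub>C\<^esub> f) (incmp \<tau> \<cdot>\<^bsub>C\<^esub> (idom A \<cdot>\<^bsub>C\<^esub> f))"
proof -
  have "icmp C B (incmp \<tau> \<cdot>\<^bsub>C\<^esub> icod A) (if1 F) = icmp C B (if1 G) (incmp \<tau> \<cdot>\<^bsub>C\<^esub> idom A)"
    using intnat indom incod F.ifdom F.ifcod by (auto simp: is_intnat_def hom_iff Let_def)
  from arg_cong[OF this, of "\<lambda>h. h \<cdot>\<^bsub>C\<^esub> f"] show ?thesis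
    using assms by (simp add: F.B.icmp_cmp F.A.C.assoc F.if_eqs G.if_eqs)
qed

end

lemma intnatI: "category C \<Longrightarrow> is_intnat C \<tau> \<Longrightarrow> indom \<tau> = F \<Longrightarrow> incod \<tau> = G \<Longrightarrow> ifdom F = A \<Longrightarrow> ifcod F = B \<Longrightarrow> intnat C A B F G \<tau>"
  by (auto simp: intnat_def intnat_axioms_def is_intnat_def Let_def intro!: intfunctorI)

lemma IntCat_simps [simp]:
  "A \<in> obj (one (IntCat C)) \<longleftrightarrow> internal_category C A" "F \<in> arr (one (IntCat C)) \<longleftrightarrow> is_intfun C F"
  "src (one (IntCat C)) = ifdom" "tgt (one (IntCat C)) = ifcod"
  "idt (one (IntCat C)) A = \<lparr>ifdom = A, ifcod = A, if0 = idt C (ob0 A), if1 = idt C (ob1 A)\<rparr>"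
  "cmp (one (IntCat C)) G F = \<lparr>ifdom = ifdom F, ifcod = ifcod G, if0 = if0 G \<cdot>\<^bsub>C\<^esub> if0 F, if1 = if1 G \<cdot>\<^bsub>C\<^esub> if1 F\<rparr>"
  "F \<in> obj (two (IntCat C)) \<longleftrightarrow> is_intfun C F" "\<tau> \<in> arr (two (IntCat C)) \<longleftrightarrow> is_intnat C \<tau>"
  "src (two (IntCat C)) = indom" "tgt (two (IntCat C)) = incod"
  "idt (two (IntCat C)) F = \<lparr>indom = F, incod = F, incmp = iid (ifcod F) \<cdot>\<^bsub>C\<^esub> if0 F\<rparr>"
  "cmp (two (IntCat C)) \<sigma> \<tau> = \<lparr>indom = indom \<tau>, incod = incod \<sigma>, incmp = icmp C (ifcod (indom \<tau>)) (incmp \<sigma>) (incmp \<tau>)\<rparr>"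
  "hcmp (IntCat C) \<sigma> \<tau> = \<lparr>indom = \<lparr>ifdom = ifdom (indom \<tau>), ifcod = ifcod (indom \<sigma>),
                  if0 = if0 (indom \<sigma>) \<cdot>\<^bsub>C\<^esub> if0 (indom \<tau>), if1 = if1 (indom \<sigma>) \<cdot>\<^bsub>C\<^esub> if1 (indom \<tau>)\<rparr>,
         incod = \<lparr>ifdom = ifdom (incod \<tau>), ifcod = ifcod (incod \<sigma>),
                  if0 = if0 (incod \<sigma>) \<cdot>\<^bsub>C\<^esub> if0 (incod \<tau>), if1 = if1 (incod \<sigma>) \<cdot>\<^bsub>C\<^esub> if1 (incod \<tau>)\<rparr>,
         incmp = icmp C (ifcod (indom \<sigma>))
                   (incmp \<sigma> \<cdot>\<^bsub>C\<^esub> if0 (incod \<tau>)) (if1 (indom \<sigma>) \<cdot>\<^bsub>C\<^esub> incmp \<tau>)\<rparr>"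
  by (simp_all add: IntCat_def)

section \<open>The 2-category axioms for internal categories\<close>

context category
begin

lemma is_intfun_idt: 
  assumes "internal_category C A"
  shows "is_intfun C \<lparr>ifdom = A, ifcod = A, if0 = idt C (ob0 A), if1 = idt C (ob1 A)\<rparr>"
proof -
  interpret intcat C A using assms category_axioms by (intro intcatI)
  show ?thesis using assms
    by (simp add: is_intfun_def hom_iff icmp_def) (simp add: ipair_pr[of "idt C (ob2 C A)", simplified])
qed

lemma is_intfun_cmp:
  assumes "intfunctor C A B F" "intfunctor C B D G"
  shows "is_intfun C \<lparr>ifdom = A, ifcod = D, if0 = if0 G \<cdot>\<^bsub>C\<^esub> if0 F, if1 = if1 G \<cdot>\<^bsub>C\<^esub> if1 F\<rparr>"
proof -
  interpret F: intfunctor C A B F by fact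
  interpret G: intfunctor C B D G by fact
  show ?thesis
    by (simp add: is_intfun_def hom_iff F.A.internal_category_axioms G.B.internal_category_axioms assoc F.if_eqs G.if_eqs G.if_icmp
        F.A.pullback_square)
qed

lemma is_intnat_idt:
  assumes "intfunctor C A B F"
  shows "is_intnat C \<lparr>indom = F, incod = F, incmp = iid B \<cdot>\<^bsub>C\<^esub> if0 F\<rparr>"
proof -
  interpret F: intfunctor C A B F by fact
  show ?thesis
    by (simp add: is_intnat_def hom_iff F.intfun F.ifdom F.ifcod assoc F.if_eqs)
qed

text \<open>The naturality squares of \<open>\<tau>\<close> and \<open>\<sigma>\<close> are pasted
  at the generic arrow, with \<open>icmp_assoc\<close> shifting the brackets between them.\<close>

lemma is_intnat_vcmp:
  assumes "intnat C A B F G \<tau>" "intnat C A B G H \<sigma>"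
  shows "is_intnat C \<lparr>indom = F, incod = H, incmp = icmp C B (incmp \<sigma>) (incmp \<tau>)\<rparr>"
proof -
  interpret t: intnat C A B F G \<tau> by fact
  interpret s: intnat C A B G H \<sigma> by fact
  have "icmp C B (icmp C B (incmp \<sigma> \<cdot>\<^bsub>C\<^esub> icod A) (incmp \<tau> \<cdot>\<^bsub>C\<^esub> icod A)) (if1 F)
    = icmp C B (incmp \<sigma> \<cdot>\<^bsub>C\<^esub> icod A) (icmp C B (incmp \<tau> \<cdot>\<^bsub>C\<^esub> icod A) (if1 F))"
    by (subst t.F.B.icmp_assoc) (auto simp: t.F.if_eqs)
  \<comment> \<open>\<open>idt C (ob1 A)\<close> is the generic arrow of \<open>A\<close>, at which
    \<open>in_natural\<close> is the naturality square itself.\<close>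
  also have "\<dots> = icmp C B (incmp \<sigma> \<cdot>\<^bsub>C\<^esub> icod A) (icmp C B (if1 G) (incmp \<tau> \<cdot>\<^bsub>C\<^esub> idom A))"
    using t.in_natural[of "idt C (ob1 A)"] by simp
  also have "\<dots> = icmp C B (icmp C B (incmp \<sigma> \<cdot>\<^bsub>C\<^esub> icod A) (if1 G)) (incmp \<tau> \<cdot>\<^bsub>C\<^esub> idom A)"
    by (subst t.F.B.icmp_assoc) (auto simp: t.G.if_eqs)
  also have "\<dots> = icmp C B (icmp C B (if1 H) (incmp \<sigma> \<cdot>\<^bsub>C\<^esub> idom A)) (incmp \<tau> \<cdot>\<^bsub>C\<^esub> idom A)"
    using s.in_natural[of "idt C (ob1 A)"] by simp
  also have "\<dots> = icmp C B (if1 H) (icmp C B (incmp \<sigma> \<cdot>\<^bsub>C\<^esub> idom A) (incmp \<tau> \<cdot>\<^bsub>C\<^esub> idom A))"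
    by (subst t.F.B.icmp_assoc) (auto simp: s.G.if_eqs)
  finally show ?thesis
    by (simp add: is_intnat_def hom_iff t.F.intfun s.G.intfun t.F.ifdom t.F.ifcod s.G.ifdom s.G.ifcod t.F.B.icmp_cmp)
qed

text \<open>The naturality square of \<open>\<tau>\<close> is first transported by
  \<open>F'\<close>; then that of \<open>\<sigma>\<close> is used at \<open>if1 G\<close>, the image
  of the generic arrow of \<open>A\<close>.\<close>

lemma is_intnat_hcmp:
  assumes "intnat C A B F G \<tau>" "intnat C B D F' G' \<sigma>"
  shows "is_intnat C \<lparr>indom = \<lparr>ifdom = A, ifcod = D, if0 = if0 F' \<cdot>\<^bsub>C\<^esub> if0 F, if1 = if1 F' \<cdot>\<^bsub>C\<^esub> if1 F\<rparr>,
         incod = \<lparr>ifdom = A, ifcod = D, if0 = if0 G' \<cdot>\<^bsub>C\<^esub> if0 G, if1 = if1 G' \<cdot>\<^bsub>C\<^esub> if1 G\<rparr>,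
         incmp = icmp C D (incmp \<sigma> \<cdot>\<^bsub>C\<^esub> if0 G) (if1 F' \<cdot>\<^bsub>C\<^esub> incmp \<tau>)\<rparr>"
proof -
  interpret t: intnat C A B F G \<tau> by fact
  interpret s: intnat C B D F' G' \<sigma> by fact
  note ifs = is_intfun_cmp[OF t.F.intfunctor_axioms s.F.intfunctor_axioms]
    is_intfun_cmp[OF t.G.intfunctor_axioms s.G.intfunctor_axioms]
  have "icmp C D (icmp C D (incmp \<sigma> \<cdot>\<^bsub>C\<^esub> (if0 G \<cdot>\<^bsub>C\<^esub> icod A)) (if1 F' \<cdot>\<^bsub>C\<^esub> (incmp \<tau> \<cdot>\<^bsub>C\<^esub> icod A))) (if1 F' \<cdot>\<^bsub>C\<^esub> if1 F)
    = icmp C D (incmp \<sigma> \<cdot>\<^bsub>C\<^esub> (if0 G \<cdot>\<^bsub>C\<^esub> icod A)) (icmp C D (if1 F' \<cdot>\<^bsub>C\<^esub> (incmp \<tau> \<cdot>\<^bsub>C\<^esub> icod A)) (if1 F' \<cdot>\<^bsub>C\<^esub> if1 F))"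
    by (subst s.F.B.icmp_assoc) (auto simp: t.F.if_eqs)
  also have "icmp C D (if1 F' \<cdot>\<^bsub>C\<^esub> (incmp \<tau> \<cdot>\<^bsub>C\<^esub> icod A)) (if1 F' \<cdot>\<^bsub>C\<^esub> if1 F) = if1 F' \<cdot>\<^bsub>C\<^esub> icmp C B (incmp \<tau> \<cdot>\<^bsub>C\<^esub> icod A) (if1 F)"
    by (subst s.F.if_icmp) (auto simp: t.F.if_eqs)
  also have "icmp C B (incmp \<tau> \<cdot>\<^bsub>C\<^esub> icod A) (if1 F) = icmp C B (if1 G) (incmp \<tau> \<cdot>\<^bsub>C\<^esub> idom A)"
    using t.in_natural[of "idt C (ob1 A)"] by simp
  also have "if1 F' \<cdot>\<^bsub>C\<^esub> \<dots> = icmp C D (if1 F' \<cdot>\<^bsub>C\<^esub> if1 G) (if1 F' \<cdot>\<^bsub>C\<^esub> (incmp \<tau> \<cdot>\<^bsub>C\<^esub> idom A))"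
    by (subst s.F.if_icmp) (auto simp: t.G.if_eqs)
  also have "icmp C D (incmp \<sigma> \<cdot>\<^bsub>C\<^esub> (if0 G \<cdot>\<^bsub>C\<^esub> icod A)) \<dots> =
    icmp C D (icmp C D (incmp \<sigma> \<cdot>\<^bsub>C\<^esub> (if0 G \<cdot>\<^bsub>C\<^esub> icod A)) (if1 F' \<cdot>\<^bsub>C\<^esub> if1 G)) (if1 F' \<cdot>\<^bsub>C\<^esub> (incmp \<tau> \<cdot>\<^bsub>C\<^esub> idom A))"
    by (subst s.F.B.icmp_assoc) (auto simp: t.G.if_eqs)
  also have "icmp C D (incmp \<sigma> \<cdot>\<^bsub>C\<^esub> (if0 G \<cdot>\<^bsub>C\<^esub> icod A)) (if1 F' \<cdot>\<^bsub>C\<^esub> if1 G)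
     = icmp C D (if1 G' \<cdot>\<^bsub>C\<^esub> if1 G) (incmp \<sigma> \<cdot>\<^bsub>C\<^esub> (if0 G \<cdot>\<^bsub>C\<^esub> idom A))"
    using s.in_natural[of "if1 G"] by (simp add: t.G.if_eqs)
  also have "icmp C D \<dots> (if1 F' \<cdot>\<^bsub>C\<^esub> (incmp \<tau> \<cdot>\<^bsub>C\<^esub> idom A)) = icmp C D (if1 G' \<cdot>\<^bsub>C\<^esub> if1 G)
    (icmp C D (incmp \<sigma> \<cdot>\<^bsub>C\<^esub> (if0 G \<cdot>\<^bsub>C\<^esub> idom A)) (if1 F' \<cdot>\<^bsub>C\<^esub> (incmp \<tau> \<cdot>\<^bsub>C\<^esub> idom A)))"
    by (subst s.F.B.icmp_assoc) (auto simp: t.G.if_eqs)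
  finally show ?thesis
    using ifs by (simp add: is_intnat_def hom_iff s.F.B.icmp_cmp assoc)
qed

lemma two_category_IntCat: "two_category (IntCat C)"
proof (intro two_categoryI categoryI)
  note c = category_axioms
  fix \<alpha> assume a: "\<alpha> \<in> arr (two (IntCat C))"
  then interpret a: intnat C "ifdom (indom \<alpha>)" "ifcod (indom \<alpha>)" "indom \<alpha>" "incod \<alpha>" \<alpha> by (intro intnatI c) auto
  note [simp] = a.G.ifdom a.G.ifcod
  show "src (one (IntCat C)) (tgt (two (IntCat C)) \<alpha>) = src (one (IntCat C)) (src (two (IntCat C)) \<alpha>) \<and>
      tgt (one (IntCat C)) (tgt (two (IntCat C)) \<alpha>) = tgt (one (IntCat C)) (src (two (IntCat C)) \<alpha>)" by simp
  show "src (two (IntCat C)) \<alpha> \<in> obj (two (IntCat C)) \<and> tgt (two (IntCat C)) \<alpha> \<in> obj (two (IntCat C))"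
    by (simp add: a.F.intfun a.G.intfun)
  show "idt (two (IntCat C)) (tgt (two (IntCat C)) \<alpha>) \<cdot>\<^bsub>two (IntCat C)\<^esub> \<alpha> = \<alpha> \<and>
      \<alpha> \<cdot>\<^bsub>two (IntCat C)\<^esub> idt (two (IntCat C)) (src (two (IntCat C)) \<alpha>) = \<alpha>"
    by simp
  show "idt (two (IntCat C)) (idt (one (IntCat C)) (tgt (one (IntCat C)) (src (two (IntCat C)) \<alpha>))) \<star>\<^bsub>IntCat C\<^esub> \<alpha> = \<alpha> \<and>
      \<alpha> \<star>\<^bsub>IntCat C\<^esub> idt (two (IntCat C)) (idt (one (IntCat C)) (src (one (IntCat C)) (src (two (IntCat C)) \<alpha>))) = \<alpha>"
    by (auto intro!: intnat.equality intfun.equality simp: a.F.if_eqs(3))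
  fix \<beta> assume b: "\<beta> \<in> arr (two (IntCat C))"
  then interpret b: intnat C "ifdom (indom \<beta>)" "ifcod (indom \<beta>)" "indom \<beta>" "incod \<beta>" \<beta> by (intro intnatI c) auto
  note [simp] = b.G.ifdom b.G.ifcod
  show "\<beta> \<cdot>\<^bsub>two (IntCat C)\<^esub> \<alpha> \<in> arr (two (IntCat C)) \<and> src (two (IntCat C)) (\<beta> \<cdot>\<^bsub>two (IntCat C)\<^esub> \<alpha>) = src (two (IntCat C)) \<alpha> \<and>
      tgt (two (IntCat C)) (\<beta> \<cdot>\<^bsub>two (IntCat C)\<^esub> \<alpha>) = tgt (two (IntCat C)) \<beta>"
    if "src (two (IntCat C)) \<beta> = tgt (two (IntCat C)) \<alpha>"
  proof -
    \<comment> \<open>Composability is an equation of records; reinterpreting \<open>\<beta>\<close>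
      with its boundary named through \<open>\<alpha>\<close> lets both share one source and one
      target.\<close>
    have "intnat C (ifdom (indom \<alpha>)) (ifcod (indom \<alpha>)) (incod \<alpha>) (incod \<beta>) \<beta>"
      using that b by (intro intnatI c) auto
    from is_intnat_vcmp[OF a.intnat_axioms this] show ?thesis by simp
  qed
  show "\<beta> \<star>\<^bsub>IntCat C\<^esub> \<alpha> \<in> arr (two (IntCat C)) \<and> src (two (IntCat C)) (\<beta> \<star>\<^bsub>IntCat C\<^esub> \<alpha>) = src (two (IntCat C)) \<beta> \<cdot>\<^bsub>one (IntCat C)\<^esub> src (two (IntCat C)) \<alpha> \<and>
      tgt (two (IntCat C)) (\<beta> \<star>\<^bsub>IntCat C\<^esub> \<alpha>) = tgt (two (IntCat C)) \<beta> \<cdot>\<^bsub>one (IntCat C)\<^esub> tgt (two (IntCat C)) \<alpha>"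
    if "src (one (IntCat C)) (src (two (IntCat C)) \<beta>) = tgt (one (IntCat C)) (src (two (IntCat C)) \<alpha>)"
  proof -
    have "intnat C (ifcod (indom \<alpha>)) (ifcod (indom \<beta>)) (indom \<beta>) (incod \<beta>) \<beta>"
      using that b by (intro intnatI c) auto
    from is_intnat_hcmp[OF a.intnat_axioms this] show ?thesis by simp
  qed
  fix \<gamma> assume g: "\<gamma> \<in> arr (two (IntCat C))"
  then interpret g: intnat C "ifdom (indom \<gamma>)" "ifcod (indom \<gamma>)" "indom \<gamma>" "incod \<gamma>" \<gamma> by (intro intnatI c) auto
  note [simp] = g.G.ifdom g.G.ifcod
  show "(\<gamma> \<cdot>\<^bsub>two (IntCat C)\<^esub> \<beta>) \<cdot>\<^bsub>two (IntCat C)\<^esub> \<alpha> = \<gamma> \<cdot>\<^bsub>two (IntCat C)\<^esub> (\<beta> \<cdot>\<^bsub>two (IntCat C)\<^esub> \<alpha>)"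
    if e: "src (two (IntCat C)) \<beta> = tgt (two (IntCat C)) \<alpha>" "src (two (IntCat C)) \<gamma> = tgt (two (IntCat C)) \<beta>"
  proof -
    interpret b': intnat C "ifdom (indom \<alpha>)" "ifcod (indom \<alpha>)" "incod \<alpha>" "incod \<beta>" \<beta>
      using e b by (intro intnatI c) auto
    interpret g': intnat C "ifdom (indom \<alpha>)" "ifcod (indom \<alpha>)" "incod \<beta>" "incod \<gamma>" \<gamma>
      using e g b'.G.ifdom b'.G.ifcod by (intro intnatI c) auto
    show ?thesis using e b'.G.ifcod by (simp add: a.F.B.icmp_assoc)
  qed
  show "(\<gamma> \<star>\<^bsub>IntCat C\<^esub> \<beta>) \<star>\<^bsub>IntCat C\<^esub> \<alpha> = \<gamma> \<star>\<^bsub>IntCat C\<^esub> (\<beta> \<star>\<^bsub>IntCat C\<^esub> \<alpha>)"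
    if e: "src (one (IntCat C)) (src (two (IntCat C)) \<beta>) = tgt (one (IntCat C)) (src (two (IntCat C)) \<alpha>)"
      "src (one (IntCat C)) (src (two (IntCat C)) \<gamma>) = tgt (one (IntCat C)) (src (two (IntCat C)) \<beta>)"
  proof -
    note [simp] = e[simplified]
    interpret g': intnat C "ifcod (indom \<beta>)" "ifcod (indom \<gamma>)" "indom \<gamma>" "incod \<gamma>" \<gamma>
      using e g by (intro intnatI c) auto
    show ?thesis
      by (simp add: assoc g'.F.if_icmp g.F.B.icmp_cmp g.F.B.icmp_assoc)
  qed
next
  note c = category_axioms
  fix \<alpha> \<alpha>' \<beta> \<beta>' assume a: "\<alpha> \<in> arr (two (IntCat C))" "\<alpha>' \<in> arr (two (IntCat C))" "\<beta> \<in> arr (two (IntCat C))" "\<beta>' \<in> arr (two (IntCat C))"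
    "src (two (IntCat C)) \<alpha>' = tgt (two (IntCat C)) \<alpha>" "src (two (IntCat C)) \<beta>' = tgt (two (IntCat C)) \<beta>"
    "src (one (IntCat C)) (src (two (IntCat C)) \<beta>) = tgt (one (IntCat C)) (src (two (IntCat C)) \<alpha>)"
  define A B D F G H F' G' H' where d: "A = ifdom (indom \<alpha>)" "B = ifcod (indom \<alpha>)" "D = ifcod (indom \<beta>)"
    "F = indom \<alpha>" "G = incod \<alpha>" "H = incod \<alpha>'" "F' = indom \<beta>" "G' = incod \<beta>" "H' = incod \<beta>'"
  interpret a: intnat C A B F G \<alpha> using a by (intro intnatI c) (auto simp: d)
  note [simp] = a.F.ifdom a.F.ifcod a.G.ifdom a.G.ifcod
  interpret b: intnat C B D F' G' \<beta> using a by (intro intnatI c) (auto simp: d)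
  note [simp] = b.F.ifdom b.F.ifcod b.G.ifdom b.G.ifcod
  interpret a': intnat C A B G H \<alpha>' using a a.G.ifdom a.G.ifcod by (intro intnatI c) (auto simp: d)
  note [simp] = a'.G.ifdom a'.G.ifcod
  interpret b': intnat C B D G' H' \<beta>' using a b.G.ifdom b.G.ifcod by (intro intnatI c) (auto simp: d)
  note [simp] = b'.G.ifdom b'.G.ifcod
  \<comment> \<open>Interchange rests on this one square: naturality of \<open>\<beta>\<close> at
    the component of \<open>\<alpha>'\<close> swaps the two middle factors. The rest is
    rebracketing.\<close>
  have nat: "icmp C D (incmp \<beta> \<cdot>\<^bsub>C\<^esub> if0 H) (if1 F' \<cdot>\<^bsub>C\<^esub> incmp \<alpha>') = icmp C D (if1 G' \<cdot>\<^bsub>C\<^esub> incmp \<alpha>') (incmp \<beta> \<cdot>\<^bsub>C\<^esub> if0 G)"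
    using b.in_natural[of "incmp \<alpha>'"] by simp
  have "icmp C D (icmp C D (incmp \<beta>') (incmp \<beta>) \<cdot>\<^bsub>C\<^esub> if0 H) (if1 F' \<cdot>\<^bsub>C\<^esub> icmp C B (incmp \<alpha>') (incmp \<alpha>)) =
    icmp C D (icmp C D (incmp \<beta>' \<cdot>\<^bsub>C\<^esub> if0 H) (incmp \<beta> \<cdot>\<^bsub>C\<^esub> if0 H)) (icmp C D (if1 F' \<cdot>\<^bsub>C\<^esub> incmp \<alpha>') (if1 F' \<cdot>\<^bsub>C\<^esub> incmp \<alpha>))"
    by (simp add: b.F.B.icmp_cmp b.F.if_icmp)
  also have "\<dots> = icmp C D (incmp \<beta>' \<cdot>\<^bsub>C\<^esub> if0 H) (icmp C D (icmp C D (incmp \<beta> \<cdot>\<^bsub>C\<^esub> if0 H) (if1 F' \<cdot>\<^bsub>C\<^esub> incmp \<alpha>')) (if1 F' \<cdot>\<^bsub>C\<^esub> incmp \<alpha>))"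
    by (simp add: b.F.B.icmp_assoc)
  also have "\<dots> = icmp C D (incmp \<beta>' \<cdot>\<^bsub>C\<^esub> if0 H) (icmp C D (if1 G' \<cdot>\<^bsub>C\<^esub> incmp \<alpha>') (icmp C D (incmp \<beta> \<cdot>\<^bsub>C\<^esub> if0 G) (if1 F' \<cdot>\<^bsub>C\<^esub> incmp \<alpha>)))"
    unfolding nat by (simp add: b.F.B.icmp_assoc)
  also have "\<dots> = icmp C D (icmp C D (incmp \<beta>' \<cdot>\<^bsub>C\<^esub> if0 H) (if1 G' \<cdot>\<^bsub>C\<^esub> incmp \<alpha>')) (icmp C D (incmp \<beta> \<cdot>\<^bsub>C\<^esub> if0 G) (if1 F' \<cdot>\<^bsub>C\<^esub> incmp \<alpha>))"
    by (simp add: b.F.B.icmp_assoc)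
  finally show "(\<beta>' \<cdot>\<^bsub>two (IntCat C)\<^esub> \<beta>) \<star>\<^bsub>IntCat C\<^esub> (\<alpha>' \<cdot>\<^bsub>two (IntCat C)\<^esub> \<alpha>) =
    (\<beta>' \<star>\<^bsub>IntCat C\<^esub> \<alpha>') \<cdot>\<^bsub>two (IntCat C)\<^esub> (\<beta> \<star>\<^bsub>IntCat C\<^esub> \<alpha>)"
    using a by (simp add: a.indom a.incod a'.indom a'.incod b.indom b.incod b'.indom b'.incod)
next
  note c = category_axioms
  fix F assume F: "F \<in> arr (one (IntCat C))"
  then interpret F: intfunctor C "ifdom F" "ifcod F" F by (intro intfunctorI c) auto
  show "src (one (IntCat C)) F \<in> obj (one (IntCat C)) \<and> tgt (one (IntCat C)) F \<in> obj (one (IntCat C))"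
    by (simp add: F.A.internal_category_axioms F.B.internal_category_axioms)
  show "idt (one (IntCat C)) (tgt (one (IntCat C)) F) \<cdot>\<^bsub>one (IntCat C)\<^esub> F = F \<and>
      F \<cdot>\<^bsub>one (IntCat C)\<^esub> idt (one (IntCat C)) (src (one (IntCat C)) F) = F"
    by simp
  fix G assume G: "G \<in> arr (one (IntCat C))" and e: "src (one (IntCat C)) G = tgt (one (IntCat C)) F"
  then interpret G: intfunctor C "ifcod F" "ifcod G" G by (intro intfunctorI c) auto
  show "G \<cdot>\<^bsub>one (IntCat C)\<^esub> F \<in> arr (one (IntCat C)) \<and> src (one (IntCat C)) (G \<cdot>\<^bsub>one (IntCat C)\<^esub> F) = src (one (IntCat C)) F \<and>
    tgt (one (IntCat C)) (G \<cdot>\<^bsub>one (IntCat C)\<^esub> F) = tgt (one (IntCat C)) G"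
    using is_intfun_cmp[OF F.intfunctor_axioms G.intfunctor_axioms] by simp
  show "idt (two (IntCat C)) G \<star>\<^bsub>IntCat C\<^esub> idt (two (IntCat C)) F = idt (two (IntCat C)) (G \<cdot>\<^bsub>one (IntCat C)\<^esub> F)"
    using e by (simp add: assoc)
  fix H assume H: "H \<in> arr (one (IntCat C))" and e': "src (one (IntCat C)) H = tgt (one (IntCat C)) G"
  then interpret H: intfunctor C "ifcod G" "ifcod H" H by (intro intfunctorI c) auto
  show "(H \<cdot>\<^bsub>one (IntCat C)\<^esub> G) \<cdot>\<^bsub>one (IntCat C)\<^esub> F = H \<cdot>\<^bsub>one (IntCat C)\<^esub> (G \<cdot>\<^bsub>one (IntCat C)\<^esub> F)"
    by (simp add: assoc)
next
  fix A assume "A \<in> obj (one (IntCat C))"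
  then show "idt (one (IntCat C)) A \<in> arr (one (IntCat C)) \<and> src (one (IntCat C)) (idt (one (IntCat C)) A) = A \<and>
    tgt (one (IntCat C)) (idt (one (IntCat C)) A) = A"
    by (simp add: is_intfun_idt)
next
  fix F assume "F \<in> obj (two (IntCat C))"
  then show "idt (two (IntCat C)) F \<in> arr (two (IntCat C)) \<and> src (two (IntCat C)) (idt (two (IntCat C)) F) = F \<and>
    tgt (two (IntCat C)) (idt (two (IntCat C)) F) = F"
    by (auto intro!: is_intnat_idt intfunctorI category_axioms)
next
  show "obj (two (IntCat C)) = arr (one (IntCat C))" by (simp add: IntCat_def)
qed

end

section \<open>Externalisation is 2-fully faithful\<close>

lemma ext_simps [simp]:
  "app0 (ext0 C A) = ext_cat C A" "app1 (ext0 C A) = ext_reindex C A" "app2 (ext0 C A) u = cnat_id (ext_reindex C A u)"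
  "fdom (ext_reindex C A u) = ext_cat C A (tgt C u)" "fcod (ext_reindex C A u) = ext_cat C A (src C u)"
  "x \<in> obj (ext_cat C A (tgt C u)) \<Longrightarrow> fob (ext_reindex C A u) x = x \<cdot>\<^bsub>C\<^esub> u"
  "f \<in> arr (ext_cat C A (tgt C u)) \<Longrightarrow> far (ext_reindex C A u) f = f \<cdot>\<^bsub>C\<^esub> u"
  "tdom (ext1 C F) = ext0 C (ifdom F)" "tcod (ext1 C F) = ext0 C (ifcod F)"
  "X \<in> obj C \<Longrightarrow> fdom (tcmp (ext1 C F) X) = ext_cat C (ifdom F) X"
  "X \<in> obj C \<Longrightarrow> fcod (tcmp (ext1 C F) X) = ext_cat C (ifcod F) X"
  "X \<in> obj C \<Longrightarrow> x \<in> obj (ext_cat C (ifdom F) X) \<Longrightarrow> fob (tcmp (ext1 C F) X) x = if0 F \<cdot>\<^bsub>C\<^esub> x"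
  "X \<in> obj C \<Longrightarrow> f \<in> arr (ext_cat C (ifdom F) X) \<Longrightarrow> far (tcmp (ext1 C F) X) f = if1 F \<cdot>\<^bsub>C\<^esub> f"
  "mdom (ext2 C \<tau>) = ext1 C (indom \<tau>)" "mcod (ext2 C \<tau>) = ext1 C (incod \<tau>)"
  "X \<in> obj C \<Longrightarrow> ndom (mcmp (ext2 C \<tau>) X) = tcmp (ext1 C (indom \<tau>)) X"
  "X \<in> obj C \<Longrightarrow> ncod (mcmp (ext2 C \<tau>) X) = tcmp (ext1 C (incod \<tau>)) X"
  "X \<in> obj C \<Longrightarrow> x \<in> obj (ext_cat C (ifdom (indom \<tau>)) X) \<Longrightarrow> ncmp (mcmp (ext2 C \<tau>) X) x = incmp \<tau> \<cdot>\<^bsub>C\<^esub> x"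
  by (simp_all add: ext0_def ext_reindex_def ext1_def ext2_def)

lemma externalisation_simps [simp]: "app0 (externalisation C) = ext0 C" "app1 (externalisation C) = ext1 C"
  "app2 (externalisation C) = ext2 C"
  by (simp_all add: externalisation_def)

text \<open>\<open>(pr1, pr2)\<close> is the generic composable pair. This exhibits
  \<open>icomp\<close> as a value of composition at stage \<open>ob2\<close>, so that preservation
  of composition can be tested there.\<close>

lemma (in intcat) icmp_pr: "icmp C A (pr1 A) (pr2 A) = icomp A"
  using ipair_pr[of "idt C (ob2 C A)"] by (simp add: icmp_def)

lemma (in intcat) two_functor_ext0: "two_functor (op_twocat (loc_disc C)) Cat (ext0 C A)"
proof (rule two_functor_CatI)
  note [simp] = ext_cat_category
  have cfun: "is_cfun (ext_reindex C A u)" if u: "u \<in> arr C" for u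
  proof -
    have "is_functor (ext_cat C A (tgt C u)) (ext_cat C A (src C u)) (fob (ext_reindex C A u)) (far (ext_reindex C A u))"
      using u by (intro is_functorI) (auto simp: C.assoc icmp_cmp)
    then show ?thesis by (intro is_cfunI) (auto, simp_all add: ext_reindex_def)
  qed
  show "is_cfun (app1 (ext0 C A) u) \<and> fdom (app1 (ext0 C A) u) = app0 (ext0 C A) (src (one (op_twocat (loc_disc C))) u) \<and>
      fcod (app1 (ext0 C A) u) = app0 (ext0 C A) (tgt (one (op_twocat (loc_disc C))) u)"
    if "u \<in> arr (one (op_twocat (loc_disc C)))" for u
    using that cfun by simp
  show "is_cnat (app2 (ext0 C A) \<theta>) \<and> ndom (app2 (ext0 C A) \<theta>) = app1 (ext0 C A) (src (two (op_twocat (loc_disc C))) \<theta>) \<and>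
      ncod (app2 (ext0 C A) \<theta>) = app1 (ext0 C A) (tgt (two (op_twocat (loc_disc C))) \<theta>)"
    if "\<theta> \<in> arr (two (op_twocat (loc_disc C)))" for \<theta>
    using that cfun by simp
qed (auto simp: two_category_op two_category_loc_disc C.category_axioms ext_cat_category C.assoc)

lemma (in intfunctor) is_tnat_ext1: "is_tnat (op_twocat (loc_disc C)) (ext1 C F)"
proof (rule is_tnatI)
  note [simp] = A.ext_cat_category B.ext_cat_category ifdom ifcod
  fix X assume X: "X \<in> obj (one (op_twocat (loc_disc C)))"
  have "is_functor (ext_cat C A X) (ext_cat C B X) (fob (tcmp (ext1 C F) X)) (far (tcmp (ext1 C F) X))"
    using X by (intro is_functorI) (auto simp: if_icmp)
  then show "is_cfun (tcmp (ext1 C F) X) \<and> fdom (tcmp (ext1 C F) X) = app0 (tdom (ext1 C F)) X \<and>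
      fcod (tcmp (ext1 C F) X) = app0 (tcod (ext1 C F)) X"
    using X by (intro conjI is_cfunI) (auto, simp_all add: ext1_def)
qed (auto simp: two_category_op two_category_loc_disc A.C.category_axioms A.two_functor_ext0 B.two_functor_ext0 ifdom ifcod A.C.assoc,
  simp add: ext1_def)

lemma (in intnat) is_modif_ext2: "is_modif (op_twocat (loc_disc C)) (ext2 C \<tau>)"
proof (rule is_modifI)
  note [simp] = F.A.ext_cat_category F.B.ext_cat_category F.ifdom F.ifcod G.ifdom G.ifcod indom incod F.A.C.category_axioms
    two_category_op two_category_loc_disc
  interpret f: cat_nat "op_twocat (loc_disc C)" "ext0 C A" "ext0 C B" "ext1 C F"
    by (intro cat_natI F.is_tnat_ext1) auto
  interpret g: cat_nat "op_twocat (loc_disc C)" "ext0 C A" "ext0 C B" "ext1 C G"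
    by (intro cat_natI G.is_tnat_ext1) auto
  fix X assume X: "X \<in> obj (one (op_twocat (loc_disc C)))"
  have "is_cnat (mcmp (ext2 C \<tau>) X)"
    using X f.cfun(1)[OF X] g.cfun(1)[OF X] by (intro is_cnatI) (auto simp: in_natural, simp add: ext2_def)
  then show "is_cnat (mcmp (ext2 C \<tau>) X) \<and> ndom (mcmp (ext2 C \<tau>) X) = tcmp (mdom (ext2 C \<tau>)) X \<and>
      ncod (mcmp (ext2 C \<tau>) X) = tcmp (mcod (ext2 C \<tau>)) X"
    using X by auto
qed (auto simp: two_category_op two_category_loc_disc F.A.C.category_axioms F.is_tnat_ext1 G.is_tnat_ext1
    F.ifdom F.ifcod G.ifdom G.ifcod indom incod F.A.C.assoc,
  simp add: ext2_def)

context category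
begin

lemma cat_functor_externalisation: "cat_functor (IntCat C) (op_twocat (loc_disc C)) (externalisation C)"
proof -
  note c [simp] = category_axioms and [simp] = two_category_op two_category_loc_disc two_category_IntCat
  have F: "intfunctor C (ifdom F) (ifcod F) F" if "is_intfun C F" for F
    using that by (intro intfunctorI c) auto
  have N: "intnat C (ifdom (indom \<tau>)) (ifcod (indom \<tau>)) (indom \<tau>) (incod \<tau>) \<tau>" if "is_intnat C \<tau>" for \<tau>
    using that by (intro intnatI c) auto
  have "two_functor (IntCat C) (CatFun (op_twocat (loc_disc C))) (externalisation C)"
  proof (rule two_functor_CatFunI)
    fix A assume "A \<in> obj (one (IntCat C))"
    then interpret intcat C A by (intro intcatI) auto
    show "two_functor (op_twocat (loc_disc C)) Cat (app0 (externalisation C) A)"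
      using two_functor_ext0 by simp
    show "fob (tcmp (app1 (externalisation C) (idt (one (IntCat C)) A)) i) x = x"
      if "i \<in> obj (one (op_twocat (loc_disc C)))" "x \<in> obj (app0 (app0 (externalisation C) A) i)" for i x
      using that by simp
    show "far (tcmp (app1 (externalisation C) (idt (one (IntCat C)) A)) i) x = x"
      if "i \<in> obj (one (op_twocat (loc_disc C)))" "x \<in> arr (app0 (app0 (externalisation C) A) i)" for i x
      using that by simp
  next
    fix F assume "F \<in> arr (one (IntCat C))"
    then interpret F: intfunctor C "ifdom F" "ifcod F" F by (intro F) auto
    show "is_tnat (op_twocat (loc_disc C)) (app1 (externalisation C) F) \<and>
       tdom (app1 (externalisation C) F) = app0 (externalisation C) (src (one (IntCat C)) F) \<and>
       tcod (app1 (externalisation C) F) = app0 (externalisation C) (tgt (one (IntCat C)) F)"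
      by (simp add: F.is_tnat_ext1)
    show "ncmp (mcmp (app2 (externalisation C) (idt (two (IntCat C)) F)) i) x =
       idt (app0 (app0 (externalisation C) (tgt (one (IntCat C)) F)) i) (fob (tcmp (app1 (externalisation C) F) i) x)"
      if "i \<in> obj (one (op_twocat (loc_disc C)))" "x \<in> obj (app0 (app0 (externalisation C) (src (one (IntCat C)) F)) i)" for i x
      using that by (simp add: assoc)
    fix G assume "G \<in> arr (one (IntCat C))" and e: "src (one (IntCat C)) G = tgt (one (IntCat C)) F"
    then interpret G: intfunctor C "ifcod F" "ifcod G" G by (intro intfunctorI) auto
    show "fob (tcmp (app1 (externalisation C) (G \<cdot>\<^bsub>one (IntCat C)\<^esub> F)) i) x =
       fob (tcmp (app1 (externalisation C) G) i) (fob (tcmp (app1 (externalisation C) F) i) x)"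
      if "i \<in> obj (one (op_twocat (loc_disc C)))" "x \<in> obj (app0 (app0 (externalisation C) (src (one (IntCat C)) F)) i)" for i x
      using that e by (simp add: assoc)
    show "far (tcmp (app1 (externalisation C) (G \<cdot>\<^bsub>one (IntCat C)\<^esub> F)) i) x =
       far (tcmp (app1 (externalisation C) G) i) (far (tcmp (app1 (externalisation C) F) i) x)"
      if "i \<in> obj (one (op_twocat (loc_disc C)))" "x \<in> arr (app0 (app0 (externalisation C) (src (one (IntCat C)) F)) i)" for i x
      using that e by (simp add: assoc)
  next
    fix \<alpha> assume "\<alpha> \<in> arr (two (IntCat C))"
    then interpret a: intnat C "ifdom (indom \<alpha>)" "ifcod (indom \<alpha>)" "indom \<alpha>" "incod \<alpha>" \<alpha> by (intro N) auto
    note [simp] = a.G.ifdom a.G.ifcod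
    show "is_modif (op_twocat (loc_disc C)) (app2 (externalisation C) \<alpha>) \<and>
       mdom (app2 (externalisation C) \<alpha>) = app1 (externalisation C) (src (two (IntCat C)) \<alpha>) \<and>
       mcod (app2 (externalisation C) \<alpha>) = app1 (externalisation C) (tgt (two (IntCat C)) \<alpha>)"
      by (simp add: a.is_modif_ext2)
    fix \<beta> assume b: "\<beta> \<in> arr (two (IntCat C))"
    show "ncmp (mcmp (app2 (externalisation C) (\<beta> \<cdot>\<^bsub>two (IntCat C)\<^esub> \<alpha>)) i) x =
       ncmp (mcmp (app2 (externalisation C) \<beta>) i) x
         \<cdot>\<^bsub>app0 (app0 (externalisation C) (tgt (one (IntCat C)) (src (two (IntCat C)) \<alpha>))) i\<^esub>
       ncmp (mcmp (app2 (externalisation C) \<alpha>) i) x"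
      if e: "src (two (IntCat C)) \<beta> = tgt (two (IntCat C)) \<alpha>" and "i \<in> obj (one (op_twocat (loc_disc C)))"
        "x \<in> obj (app0 (app0 (externalisation C) (src (one (IntCat C)) (src (two (IntCat C)) \<alpha>))) i)" for i x
    proof -
      interpret b: intnat C "ifdom (indom \<alpha>)" "ifcod (indom \<alpha>)" "incod \<alpha>" "incod \<beta>" \<beta>
        using b e by (intro intnatI) auto
      show ?thesis using that by (simp add: a.F.B.icmp_cmp)
    qed
    show "ncmp (mcmp (app2 (externalisation C) (\<beta> \<star>\<^bsub>IntCat C\<^esub> \<alpha>)) i) x =
       ncmp (mcmp (app2 (externalisation C) \<beta>) i)
        (fob (tcmp (app1 (externalisation C) (tgt (two (IntCat C)) \<alpha>)) i) x)
         \<cdot>\<^bsub>app0 (app0 (externalisation C) (tgt (one (IntCat C)) (src (two (IntCat C)) \<beta>))) i\<^esub>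
       far (tcmp (app1 (externalisation C) (src (two (IntCat C)) \<beta>)) i) (ncmp (mcmp (app2 (externalisation C) \<alpha>) i) x)"
      if e: "src (one (IntCat C)) (src (two (IntCat C)) \<beta>) = tgt (one (IntCat C)) (src (two (IntCat C)) \<alpha>)"
        and "i \<in> obj (one (op_twocat (loc_disc C)))"
        "x \<in> obj (app0 (app0 (externalisation C) (src (one (IntCat C)) (src (two (IntCat C)) \<alpha>))) i)" for i x
    proof -
      interpret b: intnat C "ifcod (indom \<alpha>)" "ifcod (indom \<beta>)" "indom \<beta>" "incod \<beta>" \<beta>
        using b e by (intro intnatI) auto
      show ?thesis using that by (simp add: b.F.B.icmp_cmp assoc)
    qed
  qed auto
  then show ?thesis by (intro cat_functor.intro) auto
qed

text \<open>The Yoneda argument runs on generic elements: \<open>idt C (ob0 A)\<close> is the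
  generic object of \<open>A\<close> and \<open>idt C (ob1 A)\<close> its generic arrow. A
  transformation is determined by its values there, since every element arises from a generic one by
  reindexing along itself. The laws of internal functors and transformations are the ordinary ones
  read at the generic elements over \<open>ob0 A\<close>, \<open>ob1 A\<close> and
  \<open>ob2 C A\<close>.\<close>

lemma externalisation_two_fully_faithful:
  "two_fully_faithful (IntCat C) (CatFun (op_twocat (loc_disc C))) (externalisation C)"
  unfolding two_fully_faithful_def
proof (intro ballI)
  note c [simp] = category_axioms and [simp] = two_category_op two_category_loc_disc two_category_IntCat
  fix A B assume "A \<in> obj (one (IntCat C))" "B \<in> obj (one (IntCat C))"
  then interpret A: intcat C A + B: intcat C B by (auto intro: intcatI)
  let ?K = "op_twocat (loc_disc C)" and ?E = "externalisation C"
  interpret E: cat_functor "IntCat C" ?K ?E by (rule cat_functor_externalisation)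
  interpret EF: is_functor "homcat (IntCat C) A B" "homcat (CatFun ?K) (app0 ?E A) (app0 ?E B)" "app1 ?E" "app2 ?E"
    by (rule E.hom_functor) simp
  have inj1: "F = G" if F: "is_intfun C F" "ifdom F = A" "ifcod F = B" and G: "is_intfun C G" "ifdom G = A" "ifcod G = B"
    and eq: "ext1 C F = ext1 C G" for F G
  proof -
    interpret F: intfunctor C A B F using F by (intro intfunctorI) auto
    interpret G: intfunctor C A B G using G by (intro intfunctorI) auto
    have "if0 F = if0 G"
      using arg_cong[OF eq, of "\<lambda>t. fob (tcmp t (ob0 A)) (idt C (ob0 A))"] F G by simp
    moreover have "if1 F = if1 G"
      using arg_cong[OF eq, of "\<lambda>t. far (tcmp t (ob1 A)) (idt C (ob1 A))"] F G by simp
    ultimately show ?thesis using F G by (auto intro!: intfun.equality)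
  qed
  have surj1: "\<exists>F. is_intfun C F \<and> ifdom F = A \<and> ifcod F = B \<and> ext1 C F = \<tau>"
    if "is_tnat ?K \<tau>" "tdom \<tau> = ext0 C A" "tcod \<tau> = ext0 C B" for \<tau>
  proof -
    interpret t: cat_nat ?K "ext0 C A" "ext0 C B" \<tau> using that by (intro cat_natI) auto
    define F where "F = \<lparr>ifdom = A, ifcod = B, if0 = fob (tcmp \<tau> (ob0 A)) (idt C (ob0 A)), if1 = far (tcmp \<tau> (ob1 A)) (idt C (ob1 A))\<rparr>"
    have f0: "if0 F \<in> arr C" "src C (if0 F) = ob0 A" "tgt C (if0 F) = ob0 B"
      using t.cfun_map(1)[of "ob0 A" "idt C (ob0 A)"] by (auto simp: F_def)
    have f1: "if1 F \<in> arr C" "src C (if1 F) = ob1 A" "tgt C (if1 F) = ob1 B"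
      using t.cfun_map(2)[of "ob1 A" "idt C (ob1 A)"] by (auto simp: F_def)
    \<comment> \<open>Naturality along \<open>x\<close> itself, which reindexes the generic object
      to \<open>x\<close>.\<close>
    have t0: "fob (tcmp \<tau> (src C x)) x = if0 F \<cdot>\<^bsub>C\<^esub> x" if "x \<in> arr C" "tgt C x = ob0 A" for x
      using that t.natural(1)[of x "idt C (ob0 A)"] f0 by (simp add: F_def)
    have t1: "far (tcmp \<tau> (src C x)) x = if1 F \<cdot>\<^bsub>C\<^esub> x" if "x \<in> arr C" "tgt C x = ob1 A" for x
      using that t.natural(2)[of x "idt C (ob1 A)"] f1 by (simp add: F_def)
    have "is_intfun C F"
      unfolding is_intfun_def Let_def
    proof (intro conjI)
      show "internal_category C (ifdom F)" "internal_category C (ifcod F)"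
        by (simp_all add: F_def A.internal_category_axioms B.internal_category_axioms)
      show "if0 F \<in> hom C (ob0 (ifdom F)) (ob0 (ifcod F))" "if1 F \<in> hom C (ob1 (ifdom F)) (ob1 (ifcod F))"
        using f0 f1 by (simp_all add: hom_iff) (simp_all add: F_def)
      show "idom (ifcod F) \<cdot>\<^bsub>C\<^esub> if1 F = if0 F \<cdot>\<^bsub>C\<^esub> idom (ifdom F)"
        using t.cfun_map(3)[of "ob1 A" "idt C (ob1 A)"] t0[of "idom A"] by (simp add: F_def)
      show "icod (ifcod F) \<cdot>\<^bsub>C\<^esub> if1 F = if0 F \<cdot>\<^bsub>C\<^esub> icod (ifdom F)"
        using t.cfun_map(4)[of "ob1 A" "idt C (ob1 A)"] t0[of "icod A"] by (simp add: F_def)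
      show "if1 F \<cdot>\<^bsub>C\<^esub> iid (ifdom F) = iid (ifcod F) \<cdot>\<^bsub>C\<^esub> if0 F"
        using t.cfun_cmp(2)[of "ob0 A" "idt C (ob0 A)"] t1[of "iid A"] by (simp add: F_def)
      show "if1 F \<cdot>\<^bsub>C\<^esub> icomp (ifdom F) = icmp C (ifcod F) (if1 F \<cdot>\<^bsub>C\<^esub> pr1 (ifdom F)) (if1 F \<cdot>\<^bsub>C\<^esub> pr2 (ifdom F))"
        \<comment> \<open>Preservation of composition at the generic composable pair.\<close>
        using t.cfun_cmp(1)[of "ob2 C A" "pr2 A" "pr1 A"] t1[of "icomp A"] t1[of "pr1 A"] t1[of "pr2 A"]
        by (simp add: A.icmp_pr A.pullback_square) (simp add: F_def)
    qed
    moreover have "ifdom F = A" "ifcod F = B" by (auto simp: F_def)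
    moreover have "ext1 C F = \<tau>"
    proof (rule tnat_eqI)
      interpret F: intfunctor C A B F by (intro intfunctorI) (fact c calculation)+
      show "is_tnat ?K (ext1 C F)" by (rule F.is_tnat_ext1)
      show "fob (tcmp (ext1 C F) i) x = fob (tcmp \<tau> i) x" if "i \<in> obj (one ?K)" "x \<in> obj (app0 (tdom (ext1 C F)) i)" for i x
        using that t0[of x] by (auto simp: F.ifdom)
      show "far (tcmp (ext1 C F) i) x = far (tcmp \<tau> i) x" if "i \<in> obj (one ?K)" "x \<in> arr (app0 (tdom (ext1 C F)) i)" for i x
        using that t1[of x] by (auto simp: F.ifdom)
    qed (auto simp: t.tnat t.tdom t.tcod F_def)
    ultimately show ?thesis by blast
  qed
  have inj2: "\<sigma> = \<tau>" if s: "is_intnat C \<sigma>" "ifdom (indom \<sigma>) = A" "ifcod (indom \<sigma>) = B"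
    and t: "is_intnat C \<tau>" "ifdom (indom \<tau>) = A" "ifcod (indom \<tau>) = B"
    and eq: "ext2 C \<sigma> = ext2 C \<tau>" for \<sigma> \<tau>
  proof -
    interpret s: intnat C A B "indom \<sigma>" "incod \<sigma>" \<sigma> using s by (intro intnatI) auto
    interpret t: intnat C A B "indom \<tau>" "incod \<tau>" \<tau> using t by (intro intnatI) auto
    have "incmp \<sigma> = incmp \<tau>"
      using arg_cong[OF eq, of "\<lambda>t. ncmp (mcmp t (ob0 A)) (idt C (ob0 A))"] s t by simp
    moreover have "indom \<sigma> = indom \<tau>"
      using arg_cong[OF eq, of mdom] by (intro inj1) (auto simp: s.F.intfun t.F.intfun s.F.ifdom s.F.ifcod t.F.ifdom t.F.ifcod)
    moreover have "incod \<sigma> = incod \<tau>"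
      using arg_cong[OF eq, of mcod] by (intro inj1) (auto simp: s.G.intfun t.G.intfun s.G.ifdom s.G.ifcod t.G.ifdom t.G.ifcod)
    ultimately show ?thesis by (auto intro!: intnat.equality)
  qed
  have surj2: "\<exists>\<tau>. is_intnat C \<tau> \<and> ifdom (indom \<tau>) = A \<and> ifcod (indom \<tau>) = B \<and> ext2 C \<tau> = m"
    if "is_modif ?K m" "tdom (mdom m) = ext0 C A" "tcod (mdom m) = ext0 C B" for m
  proof -
    interpret m: cat_modif ?K "ext0 C A" "ext0 C B" "mdom m" "mcod m" m using that by (intro cat_modifI) auto
    obtain F where F: "is_intfun C F" "ifdom F = A" "ifcod F = B" "ext1 C F = mdom m"
      using surj1[OF m.S.tnat m.S.tdom m.S.tcod] by blast
    obtain G where G: "is_intfun C G" "ifdom G = A" "ifcod G = B" "ext1 C G = mcod m"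
      using surj1[OF m.T.tnat m.T.tdom m.T.tcod] by blast
    interpret F: intfunctor C A B F using F by (intro intfunctorI) auto
    interpret G: intfunctor C A B G using G by (intro intfunctorI) auto
    \<comment> \<open>The component is the value at the generic object; its naturality below is that
      of \<open>m\<close> at the generic arrow.\<close>
    define \<tau> where "\<tau> = \<lparr>indom = F, incod = G, incmp = ncmp (mcmp m (ob0 A)) (idt C (ob0 A))\<rparr>"
    have f0: "incmp \<tau> \<in> arr C" "src C (incmp \<tau>) = ob0 A" "tgt C (incmp \<tau>) = ob1 B"
      using m.cnat_map(1)[of "ob0 A" "idt C (ob0 A)"] by (auto simp: \<tau>_def)
    have t0: "ncmp (mcmp m (src C x)) x = incmp \<tau> \<cdot>\<^bsub>C\<^esub> x" if "x \<in> arr C" "tgt C x = ob0 A" for x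
      using that m.natural[of x "idt C (ob0 A)"] f0 by (simp add: \<tau>_def)
    have "is_intnat C \<tau>"
      unfolding is_intnat_def Let_def
    proof (intro conjI)
      show "incmp \<tau> \<in> hom C (ob0 (ifdom (indom \<tau>))) (ob1 (ifcod (indom \<tau>)))"
        using f0 F by (simp add: hom_iff) (simp add: \<tau>_def)
      show "idom (ifcod (indom \<tau>)) \<cdot>\<^bsub>C\<^esub> incmp \<tau> = if0 (indom \<tau>)"
        using m.cnat_map(2)[of "ob0 A" "idt C (ob0 A)"] F(2,3) by (simp add: \<tau>_def F(4)[symmetric])
      show "icod (ifcod (indom \<tau>)) \<cdot>\<^bsub>C\<^esub> incmp \<tau> = if0 (incod \<tau>)"
        using m.cnat_map(3)[of "ob0 A" "idt C (ob0 A)"] F(2,3) G(2,3) by (simp add: \<tau>_def G(4)[symmetric])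
      show "icmp C (ifcod (indom \<tau>)) (incmp \<tau> \<cdot>\<^bsub>C\<^esub> icod (ifdom (indom \<tau>))) (if1 (indom \<tau>)) =
        icmp C (ifcod (indom \<tau>)) (if1 (incod \<tau>)) (incmp \<tau> \<cdot>\<^bsub>C\<^esub> idom (ifdom (indom \<tau>)))"
        using m.cnat_natural[of "ob1 A" "idt C (ob1 A)"] F(2,3) G(2,3) t0[of "idom A"] t0[of "icod A"]
        by (simp add: F(4)[symmetric] G(4)[symmetric]) (simp add: \<tau>_def F(2,3))
    qed (use F G in \<open>simp_all add: \<tau>_def\<close>)
    moreover have "ifdom (indom \<tau>) = A" "ifcod (indom \<tau>) = B" using F by (auto simp: \<tau>_def)
    moreover have "ext2 C \<tau> = m"
    proof (rule modif_eqI)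
      interpret t: intnat C A B F G \<tau> using F G calculation by (intro intnatI) (auto simp: \<tau>_def)
      show "is_modif ?K (ext2 C \<tau>)" by (rule t.is_modif_ext2)
      show "ncmp (mcmp (ext2 C \<tau>) i) x = ncmp (mcmp m i) x"
        if "i \<in> obj (one ?K)" "x \<in> obj (app0 (tdom (mdom (ext2 C \<tau>))) i)" for i x
      proof -
        have "x \<in> arr C" "src C x = i" "tgt C x = ob0 A"
          using that by (simp_all add: t.indom F(4) m.S.tdom)
        then show ?thesis using that(1) t0[of x] F(2) by (auto simp: t.indom)
      qed
    qed (use that F G in \<open>simp_all add: \<tau>_def\<close>)
    ultimately show ?thesis by blast
  qed
  show "cat_iso (homcat (IntCat C) A B) (homcat (CatFun ?K) (app0 ?E A) (app0 ?E B)) (app1 ?E) (app2 ?E)"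
    unfolding cat_iso_def
  proof (intro conjI EF.is_functor_axioms)
    show "bij_betw (app1 ?E) (obj (homcat (IntCat C) A B)) (obj (homcat (CatFun ?K) (app0 ?E A) (app0 ?E B)))"
      unfolding bij_betw_def inj_on_def
      using inj1 EF.map_obj surj1 by (fastforce simp: homcat_CatFun)
    show "bij_betw (app2 ?E) (arr (homcat (IntCat C) A B)) (arr (homcat (CatFun ?K) (app0 ?E A) (app0 ?E B)))"
      unfolding bij_betw_def inj_on_def
      using inj2 EF.arr surj2 by (fastforce simp: homcat_CatFun)
  qed
qed

end

section \<open>Density of a fully faithful 2-functor with dense restriction\<close>

lemma two_fully_faithful_surj1:
  assumes V: "two_category V" and W: "two_category W" and ff: "two_fully_faithful W V E"
    and A: "A \<in> obj (one W)" and B: "B \<in> obj (one W)"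
    and y: "y \<in> arr (one V)" "src (one V) y = app0 E A" "tgt (one V) y = app0 E B"
  shows "\<exists>x. x \<in> arr (one W) \<and> src (one W) x = A \<and> tgt (one W) x = B \<and> app1 E x = y"
proof -
  have "bij_betw (app1 E) (obj (homcat W A B)) (obj (homcat V (app0 E A) (app0 E B)))"
    using ff A B by (auto simp: two_fully_faithful_def cat_iso_def)
  moreover have "y \<in> obj (homcat V (app0 E A) (app0 E B))" using y V by simp
  ultimately obtain x where "x \<in> obj (homcat W A B)" "y = app1 E x" by (auto dest!: bij_betw_imp_surj_on[symmetric])
  then show ?thesis using W by (intro exI[of _ x]) simp
qed

lemma two_fully_faithful_surj2:
  assumes V: "two_category V" and W: "two_category W" and ff: "two_fully_faithful W V E"
    and A: "A \<in> obj (one W)" and B: "B \<in> obj (one W)"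
    and y: "y \<in> arr (two V)" "src (one V) (src (two V) y) = app0 E A" "tgt (one V) (src (two V) y) = app0 E B"
  shows "\<exists>x. x \<in> arr (two W) \<and> src (one W) (src (two W) x) = A \<and> tgt (one W) (src (two W) x) = B \<and> app2 E x = y"
proof -
  have "bij_betw (app2 E) (arr (homcat W A B)) (arr (homcat V (app0 E A) (app0 E B)))"
    using ff A B by (auto simp: two_fully_faithful_def cat_iso_def)
  moreover have "y \<in> arr (homcat V (app0 E A) (app0 E B))" using y V by simp
  ultimately obtain x where "x \<in> arr (homcat W A B)" "y = app2 E x" by (auto dest!: bij_betw_imp_surj_on[symmetric])
  then show ?thesis using W by (intro exI[of _ x]) simp
qed

text \<open>Cells with domain \<open>E A\<close> are determined by their composites with cells \<open>E (J X) \<rightarrow> E A\<close>, all of which come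
  from \<open>W\<close>, where 2-naturality applies.\<close>

lemma dense_comp:
  assumes D: "two_category D" and W: "two_category W" and V: "two_category V"
    and J: "two_functor D W J" and E: "two_functor W V E" and ff: "two_fully_faithful W V E"
    and dense: "dense D V (twofun_comp E J)"
  shows "dense W V E"
  unfolding dense_def two_fully_faithful_def
proof (intro ballI)
  interpret D: two_category D by fact
  interpret W: two_category W by fact
  interpret V: two_category V by fact
  interpret J: two_functor D W J by fact
  interpret E: two_functor W V E by fact
  note [simp] = D W V
  note surj1 = two_fully_faithful_surj1[OF V W ff] and surj2 = two_fully_faithful_surj2[OF V W ff]
  let ?EJ = "twofun_comp E J" and ?N = "nerve W V E" and ?M = "nerve D V (twofun_comp E J)"
  have EJ: "two_functor D V ?EJ" by (rule two_functor_comp[OF D W J E])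
  have [simp]: "app0 ?EJ X = app0 E (app0 J X)" "app1 ?EJ u = app1 E (app1 J u)" "app2 ?EJ \<theta> = app2 E (app2 J \<theta>)" for X u \<theta>
    by (simp_all add: twofun_comp_def)
  interpret N: cat_functor V "op_twocat W" ?N by (rule cat_functor_nerve[OF W V E])
  interpret M: cat_functor V "op_twocat D" ?M by (rule cat_functor_nerve[OF D V EJ])
  note dn = dense[unfolded dense_def]
  note opD = two_category_op[OF D] and opW = two_category_op[OF W]
  \<comment> \<open>Equality of 1-cells is tested on nerves, whose components act on objects and on
    arrows of hom-categories; hence one test with 1-cells and one with 2-cells. Fullness of
    \<open>E\<close> lets the tests range over cells of \<open>W\<close>.\<close>
  have detect1: "h = h'" if h: "h \<in> arr (one V)" "h' \<in> arr (one V)" "src (one V) h = app0 E A" "src (one V) h' = app0 E A"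
      "tgt (one V) h' = tgt (one V) h"
    and A: "A \<in> obj (one W)"
    and 1: "\<And>X x. X \<in> obj (one D) \<Longrightarrow> x \<in> arr (one W) \<Longrightarrow> src (one W) x = app0 J X \<Longrightarrow> tgt (one W) x = A \<Longrightarrow>
      h \<cdot>\<^bsub>one V\<^esub> app1 E x = h' \<cdot>\<^bsub>one V\<^esub> app1 E x"
    and 2: "\<And>X \<xi>. X \<in> obj (one D) \<Longrightarrow> \<xi> \<in> arr (two W) \<Longrightarrow> src (one W) (src (two W) \<xi>) = app0 J X \<Longrightarrow>
      tgt (one W) (src (two W) \<xi>) = A \<Longrightarrow> idt (two V) h \<star>\<^bsub>V\<^esub> app2 E \<xi> = idt (two V) h' \<star>\<^bsub>V\<^esub> app2 E \<xi>" for h h' A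
  proof -
    have "nerve1 D V ?EJ h = nerve1 D V ?EJ h'"
    proof (rule tnat_eqI)
      show "is_tnat (op_twocat D) (nerve1 D V ?EJ h)" "is_tnat (op_twocat D) (nerve1 D V ?EJ h')"
        using h by (auto intro!: is_tnat_nerve1 EJ)
    next
      fix X y assume X: "X \<in> obj (one (op_twocat D))" and y: "y \<in> obj (app0 (tdom (nerve1 D V ?EJ h)) X)"
      then obtain x where "x \<in> arr (one W)" "src (one W) x = app0 J X" "tgt (one W) x = A" "app1 E x = y"
        using surj1[of "app0 J X" A y] h A by auto
      then show "fob (tcmp (nerve1 D V ?EJ h) X) y = fob (tcmp (nerve1 D V ?EJ h') X) y"
        using X 1[of X x] h by auto
    next
      fix X y assume X: "X \<in> obj (one (op_twocat D))" and y: "y \<in> arr (app0 (tdom (nerve1 D V ?EJ h)) X)"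
      then obtain x where "x \<in> arr (two W)" "src (one W) (src (two W) x) = app0 J X" "tgt (one W) (src (two W) x) = A" "app2 E x = y"
        using surj2[of "app0 J X" A y] h A by auto
      then show "far (tcmp (nerve1 D V ?EJ h) X) y = far (tcmp (nerve1 D V ?EJ h') X) y"
        using X 2[of X x] h by auto
    qed (use h in simp_all)
    then show ?thesis using h by (intro two_fully_faithful_inj1[OF V dn, of h h']) auto
  qed
  \<comment> \<open>The nerve of a 2-cell has components at 1-cells only, so a single test remains
    once the boundaries agree.\<close>
  have detect2: "\<delta> = \<delta>'" if d: "\<delta> \<in> arr (two V)" "\<delta>' \<in> arr (two V)" "src (two V) \<delta> = src (two V) \<delta>'" "tgt (two V) \<delta> = tgt (two V) \<delta>'"
      "src (one V) (src (two V) \<delta>') = app0 E A"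
    and A: "A \<in> obj (one W)"
    and 1: "\<And>X x. X \<in> obj (one D) \<Longrightarrow> x \<in> arr (one W) \<Longrightarrow> src (one W) x = app0 J X \<Longrightarrow> tgt (one W) x = A \<Longrightarrow>
      \<delta> \<star>\<^bsub>V\<^esub> idt (two V) (app1 E x) = \<delta>' \<star>\<^bsub>V\<^esub> idt (two V) (app1 E x)" for \<delta> \<delta>' A
  proof -
    have "nerve2 D V ?EJ \<delta> = nerve2 D V ?EJ \<delta>'"
    proof (rule modif_eqI)
      show "is_modif (op_twocat D) (nerve2 D V ?EJ \<delta>)" "is_modif (op_twocat D) (nerve2 D V ?EJ \<delta>')"
        using d by (auto intro!: is_modif_nerve2 EJ)
    next
      fix X y assume X: "X \<in> obj (one (op_twocat D))" and y: "y \<in> obj (app0 (tdom (mdom (nerve2 D V ?EJ \<delta>))) X)"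
      then obtain x where "x \<in> arr (one W)" "src (one W) x = app0 J X" "tgt (one W) x = A" "app1 E x = y"
        using surj1[of "app0 J X" A y] d A by auto
      then show "ncmp (mcmp (nerve2 D V ?EJ \<delta>) X) y = ncmp (mcmp (nerve2 D V ?EJ \<delta>') X) y"
        using X 1[of X x] d by auto
    qed (use d in simp_all)
    then show ?thesis using d by (intro two_fully_faithful_inj2[OF V dn, of \<delta> \<delta>']) auto
  qed
  fix B B' assume B: "B \<in> obj (one V)" and B': "B' \<in> obj (one V)"
  \<comment> \<open>The nerve of \<open>E\<close> restricts along \<open>J\<close> to the nerve of
    the composite, so injectivity is inherited from the latter.\<close>
  have res1: "nerve1 D V ?EJ f = nerve1 D V ?EJ g"
    if "nerve1 W V E f = nerve1 W V E g" "src (one V) f = B" "tgt (one V) f = B'" "src (one V) g = B" "tgt (one V) g = B'" for f g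
  proof -
    have "hom_post V (app0 E A) f = hom_post V (app0 E A) g" if "A \<in> obj (one W)" for A
      using \<open>nerve1 W V E f = nerve1 W V E g\<close> that by (metis nerve1_simps(3))
    then show ?thesis using that by (auto simp: nerve1_def intro!: restrict_ext)
  qed
  have res2: "nerve2 D V ?EJ \<alpha> = nerve2 D V ?EJ \<beta>"
    if "nerve2 W V E \<alpha> = nerve2 W V E \<beta>" "src (two V) \<alpha> = src (two V) \<beta>" "tgt (two V) \<alpha> = tgt (two V) \<beta>" for \<alpha> \<beta>
  proof -
    have "hom_post2 V (app0 E A) \<alpha> = hom_post2 V (app0 E A) \<beta>" if "A \<in> obj (one W)" for A
      using \<open>nerve2 W V E \<alpha> = nerve2 W V E \<beta>\<close> that by (metis nerve1_simps(6))
    then show ?thesis using that by (auto simp: nerve2_def intro!: restrict_ext)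
  qed
  have inj1: "f = g" if "f \<in> arr (one V)" "src (one V) f = B" "tgt (one V) f = B'"
    "g \<in> arr (one V)" "src (one V) g = B" "tgt (one V) g = B'" "nerve1 W V E f = nerve1 W V E g" for f g
    using that res1[of f g] by (intro two_fully_faithful_inj1[OF V dn, of f g]) auto
  have ex1: "\<exists>f. f \<in> arr (one V) \<and> src (one V) f = B \<and> tgt (one V) f = B' \<and> nerve1 W V E f = \<tau>"
    if "cat_nat (op_twocat W) (nerve0 V E B) (nerve0 V E B') \<tau>" for \<tau>
  proof -
    interpret t: cat_nat "op_twocat W" "nerve0 V E B" "nerve0 V E B'" \<tau> by fact
    \<comment> \<open>Restriction of \<open>\<tau>\<close> along \<open>J\<close>. Density of the
      composite turns it into a 1-cell \<open>f\<close>, the candidate preimage of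
      \<open>\<tau>\<close>.\<close>
    define \<rho> where "\<rho> = \<lparr>tdom = nerve0 V ?EJ B, tcod = nerve0 V ?EJ B', tcmp = (\<lambda>X \<in> obj (one D). tcmp \<tau> (app0 J X))\<rparr>"
    have "is_tnat (op_twocat D) \<rho>"
    proof (rule is_tnatI)
      fix u x assume "u \<in> arr (one (op_twocat D))" "x \<in> obj (app0 (tdom \<rho>) (src (one (op_twocat D)) u))"
      then show "fob (tcmp \<rho> (tgt (one (op_twocat D)) u)) (fob (app1 (tdom \<rho>) u) x) =
        fob (app1 (tcod \<rho>) u) (fob (tcmp \<rho> (src (one (op_twocat D)) u)) x)"
        using t.natural(1)[of "app1 J u" x] by (simp add: \<rho>_def)
    next
      fix u x assume "u \<in> arr (one (op_twocat D))" "x \<in> arr (app0 (tdom \<rho>) (src (one (op_twocat D)) u))"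
      then show "far (tcmp \<rho> (tgt (one (op_twocat D)) u)) (far (app1 (tdom \<rho>) u) x) =
        far (app1 (tcod \<rho>) u) (far (tcmp \<rho> (src (one (op_twocat D)) u)) x)"
        using t.natural(2)[of "app1 J u" x] by (simp add: \<rho>_def)
    next
      fix \<theta> x assume "\<theta> \<in> arr (two (op_twocat D))" "x \<in> obj (app0 (tdom \<rho>) (src (one (op_twocat D)) (src (two (op_twocat D)) \<theta>)))"
      then show "far (tcmp \<rho> (tgt (one (op_twocat D)) (src (two (op_twocat D)) \<theta>))) (ncmp (app2 (tdom \<rho>) \<theta>) x) =
        ncmp (app2 (tcod \<rho>) \<theta>) (fob (tcmp \<rho> (src (one (op_twocat D)) (src (two (op_twocat D)) \<theta>))) x)"
        using t.natural2[of "app2 J \<theta>" x] by (simp add: \<rho>_def)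
    next
      fix X assume "X \<in> obj (one (op_twocat D))"
      then show "is_cfun (tcmp \<rho> X) \<and> fdom (tcmp \<rho> X) = app0 (tdom \<rho>) X \<and> fcod (tcmp \<rho> X) = app0 (tcod \<rho>) X"
        using t.cfun[of "app0 J X"] by (simp add: \<rho>_def)
    qed (auto simp: \<rho>_def opD two_functor_nerve0[OF D V EJ] B B')
    then obtain f where f: "f \<in> arr (one V)" "src (one V) f = B" "tgt (one V) f = B'" "nerve1 D V ?EJ f = \<rho>"
      using dn[unfolded two_fully_faithful_def cat_iso_def, rule_format, OF B B'] B B'
      by (auto simp: homcat_CatFun \<rho>_def dest!: bij_betw_imp_surj_on[THEN equalityD2, THEN subsetD[of _ _ \<rho>]])
    have post: "tcmp \<tau> (app0 J X) = hom_post V (app0 E (app0 J X)) f" if "X \<in> obj (one D)" for X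
      using arg_cong[OF f(4), of "\<lambda>t. tcmp t X"] that by (simp add: \<rho>_def)
    \<comment> \<open>At the objects \<open>J X\<close> the component of \<open>\<tau>\<close> is
      postcomposition with \<open>f\<close> by construction. At an arbitrary \<open>A\<close> the
      two are compared after precomposing with cells \<open>E x\<close> out of such objects, where
      naturality of \<open>\<tau>\<close> moves the comparison to \<open>J X\<close>.\<close>
    have ob: "fob (tcmp \<tau> A) g = f \<cdot>\<^bsub>one V\<^esub> g"
      if A: "A \<in> obj (one W)" and g: "g \<in> arr (one V)" "src (one V) g = app0 E A" "tgt (one V) g = B" for A g
    proof (rule detect1)
      have t: "fob (tcmp \<tau> A) g \<in> arr (one V)" "src (one V) (fob (tcmp \<tau> A) g) = app0 E A" "tgt (one V) (fob (tcmp \<tau> A) g) = B'"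
        using t.cfun_map(1)[of A g] A g by auto
      show "fob (tcmp \<tau> A) g \<in> arr (one V)" "src (one V) (fob (tcmp \<tau> A) g) = app0 E A" "A \<in> obj (one W)"
        "f \<cdot>\<^bsub>one V\<^esub> g \<in> arr (one V)" "src (one V) (f \<cdot>\<^bsub>one V\<^esub> g) = app0 E A"
        "tgt (one V) (f \<cdot>\<^bsub>one V\<^esub> g) = tgt (one V) (fob (tcmp \<tau> A) g)"
        using t f g A by auto
      show "fob (tcmp \<tau> A) g \<cdot>\<^bsub>one V\<^esub> app1 E x = f \<cdot>\<^bsub>one V\<^esub> g \<cdot>\<^bsub>one V\<^esub> app1 E x"
        if "X \<in> obj (one D)" "x \<in> arr (one W)" "src (one W) x = app0 J X" "tgt (one W) x = A" for X x
        using t.natural(1)[of x g] that f g t by (auto simp: post V.one.assoc)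
      \<comment> \<open>The test with 2-cells is where compatibility of \<open>\<tau>\<close> with
        2-cells of \<open>W\<close> enters.\<close>
      show "idt (two V) (fob (tcmp \<tau> A) g) \<star>\<^bsub>V\<^esub> app2 E \<xi> = idt (two V) (f \<cdot>\<^bsub>one V\<^esub> g) \<star>\<^bsub>V\<^esub> app2 E \<xi>"
        if "X \<in> obj (one D)" "\<xi> \<in> arr (two W)" "src (one W) (src (two W) \<xi>) = app0 J X" "tgt (one W) (src (two W) \<xi>) = A" for X \<xi>
        using t.natural2[of \<xi> g] that f g t V.hassoc[of "app2 E \<xi>" "idt (two V) g" "idt (two V) f"]
        by (auto simp: post V.idt_hcmp_idt)
    qed
    have "nerve1 W V E f = \<tau>"
    proof (rule tnat_eqI)
      show "is_tnat (op_twocat W) (nerve1 W V E f)" by (rule is_tnat_nerve1) (auto simp: f E)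
      show "is_tnat (op_twocat W) \<tau>" by (rule t.tnat)
    next
      fix A g assume "A \<in> obj (one (op_twocat W))" "g \<in> obj (app0 (tdom (nerve1 W V E f)) A)"
      then show "fob (tcmp (nerve1 W V E f) A) g = fob (tcmp \<tau> A) g"
        using ob[of A g] f by simp
    next
      fix A \<gamma> assume A: "A \<in> obj (one (op_twocat W))" and "\<gamma> \<in> arr (app0 (tdom (nerve1 W V E f)) A)"
      then have g: "\<gamma> \<in> arr (two V)" "src (one V) (src (two V) \<gamma>) = app0 E A" "tgt (one V) (src (two V) \<gamma>) = B" and A': "A \<in> obj (one W)"
        using f by auto
      have t: "far (tcmp \<tau> A) \<gamma> \<in> arr (two V)" "src (two V) (far (tcmp \<tau> A) \<gamma>) = f \<cdot>\<^bsub>one V\<^esub> src (two V) \<gamma>"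
        "tgt (two V) (far (tcmp \<tau> A) \<gamma>) = f \<cdot>\<^bsub>one V\<^esub> tgt (two V) \<gamma>"
        using t.cfun_map(2-4)[of A \<gamma>] A g ob[of A "src (two V) \<gamma>"] ob[of A "tgt (two V) \<gamma>"] by auto
      \<comment> \<open>By \<open>ob\<close> both sides have the same boundary, so
        \<open>detect2\<close> applies.\<close>
      have "far (tcmp \<tau> A) \<gamma> = idt (two V) f \<star>\<^bsub>V\<^esub> \<gamma>"
      proof (rule detect2)
        show "far (tcmp \<tau> A) \<gamma> \<in> arr (two V)" "idt (two V) f \<star>\<^bsub>V\<^esub> \<gamma> \<in> arr (two V)"
          "src (two V) (far (tcmp \<tau> A) \<gamma>) = src (two V) (idt (two V) f \<star>\<^bsub>V\<^esub> \<gamma>)"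
          "tgt (two V) (far (tcmp \<tau> A) \<gamma>) = tgt (two V) (idt (two V) f \<star>\<^bsub>V\<^esub> \<gamma>)"
          "src (one V) (src (two V) (idt (two V) f \<star>\<^bsub>V\<^esub> \<gamma>)) = app0 E A" "A \<in> obj (one W)"
          using t f g A by auto
        show "far (tcmp \<tau> A) \<gamma> \<star>\<^bsub>V\<^esub> idt (two V) (app1 E x) = (idt (two V) f \<star>\<^bsub>V\<^esub> \<gamma>) \<star>\<^bsub>V\<^esub> idt (two V) (app1 E x)"
          if "X \<in> obj (one D)" "x \<in> arr (one W)" "src (one W) x = app0 J X" "tgt (one W) x = A" for X x
          using t.natural(2)[of x \<gamma>] that f g t by (auto simp: post V.hassoc)
      qed
      then show "far (tcmp (nerve1 W V E f) A) \<gamma> = far (tcmp \<tau> A) \<gamma>" using A g f by simp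
    qed (auto simp: f t.tdom t.tcod)
    then show ?thesis using f by blast
  qed
  have inj2: "\<alpha> = \<beta>" if a: "\<alpha> \<in> arr (two V)" "src (one V) (src (two V) \<alpha>) = B" "tgt (one V) (src (two V) \<alpha>) = B'"
    and b: "\<beta> \<in> arr (two V)" "src (one V) (src (two V) \<beta>) = B" "tgt (one V) (src (two V) \<beta>) = B'"
    and eq: "nerve2 W V E \<alpha> = nerve2 W V E \<beta>" for \<alpha> \<beta>
  proof -
    have "src (two V) \<alpha> = src (two V) \<beta>"
      using arg_cong[OF eq, of mdom] a b by (intro inj1) auto
    moreover have "tgt (two V) \<alpha> = tgt (two V) \<beta>"
      using arg_cong[OF eq, of mcod] a b by (intro inj1) auto
    ultimately show ?thesis
      using a b res2[OF eq] by (intro two_fully_faithful_inj2[OF V dn, of \<alpha> \<beta>]) auto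
  qed
  have ex2: "\<exists>\<theta>. \<theta> \<in> arr (two V) \<and> src (one V) (src (two V) \<theta>) = B \<and> tgt (one V) (src (two V) \<theta>) = B' \<and> nerve2 W V E \<theta> = m"
    if m: "is_modif (op_twocat W) m" "tdom (mdom m) = nerve0 V E B" "tcod (mdom m) = nerve0 V E B'" for m
  proof -
    interpret m: cat_modif "op_twocat W" "nerve0 V E B" "nerve0 V E B'" "mdom m" "mcod m" m
      using m by (intro cat_modifI opW) auto
    obtain f where f: "f \<in> arr (one V)" "src (one V) f = B" "tgt (one V) f = B'" "nerve1 W V E f = mdom m"
      using ex1[OF m.S.cat_nat_axioms] by blast
    obtain g where g: "g \<in> arr (one V)" "src (one V) g = B" "tgt (one V) g = B'" "nerve1 W V E g = mcod m"
      using ex1[OF m.T.cat_nat_axioms] by blast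
    have mf: "tcmp (mdom m) A = hom_post V (app0 E A) f" "tcmp (mcod m) A = hom_post V (app0 E A) g" if "A \<in> obj (one W)" for A
      using that by (simp_all add: f(4)[symmetric] g(4)[symmetric])
    \<comment> \<open>The boundary cells \<open>f\<close> and \<open>g\<close> are already found, so
      the restricted modification is placed directly between their nerves.\<close>
    define n where "n = \<lparr>mdom = nerve1 D V ?EJ f, mcod = nerve1 D V ?EJ g, mcmp = (\<lambda>X \<in> obj (one D). mcmp m (app0 J X))\<rparr>"
    have "is_modif (op_twocat D) n"
    proof (rule is_modifI)
      fix X assume "X \<in> obj (one (op_twocat D))"
      then show "is_cnat (mcmp n X) \<and> ndom (mcmp n X) = tcmp (mdom n) X \<and> ncod (mcmp n X) = tcmp (mcod n) X"
        using m.cnat[of "app0 J X"] by (simp add: n_def mf)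
    next
      fix u x assume "u \<in> arr (one (op_twocat D))" "x \<in> obj (app0 (tdom (mdom n)) (src (one (op_twocat D)) u))"
      then show "ncmp (mcmp n (tgt (one (op_twocat D)) u)) (fob (app1 (tdom (mdom n)) u) x) =
        far (app1 (tcod (mdom n)) u) (ncmp (mcmp n (src (one (op_twocat D)) u)) x)"
        using m.natural[of "app1 J u" x] by (simp add: n_def f)
    qed (use f g in \<open>auto simp: n_def opD intro!: is_tnat_nerve1 EJ\<close>)
    then obtain \<theta> where th: "\<theta> \<in> arr (two V)" "src (one V) (src (two V) \<theta>) = B" "tgt (one V) (src (two V) \<theta>) = B'" "nerve2 D V ?EJ \<theta> = n"
      using dn[unfolded two_fully_faithful_def cat_iso_def, rule_format, OF B B'] B B' f
      by (auto simp: homcat_CatFun n_def dest!: bij_betw_imp_surj_on[THEN equalityD2, THEN subsetD[of _ _ n]])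
    have "nerve1 D V ?EJ (src (two V) \<theta>) = nerve1 D V ?EJ f" "nerve1 D V ?EJ (tgt (two V) \<theta>) = nerve1 D V ?EJ g"
      using arg_cong[OF th(4), of mdom] arg_cong[OF th(4), of mcod] by (simp_all add: n_def)
    then have st: "src (two V) \<theta> = f" "tgt (two V) \<theta> = g"
      using th(1-3) f g by (auto intro!: two_fully_faithful_inj1[OF V dn])
    have post: "mcmp m (app0 J X) = hom_post2 V (app0 E (app0 J X)) \<theta>" if "X \<in> obj (one D)" for X
      using arg_cong[OF th(4), of "\<lambda>t. mcmp t X"] that by (simp add: n_def)
    have "nerve2 W V E \<theta> = m"
    proof (rule modif_eqI)
      show "is_modif (op_twocat W) (nerve2 W V E \<theta>)" by (rule is_modif_nerve2) (auto simp: th E)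
      show "is_modif (op_twocat W) m" by (rule m.modif)
    next
      fix A h assume A: "A \<in> obj (one (op_twocat W))" and "h \<in> obj (app0 (tdom (mdom (nerve2 W V E \<theta>))) A)"
      then have h: "h \<in> arr (one V)" "src (one V) h = app0 E A" "tgt (one V) h = B" and A': "A \<in> obj (one W)"
        using f(1-3) st by auto
      have c: "ncmp (mcmp m A) h \<in> arr (two V)" "src (two V) (ncmp (mcmp m A) h) = f \<cdot>\<^bsub>one V\<^esub> h"
        "tgt (two V) (ncmp (mcmp m A) h) = g \<cdot>\<^bsub>one V\<^esub> h"
        using m.cnat_map[of A h] A' h f g by (auto simp: mf)
      have "ncmp (mcmp m A) h = \<theta> \<star>\<^bsub>V\<^esub> idt (two V) h"
      proof (rule detect2)
        show "ncmp (mcmp m A) h \<in> arr (two V)" "\<theta> \<star>\<^bsub>V\<^esub> idt (two V) h \<in> arr (two V)"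
          "src (two V) (ncmp (mcmp m A) h) = src (two V) (\<theta> \<star>\<^bsub>V\<^esub> idt (two V) h)"
          "tgt (two V) (ncmp (mcmp m A) h) = tgt (two V) (\<theta> \<star>\<^bsub>V\<^esub> idt (two V) h)"
          "src (one V) (src (two V) (\<theta> \<star>\<^bsub>V\<^esub> idt (two V) h)) = app0 E A" "A \<in> obj (one W)"
          using c th h A' st f by auto
        show "ncmp (mcmp m A) h \<star>\<^bsub>V\<^esub> idt (two V) (app1 E x) = (\<theta> \<star>\<^bsub>V\<^esub> idt (two V) h) \<star>\<^bsub>V\<^esub> idt (two V) (app1 E x)"
          if "X \<in> obj (one D)" "x \<in> arr (one W)" "src (one W) x = app0 J X" "tgt (one W) x = A" for X x
          using m.natural[of x h] that f g h c th st by (auto simp: post V.hassoc V.idt_hcmp_idt)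
      qed
      then show "ncmp (mcmp (nerve2 W V E \<theta>) A) h = ncmp (mcmp m A) h" using A' h f st by simp
    qed (use f g st in auto)
    then show ?thesis using th by blast
  qed
  interpret NF: is_functor "homcat V B B'" "homcat (CatFun (op_twocat W)) (app0 ?N B) (app0 ?N B')" "app1 ?N" "app2 ?N"
    by (rule N.hom_functor) simp
  show "cat_iso (homcat V B B') (homcat (CatFun (op_twocat W)) (app0 ?N B) (app0 ?N B')) (app1 ?N) (app2 ?N)"
    unfolding cat_iso_def
  proof (intro conjI NF.is_functor_axioms)
    have s: "\<tau> \<in> app1 ?N ` obj (homcat V B B')" if "\<tau> \<in> obj (homcat (CatFun (op_twocat W)) (app0 ?N B) (app0 ?N B'))" for \<tau>
      using ex1[OF cat_natI[OF opW, of \<tau>]] that by (auto simp: homcat_CatFun image_iff)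
    then show "bij_betw (app1 ?N) (obj (homcat V B B')) (obj (homcat (CatFun (op_twocat W)) (app0 ?N B) (app0 ?N B')))"
      unfolding bij_betw_def inj_on_def using inj1 NF.map_obj by auto
    have s: "m \<in> app2 ?N ` arr (homcat V B B')" if "m \<in> arr (homcat (CatFun (op_twocat W)) (app0 ?N B) (app0 ?N B'))" for m
      using ex2[of m] that by (auto simp: homcat_CatFun image_iff)
    then show "bij_betw (app2 ?N) (arr (homcat V B B')) (arr (homcat (CatFun (op_twocat W)) (app0 ?N B) (app0 ?N B')))"
      unfolding bij_betw_def inj_on_def using inj2 NF.arr by auto
  qed
qed

section \<open>Pullbacks and arrow objects from finite weighted limits\<close>

lemma conerve_simps [simp]:
  "app0 (conerve0 W D X) i = homcat W X (app0 D i)"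
  "app1 (conerve0 W D X) u = hom_post W X (app1 D u)"
  "app2 (conerve0 W D X) \<theta> = hom_post2 W X (app2 D \<theta>)"
  "tdom (conerve1 J W D f) = conerve0 W D (tgt (one W) f)" "tcod (conerve1 J W D f) = conerve0 W D (src (one W) f)"
  "i \<in> obj (one J) \<Longrightarrow> tcmp (conerve1 J W D f) i = hom_pre W (app0 D i) f"
  by (simp_all add: conerve0_def conerve1_def)

text \<open>A conerve is a nerve in the opposite 2-category, so the laws need no second
  verification.\<close>

lemma two_functor_conerve0:
  assumes J: "two_category J" and W: "two_category W" and D: "two_functor J W D" and X: "X \<in> obj (one W)"
  shows "two_functor J Cat (conerve0 W D X)"
proof -
  have "nerve0 (op_twocat W) D X = conerve0 W D X"
    by (simp add: nerve0_def conerve0_def homcat_op two_category.hom_pre_op two_category_op W)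
  then show ?thesis
    using two_functor_nerve0[OF two_category_op[OF J] two_category_op[OF W] two_functor_op[OF J D], of X] X by simp
qed

text \<open>The bijection on 1-cells contained in the universal property, split into existence and
  uniqueness of \<open>v\<close> and expressed by the elements of the limiting cone
  \<open>u\<close>; pullbacks and arrow objects are read off from this form.\<close>

lemma weighted_limitE:
  assumes W: "two_category W" and J: "two_category J" and lim: "is_weighted_limit W J \<Phi> D L u"
  shows "L \<in> obj (one W)" "cat_nat J \<Phi> (conerve0 W D L) u"
    and "\<And>t X. cat_nat J \<Phi> (conerve0 W D X) t \<Longrightarrow> X \<in> obj (one W) \<Longrightarrow>
      \<exists>v \<in> arr (one W). src (one W) v = X \<and> tgt (one W) v = L \<and>
        (\<forall>i \<in> obj (one J). (\<forall>x \<in> obj (app0 \<Phi> i). fob (tcmp u i) x \<cdot>\<^bsub>one W\<^esub> v = fob (tcmp t i) x) \<and>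
          (\<forall>f \<in> arr (app0 \<Phi> i). far (tcmp u i) f \<star>\<^bsub>W\<^esub> idt (two W) v = far (tcmp t i) f))"
    and "\<And>v w. v \<in> arr (one W) \<Longrightarrow> w \<in> arr (one W) \<Longrightarrow> src (one W) v = src (one W) w \<Longrightarrow>
      tgt (one W) v = L \<Longrightarrow> tgt (one W) w = L \<Longrightarrow>
      (\<And>i x. i \<in> obj (one J) \<Longrightarrow> x \<in> obj (app0 \<Phi> i) \<Longrightarrow> fob (tcmp u i) x \<cdot>\<^bsub>one W\<^esub> v = fob (tcmp u i) x \<cdot>\<^bsub>one W\<^esub> w) \<Longrightarrow>
      (\<And>i f. i \<in> obj (one J) \<Longrightarrow> f \<in> arr (app0 \<Phi> i) \<Longrightarrow>
        far (tcmp u i) f \<star>\<^bsub>W\<^esub> idt (two W) v = far (tcmp u i) f \<star>\<^bsub>W\<^esub> idt (two W) w) \<Longrightarrow> v = w"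
proof -
  interpret W: two_category W by fact
  note [simp] = W
  have u: "is_tnat J u" "tdom u = \<Phi>" "tcod u = conerve0 W D L" and L: "L \<in> obj (one W)"
    and iso: "\<And>X. X \<in> obj (one W) \<Longrightarrow> cat_iso (homcat W X L) (tnat_cat J \<Phi> (conerve0 W D X))
          (\<lambda>f. tnat_comp J (conerve1 J W D f) u)
          (\<lambda>\<alpha>. modif_hcomp J (conerve2 J W D \<alpha>) (modif_id J u))"
    using lim by (auto simp: is_weighted_limit_def)
  show "L \<in> obj (one W)" by fact
  show "cat_nat J \<Phi> (conerve0 W D L) u" using J u by (intro cat_natI)
  then interpret u: cat_nat J \<Phi> "conerve0 W D L" u .
  have comp: "fob (tcmp (tnat_comp J (conerve1 J W D v) u) i) x = fob (tcmp u i) x \<cdot>\<^bsub>one W\<^esub> v"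
    if "v \<in> arr (one W)" "tgt (one W) v = L" "i \<in> obj (one J)" "x \<in> obj (app0 \<Phi> i)" for v i x
    using that u.cfun_map(1)[of i x] by auto
  have comp': "far (tcmp (tnat_comp J (conerve1 J W D v) u) i) x = far (tcmp u i) x \<star>\<^bsub>W\<^esub> idt (two W) v"
    if "v \<in> arr (one W)" "tgt (one W) v = L" "i \<in> obj (one J)" "x \<in> arr (app0 \<Phi> i)" for v i x
    using that u.cfun_map(2)[of i x] by auto
  show "\<exists>v \<in> arr (one W). src (one W) v = X \<and> tgt (one W) v = L \<and>
        (\<forall>i \<in> obj (one J). (\<forall>x \<in> obj (app0 \<Phi> i). fob (tcmp u i) x \<cdot>\<^bsub>one W\<^esub> v = fob (tcmp t i) x) \<and>
          (\<forall>f \<in> arr (app0 \<Phi> i). far (tcmp u i) f \<star>\<^bsub>W\<^esub> idt (two W) v = far (tcmp t i) f))"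
    if t: "cat_nat J \<Phi> (conerve0 W D X) t" and X: "X \<in> obj (one W)" for t X
  proof -
    interpret t: cat_nat J \<Phi> "conerve0 W D X" t by fact
    have "t \<in> obj (tnat_cat J \<Phi> (conerve0 W D X))" by (simp add: t.tnat t.tdom t.tcod)
    moreover have "bij_betw (\<lambda>f. tnat_comp J (conerve1 J W D f) u) (obj (homcat W X L)) (obj (tnat_cat J \<Phi> (conerve0 W D X)))"
      using iso[OF X] by (simp add: cat_iso_def)
    ultimately obtain v where v: "v \<in> obj (homcat W X L)" "t = tnat_comp J (conerve1 J W D v) u"
      by (metis (no_types, lifting) bij_betw_imp_surj_on imageE)
    show ?thesis
      using v comp[of v] comp'[of v] by (intro bexI[of _ v]) auto
  qed
  show "v = w" if v: "v \<in> arr (one W)" "w \<in> arr (one W)" "src (one W) v = src (one W) w" "tgt (one W) v = L" "tgt (one W) w = L"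
    and e0: "\<And>i x. i \<in> obj (one J) \<Longrightarrow> x \<in> obj (app0 \<Phi> i) \<Longrightarrow> fob (tcmp u i) x \<cdot>\<^bsub>one W\<^esub> v = fob (tcmp u i) x \<cdot>\<^bsub>one W\<^esub> w"
    and e1: "\<And>i f. i \<in> obj (one J) \<Longrightarrow> f \<in> arr (app0 \<Phi> i) \<Longrightarrow>
        far (tcmp u i) f \<star>\<^bsub>W\<^esub> idt (two W) v = far (tcmp u i) f \<star>\<^bsub>W\<^esub> idt (two W) w" for v w
  proof -
    define X where "X = src (one W) w"
    have X: "X \<in> obj (one W)" using v by (simp add: X_def)
    have vw: "v \<in> obj (homcat W X L)" "w \<in> obj (homcat W X L)" using v by (simp_all add: X_def)
    have "is_functor (homcat W X L) (tnat_cat J \<Phi> (conerve0 W D X))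
          (\<lambda>f. tnat_comp J (conerve1 J W D f) u)
          (\<lambda>\<alpha>. modif_hcomp J (conerve2 J W D \<alpha>) (modif_id J u))" using iso[OF X] by (simp add: cat_iso_def)
    from is_functor.map_obj[OF this vw(1)] is_functor.map_obj[OF this vw(2)]
    have "is_tnat J (tnat_comp J (conerve1 J W D v) u)" "is_tnat J (tnat_comp J (conerve1 J W D w) u)" by auto
    then have "tnat_comp J (conerve1 J W D v) u = tnat_comp J (conerve1 J W D w) u"
    proof (rule tnat_eqI)
      show "fob (tcmp (tnat_comp J (conerve1 J W D v) u) i) x = fob (tcmp (tnat_comp J (conerve1 J W D w) u) i) x"
        if "i \<in> obj (one J)" "x \<in> obj (app0 (tdom (tnat_comp J (conerve1 J W D v) u)) i)" for i x
      proof -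
        have "x \<in> obj (app0 \<Phi> i)" using that by (simp add: u)
        then show ?thesis using that(1) comp[of v i x] comp[of w i x] v e0[of i x] by simp
      qed
      show "far (tcmp (tnat_comp J (conerve1 J W D v) u) i) x = far (tcmp (tnat_comp J (conerve1 J W D w) u) i) x"
        if "i \<in> obj (one J)" "x \<in> arr (app0 (tdom (tnat_comp J (conerve1 J W D v) u)) i)" for i x
      proof -
        have "x \<in> arr (app0 \<Phi> i)" using that by (simp add: u)
        then show ?thesis using that(1) comp'[of v i x] comp'[of w i x] v e1[of i x] by simp
      qed
    qed (use v in auto)
    then show ?thesis
      using iso[OF X] vw unfolding cat_iso_def bij_betw_def by (auto dest: inj_onD)
  qed
qed

text \<open>For this weight a cone over a single object \<open>A\<close> is a functor from
  \<open>T\<close> into a hom-category, so the limit is the cotensor of \<open>A\<close> with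
  \<open>T\<close>; for terminal \<open>T\<close> the limit is the conical one. Arrow objects and
  pullbacks thus share one construction.\<close>

definition const_weight :: "('x, 'y) cat \<Rightarrow> ('i, 'j, 'k, 'x, 'y) catvalued" where
  "const_weight T = \<lparr>app0 = (\<lambda>_. T), app1 = (\<lambda>_. cfun_id T), app2 = (\<lambda>_. cnat_id (cfun_id T))\<rparr>"

definition loc_disc_fun :: "('o, 'm, 't) twocat \<Rightarrow> ('i \<Rightarrow> 'o) \<Rightarrow> ('j \<Rightarrow> 'm) \<Rightarrow> ('i, 'j, 'j, 'o, 'm, 't) twofun" where
  "loc_disc_fun W Fo Fa = \<lparr>app0 = Fo, app1 = Fa, app2 = (\<lambda>u. idt (two W) (Fa u))\<rparr>"

lemma const_weight_simps [simp]: "app0 (const_weight T) i = T" "app1 (const_weight T) u = cfun_id T"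
    "app2 (const_weight T) \<theta> = cnat_id (cfun_id T)"
  and loc_disc_fun_simps [simp]: "app0 (loc_disc_fun W Fo Fa) = Fo" "app1 (loc_disc_fun W Fo Fa) = Fa"
    "app2 (loc_disc_fun W Fo Fa) v = idt (two W) (Fa v)"
  by (simp_all add: const_weight_def loc_disc_fun_def)

lemma two_functor_const_weight:
  assumes K: "two_category K" and T: "category T"
  shows "two_functor K Cat (const_weight T)"
proof -
  interpret T: category T by fact
  show ?thesis by (rule two_functor_CatI) (auto simp: K T)
qed

lemma two_functor_loc_disc_fun:
  assumes W: "two_category W" and C: "category C" and F: "is_functor C (one W) Fo Fa"
  shows "two_functor (loc_disc C) W (loc_disc_fun W Fo Fa)"
proof -
  interpret W: two_category W by fact
  interpret F: is_functor C "one W" Fo Fa by fact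
  show ?thesis
    by (intro two_functorI is_functorI two_category_loc_disc C) 
      (auto simp: F.map_idt F.cmp W.obj_two W.idt_hcmp_idt)
qed

text \<open>Packages a compatible family of functors as a cone. As all 2-cells of
  \<open>loc_disc C\<close> are identities, its 2-naturality amounts to preservation of
  identities.\<close>

lemma cat_nat_cone:
  assumes W: "two_category W" and C: "category C" and T: "category T" and F: "is_functor C (one W) Fo Fa" and X: "X \<in> obj (one W)"
    and t: "\<And>i. i \<in> obj C \<Longrightarrow> is_functor T (homcat W X (Fo i)) (to i) (ta i)"
    and nat0: "\<And>a x. a \<in> arr C \<Longrightarrow> x \<in> obj T \<Longrightarrow> to (tgt C a) x = Fa a \<cdot>\<^bsub>one W\<^esub> to (src C a) x"
    and nat1: "\<And>a f. a \<in> arr C \<Longrightarrow> f \<in> arr T \<Longrightarrow> ta (tgt C a) f = idt (two W) (Fa a) \<star>\<^bsub>W\<^esub> ta (src C a) f"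
  shows "cat_nat (loc_disc C) (const_weight T) (conerve0 W (loc_disc_fun W Fo Fa) X)
    \<lparr>tdom = const_weight T, tcod = conerve0 W (loc_disc_fun W Fo Fa) X,
     tcmp = (\<lambda>i \<in> obj C. \<lparr>fdom = T, fcod = homcat W X (Fo i), fob = (\<lambda>x \<in> obj T. to i x), far = (\<lambda>f \<in> arr T. ta i f)\<rparr>)\<rparr>"
    (is "cat_nat _ _ _ ?t")
proof -
  interpret W: two_category W by fact
  interpret C: category C by fact
  interpret T: category T by fact
  interpret F: is_functor C "one W" Fo Fa by fact
  note [simp] = W and J = two_category_loc_disc[OF C]
  have tm: "to i x \<in> arr (one W)" "src (one W) (to i x) = X" "tgt (one W) (to i x) = Fo i"
    if "i \<in> obj C" "x \<in> obj T" for i x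
    using is_functor.map_obj[OF t[OF that(1)] that(2)] by auto
  have tm1: "ta i f \<in> arr (two W)" "src (one W) (src (two W) (ta i f)) = X" "tgt (one W) (src (two W) (ta i f)) = Fo i"
    if "i \<in> obj C" "f \<in> arr T" for i f
    using is_functor.arr[OF t[OF that(1)] that(2)] by auto
  have "is_tnat (loc_disc C) ?t"
  proof (rule is_tnatI)
    fix i assume i: "i \<in> obj (one (loc_disc C))"
    then have "is_functor T (homcat W X (Fo i)) (\<lambda>x \<in> obj T. to i x) (\<lambda>f \<in> arr T. ta i f)"
      by (intro is_functor_cong[OF t[of i] T]) auto
    then show "is_cfun (tcmp ?t i) \<and> fdom (tcmp ?t i) = app0 (tdom ?t) i \<and> fcod (tcmp ?t i) = app0 (tcod ?t) i"
      using i by (intro conjI is_cfunI) (auto simp: T W.homcat_category)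
  next
    fix \<theta> x assume "\<theta> \<in> arr (two (loc_disc C))" "x \<in> obj (app0 (tdom ?t) (src (one (loc_disc C)) (src (two (loc_disc C)) \<theta>)))"
    then show "far (tcmp ?t (tgt (one (loc_disc C)) (src (two (loc_disc C)) \<theta>))) (ncmp (app2 (tdom ?t) \<theta>) x) =
      ncmp (app2 (tcod ?t) \<theta>) (fob (tcmp ?t (src (one (loc_disc C)) (src (two (loc_disc C)) \<theta>))) x)"
      using is_functor.map_idt[OF t[of "tgt C \<theta>"], of x] tm[of "src C \<theta>" x] nat0[of \<theta> x]
      by (auto simp: W.idt_hcmp_idt)
  qed (auto simp: J two_functor_const_weight[OF J T] two_functor_conerve0[OF J W two_functor_loc_disc_fun[OF W C F] X]
      nat0 nat1 tm tm1)
  then show ?thesis by (intro cat_natI J) auto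
qed

lemma finite_limit:
  fixes C :: "(nat, nat) cat" and T :: "(nat, nat) cat"
  assumes W: "two_category W" and lim: "has_finite_weighted_limits W"
    and C: "category C" "finite_cat C" and T: "category T" "finite_cat T" and F: "is_functor C (one W) Fo Fa"
  shows "\<exists>L u. is_weighted_limit W (loc_disc C) (const_weight T) (loc_disc_fun W Fo Fa) L u"
proof -
  note J = two_category_loc_disc[OF C(1)]
  have "finite_cat (two (loc_disc C))" using C by (simp add: finite_cat_def)
  then show ?thesis
    using lim C T J two_functor_const_weight[OF J T(1)] two_functor_loc_disc_fun[OF W C(1) F]
    unfolding has_finite_weighted_limits_def by simp
qed

section \<open>Finite shapes, pullbacks and arrow objects\<close>

definition one_cat :: "(nat, nat) cat" where
  "one_cat = \<lparr>obj = {0}, arr = {0}, src = id, tgt = id, idt = id, cmp = (\<lambda>_ _. 0)\<rparr>"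

lemma one_cat: "category one_cat" "finite_cat one_cat"
  by (auto simp: one_cat_def finite_cat_def intro!: categoryI)

text \<open>The walking arrow \<open>2 : 0 \<rightarrow> 1\<close> and the walking cospan \<open>3 : 0 \<rightarrow> 2\<close>, \<open>4 : 1 \<rightarrow> 2\<close>; a smaller
  number stands both for an object and for its identity.\<close>

definition arrow_cat :: "(nat, nat) cat" where
  "arrow_cat = \<lparr>obj = {0, 1}, arr = {0, 1, 2}, src = (\<lambda>f. if f = 2 then 0 else f), tgt = (\<lambda>f. if f = 2 then 1 else f),
    idt = id, cmp = (\<lambda>g f. if f = 2 then f else g)\<rparr>"

definition cospan_cat :: "(nat, nat) cat" where
  "cospan_cat = \<lparr>obj = {0, 1, 2}, arr = {0, 1, 2, 3, 4},
    src = (\<lambda>f. if f = 3 then 0 else if f = 4 then 1 else f), tgt = (\<lambda>f. if f = 3 \<or> f = 4 then 2 else f),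
    idt = id, cmp = (\<lambda>g f. if f = 3 \<or> f = 4 then f else g)\<rparr>"

lemma arrow_cat: "category arrow_cat" "finite_cat arrow_cat"
  by (auto simp: arrow_cat_def finite_cat_def intro!: categoryI)

lemma cospan_cat: "category cospan_cat" "finite_cat cospan_cat"
  by (auto simp: cospan_cat_def finite_cat_def intro!: categoryI)

lemma pullback_exists:
  assumes W: "two_category W" and lim: "has_finite_weighted_limits W"
    and f: "f \<in> arr (one W)" and g: "g \<in> arr (one W)" and fg: "tgt (one W) f = tgt (one W) g"
  shows "\<exists>p q. is_pullback (one W) f g p q"
proof -
  interpret W: two_category W by fact
  note [simp] = W f g fg
  \<comment> \<open>The cospan of \<open>f\<close> and \<open>g\<close> as a diagram on
    \<open>cospan_cat\<close>: objects \<open>0\<close> and \<open>1\<close> are the two sources,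
    \<open>2\<close> is the common target, and the arrows \<open>3\<close> and \<open>4\<close> go
    to \<open>f\<close> and \<open>g\<close>. The other numbers stand for identities.\<close>
  define Fo where "Fo i = (if i = 0 then src (one W) f else if i = 1 then src (one W) g else tgt (one W) g)" for i :: nat
  define Fa where "Fa a = (if a = 3 then f else if a = 4 then g else idt (one W) (Fo a))" for a :: nat
  have arr: "Fa a \<in> arr (one W)" "src (one W) (Fa a) = Fo (src cospan_cat a)" "tgt (one W) (Fa a) = Fo (tgt cospan_cat a)"
    if "a \<in> arr cospan_cat" for a
    using that by (auto simp: cospan_cat_def Fo_def Fa_def)
  have F: "is_functor cospan_cat (one W) Fo Fa"
  proof (rule is_functorI)
    fix a b assume ab: "a \<in> arr cospan_cat" "b \<in> arr cospan_cat" "src cospan_cat b = tgt cospan_cat a"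
    show "Fa (b \<cdot>\<^bsub>cospan_cat\<^esub> a) = Fa b \<cdot>\<^bsub>one W\<^esub> Fa a"
    proof (cases "a = 3 \<or> a = 4")
      case True
      then have "b = 2" "b \<cdot>\<^bsub>cospan_cat\<^esub> a = a" "tgt cospan_cat a = 2" "Fa 2 = idt (one W) (Fo 2)"
        using ab by (auto simp: cospan_cat_def Fa_def split: if_splits)
      then show ?thesis using arr[OF ab(1)] by simp
    next
      case False
      then have "src cospan_cat b = a" "b \<cdot>\<^bsub>cospan_cat\<^esub> a = b" "Fa a = idt (one W) (Fo a)"
        using ab by (auto simp: cospan_cat_def Fa_def)
      then show ?thesis using arr[OF ab(2)] by simp
    qed
  next
    fix i assume "i \<in> obj cospan_cat"
    then show "Fo i \<in> obj (one W)" "Fa (idt cospan_cat i) = idt (one W) (Fo i)"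
      by (auto simp: cospan_cat_def Fo_def Fa_def)
  qed (simp add: arr)
  obtain L u where lim: "is_weighted_limit W (loc_disc cospan_cat) (const_weight one_cat) (loc_disc_fun W Fo Fa) L u"
    using finite_limit[OF W lim cospan_cat one_cat F] by blast
  note E = weighted_limitE[OF W two_category_loc_disc[OF cospan_cat(1)] lim]
  interpret u: cat_nat "loc_disc cospan_cat" "const_weight one_cat" "conerve0 W (loc_disc_fun W Fo Fa) L" u by (rule E)
  define p q where "p = fob (tcmp u 0) 0" and "q = fob (tcmp u (Suc 0)) 0"
  have [simp]: "p \<in> arr (one W)" "src (one W) p = L" "tgt (one W) p = src (one W) f"
    "q \<in> arr (one W)" "src (one W) q = L" "tgt (one W) q = src (one W) g"
    using u.cfun_map(1)[of 0 0] u.cfun_map(1)[of 1 0] by (auto simp: p_def q_def one_cat_def cospan_cat_def Fo_def)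
  have u2: "fob (tcmp u 2) 0 = f \<cdot>\<^bsub>one W\<^esub> p" "fob (tcmp u 2) 0 = g \<cdot>\<^bsub>one W\<^esub> q"
    using u.natural(1)[of 3 0] u.natural(1)[of 4 0]
    by (auto simp: p_def[symmetric] q_def[symmetric] one_cat_def cospan_cat_def Fa_def)
  \<comment> \<open>The weight is constant at the one-arrow category, so the arrow part of the cone
    consists of identities and is determined by the object part.\<close>
  have ui: "far (tcmp u i) 0 = idt (two W) (fob (tcmp u i) 0)" if "i = 0 \<or> i = 1 \<or> i = 2" for i
    using u.cfun_cmp(2)[of i 0] that by (auto simp: one_cat_def cospan_cat_def)
  have [simp]: "L \<in> obj (one W)" by (rule E)
  have ex: "\<exists>v. v \<in> hom (one W) X L \<and> p \<cdot>\<^bsub>one W\<^esub> v = h \<and> q \<cdot>\<^bsub>one W\<^esub> v = k"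
    if X: "X \<in> obj (one W)" and h: "h \<in> arr (one W)" "src (one W) h = X" "tgt (one W) h = src (one W) f"
    and k: "k \<in> arr (one W)" "src (one W) k = X" "tgt (one W) k = src (one W) g" and hk: "f \<cdot>\<^bsub>one W\<^esub> h = g \<cdot>\<^bsub>one W\<^esub> k" for X h k
  proof -
    \<comment> \<open>The competing cone, whose leg at \<open>2\<close> is forced to be the common
      composite.\<close>
    define z where "z i = (if i = 0 then h else if i = 1 then k else f \<cdot>\<^bsub>one W\<^esub> h)" for i :: nat
    have "is_functor one_cat (homcat W X (Fo i)) (\<lambda>_. z i) (\<lambda>_. idt (two W) (z i))" if "i \<in> obj cospan_cat" for i
      using that X h k by (intro is_functorI) (auto simp: one_cat_def cospan_cat_def z_def Fo_def)
    moreover have zt: "z i \<in> arr (one W)" "src (one W) (z i) = X" "tgt (one W) (z i) = Fo i" if "i \<in> obj cospan_cat" for i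
      using that h k by (auto simp: cospan_cat_def z_def Fo_def)
    moreover have z: "z (tgt cospan_cat a) = Fa a \<cdot>\<^bsub>one W\<^esub> z (src cospan_cat a)" if "a \<in> arr cospan_cat" for a
    proof (cases "a = 3 \<or> a = 4")
      case True
      then show ?thesis using hk by (auto simp: cospan_cat_def Fa_def z_def)
    next
      case False
      then have "src cospan_cat a = a" "tgt cospan_cat a = a" "Fa a = idt (one W) (Fo a)" "a \<in> obj cospan_cat"
        using that by (auto simp: cospan_cat_def Fa_def)
      then show ?thesis using zt[of a] by simp
    qed
    moreover have "idt (two W) (z (tgt cospan_cat a)) = idt (two W) (Fa a) \<star>\<^bsub>W\<^esub> idt (two W) (z (src cospan_cat a))"
      if "a \<in> arr cospan_cat" for a
      using that z[OF that] zt[of "src cospan_cat a"] arr[of a] category.src_obj[OF cospan_cat(1) that]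
      by (simp add: W.idt_hcmp_idt)
    ultimately have "cat_nat (loc_disc cospan_cat) (const_weight one_cat) (conerve0 W (loc_disc_fun W Fo Fa) X)
      \<lparr>tdom = const_weight one_cat, tcod = conerve0 W (loc_disc_fun W Fo Fa) X,
       tcmp = (\<lambda>i \<in> obj cospan_cat. \<lparr>fdom = one_cat, fcod = homcat W X (Fo i), fob = (\<lambda>x \<in> obj one_cat. z i),
         far = (\<lambda>f \<in> arr one_cat. idt (two W) (z i))\<rparr>)\<rparr>"
      by (intro cat_nat_cone[OF W cospan_cat(1) one_cat(1) F X])
    from E(3)[OF this X] obtain v where v: "v \<in> arr (one W)" "src (one W) v = X" "tgt (one W) v = L"
      "\<And>i x. i \<in> obj cospan_cat \<Longrightarrow> x \<in> obj one_cat \<Longrightarrow> fob (tcmp u i) x \<cdot>\<^bsub>one W\<^esub> v = z i"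
      by auto
    then show ?thesis
      using v(4)[of 0 0] v(4)[of 1 0] by (intro exI[of _ v]) (auto simp: hom_iff cospan_cat_def one_cat_def z_def p_def q_def)
  qed
  have uniq: "v = w" if v: "v \<in> arr (one W)" "w \<in> arr (one W)" "src (one W) v = src (one W) w" "tgt (one W) v = L" "tgt (one W) w = L"
    "p \<cdot>\<^bsub>one W\<^esub> v = p \<cdot>\<^bsub>one W\<^esub> w" "q \<cdot>\<^bsub>one W\<^esub> v = q \<cdot>\<^bsub>one W\<^esub> w" for v w
  proof (rule E(4)[OF v(1-5)])
    \<comment> \<open>The leg at \<open>2\<close> is \<open>f\<close> after \<open>p\<close>, so
      agreement on \<open>p\<close> and \<open>q\<close> carries over to all three legs.\<close>
    have z: "fob (tcmp u i) 0 \<cdot>\<^bsub>one W\<^esub> v = fob (tcmp u i) 0 \<cdot>\<^bsub>one W\<^esub> w" "fob (tcmp u i) 0 \<in> arr (one W)" "src (one W) (fob (tcmp u i) 0) = L"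
      if "i = 0 \<or> i = 1 \<or> i = 2" for i
      using that v by (auto simp: p_def[symmetric] q_def[symmetric] u2(1) W.one.assoc)
    fix i x assume "i \<in> obj (one (loc_disc cospan_cat))"
    then have i: "i = 0 \<or> i = 1 \<or> i = 2" by (simp add: cospan_cat_def)
    show "fob (tcmp u i) x \<cdot>\<^bsub>one W\<^esub> v = fob (tcmp u i) x \<cdot>\<^bsub>one W\<^esub> w" if "x \<in> obj (app0 (const_weight one_cat) i)"
      using that z(1)[OF i] by (simp add: one_cat_def)
    show "far (tcmp u i) x \<star>\<^bsub>W\<^esub> idt (two W) v = far (tcmp u i) x \<star>\<^bsub>W\<^esub> idt (two W) w" if "x \<in> arr (app0 (const_weight one_cat) i)"
      using that z[OF i] ui[OF i] v by (simp add: one_cat_def W.idt_hcmp_idt)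
  qed
  have "is_pullback (one W) f g p q"
    unfolding is_pullback_def
  proof (intro conjI ballI impI)
    fix X h k assume *: "X \<in> obj (one W)" "h \<in> hom (one W) X (src (one W) f)" "k \<in> hom (one W) X (src (one W) g)"
      "f \<cdot>\<^bsub>one W\<^esub> h = g \<cdot>\<^bsub>one W\<^esub> k"
    then obtain v where v: "v \<in> hom (one W) X L" "p \<cdot>\<^bsub>one W\<^esub> v = h" "q \<cdot>\<^bsub>one W\<^esub> v = k"
      using ex[of X h k] by (auto simp: hom_iff)
    show "\<exists>!v. v \<in> hom (one W) X (src (one W) p) \<and> p \<cdot>\<^bsub>one W\<^esub> v = h \<and> q \<cdot>\<^bsub>one W\<^esub> v = k"
    proof (rule ex1I)
      show "v \<in> hom (one W) X (src (one W) p) \<and> p \<cdot>\<^bsub>one W\<^esub> v = h \<and> q \<cdot>\<^bsub>one W\<^esub> v = k" using v by simp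
      show "w = v" if "w \<in> hom (one W) X (src (one W) p) \<and> p \<cdot>\<^bsub>one W\<^esub> w = h \<and> q \<cdot>\<^bsub>one W\<^esub> w = k" for w
        using that v by - (rule uniq, simp_all add: hom_iff)
    qed
  qed (use u2 in auto)
  then show ?thesis by blast
qed

text \<open>The cotensor of \<open>A\<close> with the walking arrow, obtained as the limit over one
  object with weight constant at \<open>arrow_cat\<close>. Its universal 2-cell
  \<open>\<epsilon>\<close> lets 1-cells into \<open>L\<close> represent 2-cells into
  \<open>A\<close>.\<close>

lemma arrow_object_exists:
  assumes W: "two_category W" and lim: "has_finite_weighted_limits W" and A: "A \<in> obj (one W)"
  shows "\<exists>L \<epsilon>. L \<in> obj (one W) \<and> \<epsilon> \<in> arr (homcat W L A) \<and>
    (\<forall>X \<in> obj (one W). bij_betw (\<lambda>v. \<epsilon> \<star>\<^bsub>W\<^esub> idt (two W) v) (obj (homcat W X L)) (arr (homcat W X A)))"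
proof -
  interpret W: two_category W by fact
  note [simp] = W A
  define Fo where "Fo i = A" for i :: nat
  define Fa where "Fa a = idt (one W) A" for a :: nat
  have F: "is_functor one_cat (one W) Fo Fa"
    by (rule is_functorI) (auto simp: one_cat_def Fo_def Fa_def)
  obtain L u where lim: "is_weighted_limit W (loc_disc one_cat) (const_weight arrow_cat) (loc_disc_fun W Fo Fa) L u"
    using finite_limit[OF W lim one_cat arrow_cat F] by blast
  note E = weighted_limitE[OF W two_category_loc_disc[OF one_cat(1)] lim]
  interpret u: cat_nat "loc_disc one_cat" "const_weight arrow_cat" "conerve0 W (loc_disc_fun W Fo Fa) L" u by (rule E)
  \<comment> \<open>\<open>2\<close> is the non-identity arrow of \<open>arrow_cat\<close>, so the
    limiting cone evaluates there to the universal 2-cell.\<close>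
  define \<epsilon> where "\<epsilon> = far (tcmp u 0) 2"
  have [simp]: "\<epsilon> \<in> arr (two W)" "src (one W) (src (two W) \<epsilon>) = L" "tgt (one W) (src (two W) \<epsilon>) = A"
    using u.cfun_map(2)[of 0 2] by (auto simp: \<epsilon>_def one_cat_def arrow_cat_def Fo_def)
  have u0: "fob (tcmp u 0) 0 = src (two W) \<epsilon>" "fob (tcmp u 0) (Suc 0) = tgt (two W) \<epsilon>"
    using u.cfun_map(3,4)[of 0 2] by (auto simp: \<epsilon>_def one_cat_def arrow_cat_def)
  have u1: "far (tcmp u 0) 0 = idt (two W) (src (two W) \<epsilon>)" "far (tcmp u 0) (Suc 0) = idt (two W) (tgt (two W) \<epsilon>)"
    using u.cfun_cmp(2)[of 0 0] u.cfun_cmp(2)[of 0 1] by (auto simp: one_cat_def arrow_cat_def u0)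
  have [simp]: "L \<in> obj (one W)" by (rule E)
  have ex: "\<exists>v. v \<in> arr (one W) \<and> src (one W) v = X \<and> tgt (one W) v = L \<and> \<alpha> = \<epsilon> \<star>\<^bsub>W\<^esub> idt (two W) v"
    if X: "X \<in> obj (one W)" and a: "\<alpha> \<in> arr (two W)" "src (one W) (src (two W) \<alpha>) = X" "tgt (one W) (src (two W) \<alpha>) = A" for X \<alpha>
  proof -
    \<comment> \<open>\<open>z0\<close> and \<open>z1\<close> form the functor out of the walking
      arrow that names \<open>\<alpha>\<close>.\<close>
    define z0 where "z0 i = (if i = 0 then src (two W) \<alpha> else tgt (two W) \<alpha>)" for i :: nat
    define z1 where "z1 i = (if i = 2 then \<alpha> else idt (two W) (z0 i))" for i :: nat
    have "is_functor arrow_cat (homcat W X (Fo i)) z0 z1" if "i \<in> obj one_cat" for i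
      using that X a by (intro is_functorI) (auto simp: arrow_cat_def z0_def z1_def Fo_def)
    moreover have "z0 x \<in> arr (one W)" "tgt (one W) (z0 x) = A" "z1 y \<in> arr (two W)" "tgt (one W) (src (two W) (z1 y)) = A"
      for x y using a by (simp_all add: z0_def z1_def)
    ultimately have "cat_nat (loc_disc one_cat) (const_weight arrow_cat) (conerve0 W (loc_disc_fun W Fo Fa) X)
      \<lparr>tdom = const_weight arrow_cat, tcod = conerve0 W (loc_disc_fun W Fo Fa) X,
       tcmp = (\<lambda>i \<in> obj one_cat. \<lparr>fdom = arrow_cat, fcod = homcat W X (Fo i), fob = (\<lambda>x \<in> obj arrow_cat. z0 x),
         far = (\<lambda>f \<in> arr arrow_cat. z1 f)\<rparr>)\<rparr>"
      by (intro cat_nat_cone[OF W one_cat(1) arrow_cat(1) F X]) (auto simp: Fa_def)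
    from E(3)[OF this X] obtain v where v: "v \<in> arr (one W)" "src (one W) v = X" "tgt (one W) v = L"
      "\<And>i x. i \<in> obj one_cat \<Longrightarrow> x \<in> arr arrow_cat \<Longrightarrow> far (tcmp u i) x \<star>\<^bsub>W\<^esub> idt (two W) v = z1 x"
      by auto
    then show ?thesis
      using v(4)[of 0 2] by (intro exI[of _ v]) (auto simp: one_cat_def arrow_cat_def z1_def \<epsilon>_def)
  qed
  have uniq: "v = w" if v: "v \<in> arr (one W)" "w \<in> arr (one W)" "src (one W) v = src (one W) w" "tgt (one W) v = L" "tgt (one W) w = L"
    and eq: "\<epsilon> \<star>\<^bsub>W\<^esub> idt (two W) v = \<epsilon> \<star>\<^bsub>W\<^esub> idt (two W) w" for v w
  proof (rule E(4)[OF v])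
    \<comment> \<open>Taking source and target of the whiskered 2-cells shows that \<open>v\<close>
      and \<open>w\<close> also agree on the boundary of \<open>\<epsilon>\<close>, hence on the
      whole cone.\<close>
    have st: "src (two W) \<epsilon> \<cdot>\<^bsub>one W\<^esub> v = src (two W) \<epsilon> \<cdot>\<^bsub>one W\<^esub> w" "tgt (two W) \<epsilon> \<cdot>\<^bsub>one W\<^esub> v = tgt (two W) \<epsilon> \<cdot>\<^bsub>one W\<^esub> w"
      using arg_cong[OF eq, of "src (two W)"] arg_cong[OF eq, of "tgt (two W)"] v by auto
    fix i x assume i: "i \<in> obj (one (loc_disc one_cat))"
    show "fob (tcmp u i) x \<cdot>\<^bsub>one W\<^esub> v = fob (tcmp u i) x \<cdot>\<^bsub>one W\<^esub> w" if "x \<in> obj (app0 (const_weight arrow_cat) i)"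
      using that i st by (auto simp: one_cat_def arrow_cat_def u0)
    show "far (tcmp u i) x \<star>\<^bsub>W\<^esub> idt (two W) v = far (tcmp u i) x \<star>\<^bsub>W\<^esub> idt (two W) w" if "x \<in> arr (app0 (const_weight arrow_cat) i)"
      using that i st v eq by (auto simp: one_cat_def arrow_cat_def u1 W.idt_hcmp_idt \<epsilon>_def[symmetric])
  qed
  have "bij_betw (\<lambda>v. \<epsilon> \<star>\<^bsub>W\<^esub> idt (two W) v) (obj (homcat W X L)) (arr (homcat W X A))" if X: "X \<in> obj (one W)" for X
  proof -
    have "\<alpha> \<in> (\<lambda>v. \<epsilon> \<star>\<^bsub>W\<^esub> idt (two W) v) ` obj (homcat W X L)" if "\<alpha> \<in> arr (homcat W X A)" for \<alpha>
      using ex[OF X, of \<alpha>] that unfolding image_iff Bex_def by simp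
    then show ?thesis unfolding bij_betw_def inj_on_def using uniq by auto
  qed
  then show ?thesis by (intro exI[of _ L] exI[of _ \<epsilon>]) auto
qed

section \<open>Internal categories from representable indexed categories\<close>

text \<open>All 2-cells of \<open>loc_disc C\<close> are identities, and functors preserve these;
  compatibility with 2-cells follows from naturality in 1-cells.\<close>

lemma is_tnat_loc_discI:
  assumes C: "category C" and P: "two_functor (op_twocat (loc_disc C)) Cat (tdom \<tau>)" and Q: "two_functor (op_twocat (loc_disc C)) Cat (tcod \<tau>)"
    and c: "\<And>X. X \<in> obj C \<Longrightarrow> is_cfun (tcmp \<tau> X) \<and> fdom (tcmp \<tau> X) = app0 (tdom \<tau>) X \<and> fcod (tcmp \<tau> X) = app0 (tcod \<tau>) X"
    and n0: "\<And>u x. u \<in> arr C \<Longrightarrow> x \<in> obj (app0 (tdom \<tau>) (tgt C u)) \<Longrightarrow>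
      fob (tcmp \<tau> (src C u)) (fob (app1 (tdom \<tau>) u) x) = fob (app1 (tcod \<tau>) u) (fob (tcmp \<tau> (tgt C u)) x)"
    and n1: "\<And>u f. u \<in> arr C \<Longrightarrow> f \<in> arr (app0 (tdom \<tau>) (tgt C u)) \<Longrightarrow>
      far (tcmp \<tau> (src C u)) (far (app1 (tdom \<tau>) u) f) = far (app1 (tcod \<tau>) u) (far (tcmp \<tau> (tgt C u)) f)"
    and e: "tcmp \<tau> \<in> extensional (obj C)"
  shows "is_tnat (op_twocat (loc_disc C)) \<tau>"
proof (rule is_tnatI)
  interpret C: category C by fact
  note K = two_category_op[OF two_category_loc_disc[OF C]]
  interpret P: cat_valued "op_twocat (loc_disc C)" "tdom \<tau>" using K P by (rule cat_valuedI)
  interpret Q: cat_valued "op_twocat (loc_disc C)" "tcod \<tau>" using K Q by (rule cat_valuedI)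
  show "two_category (op_twocat (loc_disc C))" by (rule K)
  fix \<theta> x assume "\<theta> \<in> arr (two (op_twocat (loc_disc C)))" "x \<in> obj (app0 (tdom \<tau>) (src (one (op_twocat (loc_disc C))) (src (two (op_twocat (loc_disc C))) \<theta>)))"
  then have t: "\<theta> \<in> arr C" and x: "x \<in> obj (app0 (tdom \<tau>) (tgt C \<theta>))" by simp_all
  have eq: "app2 (tdom \<tau>) \<theta> = cnat_id (app1 (tdom \<tau>) \<theta>)" "app2 (tcod \<tau>) \<theta> = cnat_id (app1 (tcod \<tau>) \<theta>)"
    using P.two.map_idt[of \<theta>] Q.two.map_idt[of \<theta>] t by simp_all
  interpret s: cfunctor "app0 (tdom \<tau>) (src C \<theta>)" "app0 (tcod \<tau>) (src C \<theta>)" "tcmp \<tau> (src C \<theta>)"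
    using c[of "src C \<theta>"] t by (intro cfunctorI) auto
  interpret r: cfunctor "app0 (tdom \<tau>) (tgt C \<theta>)" "app0 (tcod \<tau>) (tgt C \<theta>)" "tcmp \<tau> (tgt C \<theta>)"
    using c[of "tgt C \<theta>"] t by (intro cfunctorI) auto
  show "far (tcmp \<tau> (tgt (one (op_twocat (loc_disc C))) (src (two (op_twocat (loc_disc C))) \<theta>))) (ncmp (app2 (tdom \<tau>) \<theta>) x) =
    ncmp (app2 (tcod \<tau>) \<theta>) (fob (tcmp \<tau> (src (one (op_twocat (loc_disc C))) (src (two (op_twocat (loc_disc C))) \<theta>))) x)"
    using P.cfun(2,3)[of \<theta>] Q.cfun(2,3)[of \<theta>] P.cfun_map(1)[of \<theta> "src C \<theta>" x] t x n0[OF t x]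
    by (simp add: eq s.map_idt)
qed (use assms in simp_all)

text \<open>\<open>e0\<close> and \<open>e1\<close> below send generalised elements injectively to objects and arrows of \<open>P X\<close>, so the laws of
  an internal category are inherited from the categories \<open>P X\<close>.\<close>

lemma representable_internal_category:
  assumes C: "category C" and pb: "\<And>f g. f \<in> arr C \<Longrightarrow> g \<in> arr C \<Longrightarrow> tgt C f = tgt C g \<Longrightarrow> \<exists>p q. is_pullback C f g p q"
    and P: "two_functor (op_twocat (loc_disc C)) Cat P"
    and A0: "A0 \<in> obj C" and A1: "A1 \<in> obj C" and a0: "a0 \<in> obj (app0 P A0)" and a1: "a1 \<in> arr (app0 P A1)"
    and rep0: "\<And>X. X \<in> obj C \<Longrightarrow> bij_betw (\<lambda>x. fob (app1 P x) a0) (hom C X A0) (obj (app0 P X))"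
    and rep1: "\<And>X. X \<in> obj C \<Longrightarrow> bij_betw (\<lambda>x. far (app1 P x) a1) (hom C X A1) (arr (app0 P X))"
  shows "\<exists>E \<phi>. internal_category C E \<and> cat_nat_iso (op_twocat (loc_disc C)) (ext0 C E) P \<phi>"
proof -
  interpret C: category C by fact
  let ?K = "op_twocat (loc_disc C)"
  note K = two_category_op[OF two_category_loc_disc[OF C]]
  interpret P: cat_valued ?K P using K P by (rule cat_valuedI)
  note [simp] = A0 A1 a0 a1
  have cat: "category (app0 P X)" if "X \<in> obj C" for X using P.category that by simp
  define e0 where "e0 x = fob (app1 P x) a0" for x
  define e1 where "e1 x = far (app1 P x) a1" for x
  have e0_in [simp]: "e0 x \<in> obj (app0 P X)" if "x \<in> arr C" "src C x = X" "tgt C x = A0" for x X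
    using that P.cfun_map(1)[of x "src C x" a0] by (simp add: e0_def)
  have e1_in [simp]: "e1 x \<in> arr (app0 P X)" if "x \<in> arr C" "src C x = X" "tgt C x = A1" for x X
    using that P.cfun_map(2)[of x "src C x" a1] by (simp add: e1_def)
  have e0_cmp: "e0 (x \<cdot>\<^bsub>C\<^esub> u) = fob (app1 P u) (e0 x)" if "x \<in> arr C" "tgt C x = A0" "u \<in> arr C" "tgt C u = src C x" for x u
    using that P.cfun_cmp(1)[of x u a0] by (simp add: e0_def)
  have e1_cmp: "e1 (x \<cdot>\<^bsub>C\<^esub> u) = far (app1 P u) (e1 x)" if "x \<in> arr C" "tgt C x = A1" "u \<in> arr C" "tgt C u = src C x" for x u
    using that P.cfun_cmp(2)[of x u a1] by (simp add: e1_def)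
  have e0_idt [simp]: "e0 (idt C A0) = a0" using P.cfun_idt(1)[of A0 a0] by (simp add: e0_def)
  have e1_idt [simp]: "e1 (idt C A1) = a1" using P.cfun_idt(2)[of A1 a1] by (simp add: e1_def)
  have inj0: "x = y" if "e0 x = e0 y" "x \<in> arr C" "y \<in> arr C" "src C x = src C y" "tgt C x = A0" "tgt C y = A0" for x y
    using rep0[of "src C y"] that by (auto simp: bij_betw_def e0_def hom_iff dest: inj_onD)
  have inj1: "x = y" if "e1 x = e1 y" "x \<in> arr C" "y \<in> arr C" "src C x = src C y" "tgt C x = A1" "tgt C y = A1" for x y
    using rep1[of "src C y"] that by (auto simp: bij_betw_def e1_def hom_iff dest: inj_onD)
  have surj0: "\<exists>x. x \<in> arr C \<and> src C x = X \<and> tgt C x = A0 \<and> e0 x = y" if "X \<in> obj C" "y \<in> obj (app0 P X)" for X y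
  proof -
    from that obtain x where "x \<in> hom C X A0" "y = e0 x" using rep0[of X] by (auto simp: bij_betw_def e0_def)
    then show ?thesis by (auto simp: hom_iff)
  qed
  have surj1: "\<exists>x. x \<in> arr C \<and> src C x = X \<and> tgt C x = A1 \<and> e1 x = y" if "X \<in> obj C" "y \<in> arr (app0 P X)" for X y
  proof -
    from that obtain x where "x \<in> hom C X A1" "y = e1 x" using rep1[of X] by (auto simp: bij_betw_def e1_def)
    then show ?thesis by (auto simp: hom_iff)
  qed
  interpret c0: category "app0 P A0" by (rule cat) simp
  interpret c1: category "app0 P A1" by (rule cat) simp
  \<comment> \<open>The domain, codomain and identity maps represent the source and target of the
    universal arrow \<open>a1\<close> and the identity on the universal object
    \<open>a0\<close>.\<close>
  obtain d where d [simp]: "d \<in> arr C" "src C d = A1" "tgt C d = A0" and ed: "e0 d = src (app0 P A1) a1"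
    using surj0[of A1 "src (app0 P A1) a1"] by auto
  obtain c where c [simp]: "c \<in> arr C" "src C c = A1" "tgt C c = A0" and ec: "e0 c = tgt (app0 P A1) a1"
    using surj0[of A1 "tgt (app0 P A1) a1"] by auto
  obtain i where i [simp]: "i \<in> arr C" "src C i = A0" "tgt C i = A1" and ei: "e1 i = idt (app0 P A0) a0"
    using surj1[of A0 "idt (app0 P A0) a0"] by auto
  \<comment> \<open>Reindexing along \<open>f\<close> carries the facts about the universal elements
    over to all generalised elements.\<close>
  have e_src: "e0 (d \<cdot>\<^bsub>C\<^esub> f) = src (app0 P X) (e1 f)" and e_tgt: "e0 (c \<cdot>\<^bsub>C\<^esub> f) = tgt (app0 P X) (e1 f)"
    if "f \<in> arr C" "src C f = X" "tgt C f = A1" for f X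
    using that P.cfun_map(3,4)[of f "src C f" a1] by (simp_all add: e0_cmp ed ec) (simp_all add: e1_def)
  have e_idt: "e1 (i \<cdot>\<^bsub>C\<^esub> x) = idt (app0 P X) (e0 x)" if "x \<in> arr C" "src C x = X" "tgt C x = A0" for x X
    using that P.cfun_map_cmp(2)[of x a0] by (simp_all add: e1_cmp ei) (simp_all add: e0_def)
  obtain p q where pq: "is_pullback C d c p q" using pb[of d c] by auto
  note pqD = is_pullbackD[OF pq, simplified]
  have [simp]: "p \<in> arr C" "q \<in> arr C" "tgt C p = A1" "tgt C q = A1" "src C q = src C p" using pqD by auto
  interpret c2: category "app0 P (src C p)" by (rule cat) simp
  have pq_comp: "src (app0 P (src C p)) (e1 p) = tgt (app0 P (src C p)) (e1 q)"
    using pqD by (simp add: e_src[symmetric] e_tgt[symmetric])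
  \<comment> \<open>Composition represents the composite of the universal composable pair, which
    lives over the pullback.\<close>
  obtain m where m [simp]: "m \<in> arr C" "src C m = src C p" "tgt C m = A1" and em: "e1 m = e1 p \<cdot>\<^bsub>app0 P (src C p)\<^esub> e1 q"
    using surj1[of "src C p" "e1 p \<cdot>\<^bsub>app0 P (src C p)\<^esub> e1 q"] pq_comp by auto
  define E where "E = \<lparr>ob0 = A0, ob1 = A1, idom = d, icod = c, iid = i, pr1 = p, pr2 = q, icomp = m\<rparr>"
  have E [simp]: "ob0 E = A0" "ob1 E = A1" "idom E = d" "icod E = c" "iid E = i" "pr1 E = p" "pr2 E = q" "icomp E = m"
    by (simp_all add: E_def)
  have pair: "pair C p q g f \<in> arr C" "src C (pair C p q g f) = X" "tgt C (pair C p q g f) = src C p"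
    "p \<cdot>\<^bsub>C\<^esub> pair C p q g f = g" "q \<cdot>\<^bsub>C\<^esub> pair C p q g f = f"
    if "f \<in> arr C" "g \<in> arr C" "src C f = X" "src C g = X" "tgt C f = A1" "tgt C g = A1" "d \<cdot>\<^bsub>C\<^esub> g = c \<cdot>\<^bsub>C\<^esub> f" for f g X
    using C.pair[OF pq, of g f] that by auto
  have icmp: "icmp C E g f \<in> arr C" "src C (icmp C E g f) = X" "tgt C (icmp C E g f) = A1"
    "e1 (icmp C E g f) = e1 g \<cdot>\<^bsub>app0 P X\<^esub> e1 f"
    if gf: "f \<in> arr C" "g \<in> arr C" "src C f = X" "src C g = X" "tgt C f = A1" "tgt C g = A1" "d \<cdot>\<^bsub>C\<^esub> g = c \<cdot>\<^bsub>C\<^esub> f" for f g X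
  proof -
    note v = pair[OF gf]
    show "icmp C E g f \<in> arr C" "src C (icmp C E g f) = X" "tgt C (icmp C E g f) = A1"
      using v by (simp_all add: icmp_def)
    have "e1 (icmp C E g f) = far (app1 P (pair C p q g f)) (e1 p \<cdot>\<^bsub>app0 P (src C p)\<^esub> e1 q)"
      using v by (simp add: icmp_def e1_cmp em)
    also have "\<dots> = far (app1 P (pair C p q g f)) (e1 p) \<cdot>\<^bsub>app0 P X\<^esub> far (app1 P (pair C p q g f)) (e1 q)"
      using P.cfun_map_cmp(1)[of "pair C p q g f" "e1 q" "e1 p"] v pq_comp by simp
    also have "\<dots> = e1 (p \<cdot>\<^bsub>C\<^esub> pair C p q g f) \<cdot>\<^bsub>app0 P X\<^esub> e1 (q \<cdot>\<^bsub>C\<^esub> pair C p q g f)"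
      using v by (subst (1 2) e1_cmp) auto
    finally show "e1 (icmp C E g f) = e1 g \<cdot>\<^bsub>app0 P X\<^esub> e1 f" using v by simp
  qed
  have di: "d \<cdot>\<^bsub>C\<^esub> i = idt C A0" "c \<cdot>\<^bsub>C\<^esub> i = idt C A0"
    by (rule inj0; simp add: e_src e_tgt ei)+
  have di_cmp: "d \<cdot>\<^bsub>C\<^esub> (i \<cdot>\<^bsub>C\<^esub> x) = x" "c \<cdot>\<^bsub>C\<^esub> (i \<cdot>\<^bsub>C\<^esub> x) = x" if "x \<in> arr C" "tgt C x = A0" for x
    using that di by (simp_all add: C.assoc[symmetric])
  have dm: "d \<cdot>\<^bsub>C\<^esub> m = d \<cdot>\<^bsub>C\<^esub> q" "c \<cdot>\<^bsub>C\<^esub> m = c \<cdot>\<^bsub>C\<^esub> p"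
    using pq_comp by (auto intro!: inj0 simp: e_src e_tgt em)
  have "internal_category C E"
  proof
    show "icmp C E (iid E \<cdot>\<^bsub>C\<^esub> icod E) (idt C (ob1 E)) = idt C (ob1 E)"
      using icmp[of "idt C A1" "i \<cdot>\<^bsub>C\<^esub> c" A1] by (intro inj1) (auto simp: di_cmp e_idt ec)
    show "icmp C E (idt C (ob1 E)) (iid E \<cdot>\<^bsub>C\<^esub> idom E) = idt C (ob1 E)"
      using icmp[of "i \<cdot>\<^bsub>C\<^esub> d" "idt C A1" A1] by (intro inj1) (auto simp: di_cmp e_idt ed)
    obtain r s where rs: "is_pullback C q p r s" using pb[of q p] by auto
    note rsD = is_pullbackD[OF rs, simplified]
    have [simp]: "r \<in> arr C" "s \<in> arr C" "tgt C r = src C p" "tgt C s = src C p" "src C s = src C r" using rsD by auto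
    interpret c3: category "app0 P (src C r)" by (rule cat) simp
    have dc: "d \<cdot>\<^bsub>C\<^esub> (p \<cdot>\<^bsub>C\<^esub> x) = c \<cdot>\<^bsub>C\<^esub> (q \<cdot>\<^bsub>C\<^esub> x)" "d \<cdot>\<^bsub>C\<^esub> (m \<cdot>\<^bsub>C\<^esub> x) = d \<cdot>\<^bsub>C\<^esub> (q \<cdot>\<^bsub>C\<^esub> x)" "c \<cdot>\<^bsub>C\<^esub> (m \<cdot>\<^bsub>C\<^esub> x) = c \<cdot>\<^bsub>C\<^esub> (p \<cdot>\<^bsub>C\<^esub> x)"
      if "x \<in> arr C" "tgt C x = src C p" for x
      using that pqD dm by (simp_all add: C.assoc[symmetric])
    have qr: "q \<cdot>\<^bsub>C\<^esub> r = p \<cdot>\<^bsub>C\<^esub> s" using rsD by simp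
    have emx: "e1 (m \<cdot>\<^bsub>C\<^esub> x) = e1 (p \<cdot>\<^bsub>C\<^esub> x) \<cdot>\<^bsub>app0 P (src C x)\<^esub> e1 (q \<cdot>\<^bsub>C\<^esub> x)" if "x \<in> arr C" "tgt C x = src C p" for x
      using that pq_comp P.cfun_map_cmp(1)[of x "e1 q" "e1 p"] by (simp add: e1_cmp em)
    have 1: "d \<cdot>\<^bsub>C\<^esub> (m \<cdot>\<^bsub>C\<^esub> r) = c \<cdot>\<^bsub>C\<^esub> (q \<cdot>\<^bsub>C\<^esub> s)" "d \<cdot>\<^bsub>C\<^esub> (p \<cdot>\<^bsub>C\<^esub> r) = c \<cdot>\<^bsub>C\<^esub> (m \<cdot>\<^bsub>C\<^esub> s)"
      by (simp_all add: dc qr)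
    have t: "src (app0 P (src C r)) (e1 (p \<cdot>\<^bsub>C\<^esub> r)) = tgt (app0 P (src C r)) (e1 (p \<cdot>\<^bsub>C\<^esub> s))"
      "src (app0 P (src C r)) (e1 (p \<cdot>\<^bsub>C\<^esub> s)) = tgt (app0 P (src C r)) (e1 (q \<cdot>\<^bsub>C\<^esub> s))"
      by (simp_all add: e_src[symmetric] e_tgt[symmetric] dc qr)
    \<comment> \<open>Under \<open>e1\<close> both sides become bracketings of one composable triple
      of arrows in the value of \<open>P\<close> at the object of triples.\<close>
    have "icmp C E (m \<cdot>\<^bsub>C\<^esub> r) (q \<cdot>\<^bsub>C\<^esub> s) = icmp C E (p \<cdot>\<^bsub>C\<^esub> r) (m \<cdot>\<^bsub>C\<^esub> s)"
      using icmp[of "q \<cdot>\<^bsub>C\<^esub> s" "m \<cdot>\<^bsub>C\<^esub> r" "src C r"] icmp[of "m \<cdot>\<^bsub>C\<^esub> s" "p \<cdot>\<^bsub>C\<^esub> r" "src C r"] 1 t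
      by (intro inj1) (auto simp: emx qr c3.assoc)
    then show "\<exists>r s. is_pullback C (pr2 E) (pr1 E) r s \<and>
      icmp C E (icomp E \<cdot>\<^bsub>C\<^esub> r) (pr2 E \<cdot>\<^bsub>C\<^esub> s) = icmp C E (pr1 E \<cdot>\<^bsub>C\<^esub> r) (icomp E \<cdot>\<^bsub>C\<^esub> s)"
      using rs by auto
  qed (auto simp: hom_iff pq di dm)
  then interpret E: intcat C E using C by (intro intcatI)
  define \<phi> where "\<phi> = \<lparr>tdom = ext0 C E, tcod = P,
    tcmp = (\<lambda>X \<in> obj C. \<lparr>fdom = ext_cat C E X, fcod = app0 P X,
      fob = (\<lambda>x \<in> obj (ext_cat C E X). e0 x), far = (\<lambda>f \<in> arr (ext_cat C E X). e1 f)\<rparr>)\<rparr>"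
  have "is_tnat ?K \<phi>"
  proof (rule is_tnat_loc_discI[OF C])
    fix X assume X: "X \<in> obj C"
    have "is_functor (ext_cat C E X) (app0 P X) (\<lambda>x \<in> obj (ext_cat C E X). e0 x) (\<lambda>x \<in> arr (ext_cat C E X). e1 x)"
      using X E.icmp E.structure_arr by (intro is_functorI) (auto simp: e_src e_tgt e_idt icmp)
    then show "is_cfun (tcmp \<phi> X) \<and> fdom (tcmp \<phi> X) = app0 (tdom \<phi>) X \<and> fcod (tcmp \<phi> X) = app0 (tcod \<phi>) X"
      using X by (auto simp: \<phi>_def E.ext_cat_category cat intro!: is_cfunI)
  qed (auto simp: \<phi>_def E.two_functor_ext0 P e0_cmp e1_cmp)
  then interpret f: cat_nat ?K "ext0 C E" P \<phi> by (intro cat_natI K) (auto simp: \<phi>_def)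
  have "cat_nat_iso ?K (ext0 C E) P \<phi>"
  proof
    fix X assume "X \<in> obj (one ?K)"
    then have X: "X \<in> obj C" by simp
    have "bij_betw e0 (obj (ext_cat C E X)) (obj (app0 P X))"
      using rep0[OF X] unfolding e0_def by (simp add: ext_cat_def)
    then show "bij_betw (fob (tcmp \<phi> X)) (obj (app0 (ext0 C E) X)) (obj (app0 P X))"
      using X by (subst bij_betw_cong[where g = e0]) (auto simp: \<phi>_def)
    have "bij_betw e1 (arr (ext_cat C E X)) (arr (app0 P X))"
      using rep1[OF X] unfolding e1_def by (simp add: ext_cat_def)
    then show "bij_betw (far (tcmp \<phi> X)) (arr (app0 (ext0 C E) X)) (arr (app0 P X))"
      using X by (subst bij_betw_cong[where g = e1]) (auto simp: \<phi>_def)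
  qed
  then show ?thesis using E.internal_category_axioms by blast
qed

section \<open>Discrete internal categories\<close>

text \<open>Since \<open>idom\<close> after \<open>iid\<close> is an identity in any internal
  category, the assumption makes the two mutually inverse. Discreteness is meant up to this
  isomorphism: \<open>ob1 A\<close> and \<open>ob0 A\<close> may be different objects.\<close>

locale discrete_intcat = intcat +
  assumes discrete: "iid A \<cdot>\<^bsub>C\<^esub> idom A = idt C (ob1 A)"
begin

lemma icod_eq: "icod A = idom A"
proof -
  have "icod A = icod A \<cdot>\<^bsub>C\<^esub> (iid A \<cdot>\<^bsub>C\<^esub> idom A)" by (simp only: discrete) simp
  then show ?thesis by simp
qed

text \<open>Every arrow of \<open>A\<close> is an identity, so an internal functor out of
  \<open>A\<close> is fixed by its object part.\<close>

lemma if1_eq: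
  assumes "intfunctor C A B G"
  shows "if1 G = iid B \<cdot>\<^bsub>C\<^esub> (if0 G \<cdot>\<^bsub>C\<^esub> idom A)"
proof -
  interpret G: intfunctor C A B G by fact
  have "if1 G = if1 G \<cdot>\<^bsub>C\<^esub> (iid A \<cdot>\<^bsub>C\<^esub> idom A)" by (simp only: discrete) simp
  then show ?thesis by simp
qed

lemma is_intfun_discrete:
  assumes "intcat C B" and x: "x \<in> arr C" "src C x = ob0 A" "tgt C x = ob0 B"
  shows "is_intfun C \<lparr>ifdom = A, ifcod = B, if0 = x, if1 = iid B \<cdot>\<^bsub>C\<^esub> (x \<cdot>\<^bsub>C\<^esub> idom A)\<rparr>"
proof -
  interpret B: intcat C B by fact
  have eq: "idom A \<cdot>\<^bsub>C\<^esub> icomp A = idom A \<cdot>\<^bsub>C\<^esub> pr2 A" "idom A \<cdot>\<^bsub>C\<^esub> pr1 A = idom A \<cdot>\<^bsub>C\<^esub> pr2 A"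
    using idom_icomp pullback_square by (simp_all add: icod_eq)
  show ?thesis
    using x by (simp add: is_intfun_def hom_iff internal_category_axioms B.internal_category_axioms icod_eq C.assoc eq)
qed

text \<open>Naturality is automatic: \<open>if1 F\<close> and \<open>if1 G\<close> are identities in
  \<open>B\<close>, so both sides of the square reduce to \<open>t\<close> after
  \<open>idom A\<close>.\<close>

lemma is_intnat_discrete:
  assumes "intfunctor C A B F" "intfunctor C A B G"
    and t: "t \<in> arr C" "src C t = ob0 A" "tgt C t = ob1 B" "idom B \<cdot>\<^bsub>C\<^esub> t = if0 F" "icod B \<cdot>\<^bsub>C\<^esub> t = if0 G"
  shows "is_intnat C \<lparr>indom = F, incod = G, incmp = t\<rparr>"
proof -
  interpret F: intfunctor C A B F by fact
  interpret G: intfunctor C A B G by fact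
  have "idom B \<cdot>\<^bsub>C\<^esub> (t \<cdot>\<^bsub>C\<^esub> idom A) = if0 F \<cdot>\<^bsub>C\<^esub> idom A" "icod B \<cdot>\<^bsub>C\<^esub> (t \<cdot>\<^bsub>C\<^esub> idom A) = if0 G \<cdot>\<^bsub>C\<^esub> idom A"
    using t by (simp_all add: C.assoc[symmetric])
  then show ?thesis
    using t by (simp add: is_intnat_def hom_iff F.intfun G.intfun F.ifdom F.ifcod G.ifdom G.ifcod icod_eq
      if1_eq[OF F.intfunctor_axioms] if1_eq[OF G.intfunctor_axioms])
qed

end

text \<open>\<open>N\<close> is isomorphic to the inclusion of discrete internal categories, whose nerve is externalisation.\<close>

lemma dense_discrete:
  assumes C: "category C" and N: "two_functor (loc_disc C) (IntCat C) N"
    and disc: "\<And>X. X \<in> obj C \<Longrightarrow> iid (app0 N X) \<cdot>\<^bsub>C\<^esub> idom (app0 N X) = idt C (ob1 (app0 N X))"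
    and i: "\<And>X. X \<in> obj C \<Longrightarrow> i X \<in> arr C \<and> src C (i X) = X \<and> tgt C (i X) = ob0 (app0 N X)"
    and j: "\<And>X. X \<in> obj C \<Longrightarrow> j X \<in> arr C \<and> src C (j X) = ob0 (app0 N X) \<and> tgt C (j X) = X"
    and ij: "\<And>X. X \<in> obj C \<Longrightarrow> i X \<cdot>\<^bsub>C\<^esub> j X = idt C (ob0 (app0 N X)) \<and> j X \<cdot>\<^bsub>C\<^esub> i X = idt C X"
    and nat: "\<And>u. u \<in> arr C \<Longrightarrow> if0 (app1 N u) \<cdot>\<^bsub>C\<^esub> i (src C u) = i (tgt C u) \<cdot>\<^bsub>C\<^esub> u"
  shows "dense (loc_disc C) (IntCat C) N"
proof -
  interpret C: category C by fact
  interpret N: two_functor "loc_disc C" "IntCat C" N by fact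
  let ?K = "op_twocat (loc_disc C)" and ?M = "nerve (loc_disc C) (IntCat C) N"
  note L = two_category_loc_disc[OF C] and I [simp] = C.two_category_IntCat
  note K = two_category_op[OF L]
  interpret I: two_category "IntCat C" by (rule I)
  interpret ext: cat_functor "IntCat C" ?K "externalisation C" by (rule C.cat_functor_externalisation)
  interpret M: cat_functor "IntCat C" ?K ?M by (rule cat_functor_nerve[OF L I N])
  \<comment> \<open>Identities and composites stay folded: as unfolded records they would no longer
    be recognised as members of hom-categories.\<close>
  note [simp del] = IntCat_simps
  note IC [simp] = IntCat_simps(1-4,7-10)
  note [simp] = i[THEN conjunct1] i[THEN conjunct2, THEN conjunct1] i[THEN conjunct2, THEN conjunct2]
    j[THEN conjunct1] j[THEN conjunct2, THEN conjunct1] j[THEN conjunct2, THEN conjunct2]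
  have D: "discrete_intcat C (app0 N X)" if "X \<in> obj C" for X
    using N.one.map_obj[of X] that disc[OF that] C
    by (auto simp: discrete_intcat_def discrete_intcat_axioms_def intro: intcatI)
  \<comment> \<open>\<open>i X\<close> is invertible with inverse \<open>j X\<close>, so arrows out
    of the object of objects may be compared after precomposing with \<open>i X\<close>.\<close>
  have cancel: "y = z" if "y \<cdot>\<^bsub>C\<^esub> i X = z \<cdot>\<^bsub>C\<^esub> i X" "X \<in> obj C" "y \<in> arr C" "z \<in> arr C" "src C y = ob0 (app0 N X)" "src C z = ob0 (app0 N X)" for y z X
    using arg_cong[OF that(1), of "\<lambda>h. h \<cdot>\<^bsub>C\<^esub> j X"] that(2-) ij[of X] by (simp add: C.assoc)
  have extend: "(y \<cdot>\<^bsub>C\<^esub> j X) \<cdot>\<^bsub>C\<^esub> i X = y" if "X \<in> obj C" "y \<in> arr C" "src C y = X" for y X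
    using that ij[of X] by (simp add: C.assoc)
  have F: "intfunctor C (app0 N X) B g" if "g \<in> obj (homcat (IntCat C) (app0 N X) B)" for g X B
    using that by (auto intro!: intfunctorI C)
  have T: "intnat C (app0 N X) B (indom t) (incod t) t" if "t \<in> arr (homcat (IntCat C) (app0 N X) B)" for t X B
    using that by (auto intro!: intnatI C)
  \<comment> \<open>Evaluation at \<open>i X\<close>, the generic object of \<open>N X\<close>
    reindexed to \<open>X\<close>: a functor out of \<open>N X\<close> becomes an object of
    \<open>B\<close> over \<open>X\<close>, a transformation an arrow of \<open>B\<close> over
    \<open>X\<close>.\<close>
  define \<chi> where "\<chi> B = \<lparr>tdom = nerve0 (IntCat C) N B, tcod = ext0 C B,
    tcmp = (\<lambda>X \<in> obj C. \<lparr>fdom = homcat (IntCat C) (app0 N X) B, fcod = ext_cat C B X,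
      fob = (\<lambda>g \<in> obj (homcat (IntCat C) (app0 N X) B). if0 g \<cdot>\<^bsub>C\<^esub> i X),
      far = (\<lambda>t \<in> arr (homcat (IntCat C) (app0 N X) B). incmp t \<cdot>\<^bsub>C\<^esub> i X)\<rparr>)\<rparr>" for B
  have \<chi>_simps: "tdom (\<chi> B) = nerve0 (IntCat C) N B" "tcod (\<chi> B) = ext0 C B"
    "X \<in> obj C \<Longrightarrow> fob (tcmp (\<chi> B) X) g = if0 g \<cdot>\<^bsub>C\<^esub> i X"
    "X \<in> obj C \<Longrightarrow> far (tcmp (\<chi> B) X) t = incmp t \<cdot>\<^bsub>C\<^esub> i X"
    if "g \<in> obj (homcat (IntCat C) (app0 N X) B)" "t \<in> arr (homcat (IntCat C) (app0 N X) B)" for B X g t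
    using that by (auto simp: \<chi>_def)
  have iso: "cat_nat_iso ?K (app0 ?M B) (app0 (externalisation C) B) (\<chi> B)" if B: "B \<in> obj (one (IntCat C))" for B
  proof -
    interpret B: intcat C B using B C by (intro intcatI) simp_all
    have "is_tnat ?K (\<chi> B)"
    proof (rule is_tnat_loc_discI[OF C])
      show "two_functor ?K Cat (tdom (\<chi> B))" "two_functor ?K Cat (tcod (\<chi> B))"
        using two_functor_nerve0[OF L I N B] B.two_functor_ext0 by (simp_all add: \<chi>_def)
      fix X assume X: "X \<in> obj C"
      have "is_functor (homcat (IntCat C) (app0 N X) B) (ext_cat C B X)
        (\<lambda>g \<in> obj (homcat (IntCat C) (app0 N X) B). if0 g \<cdot>\<^bsub>C\<^esub> i X) (\<lambda>t \<in> arr (homcat (IntCat C) (app0 N X) B). incmp t \<cdot>\<^bsub>C\<^esub> i X)"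
      proof (rule is_functorI)
        fix g assume g: "g \<in> obj (homcat (IntCat C) (app0 N X) B)"
        interpret g: intfunctor C "app0 N X" B g using g by (rule F)
        show "(\<lambda>g \<in> obj (homcat (IntCat C) (app0 N X) B). if0 g \<cdot>\<^bsub>C\<^esub> i X) g \<in> obj (ext_cat C B X)"
          using g X by simp
        show "(\<lambda>t \<in> arr (homcat (IntCat C) (app0 N X) B). incmp t \<cdot>\<^bsub>C\<^esub> i X) (idt (homcat (IntCat C) (app0 N X) B) g) =
          idt (ext_cat C B X) ((\<lambda>g \<in> obj (homcat (IntCat C) (app0 N X) B). if0 g \<cdot>\<^bsub>C\<^esub> i X) g)"
          using g X I.two_idt[of g] I.two_src_idt[of g] by (auto simp: IntCat_simps C.assoc)
      next
        fix s assume s: "s \<in> arr (homcat (IntCat C) (app0 N X) B)"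
        interpret s: intnat C "app0 N X" B "indom s" "incod s" s using s by (rule T)
        show "(\<lambda>t \<in> arr (homcat (IntCat C) (app0 N X) B). incmp t \<cdot>\<^bsub>C\<^esub> i X) s \<in> arr (ext_cat C B X) \<and>
          src (ext_cat C B X) ((\<lambda>t \<in> arr (homcat (IntCat C) (app0 N X) B). incmp t \<cdot>\<^bsub>C\<^esub> i X) s) =
          (\<lambda>g \<in> obj (homcat (IntCat C) (app0 N X) B). if0 g \<cdot>\<^bsub>C\<^esub> i X) (src (homcat (IntCat C) (app0 N X) B) s) \<and>
          tgt (ext_cat C B X) ((\<lambda>t \<in> arr (homcat (IntCat C) (app0 N X) B). incmp t \<cdot>\<^bsub>C\<^esub> i X) s) =
          (\<lambda>g \<in> obj (homcat (IntCat C) (app0 N X) B). if0 g \<cdot>\<^bsub>C\<^esub> i X) (tgt (homcat (IntCat C) (app0 N X) B) s)"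
          using s X s.F.intfun s.G.intfun s.G.ifdom s.G.ifcod by simp
        fix t assume t: "t \<in> arr (homcat (IntCat C) (app0 N X) B)" and st: "src (homcat (IntCat C) (app0 N X) B) t = tgt (homcat (IntCat C) (app0 N X) B) s"
        interpret t: intnat C "app0 N X" B "indom t" "incod t" t using t by (rule T)
        have "t \<cdot>\<^bsub>homcat (IntCat C) (app0 N X) B\<^esub> s \<in> arr (homcat (IntCat C) (app0 N X) B)"
          using s t st by (intro category.cmp_arr I.homcat_category)
        moreover have "incmp (t \<cdot>\<^bsub>homcat (IntCat C) (app0 N X) B\<^esub> s) = icmp C B (incmp t) (incmp s)"
          using s by (simp add: IntCat_simps)
        ultimately show "(\<lambda>t \<in> arr (homcat (IntCat C) (app0 N X) B). incmp t \<cdot>\<^bsub>C\<^esub> i X) (t \<cdot>\<^bsub>homcat (IntCat C) (app0 N X) B\<^esub> s) =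
          (\<lambda>t \<in> arr (homcat (IntCat C) (app0 N X) B). incmp t \<cdot>\<^bsub>C\<^esub> i X) t \<cdot>\<^bsub>ext_cat C B X\<^esub>
          (\<lambda>t \<in> arr (homcat (IntCat C) (app0 N X) B). incmp t \<cdot>\<^bsub>C\<^esub> i X) s"
          using s t X st by (simp add: B.icmp_cmp)
      qed
      then show "is_cfun (tcmp (\<chi> B) X) \<and> fdom (tcmp (\<chi> B) X) = app0 (tdom (\<chi> B)) X \<and> fcod (tcmp (\<chi> B) X) = app0 (tcod (\<chi> B)) X"
        using X by (auto simp: \<chi>_def B.ext_cat_category I.homcat_category intro!: is_cfunI)
    next
      fix u g assume u: "u \<in> arr C" and "g \<in> obj (app0 (tdom (\<chi> B)) (tgt C u))"
      then have g: "g \<in> obj (homcat (IntCat C) (app0 N (tgt C u)) B)" by (simp add: \<chi>_def)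
      interpret g: intfunctor C "app0 N (tgt C u)" B g using g by (rule F)
      interpret u: intfunctor C "app0 N (src C u)" "app0 N (tgt C u)" "app1 N u"
        using u N.one.arr[of u] N.one.src_map[of u] N.one.tgt_map[of u] by (intro intfunctorI C) auto
      have "g \<cdot>\<^bsub>one (IntCat C)\<^esub> app1 N u \<in> obj (homcat (IntCat C) (app0 N (src C u)) B)"
        using g u N.one.arr[of u] N.one.src_map[of u] N.one.tgt_map[of u] I.one.cmp_arr[of "app1 N u" g]
          I.one.src_cmp[of "app1 N u" g] I.one.tgt_cmp[of "app1 N u" g] by simp
      moreover have "if0 (g \<cdot>\<^bsub>one (IntCat C)\<^esub> app1 N u) = if0 g \<cdot>\<^bsub>C\<^esub> if0 (app1 N u)"
        by (simp add: IntCat_simps(6))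
      ultimately show "fob (tcmp (\<chi> B) (src C u)) (fob (app1 (tdom (\<chi> B)) u) g) =
        fob (app1 (tcod (\<chi> B)) u) (fob (tcmp (\<chi> B) (tgt C u)) g)"
        using u g N.one.tgt_map[of u] N.one.src_map[of u] nat[OF u] by (simp add: \<chi>_def C.assoc)
    next
      fix u t assume u: "u \<in> arr C" and "t \<in> arr (app0 (tdom (\<chi> B)) (tgt C u))"
      then have t: "t \<in> arr (homcat (IntCat C) (app0 N (tgt C u)) B)" by (simp add: \<chi>_def)
      interpret t: intnat C "app0 N (tgt C u)" B "indom t" "incod t" t using t by (rule T)
      interpret u: intfunctor C "app0 N (src C u)" "app0 N (tgt C u)" "app1 N u"
        using u N.one.arr[of u] N.one.src_map[of u] N.one.tgt_map[of u] by (intro intfunctorI C) auto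
      let ?s = "t \<star>\<^bsub>IntCat C\<^esub> idt (two (IntCat C)) (app1 N u)"
      have "?s \<in> arr (homcat (IntCat C) (app0 N (src C u)) B)"
        using t u N.one.arr[of u] N.one.src_map[of u] N.one.tgt_map[of u]
          I.hcmp_arr[of "idt (two (IntCat C)) (app1 N u)" t] I.src_hcmp[of "idt (two (IntCat C)) (app1 N u)" t] 
          I.one.src_cmp[of "app1 N u" "indom t"] I.one.tgt_cmp[of "app1 N u" "indom t"] I.two_idt[of "app1 N u"]
          I.two_src_idt[of "app1 N u"] I.two_tgt_idt[of "app1 N u"] t.F.intfun by simp
      moreover have "incmp ?s = incmp t \<cdot>\<^bsub>C\<^esub> if0 (app1 N u)"
        using t u u.ifcod by (simp add: IntCat_simps)
      ultimately show "far (tcmp (\<chi> B) (src C u)) (far (app1 (tdom (\<chi> B)) u) t) =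
        far (app1 (tcod (\<chi> B)) u) (far (tcmp (\<chi> B) (tgt C u)) t)"
        using u t N.one.tgt_map[of u] N.one.src_map[of u] nat[OF u] by (simp add: \<chi>_def C.assoc)
    qed (simp add: \<chi>_def)
    then interpret x: cat_nat ?K "nerve0 (IntCat C) N B" "ext0 C B" "\<chi> B" by (intro cat_natI K) (auto simp: \<chi>_def)
    have "cat_nat_iso ?K (nerve0 (IntCat C) N B) (ext0 C B) (\<chi> B)"
    proof
      fix X assume "X \<in> obj (one ?K)"
      then have X: "X \<in> obj C" by simp
      interpret D: discrete_intcat C "app0 N X" using X by (rule D)
      \<comment> \<open>The functor that evaluates to \<open>x\<close>: its object part undoes
        \<open>i X\<close> by means of \<open>j X\<close>, and it sends every arrow to an
        identity.\<close>
      let ?g = "\<lambda>x. \<lparr>ifdom = app0 N X, ifcod = B, if0 = x \<cdot>\<^bsub>C\<^esub> j X, if1 = iid B \<cdot>\<^bsub>C\<^esub> ((x \<cdot>\<^bsub>C\<^esub> j X) \<cdot>\<^bsub>C\<^esub> idom (app0 N X))\<rparr>"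
      have g: "is_intfun C (?g x)" if "x \<in> arr C" "src C x = X" "tgt C x = ob0 B" for x
        using X that by (intro D.is_intfun_discrete B.intcat_axioms) auto
      have inj: "g = h" if g: "g \<in> obj (homcat (IntCat C) (app0 N X) B)" and h: "h \<in> obj (homcat (IntCat C) (app0 N X) B)"
        and eq: "if0 g \<cdot>\<^bsub>C\<^esub> i X = if0 h \<cdot>\<^bsub>C\<^esub> i X" for g h
      proof -
        interpret g: intfunctor C "app0 N X" B g using g by (rule F)
        interpret h: intfunctor C "app0 N X" B h using h by (rule F)
        have "if0 g = if0 h" using eq X by - (rule cancel[of _ X], auto)
        then show ?thesis
          using D.if1_eq[OF g.intfunctor_axioms] D.if1_eq[OF h.intfunctor_axioms]
          by (intro intfun.equality) (simp_all add: g.ifdom g.ifcod h.ifdom h.ifcod)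
      qed
      have surj: "x \<in> (\<lambda>g. if0 g \<cdot>\<^bsub>C\<^esub> i X) ` obj (homcat (IntCat C) (app0 N X) B)" if "x \<in> obj (ext_cat C B X)" for x
        using that g[of x] X extend[of X x] by (intro image_eqI[of _ _ "?g x"]) auto
      have "bij_betw (\<lambda>g. if0 g \<cdot>\<^bsub>C\<^esub> i X) (obj (homcat (IntCat C) (app0 N X) B)) (obj (ext_cat C B X))"
        unfolding bij_betw_def inj_on_def
      proof (intro conjI ballI impI equalityI subsetI)
        fix x assume "x \<in> (\<lambda>g. if0 g \<cdot>\<^bsub>C\<^esub> i X) ` obj (homcat (IntCat C) (app0 N X) B)"
        then obtain g where g: "g \<in> obj (homcat (IntCat C) (app0 N X) B)" "x = if0 g \<cdot>\<^bsub>C\<^esub> i X" by blast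
        interpret g: intfunctor C "app0 N X" B g using g by (intro F)
        show "x \<in> obj (ext_cat C B X)" using g X by simp
      qed (use inj surj in blast)+
      then show "bij_betw (fob (tcmp (\<chi> B) X)) (obj (app0 (nerve0 (IntCat C) N B) X)) (obj (app0 (ext0 C B) X))"
        using X by (subst bij_betw_cong[where g = "\<lambda>g. if0 g \<cdot>\<^bsub>C\<^esub> i X"]) (auto simp: \<chi>_def)
      have inj: "s = t" if s: "s \<in> arr (homcat (IntCat C) (app0 N X) B)" and t: "t \<in> arr (homcat (IntCat C) (app0 N X) B)"
        and eq: "incmp s \<cdot>\<^bsub>C\<^esub> i X = incmp t \<cdot>\<^bsub>C\<^esub> i X" for s t
      proof -
        interpret s: intnat C "app0 N X" B "indom s" "incod s" s using s by (rule T)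
        interpret t: intnat C "app0 N X" B "indom t" "incod t" t using t by (rule T)
        have "incmp s = incmp t" using eq X by - (rule cancel[of _ X], auto)
        \<comment> \<open>A transformation determines the object parts of its boundary through
          \<open>idom\<close> and \<open>icod\<close>, and out of a discrete category these
          determine the boundary functors.\<close>
        moreover from this have "if0 (indom s) = if0 (indom t)" "if0 (incod s) = if0 (incod t)"
          using s.in_arr(4,5) t.in_arr(4,5) by simp_all
        then have "indom s = indom t" "incod s = incod t"
          by (auto intro!: inj simp: s.F.intfun s.F.ifdom s.F.ifcod t.F.intfun t.F.ifdom t.F.ifcod
              s.G.intfun s.G.ifdom s.G.ifcod t.G.intfun t.G.ifdom t.G.ifcod)
        ultimately show ?thesis by (intro intnat.equality) simp_all
      qed
      have surj: "x \<in> (\<lambda>t. incmp t \<cdot>\<^bsub>C\<^esub> i X) ` arr (homcat (IntCat C) (app0 N X) B)" if "x \<in> arr (ext_cat C B X)" for x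
      proof -
        have x: "x \<in> arr C" "src C x = X" "tgt C x = ob1 B" using that by auto
        have f: "intfunctor C (app0 N X) B (?g (idom B \<cdot>\<^bsub>C\<^esub> x))" "intfunctor C (app0 N X) B (?g (icod B \<cdot>\<^bsub>C\<^esub> x))"
          using x g by (auto intro!: intfunctorI C)
        have "is_intnat C \<lparr>indom = ?g (idom B \<cdot>\<^bsub>C\<^esub> x), incod = ?g (icod B \<cdot>\<^bsub>C\<^esub> x), incmp = x \<cdot>\<^bsub>C\<^esub> j X\<rparr>"
          by (rule D.is_intnat_discrete[OF f]) (use x X in \<open>auto simp: C.assoc\<close>)
        then show ?thesis
          using x X extend[of X x] by (intro image_eqI[of _ _ "\<lparr>indom = ?g (idom B \<cdot>\<^bsub>C\<^esub> x), incod = ?g (icod B \<cdot>\<^bsub>C\<^esub> x), incmp = x \<cdot>\<^bsub>C\<^esub> j X\<rparr>"]) auto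
      qed
      have "bij_betw (\<lambda>g. incmp g \<cdot>\<^bsub>C\<^esub> i X) (arr (homcat (IntCat C) (app0 N X) B)) (arr (ext_cat C B X))"
        unfolding bij_betw_def inj_on_def
      proof (intro conjI ballI impI equalityI subsetI)
        fix x assume "x \<in> (\<lambda>t. incmp t \<cdot>\<^bsub>C\<^esub> i X) ` arr (homcat (IntCat C) (app0 N X) B)"
        then obtain t where t: "t \<in> arr (homcat (IntCat C) (app0 N X) B)" "x = incmp t \<cdot>\<^bsub>C\<^esub> i X" by blast
        interpret t: intnat C "app0 N X" B "indom t" "incod t" t using t by (intro T)
        show "x \<in> arr (ext_cat C B X)" using t X by simp
      qed (use inj surj in blast)+
      then show "bij_betw (far (tcmp (\<chi> B) X)) (arr (app0 (nerve0 (IntCat C) N B) X)) (arr (app0 (ext0 C B) X))"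
        using X by (subst bij_betw_cong[where g = "\<lambda>g. incmp g \<cdot>\<^bsub>C\<^esub> i X"]) (auto simp: \<chi>_def)
    qed
    then show ?thesis by simp
  qed
  have "cat_functor_iso (IntCat C) ?K ?M (externalisation C) \<chi>"
  proof (intro cat_functor_iso.intro cat_functor_iso_axioms.intro M.cat_functor_axioms ext.cat_functor_axioms iso)
    fix b X g assume b: "b \<in> arr (one (IntCat C))" and X: "X \<in> obj (one ?K)" and g: "g \<in> obj (app0 (app0 ?M (src (one (IntCat C)) b)) X)"
    interpret b: intfunctor C "ifdom b" "ifcod b" b using b by (intro intfunctorI C) auto
    interpret g: intfunctor C "app0 N X" "ifdom b" g using g by (intro F) simp
    have "b \<cdot>\<^bsub>one (IntCat C)\<^esub> g \<in> obj (homcat (IntCat C) (app0 N X) (ifcod b))"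
      using b g I.one.cmp_arr[of g b] I.one.src_cmp[of g b] I.one.tgt_cmp[of g b] by simp
    moreover have "if0 (b \<cdot>\<^bsub>one (IntCat C)\<^esub> g) = if0 b \<cdot>\<^bsub>C\<^esub> if0 g"
      by (simp add: IntCat_simps(6))
    ultimately show "fob (tcmp (\<chi> (tgt (one (IntCat C)) b)) X) (fob (tcmp (app1 ?M b) X) g) =
      fob (tcmp (app1 (externalisation C) b) X) (fob (tcmp (\<chi> (src (one (IntCat C)) b)) X) g)"
      using X g by (simp add: \<chi>_def C.assoc)
  next
    fix b X t assume b: "b \<in> arr (one (IntCat C))" and X: "X \<in> obj (one ?K)" and t: "t \<in> arr (app0 (app0 ?M (src (one (IntCat C)) b)) X)"
    interpret b: intfunctor C "ifdom b" "ifcod b" b using b by (intro intfunctorI C) auto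
    interpret t: intnat C "app0 N X" "ifdom b" "indom t" "incod t" t using t by (intro T) simp
    let ?s = "idt (two (IntCat C)) b \<star>\<^bsub>IntCat C\<^esub> t"
    have "?s \<in> arr (homcat (IntCat C) (app0 N X) (ifcod b))"
      using b t t.F.intfun I.hcmp_arr[of t "idt (two (IntCat C)) b"] I.src_hcmp[of t "idt (two (IntCat C)) b"]
        I.one.src_cmp[of "indom t" b] I.one.tgt_cmp[of "indom t" b] I.two_idt[of b] I.two_src_idt[of b] by simp
    moreover have "incmp ?s = if1 b \<cdot>\<^bsub>C\<^esub> incmp t"
      by (simp add: IntCat_simps C.assoc)
    ultimately show "far (tcmp (\<chi> (tgt (one (IntCat C)) b)) X) (far (tcmp (app1 ?M b) X) t) =
      far (tcmp (app1 (externalisation C) b) X) (far (tcmp (\<chi> (src (one (IntCat C)) b)) X) t)"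
      using X t by (simp add: \<chi>_def C.assoc)
  next
    fix \<beta> X g assume b: "\<beta> \<in> arr (two (IntCat C))" and X: "X \<in> obj (one ?K)"
      and g: "g \<in> obj (app0 (app0 ?M (src (one (IntCat C)) (src (two (IntCat C)) \<beta>))) X)"
    interpret b: intnat C "ifdom (indom \<beta>)" "ifcod (indom \<beta>)" "indom \<beta>" "incod \<beta>" \<beta> using b by (intro intnatI C) auto
    interpret g: intfunctor C "app0 N X" "ifdom (indom \<beta>)" g using g by (intro F) simp
    let ?s = "\<beta> \<star>\<^bsub>IntCat C\<^esub> idt (two (IntCat C)) g"
    have "?s \<in> arr (homcat (IntCat C) (app0 N X) (ifcod (indom \<beta>)))"
      using b g b.F.intfun I.hcmp_arr[of "idt (two (IntCat C)) g" \<beta>] I.src_hcmp[of "idt (two (IntCat C)) g" \<beta>]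
        I.one.src_cmp[of g "indom \<beta>"] I.one.tgt_cmp[of g "indom \<beta>"] I.two_idt[of g] I.two_src_idt[of g] by simp
    moreover have "incmp ?s = incmp \<beta> \<cdot>\<^bsub>C\<^esub> if0 g"
      by (simp add: IntCat_simps C.assoc g.ifcod)
    ultimately show "far (tcmp (\<chi> (tgt (one (IntCat C)) (src (two (IntCat C)) \<beta>))) X) (ncmp (mcmp (app2 ?M \<beta>) X) g) =
       ncmp (mcmp (app2 (externalisation C) \<beta>) X) (fob (tcmp (\<chi> (src (one (IntCat C)) (src (two (IntCat C)) \<beta>))) X) g)"
      using X g by (simp add: \<chi>_def C.assoc)
  qed
  \<comment> \<open>Full faithfulness is transferred from externalisation to the nerve, so the
    isomorphism is needed in the opposite direction.\<close>
  then obtain \<psi> where "cat_functor_iso (IntCat C) ?K (externalisation C) ?M \<psi>"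
    using cat_functor_iso_sym by blast
  then show ?thesis
    unfolding dense_def using two_fully_faithful_iso C.externalisation_two_fully_faithful by blast
qed

section \<open>The internal category of an object\<close>

context notion_of_discreteness
begin

lemma base_two_category: "two_category (loc_disc C)"
  by (rule two_category_loc_disc) (rule C.category_axioms)

lemma F1_eqI: "x = y" if "app1 F x = app1 F y" "x \<in> arr C" "y \<in> arr C" "src C x = src C y" "tgt C x = tgt C y"
  using two_fully_faithful_inj1[OF base_two_category fully_faithful, of x y] that by simp

lemma F1_surj: "\<exists>x. x \<in> arr C \<and> src C x = X \<and> tgt C x = Y \<and> app1 F x = y"
  if "X \<in> obj C" "Y \<in> obj C" "y \<in> arr (one W)" "src (one W) y = app0 F X" "tgt (one W) y = app0 F Y"
  using two_fully_faithful_surj1[OF W.two_category_axioms base_two_category fully_faithful, of X Y y] that by simp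

lemma F0_obj [simp]: "X \<in> obj C \<Longrightarrow> app0 F X \<in> obj (one W)"
  and F1_arr [simp]: "x \<in> arr C \<Longrightarrow> app1 F x \<in> arr (one W)"
  and F1_src [simp]: "x \<in> arr C \<Longrightarrow> src (one W) (app1 F x) = app0 F (src C x)"
  and F1_tgt [simp]: "x \<in> arr C \<Longrightarrow> tgt (one W) (app1 F x) = app0 F (tgt C x)"
  and F1_idt [simp]: "X \<in> obj C \<Longrightarrow> app1 F (idt C X) = idt (one W) (app0 F X)"
  using F.one.map_obj[of X] F.one.arr[of x] F.one.src_map[of x] F.one.tgt_map[of x] F.one.map_idt[of X] by simp_all

lemma F1_cmp: "x \<in> arr C \<Longrightarrow> y \<in> arr C \<Longrightarrow> src C y = tgt C x \<Longrightarrow> app1 F (y \<cdot>\<^bsub>C\<^esub> x) = app1 F y \<cdot>\<^bsub>one W\<^esub> app1 F x"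
  using F.one.cmp[of x y] by simp

text \<open>The adjunction as representability: the counit is a universal element among 1-cells from
  objects \<open>F X\<close> to \<open>A\<close>. The inverse bijection is transposition, and the
  two cancellations are the triangle identities combined with naturality.\<close>

lemma coreflection:
  assumes A: "A \<in> obj (one W)"
  shows "\<exists>U c. U \<in> obj C \<and> c \<in> arr (one W) \<and> src (one W) c = app0 F U \<and> tgt (one W) c = A \<and>
    (\<forall>X \<in> obj C. bij_betw (\<lambda>x. c \<cdot>\<^bsub>one W\<^esub> app1 F x) (hom C X U) (hom (one W) (app0 F X) A))"
proof -
  obtain Uo Ua unit counit where "adjunction C (one W) (app0 F) (app1 F) Uo Ua unit counit"
    using coreflective by blast
  then interpret adjunction C "one W" "app0 F" "app1 F" Uo Ua unit counit .
  have unit [simp]: "unit X \<in> arr C" "src C (unit X) = X" "tgt C (unit X) = Uo (app0 F X)" if "X \<in> obj C" for X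
    using unit_nat that by (auto simp: is_nat_iff)
  have counit [simp]: "counit B \<in> arr (one W)" "src (one W) (counit B) = app0 F (Uo B)" "tgt (one W) (counit B) = B"
    if "B \<in> obj (one W)" for B
    using counit_nat that by (auto simp: is_nat_iff)
  have unit_nat': "unit (tgt C x) \<cdot>\<^bsub>C\<^esub> x = Ua (app1 F x) \<cdot>\<^bsub>C\<^esub> unit (src C x)" if "x \<in> arr C" for x
    using unit_nat that by (auto simp: is_nat_iff)
  have counit_nat': "counit (tgt (one W) y) \<cdot>\<^bsub>one W\<^esub> app1 F (Ua y) = y \<cdot>\<^bsub>one W\<^esub> counit (src (one W) y)" if "y \<in> arr (one W)" for y
    using counit_nat that by (auto simp: is_nat_iff)
  have "bij_betw (\<lambda>x. counit A \<cdot>\<^bsub>one W\<^esub> app1 F x) (hom C X (Uo A)) (hom (one W) (app0 F X) A)" if X: "X \<in> obj C" for X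
  proof (rule bij_betw_byWitness[of _ "\<lambda>y. Ua y \<cdot>\<^bsub>C\<^esub> unit X"])
    show "\<forall>x \<in> hom C X (Uo A). Ua (counit A \<cdot>\<^bsub>one W\<^esub> app1 F x) \<cdot>\<^bsub>C\<^esub> unit X = x"
    proof
      fix x assume "x \<in> hom C X (Uo A)"
      then have x: "x \<in> arr C" "src C x = X" "tgt C x = Uo A" by (auto simp: hom_iff)
      have "Ua (counit A \<cdot>\<^bsub>one W\<^esub> app1 F x) \<cdot>\<^bsub>C\<^esub> unit X = Ua (counit A) \<cdot>\<^bsub>C\<^esub> (Ua (app1 F x) \<cdot>\<^bsub>C\<^esub> unit X)"
        using x A X by (simp add: right.cmp C.assoc)
      also have "\<dots> = (Ua (counit A) \<cdot>\<^bsub>C\<^esub> unit (Uo A)) \<cdot>\<^bsub>C\<^esub> x"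
        using x A X unit_nat'[of x] by (simp add: C.assoc)
      finally show "Ua (counit A \<cdot>\<^bsub>one W\<^esub> app1 F x) \<cdot>\<^bsub>C\<^esub> unit X = x"
        using x A by (simp add: triangle_right)
    qed
    show "\<forall>y \<in> hom (one W) (app0 F X) A. counit A \<cdot>\<^bsub>one W\<^esub> app1 F (Ua y \<cdot>\<^bsub>C\<^esub> unit X) = y"
    proof
      fix y assume "y \<in> hom (one W) (app0 F X) A"
      then have y: "y \<in> arr (one W)" "src (one W) y = app0 F X" "tgt (one W) y = A" by (auto simp: hom_iff)
      have "counit A \<cdot>\<^bsub>one W\<^esub> app1 F (Ua y \<cdot>\<^bsub>C\<^esub> unit X) = (counit A \<cdot>\<^bsub>one W\<^esub> app1 F (Ua y)) \<cdot>\<^bsub>one W\<^esub> app1 F (unit X)"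
        using y A X by (simp add: F1_cmp W.one.assoc)
      also have "\<dots> = y \<cdot>\<^bsub>one W\<^esub> (counit (app0 F X) \<cdot>\<^bsub>one W\<^esub> app1 F (unit X))"
        using y A X counit_nat'[of y] by (simp add: W.one.assoc)
      finally show "counit A \<cdot>\<^bsub>one W\<^esub> app1 F (Ua y \<cdot>\<^bsub>C\<^esub> unit X) = y"
        using y X by (simp add: triangle_left)
    qed
  qed (use A X in \<open>auto simp: hom_iff\<close>)
  then show ?thesis using A by (intro exI[of _ "Uo A"] exI[of _ "counit A"]) auto
qed

text \<open>The pullback of \<open>F f\<close> and \<open>F g\<close> is taken in \<open>W\<close>
  and coreflected. Maps from \<open>F X\<close> into it factor uniquely through the coreflection,
  and full faithfulness of \<open>F\<close> turns projections and factorisations into arrows of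
  \<open>C\<close>.\<close>

lemma base_pullback_exists:
  assumes lim: "has_finite_weighted_limits W" and f [simp]: "f \<in> arr C" and g [simp]: "g \<in> arr C" and fg: "tgt C f = tgt C g"
  shows "\<exists>p q. is_pullback C f g p q"
proof -
  obtain p q where pq: "is_pullback (one W) (app1 F f) (app1 F g) p q"
    using pullback_exists[OF W.two_category_axioms lim, of "app1 F f" "app1 F g"] fg by auto
  note pqD = is_pullbackD[OF pq, simplified]
  have [simp]: "p \<in> arr (one W)" "q \<in> arr (one W)" "tgt (one W) p = app0 F (src C f)" "tgt (one W) q = app0 F (src C g)"
    "src (one W) q = src (one W) p" using pqD by auto
  obtain U c where U [simp]: "U \<in> obj C" "c \<in> arr (one W)" "src (one W) c = app0 F U" "tgt (one W) c = src (one W) p"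
    and bij: "\<And>X. X \<in> obj C \<Longrightarrow> bij_betw (\<lambda>x. c \<cdot>\<^bsub>one W\<^esub> app1 F x) (hom C X U) (hom (one W) (app0 F X) (src (one W) p))"
    using coreflection[of "src (one W) p"] by auto
  obtain p' where p' [simp]: "p' \<in> arr C" "src C p' = U" "tgt C p' = src C f" "app1 F p' = p \<cdot>\<^bsub>one W\<^esub> c"
    using F1_surj[of U "src C f" "p \<cdot>\<^bsub>one W\<^esub> c"] by auto
  obtain q' where q' [simp]: "q' \<in> arr C" "src C q' = U" "tgt C q' = src C g" "app1 F q' = q \<cdot>\<^bsub>one W\<^esub> c"
    using F1_surj[of U "src C g" "q \<cdot>\<^bsub>one W\<^esub> c"] by auto
  have sq: "f \<cdot>\<^bsub>C\<^esub> p' = g \<cdot>\<^bsub>C\<^esub> q'"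
    by (rule F1_eqI) (use pqD fg in \<open>simp_all add: F1_cmp W.one.assoc[symmetric]\<close>)
  have "is_pullback C f g p' q'"
    unfolding is_pullback_def
  proof (intro conjI ballI impI)
    fix X h k assume X: "X \<in> obj C" and "h \<in> hom C X (src C f)" "k \<in> hom C X (src C g)" and hk: "f \<cdot>\<^bsub>C\<^esub> h = g \<cdot>\<^bsub>C\<^esub> k"
    then have h: "h \<in> arr C" "src C h = X" "tgt C h = src C f" and k: "k \<in> arr C" "src C k = X" "tgt C k = src C g"
      by (auto simp: hom_iff)
    have "app1 F f \<cdot>\<^bsub>one W\<^esub> app1 F h = app1 F g \<cdot>\<^bsub>one W\<^esub> app1 F k"
      using h k hk by (simp add: F1_cmp[symmetric])
    note w = W.one.pair[OF pq, of "app1 F h" "app1 F k", simplified h k F1_src F1_tgt f g, OF F1_arr F1_arr _ _ _ this, simplified h k, simplified]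
    obtain v where v: "v \<in> hom C X U" "pair (one W) p q (app1 F h) (app1 F k) = c \<cdot>\<^bsub>one W\<^esub> app1 F v"
    proof -
      have "pair (one W) p q (app1 F h) (app1 F k) \<in> hom (one W) (app0 F X) (src (one W) p)" using w by (simp add: hom_iff)
      then show thesis using bij[OF X] that by (metis (no_types, lifting) bij_betw_imp_surj_on imageE)
    qed
    show "\<exists>!v. v \<in> hom C X (src C p') \<and> p' \<cdot>\<^bsub>C\<^esub> v = h \<and> q' \<cdot>\<^bsub>C\<^esub> v = k"
    proof (rule ex1I)
      have v': "v \<in> arr C" "src C v = X" "tgt C v = U" using v by (auto simp: hom_iff)
      have pv: "p' \<cdot>\<^bsub>C\<^esub> v = h" by (rule F1_eqI) (use w v(2) v' h in \<open>simp_all add: F1_cmp W.one.assoc\<close>)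
      have qv: "q' \<cdot>\<^bsub>C\<^esub> v = k" by (rule F1_eqI) (use w v(2) v' k in \<open>simp_all add: F1_cmp W.one.assoc\<close>)
      show "v \<in> hom C X (src C p') \<and> p' \<cdot>\<^bsub>C\<^esub> v = h \<and> q' \<cdot>\<^bsub>C\<^esub> v = k" using v pv qv by simp
      fix u assume u: "u \<in> hom C X (src C p') \<and> p' \<cdot>\<^bsub>C\<^esub> u = h \<and> q' \<cdot>\<^bsub>C\<^esub> u = k"
      then have u': "u \<in> arr C" "src C u = X" "tgt C u = U" by (auto simp: hom_iff)
      have uv: "app1 F (p' \<cdot>\<^bsub>C\<^esub> u) = app1 F (p' \<cdot>\<^bsub>C\<^esub> v)" "app1 F (q' \<cdot>\<^bsub>C\<^esub> u) = app1 F (q' \<cdot>\<^bsub>C\<^esub> v)"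
        using u pv qv by simp_all
      have "c \<cdot>\<^bsub>one W\<^esub> app1 F u = c \<cdot>\<^bsub>one W\<^esub> app1 F v"
      proof (rule W.one.pullback_eqI[OF pq])
        show "p \<cdot>\<^bsub>one W\<^esub> (c \<cdot>\<^bsub>one W\<^esub> app1 F u) = p \<cdot>\<^bsub>one W\<^esub> (c \<cdot>\<^bsub>one W\<^esub> app1 F v)"
          using uv(1) u' v' by (simp add: F1_cmp W.one.assoc)
        show "q \<cdot>\<^bsub>one W\<^esub> (c \<cdot>\<^bsub>one W\<^esub> app1 F u) = q \<cdot>\<^bsub>one W\<^esub> (c \<cdot>\<^bsub>one W\<^esub> app1 F v)"
          using uv(2) u' v' by (simp add: F1_cmp W.one.assoc)
      qed (use u' v' in simp_all)
      then show "u = v" using bij[OF X] u v unfolding bij_betw_def by (auto dest: inj_onD)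
    qed
  qed (use sq fg in simp_all)
  then show ?thesis by blast
qed

lemma internal_category_exists:
  assumes lim: "has_finite_weighted_limits W" and A: "A \<in> obj (one W)"
  shows "\<exists>E \<phi>. internal_category C E \<and> cat_nat_iso (op_twocat (loc_disc C)) (ext0 C E) (nerve0 W F A) \<phi>"
proof -
  note W [simp] = W.two_category_axioms
  obtain B \<epsilon> where B: "B \<in> obj (one W)" "\<epsilon> \<in> arr (homcat W B A)"
    and bijB: "\<And>X. X \<in> obj (one W) \<Longrightarrow> bij_betw (\<lambda>v. \<epsilon> \<star>\<^bsub>W\<^esub> idt (two W) v) (obj (homcat W X B)) (arr (homcat W X A))"
    using arrow_object_exists[OF W lim A] by blast
  then have [simp]: "\<epsilon> \<in> arr (two W)" "src (one W) (src (two W) \<epsilon>) = B" "tgt (one W) (src (two W) \<epsilon>) = A" by auto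
  obtain U0 c0 where U0 [simp]: "U0 \<in> obj C" "c0 \<in> arr (one W)" "src (one W) c0 = app0 F U0" "tgt (one W) c0 = A"
    and bij0: "\<And>X. X \<in> obj C \<Longrightarrow> bij_betw (\<lambda>x. c0 \<cdot>\<^bsub>one W\<^esub> app1 F x) (hom C X U0) (hom (one W) (app0 F X) A)"
    using coreflection[OF A] by auto
  obtain U1 c1 where U1 [simp]: "U1 \<in> obj C" "c1 \<in> arr (one W)" "src (one W) c1 = app0 F U1" "tgt (one W) c1 = B"
    and bij1: "\<And>X. X \<in> obj C \<Longrightarrow> bij_betw (\<lambda>x. c1 \<cdot>\<^bsub>one W\<^esub> app1 F x) (hom C X U1) (hom (one W) (app0 F X) B)"
    using coreflection[OF B(1)] by auto
  show ?thesis
  proof (rule representable_internal_category[OF C.category_axioms base_pullback_exists[OF lim] two_functor_nerve0[OF base_two_category W F.two_functor_axioms A] U0(1) U1(1)])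
    \<comment> \<open>The universal object is the coreflection map of \<open>A\<close>; the
      universal arrow is the 2-cell \<open>\<epsilon>\<close> whiskered with the coreflection map of
      the arrow object \<open>B\<close>.\<close>
    show "c0 \<in> obj (app0 (nerve0 W F A) U0)" "\<epsilon> \<star>\<^bsub>W\<^esub> idt (two W) c1 \<in> arr (app0 (nerve0 W F A) U1)" by simp_all
    fix X assume X: "X \<in> obj C"
    have h: "obj (homcat W (app0 F X) D) = hom (one W) (app0 F X) D" for D by (simp add: homcat_def)
    show "bij_betw (\<lambda>x. fob (app1 (nerve0 W F A) x) c0) (hom C X U0) (obj (app0 (nerve0 W F A) X))"
      using bij0[OF X] by (subst bij_betw_cong[where g = "\<lambda>x. c0 \<cdot>\<^bsub>one W\<^esub> app1 F x"]) (auto simp: hom_iff h)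
    \<comment> \<open>By the coreflection, arrows from \<open>X\<close> to \<open>U1\<close>
      correspond to 1-cells from \<open>F X\<close> to \<open>B\<close>; by the arrow object, these
      correspond to the arrows of the family of \<open>A\<close> over \<open>X\<close>.\<close>
    have "bij_betw ((\<lambda>v. \<epsilon> \<star>\<^bsub>W\<^esub> idt (two W) v) \<circ> (\<lambda>x. c1 \<cdot>\<^bsub>one W\<^esub> app1 F x)) (hom C X U1) (arr (homcat W (app0 F X) A))"
      using bij_betw_trans[OF bij1[OF X] bijB[of "app0 F X", unfolded h]] X by simp
    then show "bij_betw (\<lambda>x. far (app1 (nerve0 W F A) x) (\<epsilon> \<star>\<^bsub>W\<^esub> idt (two W) c1)) (hom C X U1) (arr (app0 (nerve0 W F A) X))"
      by (subst bij_betw_cong[where g = "(\<lambda>v. \<epsilon> \<star>\<^bsub>W\<^esub> idt (two W) v) \<circ> (\<lambda>x. c1 \<cdot>\<^bsub>one W\<^esub> app1 F x)"])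
        (auto simp: hom_iff W.hassoc W.idt_hcmp_idt)
  qed
qed

text \<open>Only objects are chosen, one internal category with an isomorphism for each
  \<open>A\<close>; \<open>lift_two_functor\<close> supplies the cells and the laws.\<close>

lemma internalisation_exists:
  assumes lim: "has_finite_weighted_limits W"
  shows "\<exists>E. internalises_families W C F E"
proof -
  let ?K = "op_twocat (loc_disc C)"
  note W = W.two_category_axioms
  have "\<forall>A \<in> obj (one W). \<exists>E. \<exists>\<phi>. internal_category C E \<and> cat_nat_iso ?K (ext0 C E) (nerve0 W F A) \<phi>"
    using internal_category_exists[OF lim] by blast
  from bchoice[OF this] obtain e where
    "\<forall>A \<in> obj (one W). \<exists>\<phi>. internal_category C (e A) \<and> cat_nat_iso ?K (ext0 C (e A)) (nerve0 W F A) \<phi>" by blast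
  from bchoice[OF this] obtain \<phi> where
    e: "\<And>A. A \<in> obj (one W) \<Longrightarrow> internal_category C (e A) \<and> cat_nat_iso ?K (ext0 C (e A)) (nerve0 W F A) (\<phi> A)" by blast
  obtain E where E: "two_functor W (IntCat C) E" "cat_functor_iso W ?K (twofun_comp (externalisation C) E) (family_fibration W C F) \<phi>"
    using lift_two_functor[OF C.cat_functor_externalisation C.externalisation_two_fully_faithful
      cat_functor_nerve[OF base_two_category W F.two_functor_axioms], of e \<phi>] e by auto
  then have "two_naturally_isomorphic W ?K (twofun_comp (externalisation C) E) (family_fibration W C F)"
    using two_naturally_isomorphic_iff[of W ?K] by (auto simp: cat_functor_iso_def)
  with E show ?thesis by (auto simp: internalises_families_def)
qed

end

text \<open>On hom-categories \<open>Y\<close> acts by isomorphisms, which can be composed with and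
  cancelled. It is applied with externalisation as \<open>Y\<close>.\<close>

lemma two_fully_faithful_comp_iff:
  assumes V: "two_category V" and W: "two_category W" and E: "two_functor W V E" and Y: "two_fully_faithful V K Y"
  shows "two_fully_faithful W K (twofun_comp Y E) \<longleftrightarrow> two_fully_faithful W V E"
proof -
  interpret W: two_category W by fact
  interpret E: two_functor W V E by fact
  have "cat_iso (homcat W A B) (homcat K (app0 Y (app0 E A)) (app0 Y (app0 E B))) (app1 Y \<circ> app1 E) (app2 Y \<circ> app2 E) \<longleftrightarrow>
    cat_iso (homcat W A B) (homcat V (app0 E A) (app0 E B)) (app1 E) (app2 E)" if "A \<in> obj (one W)" "B \<in> obj (one W)" for A B
  proof -
    have Y': "cat_iso (homcat V (app0 E A) (app0 E B)) (homcat K (app0 Y (app0 E A)) (app0 Y (app0 E B))) (app1 Y) (app2 Y)"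
      using Y that by (simp add: two_fully_faithful_def)
    show ?thesis using cat_iso_comp[OF _ Y'] cat_iso_cancel[OF _ Y' E.hom_functor[OF W]] by blast
  qed
  then show ?thesis by (simp add: two_fully_faithful_def twofun_comp_def)
qed

section \<open>Density and full faithfulness of internalisations\<close>

context notion_of_discreteness
begin

text \<open>\<open>E\<close> is arbitrary here, so its values at discrete objects are known only
  through the isomorphism with the family fibration. Over \<open>Y\<close>, the externalisation of
  \<open>E (F X)\<close> is the hom-category from \<open>F Y\<close> to \<open>F X\<close>, a
  discrete category on the arrows from \<open>Y\<close> to \<open>X\<close>; this makes
  \<open>E (F X)\<close> discrete, with object of objects isomorphic to \<open>X\<close>.\<close>

lemma internalisation_restrict_dense:
  assumes E: "internalises_families W C F E"
  shows "dense (loc_disc C) (IntCat C) (twofun_comp E F)"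
proof -
  let ?K = "op_twocat (loc_disc C)"
  note W [simp] = W.two_category_axioms and C = C.category_axioms and I = C.two_category_IntCat
  have E2: "two_functor W (IntCat C) E" using E by (simp add: internalises_families_def)
  interpret E: two_functor W "IntCat C" E by (rule E2)
  have G: "cat_functor W ?K (twofun_comp (externalisation C) E)"
    using two_functor_comp[OF W I E2 cat_functor.axioms(3)[OF C.cat_functor_externalisation]]
    by (intro cat_functor.intro W two_category_op base_two_category)
  then obtain \<phi> where f: "cat_functor_iso W ?K (twofun_comp (externalisation C) E) (family_fibration W C F) \<phi>"
    using E two_naturally_isomorphic_iff[OF G cat_functor_nerve[OF base_two_category W F.two_functor_axioms]]
    by (auto simp: internalises_families_def)
  interpret f: cat_functor_iso W ?K "twofun_comp (externalisation C) E" "family_fibration W C F" \<phi> by (rule f)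
  have [simp]: "app0 (twofun_comp (externalisation C) E) A = ext0 C (app0 E A)"
    "app1 (twofun_comp (externalisation C) E) a = ext1 C (app1 E a)" for A a
    by (simp_all add: twofun_comp_def)
  have Fi: "cat_nat_iso ?K (ext0 C (app0 E (app0 F X))) (nerve0 W F (app0 F X)) (\<phi> (app0 F X))" if "X \<in> obj C" for X
    using f.iso[of "app0 F X"] that by simp
  have D: "intcat C (app0 E (app0 F X))" if "X \<in> obj C" for X
    using E.one.map_obj[of "app0 F X"] that C by (intro intcatI) auto
  \<comment> \<open>Yoneda in both directions: \<open>i X\<close> names the identity of
    \<open>F X\<close>, and \<open>j X\<close> below names the image of the generic object of
    \<open>E (F X)\<close>. They compare two universal elements of one representable functor, hence
    are mutually inverse.\<close>
  define i where "i X = (SOME x. x \<in> arr C \<and> src C x = X \<and> tgt C x = ob0 (app0 E (app0 F X)) \<and>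
    fob (tcmp (\<phi> (app0 F X)) X) x = idt (one W) (app0 F X))" for X
  have i: "i X \<in> arr C \<and> src C (i X) = X \<and> tgt C (i X) = ob0 (app0 E (app0 F X)) \<and>
    fob (tcmp (\<phi> (app0 F X)) X) (i X) = idt (one W) (app0 F X)" if X: "X \<in> obj C" for X
    unfolding i_def
  proof (rule someI_ex)
    interpret D: intcat C "app0 E (app0 F X)" using X by (rule D)
    show "\<exists>x. x \<in> arr C \<and> src C x = X \<and> tgt C x = ob0 (app0 E (app0 F X)) \<and> fob (tcmp (\<phi> (app0 F X)) X) x = idt (one W) (app0 F X)"
      using cat_nat_iso.surj0[OF Fi[OF X], of X "idt (one W) (app0 F X)"] X by auto
  qed
  define j where "j X = (SOME x. x \<in> arr C \<and> src C x = ob0 (app0 E (app0 F X)) \<and> tgt C x = X \<and>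
    app1 F x = fob (tcmp (\<phi> (app0 F X)) (ob0 (app0 E (app0 F X)))) (idt C (ob0 (app0 E (app0 F X)))))" for X
  have j: "j X \<in> arr C \<and> src C (j X) = ob0 (app0 E (app0 F X)) \<and> tgt C (j X) = X \<and>
    app1 F (j X) = fob (tcmp (\<phi> (app0 F X)) (ob0 (app0 E (app0 F X)))) (idt C (ob0 (app0 E (app0 F X))))" if X: "X \<in> obj C" for X
    unfolding j_def
  proof (rule someI_ex)
    interpret D: intcat C "app0 E (app0 F X)" using X by (rule D)
    interpret p: cat_nat_iso ?K "ext0 C (app0 E (app0 F X))" "nerve0 W F (app0 F X)" "\<phi> (app0 F X)" using X by (rule Fi)
    show "\<exists>x. x \<in> arr C \<and> src C x = ob0 (app0 E (app0 F X)) \<and> tgt C x = X \<and>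
      app1 F x = fob (tcmp (\<phi> (app0 F X)) (ob0 (app0 E (app0 F X)))) (idt C (ob0 (app0 E (app0 F X))))"
      using p.cfun_map(1)[of "ob0 (app0 E (app0 F X))" "idt C (ob0 (app0 E (app0 F X)))"] X by (intro F1_surj) auto
  qed
  show ?thesis
  proof (rule dense_discrete[where i = i and j = j])
    show "category C" by (rule C)
    show "two_functor (loc_disc C) (IntCat C) (twofun_comp E F)"
      by (rule two_functor_comp[OF base_two_category W F.two_functor_axioms E2])
  next
    fix X assume X: "X \<in> obj C"
    let ?D = "app0 E (app0 F X)" and ?p = "\<phi> (app0 F X)"
    have eq: "app0 (twofun_comp E F) X = ?D" by (simp add: twofun_comp_def)
    interpret D: intcat C ?D using X by (rule D)
    interpret p: cat_nat_iso ?K "ext0 C ?D" "nerve0 W F (app0 F X)" ?p using X by (rule Fi)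
    note i = i[OF X] and j = j[OF X]
    show "i X \<in> arr C \<and> src C (i X) = X \<and> tgt C (i X) = ob0 (app0 (twofun_comp E F) X)" using i eq by simp
    show "j X \<in> arr C \<and> src C (j X) = ob0 (app0 (twofun_comp E F) X) \<and> tgt C (j X) = X" using j eq by simp
    have "i X \<cdot>\<^bsub>C\<^esub> j X = idt C (ob0 ?D)"
      using i j X p.natural(1)[of "j X" "i X"] p.cfun_map(1)[of "ob0 ?D" "idt C (ob0 ?D)"] by (intro p.inj0[of "ob0 ?D"]) simp_all
    moreover have "j X \<cdot>\<^bsub>C\<^esub> i X = idt C X"
    proof (rule F1_eqI)
      show "app1 F (j X \<cdot>\<^bsub>C\<^esub> i X) = app1 F (idt C X)"
        using i j X p.natural(1)[of "i X" "idt C (ob0 ?D)"] p.cfun_map(1)[of "ob0 ?D" "idt C (ob0 ?D)"] by (simp add: F1_cmp)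
    qed (use i j X in simp_all)
    ultimately show "i X \<cdot>\<^bsub>C\<^esub> j X = idt C (ob0 (app0 (twofun_comp E F) X)) \<and> j X \<cdot>\<^bsub>C\<^esub> i X = idt C X" using eq by simp
    \<comment> \<open>The generic arrow of \<open>E (F X)\<close> corresponds to a 2-cell between
      1-cells from a discrete object to \<open>F X\<close>. Full faithfulness of \<open>F\<close>
      makes it the image of a 2-cell of \<open>loc_disc C\<close>, hence an identity; injectivity of
      the isomorphism brings this back to \<open>E (F X)\<close>.\<close>
    have "iid ?D \<cdot>\<^bsub>C\<^esub> idom ?D = idt C (ob1 ?D)"
    proof (rule p.inj1)
      have a: "far (tcmp ?p (ob1 ?D)) (idt C (ob1 ?D)) \<in> arr (homcat W (app0 F (ob1 ?D)) (app0 F X))"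
        "src (two W) (far (tcmp ?p (ob1 ?D)) (idt C (ob1 ?D))) = fob (tcmp ?p (ob1 ?D)) (idom ?D)"
        using p.cfun_map(2,3)[of "ob1 ?D" "idt C (ob1 ?D)"] by simp_all
      then obtain v where v: "v \<in> arr C" "far (tcmp ?p (ob1 ?D)) (idt C (ob1 ?D)) = app2 F v"
        using two_fully_faithful_surj2[OF W base_two_category fully_faithful, of "ob1 ?D" X "far (tcmp ?p (ob1 ?D)) (idt C (ob1 ?D))"] X by auto
      then have "app2 F v = idt (two W) (app1 F v)" "src (two W) (app2 F v) = app1 F v"
        using F.two.map_idt[of v] F.two.src_map[of v] by simp_all
      then have "far (tcmp ?p (ob1 ?D)) (idt C (ob1 ?D)) = idt (two W) (fob (tcmp ?p (ob1 ?D)) (idom ?D))"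
        using v a by simp
      then show "far (tcmp ?p (ob1 ?D)) (iid ?D \<cdot>\<^bsub>C\<^esub> idom ?D) = far (tcmp ?p (ob1 ?D)) (idt C (ob1 ?D))"
        using p.cfun_cmp(2)[of "ob1 ?D" "idom ?D"] by simp
    qed simp_all
    then show "iid (app0 (twofun_comp E F) X) \<cdot>\<^bsub>C\<^esub> idom (app0 (twofun_comp E F) X) = idt C (ob1 (app0 (twofun_comp E F) X))"
      using eq by simp
  next
    fix u assume u: "u \<in> arr C"
    let ?X = "src C u" and ?Y = "tgt C u"
    interpret D: intcat C "app0 E (app0 F ?X)" using u by (intro D) simp
    interpret p: cat_nat_iso ?K "ext0 C (app0 E (app0 F ?Y))" "nerve0 W F (app0 F ?Y)" "\<phi> (app0 F ?Y)" using u by (intro Fi) simp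
    interpret u: intfunctor C "app0 E (app0 F ?X)" "app0 E (app0 F ?Y)" "app1 E (app1 F u)"
      using u E.one.arr[of "app1 F u"] E.one.src_map[of "app1 F u"] E.one.tgt_map[of "app1 F u"] by (intro intfunctorI C) auto
    have i: "i ?X \<in> arr C" "src C (i ?X) = ?X" "tgt C (i ?X) = ob0 (app0 E (app0 F ?X))" "fob (tcmp (\<phi> (app0 F ?X)) ?X) (i ?X) = idt (one W) (app0 F ?X)"
      "i ?Y \<in> arr C" "src C (i ?Y) = ?Y" "tgt C (i ?Y) = ob0 (app0 E (app0 F ?Y))" "fob (tcmp (\<phi> (app0 F ?Y)) ?Y) (i ?Y) = idt (one W) (app0 F ?Y)"
      using i[of ?X] i[of ?Y] u by auto
    \<comment> \<open>The isomorphism sends both sides to \<open>F u\<close>: the left by naturality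
      in the object of \<open>W\<close>, the right by naturality in the stage.\<close>
    have "if0 (app1 E (app1 F u)) \<cdot>\<^bsub>C\<^esub> i ?X = i ?Y \<cdot>\<^bsub>C\<^esub> u"
    proof (rule p.inj0[of ?X])
      have "fob (tcmp (\<phi> (app0 F ?Y)) ?X) (if0 (app1 E (app1 F u)) \<cdot>\<^bsub>C\<^esub> i ?X) = app1 F u"
        using f.nat_ob[of "app1 F u" ?X "i ?X"] u i u.ifdom by simp
      also have "\<dots> = fob (tcmp (\<phi> (app0 F ?Y)) ?X) (i ?Y \<cdot>\<^bsub>C\<^esub> u)"
        using p.natural(1)[of u "i ?Y"] u i by simp
      finally show "fob (tcmp (\<phi> (app0 F ?Y)) ?X) (if0 (app1 E (app1 F u)) \<cdot>\<^bsub>C\<^esub> i ?X) = fob (tcmp (\<phi> (app0 F ?Y)) ?X) (i ?Y \<cdot>\<^bsub>C\<^esub> u)" .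
    qed (use u i in simp_all)
    then show "if0 (app1 (twofun_comp E F) u) \<cdot>\<^bsub>C\<^esub> i (src C u) = i (tgt C u) \<cdot>\<^bsub>C\<^esub> u"
      by (simp add: twofun_comp_def)
  qed
qed

text \<open>Density of \<open>F\<close> is by definition full faithfulness of the family fibration.
  The isomorphism, used in both directions, moves it to externalisation after \<open>E\<close>,
  where externalisation is cancelled.\<close>

lemma internalisation_two_fully_faithful_iff:
  assumes E: "internalises_families W C F E"
  shows "two_fully_faithful W (IntCat C) E \<longleftrightarrow> dense (loc_disc C) W F"
proof -
  let ?K = "op_twocat (loc_disc C)" and ?G = "twofun_comp (externalisation C) E"
  note W = W.two_category_axioms and I = C.two_category_IntCat
  have E2: "two_functor W (IntCat C) E" using E by (simp add: internalises_families_def)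
  have G: "cat_functor W ?K ?G"
    using two_functor_comp[OF W I E2 cat_functor.axioms(3)[OF C.cat_functor_externalisation]]
    by (intro cat_functor.intro W two_category_op base_two_category)
  then obtain \<phi> where f: "cat_functor_iso W ?K ?G (family_fibration W C F) \<phi>"
    using E two_naturally_isomorphic_iff[OF G cat_functor_nerve[OF base_two_category W F.two_functor_axioms]]
    by (auto simp: internalises_families_def)
  obtain \<psi> where g: "cat_functor_iso W ?K (family_fibration W C F) ?G \<psi>"
    using cat_functor_iso_sym[OF f] by blast
  have "two_fully_faithful W (CatFun ?K) ?G \<longleftrightarrow> dense (loc_disc C) W F"
    unfolding dense_def using two_fully_faithful_iso[OF f] two_fully_faithful_iso[OF g] by blast
  then show ?thesis
    using two_fully_faithful_comp_iff[OF I W E2 C.externalisation_two_fully_faithful] by simp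
qed

end

theorem theorem5:
  fixes W :: "('o, 'm, 't) twocat" and C :: "('c, 'a) cat"
    and F :: "('c, 'a, 'a, 'o, 'm, 't) twofun"
  assumes "notion_of_discreteness W C F"
    and "has_finite_weighted_limits W"
  shows "(\<exists>E. internalises_families W C F E) \<and>
    (\<forall>E. internalises_families W C F E \<longrightarrow>
       (two_fully_faithful W (IntCat C) E \<longleftrightarrow> dense (loc_disc C) W F) \<and>
       (two_fully_faithful W (IntCat C) E \<longrightarrow> dense W (IntCat C) E))"
proof -
  interpret notion_of_discreteness W C F by fact
  \<comment> \<open>\<open>dense_comp\<close> with \<open>F\<close> as the restricting 2-functor:
    the composite of \<open>E\<close> with \<open>F\<close> is dense for every
    internalisation.\<close>
  have "dense W (IntCat C) E" if "internalises_families W C F E" "two_fully_faithful W (IntCat C) E" for E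
    using that internalisation_restrict_dense[of E]
    by (intro dense_comp[OF base_two_category W.two_category_axioms C.two_category_IntCat F.two_functor_axioms])
      (auto simp: internalises_families_def)
  then show ?thesis
    using internalisation_exists[OF assms(2)] internalisation_two_fully_faithful_iff by blast
qed

end
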